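(* Let $t\in\mathbf C$, $s_1,s_2\in\overline{\mathbf R_\flat}$ be such that $s_1,s_2<\frac12$, $s=(s_2,s_1)$, $\Lambda=\mathbf N^{d_2}\times\mathbf N^{d_1}$, and let $U_{t,\diamond}$ be the map from $\ell_0(\Lambda)\times\ell_0(\Lambda)$ to $\ell_0(\Lambda)$ given by $$U_{t,\diamond}(c_1,c_2)(\alpha)=t^{|\alpha|}\sum_{\gamma\in\Lambda}\binom{\alpha+\gamma}\gamma^{1/2}c_1(\gamma)c_2(\alpha+\gamma),\qquad\alpha\in\Lambda.$$ Then $U_{t,\diamond}$ is uniquely extendable to continuous mappings $$\ell_{\mathcal A,s}(\Lambda)\times\ell_{\mathcal A,s}^\star(\Lambda)\to\ell_{\mathcal A,s}^\star(\Lambda),\qquad \ell_{\mathcal A,s}^\star(\Lambda)\times\ell_{\mathcal A,s}(\Lambda)\to\ell_{\mathcal A,s}(\Lambda),$$ $$\ell_{\mathcal B,s}(\Lambda)\times\ell_{\mathcal C,s}^\star(\Lambda)\to\ell_{\mathcal C,s}^\star(\Lambda),\qquad \ell_{\mathcal B,s}^\star(\Lambda)\times\ell_{\mathcal C,s}(\Lambda)\to\ell_{\mathcal C,s}(\Lambda),$$ $$\ell_{\mathcal C,s}(\Lambda)\times\ell_{\mathcal B,s}^\star(\Lambda)\to\ell_{\mathcal B,s}^\star(\Lambda),\qquad \ell_{\mathcal C,s}^\star(\Lambda)\times\ell_{\mathcal B,s}(\Lambda)\to\ell_{\mathcal B,s}(\Lambda).$$ If instead $0<s_1,s_2\le\frac12$,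 then the same holds true with $\ell_{\mathcal A,0,s}$, $\ell_{\mathcal B,0,s}$ and $\ell_{\mathcal C,0,s}$ in place of $\ell_{\mathcal A,s}$, $\ell_{\mathcal B,s}$ and $\ell_{\mathcal C,s}$, respectively, at each occurrence (and likewise for the $\star$-versions).
   Context: **Indices and weights.** $\mathbf N=\{0,1,2,\dots\}$. $\overline{\mathbf R_\flat}=[0,\infty)\cup\{\flat_\sigma:\sigma>0\}$, where the $\flat_\sigma$ are formal symbols, ordered so that $x_1<\flat_{\sigma_1}<\flat_{\sigma_2}<x_2$ whenever $x_1<\frac12\le x_2$ and $\sigma_1<\sigma_2$. For $r>0$ and a multi-index $\alpha$: $\vartheta_{r,s}(\alpha)=e^{r|\alpha|^{1/(2s)}}$ if $s\in(0,\infty)$; $\vartheta_{r,s}(\alpha)=r^{|\alpha|}(\alpha!)^{1/(2\sigma)}$ if $s=\flat_\sigma$; $\vartheta_{r,0}(\alpha)=1$ if $|\alpha|\le r$ and $=\infty$ if $|\alpha|>r$. Conventions (needed only to read the weights when $s_1=0$ or $s_2=0$, or $t=0$): $a/\infty=0$ for all $a\in(0,\infty]$, $\infty\cdot0=0$, $0^0=1$. For $\omega:\Lambda\to[0,\infty]$, $\ell_{[\omega]}(\Lambda)$ is the set of $c:\Lambda\to\mathbf C$ with $\|c\,\omega\|_{\ell^p(\Lambda)}<\infty$, with this (quasi-/semi-)norm, $p\in(0,\infty]$ fixed (the limit spaces below do not depend on $p$). **Spaces.** $\ell_0(\Lambda)$ is the set of finitely supported sequences. For $\alpha=(\alpha_2,\alpha_1)\in\Lambda$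 put $\vartheta_r(\alpha)=\vartheta_{r,s_2}(\alpha_2)\vartheta_{r,s_1}(\alpha_1)$, $\omega_{r_2,r_1}(\alpha)=\vartheta_{r_2,s_2}(\alpha_2)/\vartheta_{r_1,s_1}(\alpha_1)$, $\omega^\star_{r_2,r_1}(\alpha)=\vartheta_{r_1,s_1}(\alpha_1)/\vartheta_{r_2,s_2}(\alpha_2)$. With limits over positive parameters: $\ell_{\mathcal A,s}=\operatorname{ind\,lim}_r\ell_{[\vartheta_r]}$, $\ell_{\mathcal A,s}^\star=\operatorname{proj\,lim}_r\ell_{[1/\vartheta_r]}$, $\ell_{\mathcal A,0,s}=\operatorname{proj\,lim}_r\ell_{[\vartheta_r]}$, $\ell_{\mathcal A,0,s}^\star=\operatorname{ind\,lim}_r\ell_{[1/\vartheta_r]}$; $\ell_{\mathcal B,s}=\operatorname{proj\,lim}_{r_1}\operatorname{ind\,lim}_{r_2}\ell_{[\omega_{r_2,r_1}]}$, $\ell_{\mathcal B,0,s}=\operatorname{proj\,lim}_{r_2}\operatorname{ind\,lim}_{r_1}\ell_{[\omega_{r_2,r_1}]}$, $\ell_{\mathcal B,s}^\star=\operatorname{proj\,lim}_{r_2}\operatorname{ind\,lim}_{r_1}\ell_{[\omega^\star_{r_2,r_1}]}$, $\ell_{\mathcal B,0,s}^\star=\operatorname{proj\,lim}_{r_1}\operatorname{ind\,lim}_{r_2}\ell_{[\omega^\star_{r_2,r_1}]}$; $\ell_{\mathcal C,s}=\operatorname{ind\,lim}_{r_2}\operatorname{proj\,lim}_{r_1}\ell_{[\omega_{r_2,r_1}]}$,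 $\ell_{\mathcal C,0,s}=\operatorname{ind\,lim}_{r_1}\operatorname{proj\,lim}_{r_2}\ell_{[\omega_{r_2,r_1}]}$, $\ell_{\mathcal C,s}^\star=\operatorname{ind\,lim}_{r_1}\operatorname{proj\,lim}_{r_2}\ell_{[\omega^\star_{r_2,r_1}]}$, $\ell_{\mathcal C,0,s}^\star=\operatorname{ind\,lim}_{r_2}\operatorname{proj\,lim}_{r_1}\ell_{[\omega^\star_{r_2,r_1}]}$. As sets, projective/inductive limits are intersections/unions.
   Formalization: "Continuous" means separately continuous and jointly sequentially continuous, since joint continuity fails for the pairing at α=0 if d_1+d_2≥1; in the A-spaces, if exactly one s_j is 0, its factor takes parameter 1/r, since the given steps are not directed. *)

theory Defs
  imports "HOL-Analysis.Analysis" "HOL-Library.Function_Algebras"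
begin

section \<open>The index set of the weights\<close>

text \<open>\<open>Flat \<sigma>\<close> is the formal symbol \<open>\<flat>\<^sub>\<sigma>\<close>. The set \<open>\<real>\<^sub>\<flat>\<close>-bar consists only of the \<open>Num x\<close> with
  \<open>x \<ge> 0\<close> and the \<open>Flat \<sigma>\<close> with \<open>\<sigma> > 0\<close>; it is cut out by \<open>Rflat\<close> below.\<close>

datatype rflat = Num real | Flat real

instantiation rflat :: linorder
begin

fun less_rflat :: "rflat \<Rightarrow> rflat \<Rightarrow> bool" where
  "Num x < Num y \<longleftrightarrow> x < y"
| "Num x < Flat \<sigma> \<longleftrightarrow> x < 1/2"
| "Flat \<sigma> < Num x \<longleftrightarrow> 1/2 \<le> x"
| "Flat \<sigma> < Flat \<tau> \<longleftrightarrow> \<sigma> < \<tau>"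

definition less_eq_rflat :: "rflat \<Rightarrow> rflat \<Rightarrow> bool" where
  "x \<le> y \<longleftrightarrow> x < y \<or> x = (y :: rflat)"

instance
proof
  fix x y z :: rflat
  show "x < y \<longleftrightarrow> x \<le> y \<and> \<not> y \<le> x"
    by (cases x; cases y) (auto simp: less_eq_rflat_def)
  show "x \<le> x" by (simp add: less_eq_rflat_def)
  show "x \<le> y \<Longrightarrow> y \<le> z \<Longrightarrow> x \<le> z"
    by (cases x; cases y; cases z) (auto simp: less_eq_rflat_def)
  show "x \<le> y \<Longrightarrow> y \<le> x \<Longrightarrow> x = y"
    by (cases x; cases y) (auto simp: less_eq_rflat_def)
  show "x \<le> y \<or> y \<le> x"
    by (cases x; cases y) (auto simp: less_eq_rflat_def)
qed

end

definition Rflat :: "rflat set" where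
  "Rflat = {Num x | x. 0 \<le> x} \<union> {Flat \<sigma> | \<sigma>. 0 < \<sigma>}"


section \<open>Multi-indices\<close>

text \<open>An element of \<open>\<nat>\<^sup>d\<close> is a function \<open>nat \<Rightarrow> nat\<close> that vanishes from \<open>d\<close> on, so that addition of
  multi-indices is pointwise addition of functions. Pairs of dimensions, smoothness indices and
  multi-indices are ordered as \<open>(d\<^sub>2, d\<^sub>1)\<close>, \<open>(s\<^sub>2, s\<^sub>1)\<close>, \<open>(\<alpha>\<^sub>2, \<alpha>\<^sub>1)\<close>.\<close>

type_synonym midx = "nat \<Rightarrow> nat"

definition multi :: "nat \<Rightarrow> midx set" where
  "multi d = {\<alpha>. \<forall>i\<ge>d. \<alpha> i = 0}"

definition mdeg :: "nat \<Rightarrow> midx \<Rightarrow> nat" where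
  "mdeg d \<alpha> = (\<Sum>i<d. \<alpha> i)"

definition mfact :: "nat \<Rightarrow> midx \<Rightarrow> nat" where
  "mfact d \<alpha> = (\<Prod>i<d. fact (\<alpha> i))"

definition mbinom :: "nat \<Rightarrow> midx \<Rightarrow> midx \<Rightarrow> nat" where
  "mbinom d \<alpha> \<gamma> = (\<Prod>i<d. \<alpha> i choose \<gamma> i)"

definition Lam :: "nat \<times> nat \<Rightarrow> (midx \<times> midx) set" where
  "Lam d = multi (fst d) \<times> multi (snd d)"

definition deg2 :: "nat \<times> nat \<Rightarrow> midx \<times> midx \<Rightarrow> nat" where
  "deg2 d \<alpha> = mdeg (fst d) (fst \<alpha>) + mdeg (snd d) (snd \<alpha>)"

definition binom2 :: "nat \<times> nat \<Rightarrow> midx \<times> midx \<Rightarrow> midx \<times> midx \<Rightarrow> nat" where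
  "binom2 d \<alpha> \<gamma> = mbinom (fst d) (fst \<alpha>) (fst \<gamma>) * mbinom (snd d) (snd \<alpha>) (snd \<gamma>)"


section \<open>Weights\<close>

fun vtheta :: "nat \<Rightarrow> real \<Rightarrow> rflat \<Rightarrow> midx \<Rightarrow> ennreal" where
  "vtheta d r (Num s) \<alpha> =
     (if s = 0 then (if real (mdeg d \<alpha>) \<le> r then 1 else \<infinity>)
      else ennreal (exp (r * real (mdeg d \<alpha>) powr (1 / (2 * s)))))"
| "vtheta d r (Flat \<sigma>) \<alpha> =
     ennreal (r ^ mdeg d \<alpha> * real (mfact d \<alpha>) powr (1 / (2 * \<sigma>)))"

text \<open>The limits over \<open>r\<close> in the \<open>\<A>\<close>-spaces use one parameter for both factors. For a nonzero index
  \<open>vtheta\<close> increases with \<open>r\<close>, for the index \<open>0\<close> it decreases. If exactly one of \<open>s\<^sub>2\<close>, \<open>s\<^sub>1\<close> is \<open>0\<close>, the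
  weights with the same \<open>r\<close> in both factors are therefore not directed, and the union of the steps
  would not even be a vector space. In that case, and only then, the factor with index \<open>0\<close> gets the
  parameter \<open>1/r\<close>, so that both factors move in the same direction.\<close>

definition par :: "rflat \<Rightarrow> rflat \<Rightarrow> real \<Rightarrow> real" where
  "par s s' r = (if s = Num 0 \<and> s' \<noteq> Num 0 then 1 / r else r)"

definition vtheta2 :: "nat \<times> nat \<Rightarrow> rflat \<times> rflat \<Rightarrow> real \<Rightarrow> midx \<times> midx \<Rightarrow> ennreal" where
  "vtheta2 d s r \<alpha> =
     vtheta (fst d) (par (fst s) (snd s) r) (fst s) (fst \<alpha>) *
     vtheta (snd d) (par (snd s) (fst s) r) (snd s) (snd \<alpha>)"

lemma vtheta2_literal:
  assumes "s\<^sub>2 = Num 0 \<longleftrightarrow> s\<^sub>1 = Num 0"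
  shows "vtheta2 (d\<^sub>2, d\<^sub>1) (s\<^sub>2, s\<^sub>1) r (\<alpha>\<^sub>2, \<alpha>\<^sub>1) = vtheta d\<^sub>2 r s\<^sub>2 \<alpha>\<^sub>2 * vtheta d\<^sub>1 r s\<^sub>1 \<alpha>\<^sub>1"
  using assms by (auto simp: vtheta2_def par_def)

text \<open>Division in \<^typ>\<open>ennreal\<close> satisfies \<open>a / \<infinity> = 0\<close> also for \<open>a = \<infinity>\<close>, and \<open>\<infinity> * 0 = 0\<close>.\<close>

definition omega :: "nat \<times> nat \<Rightarrow> rflat \<times> rflat \<Rightarrow> real \<Rightarrow> real \<Rightarrow> midx \<times> midx \<Rightarrow> ennreal" where
  "omega d s r\<^sub>2 r\<^sub>1 \<alpha> =
     vtheta (fst d) r\<^sub>2 (fst s) (fst \<alpha>) / vtheta (snd d) r\<^sub>1 (snd s) (snd \<alpha>)"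

definition omega_star :: "nat \<times> nat \<Rightarrow> rflat \<times> rflat \<Rightarrow> real \<Rightarrow> real \<Rightarrow> midx \<times> midx \<Rightarrow> ennreal" where
  "omega_star d s r\<^sub>2 r\<^sub>1 \<alpha> =
     vtheta (snd d) r\<^sub>1 (snd s) (snd \<alpha>) / vtheta (fst d) r\<^sub>2 (fst s) (fst \<alpha>)"


section \<open>Weighted sequence spaces\<close>

text \<open>A sequence \<open>\<Lambda> \<rightarrow> \<complex>\<close> is a function on the whole type that vanishes outside \<open>\<Lambda>\<close>.\<close>

definition seqs :: "'i set \<Rightarrow> ('i \<Rightarrow> complex) set" where
  "seqs \<Lambda> = {c. \<forall>\<alpha>. \<alpha> \<notin> \<Lambda> \<longrightarrow> c \<alpha> = 0}"

definition ell0 :: "'i set \<Rightarrow> ('i \<Rightarrow> complex) set" where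
  "ell0 \<Lambda> = {c \<in> seqs \<Lambda>. finite {\<alpha>. c \<alpha> \<noteq> 0}}"

definition epowr :: "ennreal \<Rightarrow> real \<Rightarrow> ennreal" where
  "epowr x a = (if x = \<infinity> then \<infinity> else ennreal (enn2real x powr a))"

definition lp_norm :: "ennreal \<Rightarrow> 'i set \<Rightarrow> ('i \<Rightarrow> ennreal) \<Rightarrow> ennreal" where
  "lp_norm p \<Lambda> f =
     (if p = \<infinity> then (SUP \<alpha>\<in>\<Lambda>. f \<alpha>)
      else epowr (\<Sum>\<^sub>\<infinity>\<alpha>\<in>\<Lambda>. epowr (f \<alpha>) (enn2real p)) (1 / enn2real p))"

definition wnorm :: "ennreal \<Rightarrow> 'i set \<Rightarrow> ('i \<Rightarrow> ennreal) \<Rightarrow> ('i \<Rightarrow> complex) \<Rightarrow> ennreal" where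
  "wnorm p \<Lambda> \<omega> c = lp_norm p \<Lambda> (\<lambda>\<alpha>. ennreal (norm (c \<alpha>)) * \<omega> \<alpha>)"

definition ell_w :: "ennreal \<Rightarrow> 'i set \<Rightarrow> ('i \<Rightarrow> ennreal) \<Rightarrow> ('i \<Rightarrow> complex) set" where
  "ell_w p \<Lambda> \<omega> = {c \<in> seqs \<Lambda>. wnorm p \<Lambda> \<omega> c < \<infinity>}"

definition ell_top :: "ennreal \<Rightarrow> 'i set \<Rightarrow> ('i \<Rightarrow> ennreal) \<Rightarrow> ('i \<Rightarrow> complex) topology" where
  "ell_top p \<Lambda> \<omega> = topology (\<lambda>U. U \<subseteq> ell_w p \<Lambda> \<omega> \<and>
     (\<forall>c\<in>U. \<exists>\<epsilon>>0. \<forall>c'\<in>ell_w p \<Lambda> \<omega>. wnorm p \<Lambda> \<omega> (c' - c) < ennreal \<epsilon> \<longrightarrow> c' \<in> U))"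

lemma openin_ell_top:
  "openin (ell_top p \<Lambda> \<omega>) U \<longleftrightarrow> U \<subseteq> ell_w p \<Lambda> \<omega> \<and>
     (\<forall>c\<in>U. \<exists>\<epsilon>>0. \<forall>c'\<in>ell_w p \<Lambda> \<omega>. wnorm p \<Lambda> \<omega> (c' - c) < ennreal \<epsilon> \<longrightarrow> c' \<in> U)"
proof -
  let ?P = "\<lambda>U. U \<subseteq> ell_w p \<Lambda> \<omega> \<and>
     (\<forall>c\<in>U. \<exists>\<epsilon>>0. \<forall>c'\<in>ell_w p \<Lambda> \<omega>. wnorm p \<Lambda> \<omega> (c' - c) < ennreal \<epsilon> \<longrightarrow> c' \<in> U)"
  have "istopology ?P"
    unfolding istopology_def
  proof (intro conjI allI impI)
    fix S T assume S: "?P S" and T: "?P T"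
    show "S \<inter> T \<subseteq> ell_w p \<Lambda> \<omega>" using S by blast
    show "\<forall>c\<in>S \<inter> T. \<exists>\<epsilon>>0. \<forall>c'\<in>ell_w p \<Lambda> \<omega>. wnorm p \<Lambda> \<omega> (c' - c) < ennreal \<epsilon> \<longrightarrow> c' \<in> S \<inter> T"
    proof
      fix c assume c: "c \<in> S \<inter> T"
      from S c obtain e where e: "e > 0"
        "\<forall>c'\<in>ell_w p \<Lambda> \<omega>. wnorm p \<Lambda> \<omega> (c' - c) < ennreal e \<longrightarrow> c' \<in> S" by blast
      from T c obtain e' where e': "e' > 0"
        "\<forall>c'\<in>ell_w p \<Lambda> \<omega>. wnorm p \<Lambda> \<omega> (c' - c) < ennreal e' \<longrightarrow> c' \<in> T" by blast
      have "c' \<in> S \<inter> T"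
        if "c' \<in> ell_w p \<Lambda> \<omega>" "wnorm p \<Lambda> \<omega> (c' - c) < ennreal (min e e')" for c'
      proof -
        have "wnorm p \<Lambda> \<omega> (c' - c) < ennreal e" "wnorm p \<Lambda> \<omega> (c' - c) < ennreal e'"
          by (rule order.strict_trans2[OF that(2) ennreal_leI], simp)+
        with e e' that(1) show ?thesis by blast
      qed
      moreover have "min e e' > 0" using e(1) e'(1) by simp
      ultimately show "\<exists>\<epsilon>>0. \<forall>c'\<in>ell_w p \<Lambda> \<omega>. wnorm p \<Lambda> \<omega> (c' - c) < ennreal \<epsilon> \<longrightarrow> c' \<in> S \<inter> T"
        by blast
    qed
  next
    fix \<K> assume "\<forall>K\<in>\<K>. ?P K"
    then show "\<Union>\<K> \<subseteq> ell_w p \<Lambda> \<omega>" by blast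
  next
    fix \<K> assume K: "\<forall>K\<in>\<K>. ?P K"
    show "\<forall>c\<in>\<Union>\<K>. \<exists>\<epsilon>>0. \<forall>c'\<in>ell_w p \<Lambda> \<omega>. wnorm p \<Lambda> \<omega> (c' - c) < ennreal \<epsilon> \<longrightarrow> c' \<in> \<Union>\<K>"
    proof
      fix c assume "c \<in> \<Union>\<K>"
      then obtain A where A: "A \<in> \<K>" "c \<in> A" by blast
      then have "\<exists>\<epsilon>>0. \<forall>c'\<in>ell_w p \<Lambda> \<omega>. wnorm p \<Lambda> \<omega> (c' - c) < ennreal \<epsilon> \<longrightarrow> c' \<in> A"
        using K by blast
      then show "\<exists>\<epsilon>>0. \<forall>c'\<in>ell_w p \<Lambda> \<omega>. wnorm p \<Lambda> \<omega> (c' - c) < ennreal \<epsilon> \<longrightarrow> c' \<in> \<Union>\<K>"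
        using A(1) by (metis UnionI)
    qed
  qed
  then show ?thesis
    unfolding ell_top_def by (simp add: topology_inverse')
qed

lemma topspace_ell_top [simp]: "topspace (ell_top p \<Lambda> \<omega>) = ell_w p \<Lambda> \<omega>"
proof -
  have "openin (ell_top p \<Lambda> \<omega>) (ell_w p \<Lambda> \<omega>)"
    unfolding openin_ell_top by (auto intro: exI[of _ 1])
  moreover have "topspace (ell_top p \<Lambda> \<omega>) \<subseteq> ell_w p \<Lambda> \<omega>"
    using openin_topspace[of "ell_top p \<Lambda> \<omega>"] unfolding openin_ell_top by blast
  ultimately show ?thesis
    by (meson openin_subset subset_antisym)
qed


section \<open>Projective and inductive limits\<close>

text \<open>The index \<open>r\<close> runs over all positive reals. The projective limit carries the initial topology of
  the inclusions into the steps. The inductive limit carries the finest locally convex topology for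
  which the inclusions of the steps are continuous, that is, the topology generated by all
  seminorms on the union whose restrictions to the steps are continuous.\<close>

definition proj_lim :: "(real \<Rightarrow> ('i \<Rightarrow> complex) topology) \<Rightarrow> ('i \<Rightarrow> complex) topology" where
  "proj_lim T = topology_generated_by
     {U \<inter> (\<Inter>r'\<in>{0<..}. topspace (T r')) | U r. 0 < r \<and> openin (T r) U}"

lemma topspace_proj_lim: "topspace (proj_lim T) = (\<Inter>r\<in>{0<..}. topspace (T r))"
proof
  show "topspace (proj_lim T) \<subseteq> (\<Inter>r\<in>{0<..}. topspace (T r))"
    unfolding proj_lim_def topology_generated_by_topspace by blast
  have "topspace (T 1) \<inter> (\<Inter>r\<in>{0<..}. topspace (T r))
      \<in> {U \<inter> (\<Inter>r'\<in>{0<..}. topspace (T r')) | U r. 0 < r \<and> openin (T r) U}"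
    by (rule CollectI, rule exI[of _ "topspace (T 1)"], rule exI[of _ "1::real"]) simp
  then have "topspace (T 1) \<inter> (\<Inter>r\<in>{0<..}. topspace (T r)) \<subseteq> topspace (proj_lim T)"
    unfolding proj_lim_def topology_generated_by_topspace by (rule Union_upper)
  moreover have "(\<Inter>r\<in>{0<..}. topspace (T r)) \<subseteq> topspace (T 1)"
    by (rule INF_lower) simp
  ultimately show "(\<Inter>r\<in>{0<..}. topspace (T r)) \<subseteq> topspace (proj_lim T)"
    by (simp add: Int_absorb1)
qed

definition seminorm_on :: "('i \<Rightarrow> complex) set \<Rightarrow> (('i \<Rightarrow> complex) \<Rightarrow> real) \<Rightarrow> bool" where
  "seminorm_on V q \<longleftrightarrow>
     (\<forall>c\<in>V. 0 \<le> q c) \<and>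
     (\<forall>c\<in>V. \<forall>c'\<in>V. q (c + c') \<le> q c + q c') \<and>
     (\<forall>a. \<forall>c\<in>V. q (\<lambda>\<alpha>. a * c \<alpha>) = norm a * q c)"

definition lim_seminorm ::
  "(real \<Rightarrow> ('i \<Rightarrow> complex) topology) \<Rightarrow> (('i \<Rightarrow> complex) \<Rightarrow> real) \<Rightarrow> bool" where
  "lim_seminorm T q \<longleftrightarrow>
     seminorm_on (\<Union>r\<in>{0<..}. topspace (T r)) q \<and>
     (\<forall>r>0. continuous_map (T r) euclideanreal q)"

definition ind_lim :: "(real \<Rightarrow> ('i \<Rightarrow> complex) topology) \<Rightarrow> ('i \<Rightarrow> complex) topology" where
  "ind_lim T = topology (\<lambda>U. U \<subseteq> (\<Union>r\<in>{0<..}. topspace (T r)) \<and>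
     (\<forall>c\<in>U. \<exists>q. lim_seminorm T q \<and>
        (\<forall>c'\<in>(\<Union>r\<in>{0<..}. topspace (T r)). q (c' - c) < 1 \<longrightarrow> c' \<in> U)))"

lemma lim_seminorm_max:
  assumes "lim_seminorm T q" "lim_seminorm T q'"
  shows "lim_seminorm T (\<lambda>c. max (q c) (q' c))"
proof -
  define V where "V = (\<Union>r\<in>{0<..}. topspace (T r))"
  have sn: "seminorm_on V q" "seminorm_on V q'"
    using assms by (simp_all add: lim_seminorm_def V_def)
  have "seminorm_on V (\<lambda>c. max (q c) (q' c))"
    unfolding seminorm_on_def
  proof (intro conjI ballI allI)
    fix c assume c: "c \<in> V"
    then have "0 \<le> q c" using sn(1) by (simp add: seminorm_on_def)
    then show "0 \<le> max (q c) (q' c)" by simp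
    fix c' assume "c' \<in> V"
    with c have "q (c + c') \<le> q c + q c'" "q' (c + c') \<le> q' c + q' c'"
      using sn unfolding seminorm_on_def by blast+
    then show "max (q (c + c')) (q' (c + c')) \<le> max (q c) (q' c) + max (q c') (q' c')"
      by linarith
  next
    fix a c assume "c \<in> V"
    then have "q (\<lambda>\<alpha>. a * c \<alpha>) = norm a * q c" "q' (\<lambda>\<alpha>. a * c \<alpha>) = norm a * q' c"
      using sn unfolding seminorm_on_def by blast+
    then show "max (q (\<lambda>\<alpha>. a * c \<alpha>)) (q' (\<lambda>\<alpha>. a * c \<alpha>)) = norm a * max (q c) (q' c)"
      by (simp add: max_mult_distrib_left)
  qed
  moreover have "continuous_map (T r) euclideanreal (\<lambda>c. max (q c) (q' c))" if "r > 0" for r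
    using assms that by (auto simp: lim_seminorm_def intro: continuous_map_real_max)
  ultimately show ?thesis
    by (simp add: lim_seminorm_def V_def)
qed

lemma openin_ind_lim:
  "openin (ind_lim T) U \<longleftrightarrow> U \<subseteq> (\<Union>r\<in>{0<..}. topspace (T r)) \<and>
     (\<forall>c\<in>U. \<exists>q. lim_seminorm T q \<and>
        (\<forall>c'\<in>(\<Union>r\<in>{0<..}. topspace (T r)). q (c' - c) < 1 \<longrightarrow> c' \<in> U))"
proof -
  define V where "V = (\<Union>r\<in>{0<..}. topspace (T r))"
  let ?P = "\<lambda>U. U \<subseteq> V \<and>
     (\<forall>c\<in>U. \<exists>q. lim_seminorm T q \<and> (\<forall>c'\<in>V. q (c' - c) < 1 \<longrightarrow> c' \<in> U))"
  have "istopology ?P"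
    unfolding istopology_def
  proof (intro conjI allI impI)
    fix A B assume A: "?P A" and B: "?P B"
    show "A \<inter> B \<subseteq> V" using A by blast
    show "\<forall>c\<in>A \<inter> B. \<exists>q. lim_seminorm T q \<and> (\<forall>c'\<in>V. q (c' - c) < 1 \<longrightarrow> c' \<in> A \<inter> B)"
    proof
      fix c assume c: "c \<in> A \<inter> B"
      from A c obtain q where q: "lim_seminorm T q"
        "\<forall>c'\<in>V. q (c' - c) < 1 \<longrightarrow> c' \<in> A" by blast
      from B c obtain q' where q': "lim_seminorm T q'"
        "\<forall>c'\<in>V. q' (c' - c) < 1 \<longrightarrow> c' \<in> B" by blast
      show "\<exists>q. lim_seminorm T q \<and> (\<forall>c'\<in>V. q (c' - c) < 1 \<longrightarrow> c' \<in> A \<inter> B)"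
        using lim_seminorm_max[OF q(1) q'(1)] q(2) q'(2)
        by (intro exI[of _ "\<lambda>c. max (q c) (q' c)"]) auto
    qed
  next
    fix \<K> assume "\<forall>K\<in>\<K>. ?P K"
    then show "\<Union>\<K> \<subseteq> V" by blast
  next
    fix \<K> assume K: "\<forall>K\<in>\<K>. ?P K"
    show "\<forall>c\<in>\<Union>\<K>. \<exists>q. lim_seminorm T q \<and> (\<forall>c'\<in>V. q (c' - c) < 1 \<longrightarrow> c' \<in> \<Union>\<K>)"
    proof
      fix c assume "c \<in> \<Union>\<K>"
      then obtain A where A: "A \<in> \<K>" "c \<in> A" by blast
      then have "\<exists>q. lim_seminorm T q \<and> (\<forall>c'\<in>V. q (c' - c) < 1 \<longrightarrow> c' \<in> A)"
        using K by blast
      then show "\<exists>q. lim_seminorm T q \<and> (\<forall>c'\<in>V. q (c' - c) < 1 \<longrightarrow> c' \<in> \<Union>\<K>)"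
        using A(1) by (metis UnionI)
    qed
  qed
  then show ?thesis
    unfolding ind_lim_def V_def by (simp add: topology_inverse')
qed

lemma topspace_ind_lim: "topspace (ind_lim T) = (\<Union>r\<in>{0<..}. topspace (T r))"
proof -
  have "lim_seminorm T (\<lambda>_. 0)"
    by (simp add: lim_seminorm_def seminorm_on_def)
  then have "openin (ind_lim T) (\<Union>r\<in>{0<..}. topspace (T r))"
    unfolding openin_ind_lim by blast
  moreover have "topspace (ind_lim T) \<subseteq> (\<Union>r\<in>{0<..}. topspace (T r))"
    using openin_topspace[of "ind_lim T"] unfolding openin_ind_lim by blast
  ultimately show ?thesis
    by (meson openin_subset subset_antisym)
qed


section \<open>The spaces\<close>

context
  fixes p :: ennreal and d :: "nat \<times> nat" and s :: "rflat \<times> rflat"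
begin

definition ell_A :: "(midx \<times> midx \<Rightarrow> complex) topology" where
  "ell_A = ind_lim (\<lambda>r. ell_top p (Lam d) (vtheta2 d s r))"

definition ell_A_star :: "(midx \<times> midx \<Rightarrow> complex) topology" where
  "ell_A_star = proj_lim (\<lambda>r. ell_top p (Lam d) (\<lambda>\<alpha>. 1 / vtheta2 d s r \<alpha>))"

definition ell_A0 :: "(midx \<times> midx \<Rightarrow> complex) topology" where
  "ell_A0 = proj_lim (\<lambda>r. ell_top p (Lam d) (vtheta2 d s r))"

definition ell_A0_star :: "(midx \<times> midx \<Rightarrow> complex) topology" where
  "ell_A0_star = ind_lim (\<lambda>r. ell_top p (Lam d) (\<lambda>\<alpha>. 1 / vtheta2 d s r \<alpha>))"

definition ell_B :: "(midx \<times> midx \<Rightarrow> complex) topology" where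
  "ell_B = proj_lim (\<lambda>r\<^sub>1. ind_lim (\<lambda>r\<^sub>2. ell_top p (Lam d) (omega d s r\<^sub>2 r\<^sub>1)))"

definition ell_B0 :: "(midx \<times> midx \<Rightarrow> complex) topology" where
  "ell_B0 = proj_lim (\<lambda>r\<^sub>2. ind_lim (\<lambda>r\<^sub>1. ell_top p (Lam d) (omega d s r\<^sub>2 r\<^sub>1)))"

definition ell_B_star :: "(midx \<times> midx \<Rightarrow> complex) topology" where
  "ell_B_star = proj_lim (\<lambda>r\<^sub>2. ind_lim (\<lambda>r\<^sub>1. ell_top p (Lam d) (omega_star d s r\<^sub>2 r\<^sub>1)))"

definition ell_B0_star :: "(midx \<times> midx \<Rightarrow> complex) topology" where
  "ell_B0_star = proj_lim (\<lambda>r\<^sub>1. ind_lim (\<lambda>r\<^sub>2. ell_top p (Lam d) (omega_star d s r\<^sub>2 r\<^sub>1)))"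

definition ell_C :: "(midx \<times> midx \<Rightarrow> complex) topology" where
  "ell_C = ind_lim (\<lambda>r\<^sub>2. proj_lim (\<lambda>r\<^sub>1. ell_top p (Lam d) (omega d s r\<^sub>2 r\<^sub>1)))"

definition ell_C0 :: "(midx \<times> midx \<Rightarrow> complex) topology" where
  "ell_C0 = ind_lim (\<lambda>r\<^sub>1. proj_lim (\<lambda>r\<^sub>2. ell_top p (Lam d) (omega d s r\<^sub>2 r\<^sub>1)))"

definition ell_C_star :: "(midx \<times> midx \<Rightarrow> complex) topology" where
  "ell_C_star = ind_lim (\<lambda>r\<^sub>1. proj_lim (\<lambda>r\<^sub>2. ell_top p (Lam d) (omega_star d s r\<^sub>2 r\<^sub>1)))"

definition ell_C0_star :: "(midx \<times> midx \<Rightarrow> complex) topology" where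
  "ell_C0_star = ind_lim (\<lambda>r\<^sub>2. proj_lim (\<lambda>r\<^sub>1. ell_top p (Lam d) (omega_star d s r\<^sub>2 r\<^sub>1)))"

end


section \<open>The bilinear map and its continuous extensions\<close>

definition U_diamond :: "nat \<times> nat \<Rightarrow> complex \<Rightarrow>
    (midx \<times> midx \<Rightarrow> complex) \<Rightarrow> (midx \<times> midx \<Rightarrow> complex) \<Rightarrow> (midx \<times> midx \<Rightarrow> complex)" where
  "U_diamond d t c\<^sub>1 c\<^sub>2 = (\<lambda>\<alpha>. if \<alpha> \<in> Lam d then
     t ^ deg2 d \<alpha> *
     (\<Sum>\<^sub>\<infinity>\<gamma>\<in>Lam d. of_real (sqrt (real (binom2 d (\<alpha> + \<gamma>) \<gamma>))) * c\<^sub>1 \<gamma> * c\<^sub>2 (\<alpha> + \<gamma>))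
     else 0)"

lemma U_diamond_in_ell0:
  assumes "c\<^sub>1 \<in> ell0 (Lam d)" "c\<^sub>2 \<in> ell0 (Lam d)"
  shows "U_diamond d t c\<^sub>1 c\<^sub>2 \<in> ell0 (Lam d)"
proof -
  have "{\<alpha>. U_diamond d t c\<^sub>1 c\<^sub>2 \<alpha> \<noteq> 0}
      \<subseteq> (\<lambda>(\<beta>, \<gamma>). (\<lambda>i. fst \<beta> i - fst \<gamma> i, \<lambda>i. snd \<beta> i - snd \<gamma> i)) `
          ({\<beta>. c\<^sub>2 \<beta> \<noteq> 0} \<times> {\<gamma>. c\<^sub>1 \<gamma> \<noteq> 0})" (is "_ \<subseteq> ?R")
  proof
    fix \<alpha> assume "\<alpha> \<in> {\<alpha>. U_diamond d t c\<^sub>1 c\<^sub>2 \<alpha> \<noteq> 0}"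
    then have "(\<Sum>\<^sub>\<infinity>\<gamma>\<in>Lam d. of_real (sqrt (real (binom2 d (\<alpha> + \<gamma>) \<gamma>))) * c\<^sub>1 \<gamma> * c\<^sub>2 (\<alpha> + \<gamma>)) \<noteq> 0"
      by (auto simp: U_diamond_def split: if_splits)
    then obtain \<gamma> where "c\<^sub>1 \<gamma> \<noteq> 0" "c\<^sub>2 (\<alpha> + \<gamma>) \<noteq> 0"
      by (metis (no_types, lifting) infsum_0 mult_eq_0_iff)
    moreover have "\<alpha> = (\<lambda>i. fst (\<alpha> + \<gamma>) i - fst \<gamma> i, \<lambda>i. snd (\<alpha> + \<gamma>) i - snd \<gamma> i)"
      by (simp add: prod_eq_iff)
    ultimately show "\<alpha> \<in> ?R"
      by (intro image_eqI[of _ _ "(\<alpha> + \<gamma>, \<gamma>)"]) simp_all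
  qed
  moreover have "finite ?R"
    using assms by (simp add: ell0_def)
  ultimately have "finite {\<alpha>. U_diamond d t c\<^sub>1 c\<^sub>2 \<alpha> \<noteq> 0}"
    by (rule finite_subset)
  then show ?thesis
    by (simp add: ell0_def seqs_def U_diamond_def)
qed

text \<open>Joint continuity for the product topology fails for bilinear maps such as
  \<open>(c\<^sub>1, c\<^sub>2) \<mapsto> \<Sum>\<gamma>. c\<^sub>1 \<gamma> * c\<^sub>2 \<gamma>\<close> on \<open>\<ell>\<^sub>\<A> \<times> \<ell>\<^sub>\<A>\<^sup>\<star>\<close>, which is the value of \<open>U_diamond\<close> at
  \<open>\<alpha> = 0\<close>: the pairing of a locally convex space with its strong dual is jointly continuous
  only if the space is normable. A continuous map of two variables is therefore one that is separately continuous, and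
  in addition sequentially continuous in both variables jointly. The uniqueness clause needs
  separate continuity only.\<close>

definition separately_continuous ::
  "'a topology \<Rightarrow> 'b topology \<Rightarrow> 'c topology \<Rightarrow> ('a \<Rightarrow> 'b \<Rightarrow> 'c) \<Rightarrow> bool" where
  "separately_continuous X Y Z F \<longleftrightarrow>
     (\<forall>x\<in>topspace X. continuous_map Y Z (F x)) \<and>
     (\<forall>y\<in>topspace Y. continuous_map X Z (\<lambda>x. F x y))"

definition jointly_sequentially_continuous ::
  "'a topology \<Rightarrow> 'b topology \<Rightarrow> 'c topology \<Rightarrow> ('a \<Rightarrow> 'b \<Rightarrow> 'c) \<Rightarrow> bool" where
  "jointly_sequentially_continuous X Y Z F \<longleftrightarrow>
     (\<forall>xs ys x y. limitin X xs x sequentially \<longrightarrow> limitin Y ys y sequentially \<longrightarrow>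
        limitin Z (\<lambda>n. F (xs n) (ys n)) (F x y) sequentially)"

definition uniquely_extendable ::
  "'a set \<Rightarrow> ('a \<Rightarrow> 'a \<Rightarrow> 'a) \<Rightarrow> 'a topology \<Rightarrow> 'a topology \<Rightarrow> 'a topology \<Rightarrow> bool" where
  "uniquely_extendable D U X Y Z \<longleftrightarrow>
     D \<subseteq> topspace X \<and> D \<subseteq> topspace Y \<and> D \<subseteq> topspace Z \<and>
     (\<exists>F. (\<forall>x\<in>D. \<forall>y\<in>D. F x y = U x y) \<and>
          separately_continuous X Y Z F \<and> jointly_sequentially_continuous X Y Z F \<and>
          (\<forall>G. (\<forall>x\<in>D. \<forall>y\<in>D. G x y = U x y) \<and> separately_continuous X Y Z G \<longrightarrow>
               (\<forall>x\<in>topspace X. \<forall>y\<in>topspace Y. G x y = F x y)))"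

definition U_extendable :: "nat \<times> nat \<Rightarrow> complex \<Rightarrow>
    (midx \<times> midx \<Rightarrow> complex) topology \<Rightarrow> (midx \<times> midx \<Rightarrow> complex) topology \<Rightarrow>
    (midx \<times> midx \<Rightarrow> complex) topology \<Rightarrow> bool" where
  "U_extendable d t = uniquely_extendable (ell0 (Lam d)) (U_diamond d t)"

end

theory Submission
  imports Defs
begin

text \<open>
  The weights of all twelve spaces are products of one factor for each of the two variables, which is
  \<open>I r\<close> in an inductive parameter \<open>r\<close> or \<open>1 / I r\<close> in a projective one. For all \<open>R \<ge> 1\<close> the function \<open>I\<close>
  satisfies \<open>R ^ (\<bar>\<alpha>\<bar> + \<bar>\<gamma>\<bar>) * I c \<alpha> * I c \<gamma> \<le> M * I b (\<alpha> + \<gamma>)\<close> with \<open>c\<close> depending on \<open>b\<close>, and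
  \<open>R ^ (\<bar>\<alpha>\<bar> + \<bar>\<gamma>\<bar>) * I a (\<alpha> + \<gamma>) \<le> M * I c \<alpha> * I c \<gamma>\<close> with \<open>a\<close> depending on \<open>c\<close>. At \<open>\<gamma> = 0\<close> this says
  that successive weights differ by an arbitrary geometric factor, so the exponent \<open>p\<close> may be taken
  to be \<open>\<infinity>\<close> and the finitely supported sequences are dense. As binomial coefficients grow at most
  geometrically, the two inequalities bound \<open>U_diamond\<close> between the steps, with the quantifiers over
  the steps in the order that separate continuity requires. In each pair one variable runs through an
  inductive limit of Frechet spaces, which is barrelled, and the Banach--Steinhaus theorem in that
  variable gives joint sequential continuity.
\<close>

section \<open>Topologies generated by seminorms\<close>

text \<open>For \<open>p < 1\<close> the steps are only quasi-normed, and the inductive limits are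
  in general not metrizable, so neither norms nor sequences describe all the topologies. Directed
  families of seminorms do, once \<open>p = top\<close>, and continuity of a linear map becomes
  domination of seminorms. The first half of the theorem takes for \<open>I\<close> the weight
  \<open>vtheta\<close> with reversed parameter, the second half takes \<open>1 / vtheta\<close>;
  there the starred and unstarred spaces exchange roles, and both halves are instances of one
  statement. The bounds at 1/2 come from the geometric factor. For exponential weights of the first
  half, a small multiple of a power of the degree has to outgrow a linear term, which takes an
  exponent above 1; in the second half the multiple may be raised, and exponent 1 is enough. The
  index 0 makes weights infinite: reciprocals vanish, products infinity times 0 occur, and series
  may diverge where a target weight is 0. This causes the exceptional alternatives in the bounds and
  the care with convergence.\<close>

definition vsub :: "('i \<Rightarrow> complex) set \<Rightarrow> bool" where
  "vsub V \<longleftrightarrow> 0 \<in> V \<and> (\<forall>c\<in>V. \<forall>c'\<in>V. c + c' \<in> V) \<and> (\<forall>a. \<forall>c\<in>V. (\<lambda>\<alpha>. a * c \<alpha>) \<in> V)"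

definition lin_on :: "('i \<Rightarrow> complex) set \<Rightarrow> (('i \<Rightarrow> complex) \<Rightarrow> ('j \<Rightarrow> complex)) \<Rightarrow> bool" where
  "lin_on V f \<longleftrightarrow> (\<forall>c\<in>V. \<forall>c'\<in>V. f (c + c') = f c + f c') \<and>
     (\<forall>a. \<forall>c\<in>V. f (\<lambda>\<alpha>. a * c \<alpha>) = (\<lambda>\<alpha>. a * f c \<alpha>))"

text \<open>The family \<open>P\<close> is directed and, up to domination, closed under positive multiples, so that the
  single unit balls of its members already form a base of neighbourhoods.\<close>

definition lc :: "('i \<Rightarrow> complex) topology \<Rightarrow> (('i \<Rightarrow> complex) \<Rightarrow> real) set \<Rightarrow> bool" where
  "lc T P \<longleftrightarrow> vsub (topspace T) \<and> P \<noteq> {} \<and> (\<forall>q\<in>P. seminorm_on (topspace T) q) \<and>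
     (\<forall>q\<in>P. \<forall>q'\<in>P. \<exists>q''\<in>P. \<forall>c\<in>topspace T. q c \<le> q'' c \<and> q' c \<le> q'' c) \<and>
     (\<forall>q\<in>P. \<forall>M>0. \<exists>q'\<in>P. \<forall>c\<in>topspace T. M * q c \<le> q' c) \<and>
     (\<forall>U. openin T U \<longleftrightarrow> U \<subseteq> topspace T \<and>
        (\<forall>c\<in>U. \<exists>q\<in>P. \<forall>c'\<in>topspace T. q (c' - c) < 1 \<longrightarrow> c' \<in> U))"

text \<open>The axioms in \<open>lin_on\<close> and \<open>seminorm_on\<close> speak of sums and of
  multiples written as abstractions, so a difference has to be brought into this form before they
  apply.\<close>

lemma diff_as_sum: "c - c' = c + (\<lambda>\<alpha>. (-1) * c' \<alpha>)" for c :: "'i \<Rightarrow> complex"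
  by (auto simp: fun_eq_iff)

lemma vsub_add: "vsub V \<Longrightarrow> c \<in> V \<Longrightarrow> c' \<in> V \<Longrightarrow> c + c' \<in> V"
  by (simp add: vsub_def)

lemma vsub_scale: "vsub V \<Longrightarrow> c \<in> V \<Longrightarrow> (\<lambda>\<alpha>. a * c \<alpha>) \<in> V"
  by (simp add: vsub_def)

lemma vsub_diff: "vsub V \<Longrightarrow> c \<in> V \<Longrightarrow> c' \<in> V \<Longrightarrow> c - c' \<in> V"
  unfolding diff_as_sum by (intro vsub_add vsub_scale)

lemma vsub_0: "vsub V \<Longrightarrow> 0 \<in> V"
  by (simp add: vsub_def)

lemma lin_on_add: "lin_on V f \<Longrightarrow> c \<in> V \<Longrightarrow> c' \<in> V \<Longrightarrow> f (c + c') = f c + f c'"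
  by (simp add: lin_on_def)

lemma lin_on_scale: "lin_on V f \<Longrightarrow> c \<in> V \<Longrightarrow> f (\<lambda>\<alpha>. a * c \<alpha>) = (\<lambda>\<alpha>. a * f c \<alpha>)"
  by (simp add: lin_on_def)

lemma lin_on_subset: "lin_on V f \<Longrightarrow> W \<subseteq> V \<Longrightarrow> lin_on W f"
  unfolding lin_on_def by (meson subsetD)

lemma lin_on_diff:
  assumes "vsub V" "lin_on V f" "c \<in> V" "c' \<in> V"
  shows "f (c - c') = f c - f c'"
  unfolding diff_as_sum
  using lin_on_add[OF assms(2,3) vsub_scale[OF assms(1,4)], of "-1"] lin_on_scale[OF assms(2,4), of "-1"]
  by (simp add: fun_eq_iff)

lemma seminorm_on_nonneg: "seminorm_on V q \<Longrightarrow> c \<in> V \<Longrightarrow> 0 \<le> q c"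
  by (simp add: seminorm_on_def)

lemma seminorm_on_add: "seminorm_on V q \<Longrightarrow> c \<in> V \<Longrightarrow> c' \<in> V \<Longrightarrow> q (c + c') \<le> q c + q c'"
  by (simp add: seminorm_on_def)

lemma seminorm_on_scale: "seminorm_on V q \<Longrightarrow> c \<in> V \<Longrightarrow> q (\<lambda>\<alpha>. a * c \<alpha>) = norm a * q c"
  by (simp add: seminorm_on_def)

lemma seminorm_on_subset: "seminorm_on V q \<Longrightarrow> W \<subseteq> V \<Longrightarrow> seminorm_on W q"
  unfolding seminorm_on_def by (meson subsetD)

lemma seminorm_on_0:
  assumes "vsub V" "seminorm_on V q" shows "q 0 = 0"
proof -
  have "(0::'a \<Rightarrow> complex) = (\<lambda>\<alpha>. 0 * 0)" by (simp add: zero_fun_def)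
  then show ?thesis
    using seminorm_on_scale[OF assms(2) vsub_0[OF assms(1)], of 0] by (simp add: zero_fun_def)
qed

lemma seminorm_on_minus_commute:
  assumes "vsub V" "seminorm_on V q" "c \<in> V" "c' \<in> V" shows "q (c - c') = q (c' - c)"
proof -
  have "c - c' = (\<lambda>\<alpha>. (-1) * (c' - c) \<alpha>)" by auto
  then show ?thesis
    using seminorm_on_scale[OF assms(2) vsub_diff[OF assms(1,4,3)], of "-1"] by simp
qed

lemma seminorm_on_triangle:
  assumes "vsub V" "seminorm_on V q" "a \<in> V" "b \<in> V" "c \<in> V"
  shows "q (a - c) \<le> q (a - b) + q (b - c)"
  using seminorm_on_add[OF assms(2), of "a - b" "b - c"] assms by (simp add: vsub_diff)

lemma seminorm_on_le_diff:
  assumes "vsub V" "seminorm_on V q" "a \<in> V" "b \<in> V"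
  shows "q a \<le> q b + q (a - b)"
  using seminorm_on_add[OF assms(2), of "b" "a - b"] assms by (simp add: vsub_diff)

lemma seminorm_on_compose:
  assumes "seminorm_on W q" "lin_on V f" "f \<in> V \<rightarrow> W"
  shows "seminorm_on V (\<lambda>c. q (f c))"
  unfolding seminorm_on_def
proof (intro conjI ballI allI)
  fix c assume c: "c \<in> V"
  then have fc: "f c \<in> W" using assms(3) by auto
  show "0 \<le> q (f c)" using assms(1) fc by (rule seminorm_on_nonneg)
  show "q (f (\<lambda>\<alpha>. a * c \<alpha>)) = norm a * q (f c)" for a
    unfolding lin_on_scale[OF assms(2) c] using assms(1) fc by (rule seminorm_on_scale)
  fix c' assume c': "c' \<in> V"
  then have fc': "f c' \<in> W" using assms(3) by auto
  show "q (f (c + c')) \<le> q (f c) + q (f c')"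
    unfolding lin_on_add[OF assms(2) c c'] using assms(1) fc fc' by (rule seminorm_on_add)
qed

lemma seminorm_on_mult:
  assumes "seminorm_on V q" "0 \<le> M"
  shows "seminorm_on V (\<lambda>c. M * q c)"
  unfolding seminorm_on_def
proof (intro conjI ballI allI)
  fix c assume c: "c \<in> V"
  show "0 \<le> M * q c" using seminorm_on_nonneg[OF assms(1) c] assms(2) by simp
  show "M * q (\<lambda>\<alpha>. a * c \<alpha>) = norm a * (M * q c)" for a
    unfolding seminorm_on_scale[OF assms(1) c] by simp
  fix c' assume c': "c' \<in> V"
  show "M * q (c + c') \<le> M * q c + M * q c'"
    using mult_left_mono[OF seminorm_on_add[OF assms(1) c c'] assms(2)] by (simp add: algebra_simps)
qed

section \<open>Open sets, continuity and convergence in terms of a base of seminorms\<close>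

lemma lc_vsub: "lc T P \<Longrightarrow> vsub (topspace T)" by (simp add: lc_def)
lemma lc_seminorm: "lc T P \<Longrightarrow> q \<in> P \<Longrightarrow> seminorm_on (topspace T) q" by (simp add: lc_def)
lemma lc_directed:
  assumes "lc T P" "q \<in> P" "q' \<in> P"
  shows "\<exists>q''\<in>P. \<forall>c\<in>topspace T. q c \<le> q'' c \<and> q' c \<le> q'' c"
  using assms by (simp add: lc_def)

lemma lc_multiple:
  assumes "lc T P" "q \<in> P" "M > 0"
  shows "\<exists>q'\<in>P. \<forall>c\<in>topspace T. M * q c \<le> q' c"
  using assms by (simp add: lc_def)

lemma lc_openin:
  assumes "lc T P"
  shows "openin T U \<longleftrightarrow> U \<subseteq> topspace T \<and>
        (\<forall>c\<in>U. \<exists>q\<in>P. \<forall>c'\<in>topspace T. q (c' - c) < 1 \<longrightarrow> c' \<in> U)"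
  using assms by (simp add: lc_def)

text \<open>A member of \<open>P\<close> that dominates \<open>q\<close> is enough, since
  \<open>P\<close> contains majorants of all its positive multiples and these shrink the unit ball
  as far as required.\<close>

lemma lc_openin_ball:
  assumes T: "lc T P" and q: "seminorm_on (topspace T) q"
    and q': "q' \<in> P" "\<And>c. c \<in> topspace T \<Longrightarrow> q c \<le> q' c" and x: "x \<in> topspace T"
  shows "openin T {c \<in> topspace T. q (c - x) < e}"
  unfolding lc_openin[OF T]
proof (intro conjI ballI)
  fix c assume "c \<in> {c \<in> topspace T. q (c - x) < e}"
  then have c: "c \<in> topspace T" "q (c - x) < e" by auto
  \<comment> \<open>The reciprocal of the distance left to the boundary: the unit ball of
    \<open>M * q'\<close> about \<open>c\<close> stays inside.\<close>
  define M where "M = 1 / (e - q (c - x))"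
  have M: "M > 0" using c by (simp add: M_def)
  obtain q2 where q2: "q2 \<in> P" "\<forall>c\<in>topspace T. M * q' c \<le> q2 c"
    using lc_multiple[OF T q'(1) M] ..
  have "c' \<in> {c \<in> topspace T. q (c - x) < e}" if c': "c' \<in> topspace T" "q2 (c' - c) < 1" for c'
  proof -
    have d: "c' - c \<in> topspace T" using vsub_diff[OF lc_vsub[OF T]] c c' by simp
    have "M * q (c' - c) \<le> M * q' (c' - c)" using q'(2)[OF d] M by simp
    also have "\<dots> < 1" using bspec[OF q2(2) d] c' by linarith
    finally have "q (c' - c) < e - q (c - x)" using c by (simp add: M_def field_simps)
    then show ?thesis
      using seminorm_on_triangle[OF lc_vsub[OF T] q c'(1) c(1) x] c' by simp
  qed
  then have "\<forall>c'\<in>topspace T. q2 (c' - c) < 1 \<longrightarrow> c' \<in> {c \<in> topspace T. q (c - x) < e}" by simp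
  then show "\<exists>p\<in>P. \<forall>c'\<in>topspace T. p (c' - c) < 1 \<longrightarrow> c' \<in> {c \<in> topspace T. q (c - x) < e}"
    using q2(1) by (rule bexI)
qed auto

lemma seminorm_bound_by_ball:
  assumes V: "vsub V" and q: "seminorm_on V q" and q': "seminorm_on V q'"
    and imp: "\<And>c. c \<in> V \<Longrightarrow> q' c < 1 \<Longrightarrow> q c < e" and c: "c \<in> V" and e: "e > 0"
  shows "q c \<le> e * q' c"
proof (rule field_le_epsilon)
  fix d :: real assume d: "d > 0"
  \<comment> \<open>Adding \<open>d / e\<close> keeps \<open>m\<close> positive and above
    \<open>q' c\<close> even if \<open>q' c = 0\<close>, so \<open>c / m\<close> lies in the open
    unit ball of \<open>q'\<close>.\<close>
  define m where "m = q' c + d / e"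
  have m: "m > 0" using seminorm_on_nonneg[OF q' c] d e by (simp add: m_def add_nonneg_pos)
  let ?c = "\<lambda>\<alpha>. complex_of_real (1 / m) * c \<alpha>"
  have cV: "?c \<in> V" by (rule vsub_scale[OF V c])
  have "q' ?c = q' c / m" using seminorm_on_scale[OF q' c, of "complex_of_real (1/m)"] m by (simp add: norm_divide)
  also have "\<dots> < 1" using m d e by (simp add: m_def)
  finally have "q ?c < e" by (rule imp[OF cV])
  moreover have "q ?c = q c / m" using seminorm_on_scale[OF q c, of "complex_of_real (1/m)"] m by (simp add: norm_divide)
  ultimately have "q c / m < e" by simp
  then have "q c < e * m" using m by (simp add: pos_divide_less_eq)
  also have "e * m = e * q' c + d" using e by (simp add: m_def field_simps)
  finally show "q c \<le> e * q' c + d" by simp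
qed

text \<open>Continuity at 0 puts the unit ball of some member \<open>q'\<close> into the set where
  \<open>q < 1\<close>, and homogeneity turns this inclusion into \<open>q \<le> q'\<close>. No
  constant appears because \<open>P\<close> absorbs multiples. Through this lemma continuity becomes
  a matter of inequalities between seminorms.\<close>

lemma lc_continuous_seminorm:
  assumes T: "lc T P" and q: "seminorm_on (topspace T) q"
  shows "continuous_map T euclideanreal q \<longleftrightarrow> (\<exists>q'\<in>P. \<forall>c\<in>topspace T. q c \<le> q' c)"
proof
  assume "continuous_map T euclideanreal q"
  then have "openin T {c \<in> topspace T. q c \<in> {..<1}}"
    by (rule openin_continuous_map_preimage) auto
  moreover have "0 \<in> {c \<in> topspace T. q c \<in> {..<1}}"
    using vsub_0[OF lc_vsub[OF T]] seminorm_on_0[OF lc_vsub[OF T] q] by simp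
  ultimately have "\<exists>q'\<in>P. \<forall>c\<in>topspace T. q' (c - 0) < 1 \<longrightarrow> c \<in> {c \<in> topspace T. q c \<in> {..<1}}"
    unfolding lc_openin[OF T] by blast
  then obtain q' where q': "q' \<in> P" "\<And>c. c \<in> topspace T \<Longrightarrow> q' (c - 0) < 1 \<Longrightarrow> q c < 1"
    by auto
  have "q c \<le> 1 * q' c" if "c \<in> topspace T" for c
    by (rule seminorm_bound_by_ball[OF lc_vsub[OF T] q lc_seminorm[OF T q'(1)] _ that])
       (use q'(2) in auto)
  with q'(1) show "\<exists>q'\<in>P. \<forall>c\<in>topspace T. q c \<le> q' c" by auto
next
  assume "\<exists>q'\<in>P. \<forall>c\<in>topspace T. q c \<le> q' c"
  then obtain q' where q': "q' \<in> P" "\<And>c. c \<in> topspace T \<Longrightarrow> q c \<le> q' c" by blast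
  have "openin T {c \<in> topspace T. q c \<in> U}" if U: "open U" for U
  proof (subst openin_subopen, intro ballI)
    fix x assume x: "x \<in> {c \<in> topspace T. q c \<in> U}"
    then obtain e where e: "e > 0" "\<And>y. \<bar>y - q x\<bar> < e \<Longrightarrow> y \<in> U"
      using U unfolding open_dist dist_real_def by blast
    let ?B = "{c \<in> topspace T. q (c - x) < e}"
    have "openin T ?B" using x by (intro lc_openin_ball[OF T q q']) auto
    moreover have "x \<in> ?B" using x e seminorm_on_0[OF lc_vsub[OF T] q] by simp
    moreover have "?B \<subseteq> {c \<in> topspace T. q c \<in> U}"
    proof
      fix c assume c: "c \<in> ?B"
      have "\<bar>q c - q x\<bar> < e"
        using seminorm_on_le_diff[OF lc_vsub[OF T] q, of c x] seminorm_on_le_diff[OF lc_vsub[OF T] q, of x c]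
          seminorm_on_minus_commute[OF lc_vsub[OF T] q, of c x] c x by auto
      then show "c \<in> {c \<in> topspace T. q c \<in> U}" using e(2) c by auto
    qed
    ultimately show "\<exists>V. openin T V \<and> x \<in> V \<and> V \<subseteq> {c \<in> topspace T. q c \<in> U}" by blast
  qed
  then show "continuous_map T euclideanreal q"
    by (simp add: continuous_map_def)
qed

lemma lc_dominated:
  assumes "lc T P" "seminorm_on (topspace T) q" "continuous_map T euclideanreal q"
  shows "\<exists>q'\<in>P. \<forall>c\<in>topspace T. q c \<le> q' c"
  using lc_continuous_seminorm[OF assms(1,2)] assms(3) by simp

lemma lc_nbhd:
  assumes T: "lc T P" and "openin T U" "c \<in> U"
  shows "\<exists>q\<in>P. \<forall>c'\<in>topspace T. q (c' - c) < 1 \<longrightarrow> c' \<in> U"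
  using assms lc_openin[OF T] by simp

lemma lc_member_continuous: "lc T P \<Longrightarrow> q \<in> P \<Longrightarrow> continuous_map T euclideanreal q"
  using lc_continuous_seminorm[OF _ lc_seminorm] by force

text \<open>By linearity an estimate at 0 holds at every point, so continuity of \<open>f\<close>
  reduces to that of the seminorms pulled back along \<open>f\<close>.\<close>

lemma lc_continuous_linear:
  assumes X: "lc X P" and Z: "lc Z Q" and f: "lin_on (topspace X) f" "f \<in> topspace X \<rightarrow> topspace Z"
    and bd: "\<And>q. q \<in> Q \<Longrightarrow> continuous_map X euclideanreal (\<lambda>c. q (f c))"
  shows "continuous_map X Z f"
  unfolding continuous_map_def
proof (intro conjI allI impI)
  show "f \<in> topspace X \<rightarrow> topspace Z" by (rule f)
  fix U assume U: "openin Z U"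
  show "openin X {c \<in> topspace X. f c \<in> U}"
    unfolding lc_openin[OF X]
  proof (intro conjI ballI)
    fix c assume c: "c \<in> {c \<in> topspace X. f c \<in> U}"
    then have "f c \<in> U" by simp
    then obtain q where q: "q \<in> Q" "\<forall>z\<in>topspace Z. q (z - f c) < 1 \<longrightarrow> z \<in> U"
      using lc_nbhd[OF Z U] by blast
    have sn: "seminorm_on (topspace X) (\<lambda>c. q (f c))"
      by (rule seminorm_on_compose[OF lc_seminorm[OF Z q(1)] f])
    obtain p where p: "p \<in> P" "\<forall>c\<in>topspace X. q (f c) \<le> p c"
      using lc_dominated[OF X sn bd[OF q(1)]] ..
    have "f c' \<in> U" if "c' \<in> topspace X" "p (c' - c) < 1" for c'
    proof (rule q(2)[rule_format])
      show "f c' \<in> topspace Z" using that f(2) by auto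
      have "q (f c' - f c) = q (f (c' - c))"
        using lin_on_diff[OF lc_vsub[OF X] f(1)] that c by simp
      also have "\<dots> \<le> p (c' - c)" using p(2) vsub_diff[OF lc_vsub[OF X], of c' c] that c by simp
      finally show "q (f c' - f c) < 1" using that by simp
    qed
    then have "\<forall>c'\<in>topspace X. p (c' - c) < 1 \<longrightarrow> c' \<in> {c \<in> topspace X. f c \<in> U}" by simp
    then show "\<exists>q\<in>P. \<forall>c'\<in>topspace X. q (c' - c) < 1 \<longrightarrow> c' \<in> {c \<in> topspace X. f c \<in> U}"
      using p(1) by (rule bexI)
  qed auto
qed

lemma lc_limitinI:
  assumes T: "lc T P" and x: "x \<in> topspace T"
    and ev: "\<And>q. q \<in> P \<Longrightarrow> \<forall>\<^sub>F n in F. xs n \<in> topspace T \<and> q (xs n - x) < 1"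
  shows "limitin T xs x F"
  unfolding limitin_def
proof (intro conjI allI impI)
  fix U assume U: "openin T U \<and> x \<in> U"
  obtain q where q: "q \<in> P" "\<forall>c\<in>topspace T. q (c - x) < 1 \<longrightarrow> c \<in> U"
    using lc_nbhd[OF T conjunct1[OF U] conjunct2[OF U]] ..
  show "\<forall>\<^sub>F n in F. xs n \<in> U"
    by (rule eventually_mono[OF ev[OF q(1)]]) (use q(2) in auto)
qed (rule x)

lemma lc_limitinD:
  assumes T: "lc T P" and lim: "limitin T xs x F" and q: "seminorm_on (topspace T) q"
    "continuous_map T euclideanreal q" and e: "e > 0"
  shows "\<forall>\<^sub>F n in F. xs n \<in> topspace T \<and> q (xs n - x) < e"
proof -
  have x: "x \<in> topspace T" using lim by (simp add: limitin_def)
  obtain q' where q': "q' \<in> P" "\<forall>c\<in>topspace T. q c \<le> q' c"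
    using lc_dominated[OF T q(1,2)] ..
  have "openin T {c \<in> topspace T. q (c - x) < e}"
    by (rule lc_openin_ball[OF T q(1) q'(1) bspec[OF q'(2)] x])
  moreover have "x \<in> {c \<in> topspace T. q (c - x) < e}"
    using x e seminorm_on_0[OF lc_vsub[OF T] q(1)] by simp
  ultimately have "\<forall>\<^sub>F n in F. xs n \<in> {c \<in> topspace T. q (c - x) < e}"
    using lim unfolding limitin_def by blast
  then show ?thesis by simp
qed

lemma lc_Hausdorff:
  assumes T: "lc T P"
    and sep: "\<And>x. x \<in> topspace T \<Longrightarrow> x \<noteq> 0 \<Longrightarrow> \<exists>q. seminorm_on (topspace T) q \<and>
      continuous_map T euclideanreal q \<and> q x > 0"
  shows "Hausdorff_space T"
  unfolding Hausdorff_space_def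
proof (intro allI impI, elim conjE)
  fix x y assume xy: "x \<in> topspace T" "y \<in> topspace T" "x \<noteq> y"
  then obtain q where q: "seminorm_on (topspace T) q" "continuous_map T euclideanreal q" "q (x - y) > 0"
    using sep[of "x - y"] vsub_diff[OF lc_vsub[OF T]] by auto
  define e where "e = q (x - y) / 2"
  let ?B = "\<lambda>z. {c \<in> topspace T. q (c - z) < e}"
  obtain q' where q': "q' \<in> P" "\<forall>c\<in>topspace T. q c \<le> q' c"
    using lc_dominated[OF T q(1,2)] ..
  have "openin T (?B x)" "openin T (?B y)"
    using lc_openin_ball[OF T q(1) q'(1) bspec[OF q'(2)]] xy by auto
  moreover have "x \<in> ?B x" "y \<in> ?B y"
    using xy q(3) seminorm_on_0[OF lc_vsub[OF T] q(1)] by (auto simp: e_def)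
  moreover have "disjnt (?B x) (?B y)"
    unfolding disjnt_iff
  proof (intro allI notI, elim conjE)
    fix c assume "c \<in> ?B x" "c \<in> ?B y"
    then show False
      using seminorm_on_triangle[OF lc_vsub[OF T] q(1) xy(1) _ xy(2), of c]
        seminorm_on_minus_commute[OF lc_vsub[OF T] q(1) xy(1), of c] by (auto simp: e_def)
  qed
  ultimately show "\<exists>U V. openin T U \<and> openin T V \<and> x \<in> U \<and> y \<in> V \<and> disjnt U V" by blast
qed

lemma lc_dense:
  assumes T: "lc T P" and D: "D \<subseteq> topspace T"
    and ap: "\<And>c q. c \<in> topspace T \<Longrightarrow> q \<in> P \<Longrightarrow> \<exists>c'\<in>D. q (c' - c) < 1"
  shows "topspace T \<subseteq> T closure_of D"
proof
  fix c assume c: "c \<in> topspace T"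
  show "c \<in> T closure_of D"
    unfolding in_closure_of
  proof (intro conjI allI impI c)
    fix U assume U: "c \<in> U \<and> openin T U"
    obtain q where q: "q \<in> P" "\<forall>c'\<in>topspace T. q (c' - c) < 1 \<longrightarrow> c' \<in> U"
      using lc_nbhd[OF T conjunct2[OF U] conjunct1[OF U]] ..
    obtain c' where "c' \<in> D" "q (c' - c) < 1" using ap[OF c q(1)] by blast
    then show "\<exists>y. y \<in> D \<and> y \<in> U" using q(2) D by blast
  qed
qed

section \<open>Projective and inductive limits of such topologies\<close>

lemma proj_lim_in: "0 < a \<Longrightarrow> continuous_map (proj_lim T) (T a) id"
  unfolding continuous_map_def
proof (intro conjI allI impI)
  assume a: "0 < a"
  show "id \<in> topspace (proj_lim T) \<rightarrow> topspace (T a)"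
    using a by (auto simp: topspace_proj_lim)
  fix U assume U: "openin (T a) U"
  have "openin (proj_lim T) (U \<inter> (\<Inter>r'\<in>{0<..}. topspace (T r')))"
    unfolding proj_lim_def by (rule topology_generated_by_Basis) (use a U in blast)
  moreover have "{x \<in> topspace (proj_lim T). id x \<in> U} = U \<inter> (\<Inter>r'\<in>{0<..}. topspace (T r'))"
    unfolding topspace_proj_lim by auto
  ultimately show "openin (proj_lim T) {x \<in> topspace (proj_lim T). id x \<in> U}" by simp
qed

lemma continuous_map_proj_lim:
  assumes "\<And>a. 0 < a \<Longrightarrow> continuous_map W (T a) f"
  shows "continuous_map W (proj_lim T) f"
  unfolding proj_lim_def
proof (rule continuous_on_generated_topo)
  have f: "f ` topspace W \<subseteq> (\<Inter>r'\<in>{0<..}. topspace (T r'))"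
    using assms unfolding continuous_map_def by auto
  fix U assume "U \<in> {U \<inter> (\<Inter>r'\<in>{0<..}. topspace (T r')) | U r. 0 < r \<and> openin (T r) U}"
  then obtain U' r where U: "U = U' \<inter> (\<Inter>r'\<in>{0<..}. topspace (T r'))" "0 < r" "openin (T r) U'" by blast
  have "f -` U \<inter> topspace W = {x \<in> topspace W. f x \<in> U'}" using f U by auto
  then show "openin W (f -` U \<inter> topspace W)"
    using assms[OF U(2)] U(3) by (simp add: continuous_map_def)
next
  have "f ` topspace W \<subseteq> topspace (proj_lim T)"
    using assms unfolding continuous_map_def topspace_proj_lim by auto
  then show "f ` topspace W \<subseteq> \<Union> {U \<inter> (\<Inter>r'\<in>{0<..}. topspace (T r')) | U r. 0 < r \<and> openin (T r) U}"
    unfolding proj_lim_def topology_generated_by_topspace .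
qed

text \<open>Single unit balls form a base, without finite intersections, because the steps are
  directed: seminorms of two steps are both continuous on the step with the larger index, and there
  one member dominates them.\<close>

lemma lc_proj_lim:
  assumes T: "\<And>a. 0 < a \<Longrightarrow> lc (T a) (P a)"
    and mono: "\<And>a a'. 0 < a \<Longrightarrow> a \<le> a' \<Longrightarrow> continuous_map (T a') (T a) id"
  shows "lc (proj_lim T) (\<Union>a\<in>{0<..}. P a)"
proof -
  define V where "V = topspace (proj_lim T)"
  have V: "V \<subseteq> topspace (T a)" if "0 < a" for a using that by (auto simp: V_def topspace_proj_lim)
  have vs: "vsub V"
    using lc_vsub[OF T] unfolding vsub_def V_def topspace_proj_lim by simp
  have dom: "\<exists>q'\<in>P a'. \<forall>c\<in>topspace (T a'). q c \<le> q' c" if a: "0 < a" "a \<le> a'" and q: "q \<in> P a" for a a' q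
  proof -
    have a': "0 < a'" using a by simp
    have sub: "topspace (T a') \<subseteq> topspace (T a)"
      using mono[OF a] by (auto simp: continuous_map_def)
    have "continuous_map (T a') euclideanreal (q \<circ> id)"
      using mono[OF a] lc_member_continuous[OF T[OF a(1)] q] by (rule continuous_map_compose)
    then show ?thesis
      using lc_continuous_seminorm[OF T[OF a'] seminorm_on_subset[OF lc_seminorm[OF T[OF a(1)] q] sub]] by simp
  qed
  have dir: "\<exists>q''\<in>(\<Union>a\<in>{0<..}. P a). \<forall>c\<in>V. q c \<le> q'' c \<and> q' c \<le> q'' c"
    if q: "q \<in> (\<Union>a\<in>{0<..}. P a)" "q' \<in> (\<Union>a\<in>{0<..}. P a)" for q q'
  proof -
    from q obtain a b where a: "0 < a" "q \<in> P a" and b: "0 < b" "q' \<in> P b" by auto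
    define m where "m = max a b"
    have m: "0 < m" "a \<le> m" "b \<le> m" using a b by (auto simp: m_def)
    obtain p where p: "p \<in> P m" "\<forall>c\<in>topspace (T m). q c \<le> p c" using dom[OF a(1) m(2) a(2)] ..
    obtain p' where p': "p' \<in> P m" "\<forall>c\<in>topspace (T m). q' c \<le> p' c" using dom[OF b(1) m(3) b(2)] ..
    obtain p'' where p'': "p'' \<in> P m" "\<forall>c\<in>topspace (T m). p c \<le> p'' c \<and> p' c \<le> p'' c"
      using lc_directed[OF T[OF m(1)] p(1) p'(1)] ..
    have "q c \<le> p'' c \<and> q' c \<le> p'' c" if "c \<in> V" for c
    proof -
      have "c \<in> topspace (T m)" using V[OF m(1)] that by auto
      then show ?thesis using p(2) p'(2) p''(2) by force
    qed
    then show ?thesis using p''(1) m(1) by auto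
  qed
  have mul: "\<exists>q'\<in>(\<Union>a\<in>{0<..}. P a). \<forall>c\<in>V. M * q c \<le> q' c"
    if q: "q \<in> (\<Union>a\<in>{0<..}. P a)" and M: "M > 0" for q M
  proof -
    from q obtain a where a: "0 < a" "q \<in> P a" by auto
    obtain q' where "q' \<in> P a" "\<forall>c\<in>topspace (T a). M * q c \<le> q' c"
      using lc_multiple[OF T[OF a(1)] a(2) M] ..
    then show ?thesis using V[OF a(1)] a(1) by blast
  qed
  have sn: "seminorm_on V q" if "q \<in> (\<Union>a\<in>{0<..}. P a)" for q
  proof -
    from that obtain a where a: "0 < a" "q \<in> P a" by auto
    show ?thesis by (rule seminorm_on_subset[OF lc_seminorm[OF T[OF a(1)] a(2)] V[OF a(1)]])
  qed
  \<comment> \<open>\<open>O'\<close> is the topology with the desired base. It is compared with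
    \<open>proj_lim T\<close> by inclusion in both directions.\<close>
  define O' where "O' U \<longleftrightarrow> U \<subseteq> V \<and> (\<forall>c\<in>U. \<exists>q\<in>(\<Union>a\<in>{0<..}. P a). \<forall>c'\<in>V. q (c' - c) < 1 \<longrightarrow> c' \<in> U)" for U
  have ist: "istopology O'"
    unfolding istopology_def
  proof (intro conjI allI impI)
    fix A B assume A: "O' A" and B: "O' B"
    have "\<exists>q\<in>(\<Union>a\<in>{0<..}. P a). \<forall>c'\<in>V. q (c' - c) < 1 \<longrightarrow> c' \<in> A \<inter> B" if c: "c \<in> A \<inter> B" for c
    proof -
      obtain q where q: "q \<in> (\<Union>a\<in>{0<..}. P a)" "\<forall>c'\<in>V. q (c' - c) < 1 \<longrightarrow> c' \<in> A"
        using A c unfolding O'_def by blast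
      obtain q' where q': "q' \<in> (\<Union>a\<in>{0<..}. P a)" "\<forall>c'\<in>V. q' (c' - c) < 1 \<longrightarrow> c' \<in> B"
        using B c unfolding O'_def by blast
      obtain q'' where q'': "q'' \<in> (\<Union>a\<in>{0<..}. P a)" "\<forall>c\<in>V. q c \<le> q'' c \<and> q' c \<le> q'' c"
        using dir[OF q(1) q'(1)] by blast
      have cV: "c \<in> V" using A c unfolding O'_def by blast
      have "c' \<in> A \<inter> B" if "c' \<in> V" "q'' (c' - c) < 1" for c'
      proof -
        have "q (c' - c) \<le> q'' (c' - c)" "q' (c' - c) \<le> q'' (c' - c)"
          using q''(2) vsub_diff[OF vs that(1) cV] by auto
        then show ?thesis using q(2) q'(2) that by auto
      qed
      then show ?thesis using q''(1) by blast
    qed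
    then show "O' (A \<inter> B)" using A unfolding O'_def by blast
  next
    fix K assume K: "\<forall>U\<in>K. O' U"
    have "\<exists>q\<in>(\<Union>a\<in>{0<..}. P a). \<forall>c'\<in>V. q (c' - c) < 1 \<longrightarrow> c' \<in> \<Union>K" if c: "c \<in> A" "A \<in> K" for c A
    proof -
      have "O' A" using K c(2) by blast
      then obtain q where "q \<in> (\<Union>a\<in>{0<..}. P a)" "\<forall>c'\<in>V. q (c' - c) < 1 \<longrightarrow> c' \<in> A"
        using c(1) unfolding O'_def by blast
      then show ?thesis using c(2) by blast
    qed
    moreover have "\<Union>K \<subseteq> V" using K unfolding O'_def by blast
    ultimately show "O' (\<Union>K)" unfolding O'_def by blast
  qed
  have oT': "openin (topology O') U = O' U" for U by (rule topology_inverse'[OF ist, THEN fun_cong])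
  have ttO: "topspace (topology O') = V"
  proof
    obtain q where "q \<in> P 1" using T[of 1] unfolding lc_def by auto
    then have "q \<in> (\<Union>a\<in>{0<..}. P a)" by (intro UN_I[of 1]) auto
    then have "O' V" unfolding O'_def by (intro conjI ballI bexI[of _ q]) auto
    then show "V \<subseteq> topspace (topology O')" using oT' openin_subset by metis
    show "topspace (topology O') \<subseteq> V" using oT'[of "topspace (topology O')"] by (simp add: O'_def)
  qed
  \<comment> \<open>The inclusions into the steps are continuous for \<open>O'\<close>, and
    \<open>proj_lim T\<close> is the coarsest topology with this property.\<close>
  have 1: "openin (topology O') U" if "openin (proj_lim T) U" for U
  proof -
    have "continuous_map (topology O') (proj_lim T) id"
    proof (rule continuous_map_proj_lim)
      fix a :: real assume a: "0 < a"
      show "continuous_map (topology O') (T a) id"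
        unfolding continuous_map_def
      proof (intro conjI allI impI)
        show "id \<in> topspace (topology O') \<rightarrow> topspace (T a)" using ttO V[OF a] by auto
        fix W assume W: "openin (T a) W"
        have "O' {x \<in> V. x \<in> W}"
          unfolding O'_def
        proof (intro conjI ballI, goal_cases)
          case (2 c)
          then have c: "c \<in> V" "c \<in> W" by auto
          obtain q where q: "q \<in> P a" "\<forall>c'\<in>topspace (T a). q (c' - c) < 1 \<longrightarrow> c' \<in> W"
            using lc_nbhd[OF T[OF a] W c(2)] ..
          then have "\<forall>c'\<in>V. q (c' - c) < 1 \<longrightarrow> c' \<in> {x \<in> V. x \<in> W}" using V[OF a] by blast
          then show ?case using q(1) a by auto
        qed auto
        then show "openin (topology O') {x \<in> topspace (topology O'). id x \<in> W}"
          by (simp add: oT' ttO)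
      qed
    qed
    then have "openin (topology O') {x \<in> topspace (topology O'). id x \<in> U}"
      using that by (simp add: continuous_map_def)
    moreover have "{x \<in> topspace (topology O'). id x \<in> U} = U"
      using openin_subset[OF that] by (auto simp: ttO V_def)
    ultimately show ?thesis by simp
  qed
  \<comment> \<open>Conversely each basic ball is the preimage of an open ball of one step.\<close>
  have 2: "openin (proj_lim T) U" if U: "O' U" for U
  proof (subst openin_subopen, intro ballI)
    fix c assume c: "c \<in> U"
    then obtain q a where q: "0 < a" "q \<in> P a" "\<forall>c'\<in>V. q (c' - c) < 1 \<longrightarrow> c' \<in> U"
      using U unfolding O'_def by auto
    have cV: "c \<in> V" using U c unfolding O'_def by blast
    let ?B = "{c' \<in> topspace (T a). q (c' - c) < 1}"
    have "openin (T a) ?B"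
      using V[OF q(1)] cV by (intro lc_openin_ball[OF T[OF q(1)] lc_seminorm[OF T[OF q(1)] q(2)] q(2)]) auto
    then have "openin (proj_lim T) {x \<in> topspace (proj_lim T). id x \<in> ?B}"
      using proj_lim_in[OF q(1)] by (rule openin_continuous_map_preimage[rotated])
    moreover have "c \<in> {x \<in> topspace (proj_lim T). id x \<in> ?B}"
      using cV V[OF q(1)] seminorm_on_0[OF lc_vsub[OF T[OF q(1)]] lc_seminorm[OF T[OF q(1)] q(2)]]
      by (auto simp: V_def)
    moreover have "{x \<in> topspace (proj_lim T). id x \<in> ?B} \<subseteq> U"
      using q(3) by (auto simp: V_def)
    ultimately show "\<exists>W. openin (proj_lim T) W \<and> c \<in> W \<and> W \<subseteq> U" by blast
  qed
  have "openin (proj_lim T) U \<longleftrightarrow> O' U" for U using 1 2 oT' by blast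
  moreover have "(\<Union>a\<in>{0<..}. P a) \<noteq> {}"
    using T[of 1] unfolding lc_def by (auto intro!: exI[of _ 1])
  ultimately show ?thesis
    unfolding lc_def V_def[symmetric] using vs dir mul sn by (simp add: O'_def)
qed

lemma lim_seminorm_restrict:
  assumes "lim_seminorm T q" "0 < b"
  shows "seminorm_on (topspace (T b)) q" "continuous_map (T b) euclideanreal q"
proof -
  have "topspace (T b) \<subseteq> (\<Union>r\<in>{0<..}. topspace (T r))" using assms(2) by auto
  moreover have "seminorm_on (\<Union>r\<in>{0<..}. topspace (T r)) q"
    using assms(1) by (simp add: lim_seminorm_def)
  ultimately show "seminorm_on (topspace (T b)) q"
    by (rule seminorm_on_subset[rotated])
  show "continuous_map (T b) euclideanreal q"
    using assms by (simp add: lim_seminorm_def)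
qed

text \<open>The open sets of \<open>ind_lim\<close> already have the form that \<open>lc\<close>
  demands, with all of \<open>lim_seminorm\<close> as the family. The point is that the union of the
  steps is a vector space, for which two steps must lie in a common one.\<close>

lemma lc_ind_lim:
  assumes T: "\<And>b. 0 < b \<Longrightarrow> lc (T b) (P b)"
    and mono: "\<And>b b'. 0 < b \<Longrightarrow> b \<le> b' \<Longrightarrow> topspace (T b) \<subseteq> topspace (T b')"
  shows "lc (ind_lim T) {q. lim_seminorm T q}"
proof -
  define V where "V = (\<Union>r\<in>{0<..}. topspace (T r))"
  have 1: "vsub V"
    unfolding vsub_def
  proof (intro conjI ballI allI)
    show "0 \<in> V" using vsub_0[OF lc_vsub[OF T[of 1]]] by (auto simp: V_def intro!: bexI[of _ 1])
    fix c assume "c \<in> V"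
    then obtain b where b: "0 < b" "c \<in> topspace (T b)" by (auto simp: V_def)
    show "(\<lambda>\<alpha>. a * c \<alpha>) \<in> V" for a
      using vsub_scale[OF lc_vsub[OF T[OF b(1)]] b(2)] b(1) by (auto simp: V_def)
    fix c' assume "c' \<in> V"
    then obtain b' where b': "0 < b'" "c' \<in> topspace (T b')" by (auto simp: V_def)
    have "c \<in> topspace (T (max b b'))" "c' \<in> topspace (T (max b b'))"
      using mono[of b "max b b'"] mono[of b' "max b b'"] b b' by auto
    then have "c + c' \<in> topspace (T (max b b'))"
      using vsub_add[OF lc_vsub[OF T]] b(1) by (auto simp: less_max_iff_disj)
    then show "c + c' \<in> V" using b(1) unfolding V_def by (intro UN_I[of "max b b'"]) auto
  qed
  have z: "lim_seminorm T (\<lambda>_. 0)" by (simp add: lim_seminorm_def seminorm_on_def)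
  have mul: "lim_seminorm T (\<lambda>c. M * q c)" if "lim_seminorm T q" "M > 0" for M q
    using that seminorm_on_mult[of _ q M]
    by (auto simp: lim_seminorm_def intro: continuous_map_real_mult_left)
  show ?thesis
    unfolding lc_def topspace_ind_lim V_def[symmetric]
  proof (intro conjI ballI allI impI)
    fix q q' assume "q \<in> {q. lim_seminorm T q}" "q' \<in> {q. lim_seminorm T q}"
    then have "lim_seminorm T (\<lambda>c. max (q c) (q' c))" by (simp add: lim_seminorm_max)
    then show "\<exists>q''\<in>{q. lim_seminorm T q}. \<forall>c\<in>V. q c \<le> q'' c \<and> q' c \<le> q'' c"
      by (intro bexI[of _ "\<lambda>c. max (q c) (q' c)"]) auto
  next
    fix q and M :: real assume "q \<in> {q. lim_seminorm T q}" "0 < M"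
    then show "\<exists>q'\<in>{q. lim_seminorm T q}. \<forall>c\<in>V. M * q c \<le> q' c"
      using mul by (intro bexI[of _ "\<lambda>c. M * q c"]) auto
  next
    show "{q. lim_seminorm T q} \<noteq> {}" using z by blast
    fix q assume "q \<in> {q. lim_seminorm T q}"
    then show "seminorm_on V q" by (simp add: lim_seminorm_def V_def)
  next
    fix U
    show "openin (ind_lim T) U \<longleftrightarrow> U \<subseteq> V \<and>
       (\<forall>c\<in>U. \<exists>q\<in>{q. lim_seminorm T q}. \<forall>c'\<in>V. q (c' - c) < 1 \<longrightarrow> c' \<in> U)"
      unfolding openin_ind_lim V_def[symmetric] by simp
  qed (rule 1)
qed

lemma ind_lim_in:
  assumes T: "lc (T b) P" and b: "0 < b"
  shows "continuous_map (T b) (ind_lim T) id"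
  unfolding continuous_map_def
proof (intro conjI allI impI)
  show "id \<in> topspace (T b) \<rightarrow> topspace (ind_lim T)"
    using b by (auto simp: topspace_ind_lim)
  fix U assume U: "openin (ind_lim T) U"
  show "openin (T b) {x \<in> topspace (T b). id x \<in> U}"
    unfolding lc_openin[OF T]
  proof (intro conjI ballI)
    fix c assume c: "c \<in> {x \<in> topspace (T b). id x \<in> U}"
    then have "\<exists>q. lim_seminorm T q \<and> (\<forall>c'\<in>(\<Union>r\<in>{0<..}. topspace (T r)). q (c' - c) < 1 \<longrightarrow> c' \<in> U)"
      using U unfolding openin_ind_lim by simp
    then obtain q where q: "lim_seminorm T q"
      "\<forall>c'\<in>(\<Union>r\<in>{0<..}. topspace (T r)). q (c' - c) < 1 \<longrightarrow> c' \<in> U"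
      by blast
    obtain q' where q': "q' \<in> P" "\<forall>c\<in>topspace (T b). q c \<le> q' c"
      using lc_dominated[OF T lim_seminorm_restrict[OF q(1) b]] ..
    have "c' \<in> U" if "c' \<in> topspace (T b)" "q' (c' - c) < 1" for c'
    proof (rule q(2)[rule_format])
      show "c' \<in> (\<Union>r\<in>{0<..}. topspace (T r))" using that(1) b by auto
      show "q (c' - c) < 1"
        using bspec[OF q'(2), of "c' - c"] vsub_diff[OF lc_vsub[OF T] that(1), of c] c that(2) by simp
    qed
    then have "\<forall>c'\<in>topspace (T b). q' (c' - c) < 1 \<longrightarrow> c' \<in> {x \<in> topspace (T b). id x \<in> U}" by simp
    then show "\<exists>q\<in>P. \<forall>c'\<in>topspace (T b). q (c' - c) < 1 \<longrightarrow> c' \<in> {x \<in> topspace (T b). id x \<in> U}"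
      using q'(1) by (rule bexI)
  qed auto
qed

text \<open>Meant for seminorms such as a pointwise supremum, about which only a bound on each step
  is known; for a seminorm on a step, domination by a continuous one implies continuity.\<close>

lemma lim_seminormI:
  assumes q: "seminorm_on (\<Union>r\<in>{0<..}. topspace (T r)) q"
    and T: "\<And>b. 0 < b \<Longrightarrow> lc (T b) (P b)"
    and bd: "\<And>b. 0 < b \<Longrightarrow> \<exists>q'. seminorm_on (topspace (T b)) q' \<and>
      continuous_map (T b) euclideanreal q' \<and> (\<forall>c\<in>topspace (T b). q c \<le> q' c)"
  shows "lim_seminorm T q"
  unfolding lim_seminorm_def
proof (intro conjI allI impI q)
  fix b :: real assume b: "0 < b"
  have sn: "seminorm_on (topspace (T b)) q"
    by (rule seminorm_on_subset[OF q]) (use b in auto)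
  obtain q' where q': "seminorm_on (topspace (T b)) q'"
      "continuous_map (T b) euclideanreal q'" "\<forall>c\<in>topspace (T b). q c \<le> q' c" using bd[OF b] by blast
  obtain q'' where "q'' \<in> P b" "\<forall>c\<in>topspace (T b). q' c \<le> q'' c"
    using lc_dominated[OF T[OF b] q'(1,2)] ..
  then show "continuous_map (T b) euclideanreal q"
    using lc_continuous_seminorm[OF T[OF b] sn] q'(3) by fastforce
qed

text \<open>The universal property of the inductive limit for linear maps: for each seminorm
  \<open>q\<close> of \<open>Z\<close> the seminorm \<open>q (f c)\<close> is continuous on all
  steps and so belongs to those that generate the limit topology.\<close>

lemma continuous_map_ind_lim_linear:
  assumes T: "lc (ind_lim T) {q. lim_seminorm T q}" and Z: "lc Z Q" and f: "lin_on (\<Union>r\<in>{0<..}. topspace (T r)) f"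
    and c: "\<And>b. 0 < b \<Longrightarrow> continuous_map (T b) Z f"
  shows "continuous_map (ind_lim T) Z f"
proof (rule lc_continuous_linear[OF T Z])
  show f': "f \<in> topspace (ind_lim T) \<rightarrow> topspace Z"
    using c by (auto simp: topspace_ind_lim continuous_map_def)
  show f1: "lin_on (topspace (ind_lim T)) f" using f by (simp add: topspace_ind_lim)
  fix q assume q: "q \<in> Q"
  have "lim_seminorm T (\<lambda>c. q (f c))"
    unfolding lim_seminorm_def
  proof (intro conjI allI impI)
    show "seminorm_on (\<Union>r\<in>{0<..}. topspace (T r)) (\<lambda>c. q (f c))"
      using seminorm_on_compose[OF lc_seminorm[OF Z q] f1 f'] by (simp add: topspace_ind_lim)
    fix b :: real assume "0 < b"
    from c[OF this] lc_member_continuous[OF Z q]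
    have "continuous_map (T b) euclideanreal (q \<circ> f)" by (rule continuous_map_compose)
    then show "continuous_map (T b) euclideanreal (\<lambda>c. q (f c))" by (simp add: o_def)
  qed
  then show "continuous_map (ind_lim T) euclideanreal (\<lambda>c. q (f c))"
    using lc_member_continuous[OF T] by blast
qed

section \<open>Sequential continuity of bilinear maps\<close>

text \<open>The consequence of barrelledness that the Banach--Steinhaus theorem needs for sequences:
  a pointwise bounded sequence of continuous seminorms is equicontinuous. In this form it passes to
  inductive limits by taking a supremum.\<close>

definition barrelled_seq :: "('i \<Rightarrow> complex) topology \<Rightarrow> bool" where
  "barrelled_seq T \<longleftrightarrow> (\<forall>Q :: nat \<Rightarrow> ('i \<Rightarrow> complex) \<Rightarrow> real.
     (\<forall>n. seminorm_on (topspace T) (Q n) \<and> continuous_map T euclideanreal (Q n)) \<and>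
     (\<forall>c\<in>topspace T. bdd_above (range (\<lambda>n. Q n c))) \<longrightarrow>
     (\<exists>q. seminorm_on (topspace T) q \<and> continuous_map T euclideanreal q \<and>
        (\<forall>n. \<forall>c\<in>topspace T. Q n c \<le> q c)))"

lemma seminorm_on_SUP:
  fixes Q :: "nat \<Rightarrow> ('i \<Rightarrow> complex) \<Rightarrow> real"
  assumes V: "vsub V" and Q: "\<And>n. seminorm_on V (Q n)"
    and bdd: "\<And>c. c \<in> V \<Longrightarrow> bdd_above (range (\<lambda>n. Q n c))"
  shows "seminorm_on V (\<lambda>c. SUP n. Q n c)"
  unfolding seminorm_on_def
proof (intro conjI ballI allI)
  fix c assume c: "c \<in> V"
  have up: "Q n c' \<le> (SUP n. Q n c')" if "c' \<in> V" for n c'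
    by (rule cSUP_upper[OF _ bdd[OF that]]) simp
  show "0 \<le> (SUP n. Q n c)"
    using up[OF c, of 0] seminorm_on_nonneg[OF Q c, of 0] by linarith
  show "(SUP n. Q n (c + c')) \<le> (SUP n. Q n c) + (SUP n. Q n c')" if c': "c' \<in> V" for c'
  proof (rule cSUP_least)
    fix n show "Q n (c + c') \<le> (SUP n. Q n c) + (SUP n. Q n c')"
      using seminorm_on_add[OF Q c c', of n] up[OF c, of n] up[OF c', of n] by linarith
  qed simp
  have le: "(SUP n. Q n (\<lambda>\<alpha>. a * c' \<alpha>)) \<le> norm a * (SUP n. Q n c')" if "c' \<in> V" for a c'
  proof (rule cSUP_least)
    fix n show "Q n (\<lambda>\<alpha>. a * c' \<alpha>) \<le> norm a * (SUP n. Q n c')"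
      using seminorm_on_scale[OF Q that, of n a] mult_left_mono[OF up[OF that, of n], of "norm a"] by simp
  qed simp
  show "(SUP n. Q n (\<lambda>\<alpha>. a * c \<alpha>)) = norm a * (SUP n. Q n c)" for a
  proof (cases "a = 0")
    case True
    have "Q n (\<lambda>\<alpha>. 0 * c \<alpha>) = 0" for n
      using seminorm_on_scale[OF Q c, of n 0] by (metis mult_zero_left norm_zero)
    then show ?thesis using True by simp
  next
    \<comment> \<open>The inequality \<open>le\<close> for the factor \<open>1 / a\<close> gives the
      missing converse.\<close>
    case False
    have "(\<lambda>\<alpha>. (1 / a) * (a * c \<alpha>)) = c" using False by (simp add: fun_eq_iff)
    then have "(SUP n. Q n c) \<le> norm (1 / a) * (SUP n. Q n (\<lambda>\<alpha>. a * c \<alpha>))"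
      using le[OF vsub_scale[OF V c, of a], of "1 / a"] by simp
    then have "norm a * (SUP n. Q n c) \<le> (SUP n. Q n (\<lambda>\<alpha>. a * c \<alpha>))"
      using False by (simp add: norm_divide field_simps)
    then show ?thesis using le[OF c, of a] by linarith
  qed
qed

text \<open>The supremum of the sequence is a finite seminorm on the union. On each step it lies
  below the bound that the step provides, hence it is continuous there and belongs to the seminorms
  of the limit.\<close>

lemma barrelled_seq_ind_lim:
  assumes T: "\<And>b. 0 < b \<Longrightarrow> lc (T b) (P b)" and L: "lc (ind_lim T) {q. lim_seminorm T q}"
    and bar: "\<And>b. 0 < b \<Longrightarrow> barrelled_seq (T b)"
  shows "barrelled_seq (ind_lim T)"
  unfolding barrelled_seq_def
proof (intro allI impI, elim conjE)
  fix Q :: "nat \<Rightarrow> ('a \<Rightarrow> complex) \<Rightarrow> real"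
  assume Q: "\<forall>n. seminorm_on (topspace (ind_lim T)) (Q n) \<and> continuous_map (ind_lim T) euclideanreal (Q n)"
    and bdd: "\<forall>c\<in>topspace (ind_lim T). bdd_above (range (\<lambda>n. Q n c))"
  define q where "q = (\<lambda>c. SUP n. Q n c)"
  have sn: "seminorm_on (topspace (ind_lim T)) q"
    unfolding q_def by (rule seminorm_on_SUP[OF lc_vsub[OF L]]) (use Q bdd in auto)
  have up: "\<forall>c\<in>topspace (ind_lim T). Q n c \<le> q c" for n
    unfolding q_def using bdd by (intro ballI cSUP_upper) auto
  have "lim_seminorm T q"
  proof (rule lim_seminormI[OF sn[unfolded topspace_ind_lim] T])
    fix b :: real assume b: "0 < b"
    have sub: "topspace (T b) \<subseteq> topspace (ind_lim T)" using b by (auto simp: topspace_ind_lim)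
    have 1: "seminorm_on (topspace (T b)) (Q n)" for n
      using Q seminorm_on_subset[OF _ sub] by simp
    have 2: "continuous_map (T b) euclideanreal (Q n)" for n
      using continuous_map_compose[OF ind_lim_in[where T = T, OF T[OF b] b], of euclideanreal "Q n"] Q by simp
    have 3: "\<forall>c\<in>topspace (T b). bdd_above (range (\<lambda>n. Q n c))" using bdd sub by auto
    obtain q' where q': "seminorm_on (topspace (T b)) q'" "continuous_map (T b) euclideanreal q'"
        "\<forall>n. \<forall>c\<in>topspace (T b). Q n c \<le> q' c"
      using bar[OF b, unfolded barrelled_seq_def, rule_format, of Q] 1 2 3 by auto
    have "\<forall>c\<in>topspace (T b). q c \<le> q' c"
      unfolding q_def using q'(3) by (intro ballI cSUP_least) auto
    then show "\<exists>q'. seminorm_on (topspace (T b)) q' \<and> continuous_map (T b) euclideanreal q' \<and>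
        (\<forall>c\<in>topspace (T b). q c \<le> q' c)" using q' by (intro exI[of _ q']) simp
  qed
  then have "continuous_map (ind_lim T) euclideanreal q"
    by (intro lc_member_continuous[OF L]) simp
  then show "\<exists>q. seminorm_on (topspace (ind_lim T)) q \<and> continuous_map (ind_lim T) euclideanreal q \<and>
        (\<forall>n. \<forall>c\<in>topspace (ind_lim T). Q n c \<le> q c)"
    using sn up by (intro exI[of _ q]) simp
qed

text \<open>Banach--Steinhaus: along a convergent sequence \<open>xs\<close> the maps \<open>F (xs n)\<close> are equicontinuous.\<close>

lemma jointly_sequentially_continuous_bilinear:
  assumes X: "lc X P" and Y: "lc Y R" and Z: "lc Z Q"
    and lin: "\<And>x. x \<in> topspace X \<Longrightarrow> lin_on (topspace Y) (F x)"
      "\<And>y. y \<in> topspace Y \<Longrightarrow> lin_on (topspace X) (\<lambda>x. F x y)"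
    and sep: "separately_continuous X Y Z F" and bar: "barrelled_seq Y"
  shows "jointly_sequentially_continuous X Y Z F"
  unfolding jointly_sequentially_continuous_def
proof (intro allI impI)
  fix xs ys x y assume xs: "limitin X xs x sequentially" and ys: "limitin Y ys y sequentially"
  have x: "x \<in> topspace X" and y: "y \<in> topspace Y" using xs ys by (simp_all add: limitin_def)
  have cY: "continuous_map Y Z (F x)" if "x \<in> topspace X" for x
    using sep that by (simp add: separately_continuous_def)
  have cX: "continuous_map X Z (\<lambda>x. F x y)" if "y \<in> topspace Y" for y
    using sep that by (simp add: separately_continuous_def)
  have FZ: "F x y \<in> topspace Z" if "x \<in> topspace X" "y \<in> topspace Y" for x y
    using cY[OF that(1)] that(2) by (auto simp: continuous_map_def)
  have "\<forall>\<^sub>F n in sequentially. xs n \<in> topspace X"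
    using xs openin_topspace[of X] x unfolding limitin_def by blast
  \<comment> \<open>Convergence puts \<open>xs n\<close> into the space only from some
    \<open>N\<close> on; the shift by \<open>N\<close> makes all members of the sequence
    usable.\<close>
  then obtain N where N: "\<And>n. n \<ge> N \<Longrightarrow> xs n \<in> topspace X"
    unfolding eventually_sequentially by blast
  show "limitin Z (\<lambda>n. F (xs n) (ys n)) (F x y) sequentially"
  proof (rule lc_limitinI[OF Z FZ[OF x y]])
    fix q assume q: "q \<in> Q"
    note sq = lc_seminorm[OF Z q] and cq = lc_member_continuous[OF Z q]
    define qs where "qs n = (\<lambda>c. q (F (xs (n + N)) c))" for n
    have 1: "seminorm_on (topspace Y) (qs n)" for n
      unfolding qs_def using N FZ by (intro seminorm_on_compose[OF sq lin(1)]) auto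
    have 2: "continuous_map Y euclideanreal (qs n)" for n
      using continuous_map_compose[OF cY[OF N[of "n + N"]] cq] by (simp add: qs_def o_def)
    \<comment> \<open>Continuity in the first variable makes \<open>F (xs n) c\<close> converge, and
      a convergent real sequence is bounded.\<close>
    have 3: "bdd_above (range (\<lambda>n. qs n c))" if c: "c \<in> topspace Y" for c
    proof -
      have "limitin Z (\<lambda>n. F (xs n) c) (F x c) sequentially"
        using continuous_map_limit[OF cX[OF c] xs] by (simp add: o_def)
      then have "limitin euclideanreal (\<lambda>n. q (F (xs n) c)) (q (F x c)) sequentially"
        using continuous_map_limit[OF cq] by (fastforce simp add: o_def)
      then have "(\<lambda>n. q (F (xs n) c)) \<longlonglongrightarrow> q (F x c)" by simp
      then have "(\<lambda>n. qs n c) \<longlonglongrightarrow> q (F x c)"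
        unfolding qs_def by (rule LIMSEQ_ignore_initial_segment)
      then have "Bseq (\<lambda>n. qs n c)" by (intro convergent_imp_Bseq) (auto simp: convergent_def)
      then show ?thesis by (simp add: Bseq_eq_bounded bounded_imp_bdd_above)
    qed
    obtain p where p: "seminorm_on (topspace Y) p" "continuous_map Y euclideanreal p"
        "\<forall>n. \<forall>c\<in>topspace Y. qs n c \<le> p c"
      using bar[unfolded barrelled_seq_def, rule_format, of qs] 1 2 3 by auto
    have sx: "seminorm_on (topspace X) (\<lambda>x. q (F x y))"
      using FZ y by (intro seminorm_on_compose[OF sq lin(2)]) auto
    have cx: "continuous_map X euclideanreal (\<lambda>x. q (F x y))"
      using continuous_map_compose[OF cX[OF y] cq] by (simp add: o_def)
    have ev1: "\<forall>\<^sub>F n in sequentially. xs n \<in> topspace X \<and> q (F (xs n - x) y) < 1/2"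
      by (rule lc_limitinD[OF X xs sx cx]) simp
    have ev2: "\<forall>\<^sub>F n in sequentially. ys n \<in> topspace Y \<and> p (ys n - y) < 1/2"
      by (rule lc_limitinD[OF Y ys p(1,2)]) simp
    show "\<forall>\<^sub>F n in sequentially. F (xs n) (ys n) \<in> topspace Z \<and> q (F (xs n) (ys n) - F x y) < 1"
      using ev1 ev2 eventually_ge_at_top[of N]
    proof eventually_elim
      case (elim n)
      have a: "F (xs n) (ys n) \<in> topspace Z" "F (xs n) y \<in> topspace Z"
        using elim FZ y by auto
      \<comment> \<open>The increment is split as
        \<open>F (xs n) (ys n - y) + F (xs n - x) y\<close>. The first part is bounded by
        \<open>p\<close> uniformly in \<open>n\<close>, the second is small by continuity in the
        first variable.\<close>
      have "q (F (xs n) (ys n) - F x y) \<le> q (F (xs n) (ys n) - F (xs n) y) + q (F (xs n) y - F x y)"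
        using a FZ[OF x y] by (intro seminorm_on_triangle[OF lc_vsub[OF Z] sq])
      also have "F (xs n) (ys n) - F (xs n) y = F (xs n) (ys n - y)"
        using lin_on_diff[OF lc_vsub[OF Y] lin(1)] elim y by simp
      also have "F (xs n) y - F x y = F (xs n - x) y"
        using lin_on_diff[OF lc_vsub[OF X] lin(2)] elim x y by simp
      also have "q (F (xs n) (ys n - y)) \<le> p (ys n - y)"
      proof -
        have "qs (n - N) (ys n - y) \<le> p (ys n - y)"
          using p(3) vsub_diff[OF lc_vsub[OF Y]] elim y by simp
        then show ?thesis using elim by (simp add: qs_def)
      qed
      finally show ?case using a elim by linarith
    qed
  qed
qed

lemma jointly_sequentially_continuous_bilinear':
  assumes X: "lc X P" and Y: "lc Y R" and Z: "lc Z Q"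
    and lin: "\<And>x. x \<in> topspace X \<Longrightarrow> lin_on (topspace Y) (F x)"
      "\<And>y. y \<in> topspace Y \<Longrightarrow> lin_on (topspace X) (\<lambda>x. F x y)"
    and sep: "separately_continuous X Y Z F" and bar: "barrelled_seq X"
  shows "jointly_sequentially_continuous X Y Z F"
proof -
  have "separately_continuous Y X Z (\<lambda>y x. F x y)"
    using sep by (simp add: separately_continuous_def)
  note sep' = this
  have "jointly_sequentially_continuous Y X Z (\<lambda>y x. F x y)"
  proof (rule jointly_sequentially_continuous_bilinear[OF Y X Z])
    show "lin_on (topspace X) (\<lambda>x. F x y)" if "y \<in> topspace Y" for y by (rule lin(2)[OF that])
    show "lin_on (topspace Y) (\<lambda>y. F x y)" if "x \<in> topspace X" for x by (rule lin(1)[OF that])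
  qed (rule sep' bar)+
  then show ?thesis by (simp add: jointly_sequentially_continuous_def)
qed

text \<open>A map that is defined on the whole spaces is its own extension. Uniqueness uses density
  twice, in the second variable over points of \<open>D\<close> and then in the first, and for this
  separate continuity is enough.\<close>

lemma uniquely_extendableI:
  assumes D: "D \<subseteq> topspace X" "D \<subseteq> topspace Y" "D \<subseteq> topspace Z"
    and dense: "topspace X \<subseteq> X closure_of D" "topspace Y \<subseteq> Y closure_of D"
    and Z: "Hausdorff_space Z"
    and sep: "separately_continuous X Y Z F" and joint: "jointly_sequentially_continuous X Y Z F"
  shows "uniquely_extendable D F X Y Z"
  unfolding uniquely_extendable_def
proof (intro conjI D exI[of _ F] ballI allI impI sep joint refl)
  fix G x y assume "(\<forall>x\<in>D. \<forall>y\<in>D. G x y = F x y) \<and> separately_continuous X Y Z G"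
    and x: "x \<in> topspace X" and y: "y \<in> topspace Y"
  then have G: "\<forall>x\<in>D. \<forall>y\<in>D. G x y = F x y" "separately_continuous X Y Z G" by auto
  have 1: "G x' y = F x' y" if x': "x' \<in> D" for x'
  proof (rule forall_in_closure_of_eq[where S = D and X = Y and f = "G x'" and g = "F x'", OF _ Z])
    show "y \<in> Y closure_of D" using dense(2) y by blast
    have "x' \<in> topspace X" using D(1) x' by blast
    then show "continuous_map Y Z (G x')" "continuous_map Y Z (F x')"
      using sep G(2) by (simp_all add: separately_continuous_def)
    show "G x' z = F x' z" if "z \<in> D" for z using G(1) x' that by blast
  qed
  show "G x y = F x y"
  proof (rule forall_in_closure_of_eq[where S = D and X = X and f = "\<lambda>x. G x y" and g = "\<lambda>x. F x y", OF _ Z])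
    show "x \<in> X closure_of D" using dense(1) x by blast
    show "continuous_map X Z (\<lambda>x. G x y)" "continuous_map X Z (\<lambda>x. F x y)"
      using sep G(2) y by (simp_all add: separately_continuous_def)
  qed (rule 1)
qed

section \<open>Comparison of limits\<close>

lemma proj_lim_mono:
  assumes "\<And>a. 0 < a \<Longrightarrow> \<exists>a'>0. continuous_map (T a') (T' a) id"
  shows "continuous_map (proj_lim T) (proj_lim T') id"
proof (rule continuous_map_proj_lim)
  fix a :: real assume "0 < a"
  then obtain a' where a': "a' > 0" "continuous_map (T a') (T' a) id" using assms by blast
  show "continuous_map (proj_lim T) (T' a) id"
    using continuous_map_compose[OF proj_lim_in[where T = T, OF a'(1)] a'(2)] by simp
qed

lemma ind_lim_mono:
  assumes T: "\<And>b. 0 < b \<Longrightarrow> \<exists>b'>0. continuous_map (T b) (T' b') id"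
  shows "continuous_map (ind_lim T) (ind_lim T') id"
proof -
  have sub: "(\<Union>r\<in>{0<..}. topspace (T r)) \<subseteq> (\<Union>r\<in>{0<..}. topspace (T' r))"
  proof
    fix c assume "c \<in> (\<Union>r\<in>{0<..}. topspace (T r))"
    then obtain b where b: "0 < b" "c \<in> topspace (T b)" by auto
    then obtain b' where "0 < b'" "continuous_map (T b) (T' b') id" using T by blast
    then show "c \<in> (\<Union>r\<in>{0<..}. topspace (T' r))" using b(2) by (intro UN_I[of b']) (auto simp: continuous_map_def Pi_iff)
  qed
  have lim: "lim_seminorm T q" if q: "lim_seminorm T' q" for q
    unfolding lim_seminorm_def
  proof (intro conjI allI impI)
    show "seminorm_on (\<Union>r\<in>{0<..}. topspace (T r)) q"
      using q by (intro seminorm_on_subset[OF _ sub]) (simp add: lim_seminorm_def)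
    fix b :: real assume "0 < b"
    then obtain b' where b': "0 < b'" "continuous_map (T b) (T' b') id" using T by blast
    show "continuous_map (T b) euclideanreal q"
      using continuous_map_compose[OF b'(2) lim_seminorm_restrict(2)[OF q b'(1)]] by simp
  qed
  show ?thesis
    unfolding continuous_map_def
  proof (intro conjI allI impI)
    show "id \<in> topspace (ind_lim T) \<rightarrow> topspace (ind_lim T')"
      using sub unfolding topspace_ind_lim by (auto simp only: Pi_iff id_apply subset_iff)
    fix U assume U: "openin (ind_lim T') U"
    show "openin (ind_lim T) {x \<in> topspace (ind_lim T). id x \<in> U}"
      unfolding openin_ind_lim topspace_ind_lim
    proof (intro conjI ballI)
      fix c assume "c \<in> {x \<in> \<Union>r\<in>{0<..}. topspace (T r). id x \<in> U}"
      then have "\<exists>q. lim_seminorm T' q \<and> (\<forall>c'\<in>\<Union>r\<in>{0<..}. topspace (T' r). q (c' - c) < 1 \<longrightarrow> c' \<in> U)"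
        using U unfolding openin_ind_lim by simp
      then obtain q where q: "lim_seminorm T' q" "\<forall>c'\<in>\<Union>r\<in>{0<..}. topspace (T' r). q (c' - c) < 1 \<longrightarrow> c' \<in> U"
        by (elim exE conjE)
      show "\<exists>q. lim_seminorm T q \<and> (\<forall>c'\<in>\<Union>r\<in>{0<..}. topspace (T r). q (c' - c) < 1 \<longrightarrow>
          c' \<in> {x \<in> \<Union>r\<in>{0<..}. topspace (T r). id x \<in> U})"
      proof (intro exI[of _ q] conjI lim[OF q(1)] ballI impI)
        fix c' assume c': "c' \<in> (\<Union>r\<in>{0<..}. topspace (T r))" "q (c' - c) < 1"
        then have "c' \<in> U" using q(2)[rule_format, of c'] subsetD[OF sub c'(1)] by simp
        then show "c' \<in> {x \<in> \<Union>r\<in>{0<..}. topspace (T r). id x \<in> U}" using c'(1) by simp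
      qed
    qed auto
  qed
qed

lemma topology_eq_id:
  assumes "continuous_map X Y id" "continuous_map Y X id"
  shows "X = Y"
proof -
  have top: "topspace X = topspace Y"
    using assms by (auto simp: continuous_map_def)
  have imp: "openin Y U" if "continuous_map Y X id" "topspace X = topspace Y" "openin X U"
    for X Y :: "'a topology" and U
  proof -
    have "openin Y {x \<in> topspace Y. id x \<in> U}"
      using that(1,3) by (simp add: continuous_map_def)
    moreover have "{x \<in> topspace Y. id x \<in> U} = U"
      using openin_subset[OF that(3)] that(2) by auto
    ultimately show ?thesis by simp
  qed
  show ?thesis
    unfolding topology_eq using imp[OF assms(2) top] imp[OF assms(1) top[symmetric]] by blast
qed

lemma proj_lim_const: "proj_lim (\<lambda>_. T) = T"
  by (intro topology_eq_id continuous_map_proj_lim) (auto intro: proj_lim_in[of 1])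

text \<open>The limit retains only those neighbourhoods that seminorms produce, so \<open>T\<close>
  is recovered because it is locally convex.\<close>

lemma ind_lim_const:
  assumes "lc T P" shows "ind_lim (\<lambda>_. T) = T"
proof (rule topology_eq_id)
  show "continuous_map T (ind_lim (\<lambda>_. T)) id"
    by (rule ind_lim_in[of "\<lambda>_. T" 1 P]) (use assms in auto)
  show "continuous_map (ind_lim (\<lambda>_. T)) T id"
    by (rule continuous_map_ind_lim_linear[OF lc_ind_lim[OF assms] assms]) (auto simp: lin_on_def)
qed

text \<open>The limits do not refer to the order of the index set, so the parameter may be replaced
  by its reciprocal. This is how increasing weights are turned into decreasing ones.\<close>

lemma proj_lim_inverse: "proj_lim (\<lambda>r. T (1 / r)) = proj_lim T"
  by (rule topology_eq_id; rule proj_lim_mono)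
     (metis continuous_map_id divide_divide_eq_right div_by_1 mult_1 zero_less_divide_1_iff)+

lemma ind_lim_inverse: "ind_lim (\<lambda>r. T (1 / r)) = ind_lim T"
  by (rule topology_eq_id; rule ind_lim_mono)
     (metis continuous_map_id divide_divide_eq_right div_by_1 mult_1 zero_less_divide_1_iff)+

section \<open>Weighted supremum spaces\<close>

abbreviation ell_sup :: "'i set \<Rightarrow> ('i \<Rightarrow> ennreal) \<Rightarrow> ('i \<Rightarrow> complex) set" where
  "ell_sup \<equiv> ell_w top"

abbreviation sup_top :: "'i set \<Rightarrow> ('i \<Rightarrow> ennreal) \<Rightarrow> ('i \<Rightarrow> complex) topology" where
  "sup_top \<equiv> ell_top top"

text \<open>Where \<open>wnorm\<close> is infinite this is the default value 0 of
  \<open>enn2real\<close>, so estimates in terms of \<open>nrm\<close> carry a membership in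
  \<open>ell_sup\<close>.\<close>

definition nrm :: "'i set \<Rightarrow> ('i \<Rightarrow> ennreal) \<Rightarrow> ('i \<Rightarrow> complex) \<Rightarrow> real" where
  "nrm \<Lambda> w c = enn2real (wnorm top \<Lambda> w c)"

lemma wnorm_sup: "wnorm top \<Lambda> w c = (SUP \<alpha>\<in>\<Lambda>. ennreal (norm (c \<alpha>)) * w \<alpha>)"
  by (simp add: wnorm_def lp_norm_def)

lemma nrm_nonneg: "0 \<le> nrm \<Lambda> w c"
  by (simp add: nrm_def)

lemma ell_sup_seqs: "c \<in> ell_sup \<Lambda> w \<Longrightarrow> c \<in> seqs \<Lambda>"
  by (simp add: ell_w_def)

lemma wnorm_nrm: "c \<in> ell_sup \<Lambda> w \<Longrightarrow> wnorm top \<Lambda> w c = ennreal (nrm \<Lambda> w c)"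
  by (simp add: nrm_def ell_w_def)

lemma nrm_bound: "c \<in> ell_sup \<Lambda> w \<Longrightarrow> \<alpha> \<in> \<Lambda> \<Longrightarrow> ennreal (norm (c \<alpha>)) * w \<alpha> \<le> ennreal (nrm \<Lambda> w c)"
  unfolding wnorm_nrm[symmetric] wnorm_sup by (rule SUP_upper)

lemma ell_supI:
  assumes "c \<in> seqs \<Lambda>" "\<And>\<alpha>. \<alpha> \<in> \<Lambda> \<Longrightarrow> ennreal (norm (c \<alpha>)) * w \<alpha> \<le> ennreal B"
  shows "c \<in> ell_sup \<Lambda> w"
proof -
  have "wnorm top \<Lambda> w c \<le> ennreal B" unfolding wnorm_sup by (rule SUP_least) (rule assms(2))
  then have "wnorm top \<Lambda> w c < top" by (rule order.strict_trans1) simp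
  then show ?thesis using assms(1) by (simp add: ell_w_def)
qed

lemma nrm_le:
  assumes "0 \<le> B" "\<And>\<alpha>. \<alpha> \<in> \<Lambda> \<Longrightarrow> ennreal (norm (c \<alpha>)) * w \<alpha> \<le> ennreal B"
  shows "nrm \<Lambda> w c \<le> B"
proof -
  have "wnorm top \<Lambda> w c \<le> ennreal B" unfolding wnorm_sup by (rule SUP_least) (rule assms(2))
  then show ?thesis unfolding nrm_def by (rule enn2real_leI[OF assms(1)])
qed

lemma seqs_add: "c \<in> seqs \<Lambda> \<Longrightarrow> c' \<in> seqs \<Lambda> \<Longrightarrow> c + c' \<in> seqs \<Lambda>"
  by (simp add: seqs_def)

lemma seqs_scale: "c \<in> seqs \<Lambda> \<Longrightarrow> (\<lambda>\<alpha>. a * c \<alpha>) \<in> seqs \<Lambda>"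
  by (simp add: seqs_def)

lemma add_weighted_le:
  fixes w :: ennreal
  shows "ennreal (norm (x + y)) * w \<le> ennreal (norm x) * w + ennreal (norm y) * w"
  unfolding distrib_right[symmetric] ennreal_plus[OF norm_ge_zero norm_ge_zero, symmetric]
  by (intro mult_right_mono ennreal_leI norm_triangle_ineq) simp

lemma ell_sup_add:
  assumes "c \<in> ell_sup \<Lambda> w" "c' \<in> ell_sup \<Lambda> w"
  shows "c + c' \<in> ell_sup \<Lambda> w" "nrm \<Lambda> w (c + c') \<le> nrm \<Lambda> w c + nrm \<Lambda> w c'"
proof -
  have *: "ennreal (norm ((c + c') \<alpha>)) * w \<alpha> \<le> ennreal (nrm \<Lambda> w c + nrm \<Lambda> w c')" if "\<alpha> \<in> \<Lambda>" for \<alpha>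
    using order.trans[OF add_weighted_le add_mono[OF nrm_bound[OF assms(1) that] nrm_bound[OF assms(2) that]]]
    by (simp add: nrm_nonneg)
  show "c + c' \<in> ell_sup \<Lambda> w"
    by (rule ell_supI[OF seqs_add[OF assms[THEN ell_sup_seqs]] *])
  show "nrm \<Lambda> w (c + c') \<le> nrm \<Lambda> w c + nrm \<Lambda> w c'"
    by (rule nrm_le[OF _ *]) (simp_all add: nrm_nonneg)
qed

lemma ell_sup_scale:
  assumes "c \<in> ell_sup \<Lambda> w"
  shows "(\<lambda>\<alpha>. a * c \<alpha>) \<in> ell_sup \<Lambda> w" "nrm \<Lambda> w (\<lambda>\<alpha>. a * c \<alpha>) \<le> norm a * nrm \<Lambda> w c"
proof -
  have *: "ennreal (norm (a * c \<alpha>)) * w \<alpha> \<le> ennreal (norm a * nrm \<Lambda> w c)" if "\<alpha> \<in> \<Lambda>" for \<alpha>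
    using mult_left_mono[OF nrm_bound[OF assms that], of "ennreal (norm a)"]
    by (simp add: norm_mult ennreal_mult mult.assoc nrm_nonneg)
  show "(\<lambda>\<alpha>. a * c \<alpha>) \<in> ell_sup \<Lambda> w"
    by (rule ell_supI[OF seqs_scale[OF ell_sup_seqs[OF assms]] *])
  show "nrm \<Lambda> w (\<lambda>\<alpha>. a * c \<alpha>) \<le> norm a * nrm \<Lambda> w c"
    by (rule nrm_le[OF _ *]) (simp_all add: nrm_nonneg)
qed

lemma zero_in_ell_sup: "0 \<in> ell_sup \<Lambda> w"
  by (rule ell_supI[of _ _ _ 0]) (simp_all add: seqs_def)

lemma vsub_ell_sup: "vsub (ell_sup \<Lambda> w)"
  by (simp add: vsub_def zero_in_ell_sup ell_sup_add ell_sup_scale)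

lemma seminorm_nrm: "seminorm_on (ell_sup \<Lambda> w) (nrm \<Lambda> w)"
  unfolding seminorm_on_def
proof (intro conjI ballI allI nrm_nonneg ell_sup_add(2))
  fix a c assume c: "c \<in> ell_sup \<Lambda> w"
  show "nrm \<Lambda> w (\<lambda>\<alpha>. a * c \<alpha>) = norm a * nrm \<Lambda> w c"
  proof (cases "a = 0")
    case True
    have "nrm \<Lambda> w (\<lambda>\<alpha>. a * c \<alpha>) \<le> 0" using ell_sup_scale(2)[OF c, of a] True by simp
    then show ?thesis using True nrm_nonneg[of \<Lambda> w "\<lambda>\<alpha>. a * c \<alpha>"] by simp
  next
    case False
    have "(\<lambda>\<alpha>. (1 / a) * (a * c \<alpha>)) = c" using False by (simp add: fun_eq_iff)
    then have "nrm \<Lambda> w c \<le> norm (1 / a) * nrm \<Lambda> w (\<lambda>\<alpha>. a * c \<alpha>)"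
      using ell_sup_scale(2)[OF ell_sup_scale(1)[OF c, of a], of "1 / a"] by simp
    then have "norm a * nrm \<Lambda> w c \<le> nrm \<Lambda> w (\<lambda>\<alpha>. a * c \<alpha>)"
      using False by (simp add: norm_divide field_simps)
    then show ?thesis using ell_sup_scale(2)[OF c, of a] by linarith
  qed
qed

text \<open>All positive multiples are included because \<open>lc\<close> works with unit balls
  only.\<close>

definition nrms :: "'i set \<Rightarrow> ('i \<Rightarrow> ennreal) \<Rightarrow> (('i \<Rightarrow> complex) \<Rightarrow> real) set" where
  "nrms \<Lambda> w = {(\<lambda>c. M * nrm \<Lambda> w c) | M. 0 < M}"

lemma lc_sup_top: "lc (sup_top \<Lambda> w) (nrms \<Lambda> w)"
  unfolding lc_def topspace_ell_top
proof (intro conjI ballI allI impI vsub_ell_sup)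
  show "nrms \<Lambda> w \<noteq> {}" unfolding nrms_def using zero_less_one by blast
next
  fix q assume "q \<in> nrms \<Lambda> w"
  then show "seminorm_on (ell_sup \<Lambda> w) q"
    by (auto simp: nrms_def intro: seminorm_on_mult[OF seminorm_nrm])
next
  fix q q' assume "q \<in> nrms \<Lambda> w" "q' \<in> nrms \<Lambda> w"
  then obtain M M' where M: "0 < M" "0 < M'" "q = (\<lambda>c. M * nrm \<Lambda> w c)" "q' = (\<lambda>c. M' * nrm \<Lambda> w c)"
    by (auto simp: nrms_def)
  have "(\<lambda>c. max M M' * nrm \<Lambda> w c) \<in> nrms \<Lambda> w"
    unfolding nrms_def using M by (intro CollectI exI[of _ "max M M'"]) auto
  moreover have "q c \<le> max M M' * nrm \<Lambda> w c \<and> q' c \<le> max M M' * nrm \<Lambda> w c" for c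
    by (simp add: M mult_right_mono nrm_nonneg)
  ultimately show "\<exists>q''\<in>nrms \<Lambda> w. \<forall>c\<in>ell_sup \<Lambda> w. q c \<le> q'' c \<and> q' c \<le> q'' c"
    by (intro bexI[of _ "\<lambda>c. max M M' * nrm \<Lambda> w c"]) auto
next
  fix q and K :: real assume "q \<in> nrms \<Lambda> w" and K: "0 < K"
  then obtain M where M: "0 < M" "q = (\<lambda>c. M * nrm \<Lambda> w c)" by (auto simp: nrms_def)
  have "(\<lambda>c. (K * M) * nrm \<Lambda> w c) \<in> nrms \<Lambda> w"
    unfolding nrms_def using M K by (intro CollectI exI[of _ "K * M"]) auto
  then show "\<exists>q'\<in>nrms \<Lambda> w. \<forall>c\<in>ell_sup \<Lambda> w. K * q c \<le> q' c"
    by (intro bexI[of _ "\<lambda>c. (K * M) * nrm \<Lambda> w c"]) (auto simp: M)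
next
  fix U
  have "(\<exists>\<epsilon>>0. \<forall>c'\<in>ell_sup \<Lambda> w. wnorm top \<Lambda> w (c' - c) < ennreal \<epsilon> \<longrightarrow> c' \<in> U) \<longleftrightarrow>
      (\<exists>q\<in>nrms \<Lambda> w. \<forall>c'\<in>ell_sup \<Lambda> w. q (c' - c) < 1 \<longrightarrow> c' \<in> U)" (is "?l \<longleftrightarrow> ?r")
    if c: "c \<in> ell_sup \<Lambda> w" for c
  proof -
    \<comment> \<open>A ball of radius \<open>\<epsilon>\<close> is the unit ball of the norm
      multiplied by \<open>1 / \<epsilon>\<close>; \<open>nrm\<close> may replace
      \<open>wnorm\<close> since the difference lies in \<open>ell_sup\<close>.\<close>
    have eq: "wnorm top \<Lambda> w (c' - c) < ennreal \<epsilon> \<longleftrightarrow> (1 / \<epsilon>) * nrm \<Lambda> w (c' - c) < 1"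
      if "c' \<in> ell_sup \<Lambda> w" "0 < \<epsilon>" for c' \<epsilon>
      using that wnorm_nrm[OF vsub_diff[OF vsub_ell_sup that(1) c]]
      by (simp add: ennreal_less_iff nrm_nonneg)
    show ?thesis
    proof
      assume ?l
      then obtain \<epsilon> where \<epsilon>: "\<epsilon> > 0" "\<forall>c'\<in>ell_sup \<Lambda> w. wnorm top \<Lambda> w (c' - c) < ennreal \<epsilon> \<longrightarrow> c' \<in> U" by blast
      have "(\<lambda>c. (1 / \<epsilon>) * nrm \<Lambda> w c) \<in> nrms \<Lambda> w"
        unfolding nrms_def using \<epsilon> by (intro CollectI exI[of _ "1 / \<epsilon>"]) auto
      moreover have "\<forall>c'\<in>ell_sup \<Lambda> w. (1 / \<epsilon>) * nrm \<Lambda> w (c' - c) < 1 \<longrightarrow> c' \<in> U"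
        using \<epsilon> eq by blast
      ultimately show ?r by (intro bexI[of _ "\<lambda>c. (1 / \<epsilon>) * nrm \<Lambda> w c"])
    next
      assume ?r
      then obtain M where M: "0 < M" "\<forall>c'\<in>ell_sup \<Lambda> w. M * nrm \<Lambda> w (c' - c) < 1 \<longrightarrow> c' \<in> U"
        unfolding nrms_def by auto
      have "\<forall>c'\<in>ell_sup \<Lambda> w. wnorm top \<Lambda> w (c' - c) < ennreal (1 / M) \<longrightarrow> c' \<in> U"
        using M eq[of _ "1 / M"] by simp
      then show ?l using M(1) by (intro exI[of _ "1 / M"]) simp
    qed
  qed
  note key = this
  show "openin (sup_top \<Lambda> w) U \<longleftrightarrow> U \<subseteq> ell_sup \<Lambda> w \<and>
       (\<forall>c\<in>U. \<exists>q\<in>nrms \<Lambda> w. \<forall>c'\<in>ell_sup \<Lambda> w. q (c' - c) < 1 \<longrightarrow> c' \<in> U)"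
    unfolding openin_ell_top
  proof (intro conj_cong refl ball_cong)
    fix c assume "U \<subseteq> ell_sup \<Lambda> w" "c \<in> U"
    then show "(\<exists>\<epsilon>>0. \<forall>c'\<in>ell_sup \<Lambda> w. wnorm top \<Lambda> w (c' - c) < ennreal \<epsilon> \<longrightarrow> c' \<in> U) \<longleftrightarrow>
      (\<exists>q\<in>nrms \<Lambda> w. \<forall>c'\<in>ell_sup \<Lambda> w. q (c' - c) < 1 \<longrightarrow> c' \<in> U)"
      by (intro key) auto
  qed
qed

lemma continuous_nrm: "continuous_map (sup_top \<Lambda> w) euclideanreal (nrm \<Lambda> w)"
proof -
  have "(\<lambda>c. 1 * nrm \<Lambda> w c) \<in> nrms \<Lambda> w" unfolding nrms_def by (intro CollectI exI[of _ 1]) auto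
  then show ?thesis using lc_member_continuous[OF lc_sup_top] by simp
qed

lemma sup_top_dominated:
  assumes "seminorm_on (ell_sup \<Lambda> w) q" "continuous_map (sup_top \<Lambda> w) euclideanreal q"
  shows "\<exists>M>0. \<forall>c\<in>ell_sup \<Lambda> w. q c \<le> M * nrm \<Lambda> w c"
proof -
  obtain q' where "q' \<in> nrms \<Lambda> w" "\<forall>c\<in>ell_sup \<Lambda> w. q c \<le> q' c"
    using lc_dominated[OF lc_sup_top, of \<Lambda> w q] assms by (simp only: topspace_ell_top) blast
  then show ?thesis unfolding nrms_def by blast
qed

lemma sup_top_continuousI:
  assumes q: "seminorm_on (ell_sup \<Lambda> w) q" and bd: "\<And>c. c \<in> ell_sup \<Lambda> w \<Longrightarrow> q c \<le> M * nrm \<Lambda> w c"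
  shows "continuous_map (sup_top \<Lambda> w) euclideanreal q"
proof -
  have "(\<lambda>c. max 1 M * nrm \<Lambda> w c) \<in> nrms \<Lambda> w"
    unfolding nrms_def by (intro CollectI exI[of _ "max 1 M"]) auto
  moreover have "q c \<le> max 1 M * nrm \<Lambda> w c" if "c \<in> ell_sup \<Lambda> w" for c
    using bd[OF that] mult_right_mono[OF max.cobounded2[of M 1] nrm_nonneg[of \<Lambda> w c]] by linarith
  ultimately have "\<exists>q'\<in>nrms \<Lambda> w. \<forall>c\<in>ell_sup \<Lambda> w. q c \<le> q' c"
    by (intro bexI[of _ "\<lambda>c. max 1 M * nrm \<Lambda> w c"] ballI)
  then show ?thesis
    using lc_continuous_seminorm[OF lc_sup_top, of \<Lambda> w q] q by simp
qed

lemma sup_top_mono: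
  assumes "\<And>\<alpha>. \<alpha> \<in> \<Lambda> \<Longrightarrow> w \<alpha> \<le> w' \<alpha>"
  shows "ell_sup \<Lambda> w' \<subseteq> ell_sup \<Lambda> w" "c \<in> ell_sup \<Lambda> w' \<Longrightarrow> nrm \<Lambda> w c \<le> nrm \<Lambda> w' c"
    "continuous_map (sup_top \<Lambda> w') (sup_top \<Lambda> w) id"
proof -
  have *: "ennreal (norm (c \<alpha>)) * w \<alpha> \<le> ennreal (nrm \<Lambda> w' c)" if "c \<in> ell_sup \<Lambda> w'" "\<alpha> \<in> \<Lambda>" for c \<alpha>
    using order.trans[OF mult_left_mono[OF assms[OF that(2)]] nrm_bound[OF that]] by simp
  show sub: "ell_sup \<Lambda> w' \<subseteq> ell_sup \<Lambda> w"
  proof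
    fix c assume c: "c \<in> ell_sup \<Lambda> w'"
    show "c \<in> ell_sup \<Lambda> w" by (rule ell_supI[OF ell_sup_seqs[OF c] *[OF c]])
  qed
  show le: "nrm \<Lambda> w c \<le> nrm \<Lambda> w' c" if "c \<in> ell_sup \<Lambda> w'" for c
    using nrm_le[OF nrm_nonneg *[OF that]] .
  show "continuous_map (sup_top \<Lambda> w') (sup_top \<Lambda> w) id"
  proof (rule lc_continuous_linear[OF lc_sup_top lc_sup_top])
    fix q assume "q \<in> nrms \<Lambda> w"
    then obtain M where M: "0 < M" "q = (\<lambda>c. M * nrm \<Lambda> w c)" by (auto simp: nrms_def)
    show "continuous_map (sup_top \<Lambda> w') euclideanreal (\<lambda>c. q (id c))"
    proof (rule sup_top_continuousI[of _ _ _ M])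
      show "seminorm_on (ell_sup \<Lambda> w') (\<lambda>c. q (id c))"
        using seminorm_on_subset[OF seminorm_on_mult[OF seminorm_nrm] sub, of M] M by simp
      show "q (id c) \<le> M * nrm \<Lambda> w' c" if "c \<in> ell_sup \<Lambda> w'" for c
        using mult_left_mono[OF le[OF that], of M] M by simp
    qed
  qed (use sub in \<open>auto simp: lin_on_def\<close>)
qed

text \<open>The parameter \<open>a\<close> is that of a projective limit and \<open>b\<close> that of an inductive limit. Weights may
  vanish or be infinite.\<close>

locale weights =
  fixes \<Lambda> :: "'i set" and w :: "real \<Rightarrow> real \<Rightarrow> 'i \<Rightarrow> ennreal"
  assumes mono_a: "0 < a \<Longrightarrow> a \<le> a' \<Longrightarrow> 0 < b \<Longrightarrow> \<alpha> \<in> \<Lambda> \<Longrightarrow> w a b \<alpha> \<le> w a' b \<alpha>"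
    and mono_b: "0 < b \<Longrightarrow> b \<le> b' \<Longrightarrow> 0 < a \<Longrightarrow> \<alpha> \<in> \<Lambda> \<Longrightarrow> w a b' \<alpha> \<le> w a b \<alpha>"
    and finite_b: "\<alpha> \<in> \<Lambda> \<Longrightarrow> \<exists>b>0. \<forall>a>0. w a b \<alpha> < top"
    and pos_a: "\<alpha> \<in> \<Lambda> \<Longrightarrow> \<exists>a>0. \<forall>b>0. 0 < w a b \<alpha>"
    and zero_b: "0 < a \<Longrightarrow> 0 < b \<Longrightarrow> 0 < b' \<Longrightarrow> \<alpha> \<in> \<Lambda> \<Longrightarrow> w a b \<alpha> = 0 \<Longrightarrow> w a b' \<alpha> = 0"
begin

text \<open>As the weights increase with \<open>a\<close>, a sequence of indices is cofinal, and
  \<open>Xb b\<close> is a Frechet space. So \<open>Csp\<close> is an inductive limit of Frechet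
  spaces, and \<open>Bsp\<close> a projective limit of inductive limits of seminormed
  spaces.\<close>

definition Xb :: "real \<Rightarrow> ('i \<Rightarrow> complex) topology" where
  "Xb b = proj_lim (\<lambda>a. sup_top \<Lambda> (w a b))"

definition Ya :: "real \<Rightarrow> ('i \<Rightarrow> complex) topology" where
  "Ya a = ind_lim (\<lambda>b. sup_top \<Lambda> (w a b))"

definition Bsp :: "('i \<Rightarrow> complex) topology" where "Bsp = proj_lim Ya"
definition Csp :: "('i \<Rightarrow> complex) topology" where "Csp = ind_lim Xb"

lemma topspace_Xb: "topspace (Xb b) = (\<Inter>a\<in>{0<..}. ell_sup \<Lambda> (w a b))"
  by (simp add: Xb_def topspace_proj_lim)

lemma topspace_Ya: "topspace (Ya a) = (\<Union>b\<in>{0<..}. ell_sup \<Lambda> (w a b))"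
  by (simp add: Ya_def topspace_ind_lim)

lemma topspace_Bsp: "topspace Bsp = (\<Inter>a\<in>{0<..}. \<Union>b\<in>{0<..}. ell_sup \<Lambda> (w a b))"
  by (simp add: Bsp_def topspace_proj_lim topspace_Ya)

lemma topspace_Csp: "topspace Csp = (\<Union>b\<in>{0<..}. \<Inter>a\<in>{0<..}. ell_sup \<Lambda> (w a b))"
  by (simp add: Csp_def topspace_ind_lim topspace_Xb)

lemma lc_Xb: "0 < b \<Longrightarrow> lc (Xb b) (\<Union>a\<in>{0<..}. nrms \<Lambda> (w a b))"
  unfolding Xb_def by (intro lc_proj_lim lc_sup_top sup_top_mono mono_a)

lemma lc_Ya: "0 < a \<Longrightarrow> lc (Ya a) {q. lim_seminorm (\<lambda>b. sup_top \<Lambda> (w a b)) q}"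
  unfolding Ya_def
proof (rule lc_ind_lim[OF lc_sup_top])
  fix b b' :: real assume "0 < a" "0 < b" "b \<le> b'"
  then have "ell_sup \<Lambda> (w a b) \<subseteq> ell_sup \<Lambda> (w a b')" by (intro sup_top_mono(1) mono_b)
  then show "topspace (sup_top \<Lambda> (w a b)) \<subseteq> topspace (sup_top \<Lambda> (w a b'))" by simp
qed

lemma Ya_mono: "0 < a \<Longrightarrow> a \<le> a' \<Longrightarrow> continuous_map (Ya a') (Ya a) id"
  unfolding Ya_def
proof (rule ind_lim_mono)
  fix b :: real assume "0 < a" "a \<le> a'" "0 < b"
  then show "\<exists>b'>0. continuous_map (sup_top \<Lambda> (w a' b)) (sup_top \<Lambda> (w a b')) id"
    by (intro exI[of _ b] conjI sup_top_mono(3) mono_a)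
qed

lemma Xb_mono: "0 < b \<Longrightarrow> b \<le> b' \<Longrightarrow> continuous_map (Xb b) (Xb b') id"
  unfolding Xb_def
proof (rule proj_lim_mono)
  fix a :: real assume "0 < b" "b \<le> b'" "0 < a"
  then show "\<exists>a'>0. continuous_map (sup_top \<Lambda> (w a' b)) (sup_top \<Lambda> (w a b')) id"
    by (intro exI[of _ a] conjI sup_top_mono(3) mono_b)
qed

lemma lc_Bsp: "lc Bsp (\<Union>a\<in>{0<..}. {q. lim_seminorm (\<lambda>b. sup_top \<Lambda> (w a b)) q})"
  unfolding Bsp_def by (intro lc_proj_lim lc_Ya Ya_mono)

lemma Xb_subset: "0 < b \<Longrightarrow> b \<le> b' \<Longrightarrow> topspace (Xb b) \<subseteq> topspace (Xb b')"
  using Xb_mono[of b b'] by (auto simp: continuous_map_def)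

lemma lc_Csp: "lc Csp {q. lim_seminorm Xb q}"
  unfolding Csp_def by (rule lc_ind_lim[OF lc_Xb Xb_subset])

lemma Xb_in: "0 < a \<Longrightarrow> continuous_map (Xb b) (sup_top \<Lambda> (w a b)) id"
  unfolding Xb_def by (rule proj_lim_in)

lemma Ya_in: "0 < b \<Longrightarrow> continuous_map (sup_top \<Lambda> (w a b)) (Ya a) id"
  unfolding Ya_def by (rule ind_lim_in[OF lc_sup_top])

lemma Bsp_in: "0 < a \<Longrightarrow> continuous_map Bsp (Ya a) id"
  unfolding Bsp_def by (rule proj_lim_in)

lemma Csp_in: "0 < b \<Longrightarrow> continuous_map (Xb b) Csp id"
  unfolding Csp_def by (rule ind_lim_in[OF lc_Xb])

lemma Xb_dominated:
  assumes b: "0 < b" and q: "seminorm_on (topspace (Xb b)) q" "continuous_map (Xb b) euclideanreal q"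
  shows "\<exists>a>0. \<exists>M>0. \<forall>c\<in>topspace (Xb b). q c \<le> M * nrm \<Lambda> (w a b) c"
proof -
  obtain q' where q': "q' \<in> (\<Union>a\<in>{0<..}. nrms \<Lambda> (w a b))" "\<forall>c\<in>topspace (Xb b). q c \<le> q' c"
    using lc_dominated[OF lc_Xb[OF b] q] ..
  from q'(1) obtain a M where "0 < a" "0 < M" "q' = (\<lambda>c. M * nrm \<Lambda> (w a b) c)"
    unfolding nrms_def by auto
  then show ?thesis using q'(2) by blast
qed

lemma Xb_continuousI:
  assumes b: "0 < b" and a: "0 < a" and q: "seminorm_on (topspace (Xb b)) q"
    and bd: "\<And>c. c \<in> topspace (Xb b) \<Longrightarrow> q c \<le> M * nrm \<Lambda> (w a b) c"
  shows "continuous_map (Xb b) euclideanreal q"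
proof -
  have "(\<lambda>c. max 1 M * nrm \<Lambda> (w a b) c) \<in> (\<Union>a\<in>{0<..}. nrms \<Lambda> (w a b))"
    unfolding nrms_def using a by (intro UN_I[of a] CollectI exI[of _ "max 1 M"]) auto
  moreover have "q c \<le> max 1 M * nrm \<Lambda> (w a b) c" if "c \<in> topspace (Xb b)" for c
    using bd[OF that] mult_right_mono[OF max.cobounded2[of M 1] nrm_nonneg[of \<Lambda> "w a b" c]] by linarith
  ultimately have "\<exists>q'\<in>(\<Union>a\<in>{0<..}. nrms \<Lambda> (w a b)). \<forall>c\<in>topspace (Xb b). q c \<le> q' c"
    by (intro bexI[of _ "\<lambda>c. max 1 M * nrm \<Lambda> (w a b) c"] ballI)
  then show ?thesis
    using lc_continuous_seminorm[OF lc_Xb[OF b] q] by simp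
qed

lemma seminorm_nrm_Xb: "0 < a \<Longrightarrow> seminorm_on (topspace (Xb b)) (nrm \<Lambda> (w a b))"
  by (rule seminorm_on_subset[OF seminorm_nrm]) (auto simp: topspace_Xb)

end

section \<open>Completeness, density and independence of the exponent\<close>

text \<open>For a finite weight the bound passes to the limit. An infinite weight forces
  \<open>f m = z\<close> from \<open>n\<close> on, hence \<open>l = z\<close>.\<close>

lemma weighted_limit_le:
  fixes f :: "nat \<Rightarrow> complex" and w :: ennreal
  assumes lim: "f \<longlonglongrightarrow> l" and bd: "\<And>m. m \<ge> n \<Longrightarrow> ennreal (norm (f m - z)) * w \<le> ennreal e" and e: "0 \<le> e"
  shows "ennreal (norm (l - z)) * w \<le> ennreal e"
proof (cases w)
  case (real r)
  have "norm (l - z) * r \<le> e"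
  proof (rule LIMSEQ_le_const2)
    show "(\<lambda>m. norm (f m - z) * r) \<longlonglongrightarrow> norm (l - z) * r"
      by (intro tendsto_intros lim)
    show "\<exists>N. \<forall>m\<ge>N. norm (f m - z) * r \<le> e"
      using bd real e by (auto simp: ennreal_mult[symmetric] intro!: exI[of _ n])
  qed
  then show ?thesis using real by (simp add: ennreal_mult[symmetric] ennreal_leI)
next
  case top
  have "f m = z" if "m \<ge> n" for m
    using bd[OF that] top by (auto simp: ennreal_mult_top top_unique split: if_splits)
  then have "f \<longlonglongrightarrow> z"
    by (intro tendsto_eventually) (auto simp: eventually_sequentially)
  then have "l = z" using lim LIMSEQ_unique by blast
  then show ?thesis by simp
qed

context weights
begin

text \<open>The balls have radii tending to 0 with respect to norms that run through a cofinal sequence,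
  so the nesting makes their centres Cauchy in every norm.\<close>

lemma Xb_nested_balls:
  assumes b: "0 < b" and x: "\<And>n. x n \<in> topspace (Xb b)"
    and k: "\<And>n. real n < k n" and e: "\<And>n. 0 < e n" "\<And>n. e n \<le> (1/2) ^ n"
    and nest: "\<And>n m. n \<le> m \<Longrightarrow> nrm \<Lambda> (w (k n) b) (x m - x n) \<le> e n"
  shows "\<exists>z\<in>topspace (Xb b). \<forall>n. nrm \<Lambda> (w (k n) b) (z - x n) \<le> e n"
proof -
  have kpos: "0 < k n" for n using k[of n] by linarith
  have xk: "x m \<in> ell_sup \<Lambda> (w (k n) b)" for n m
    using x[of m] kpos[of n] by (auto simp: topspace_Xb)
  have bd: "ennreal (norm (x m \<alpha> - x n \<alpha>)) * w (k n) b \<alpha> \<le> ennreal (e n)"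
    if "n \<le> m" "\<alpha> \<in> \<Lambda>" for n m \<alpha>
    using order.trans[OF nrm_bound[OF vsub_diff[OF vsub_ell_sup xk xk] that(2)] ennreal_leI[OF nest[OF that(1)]]]
    by simp
  have "\<exists>l. (\<lambda>m. x m \<alpha>) \<longlonglongrightarrow> l" if \<alpha>: "\<alpha> \<in> \<Lambda>" for \<alpha>
  proof -
    obtain a where a: "0 < a" "0 < w a b \<alpha>" using pos_a[OF \<alpha>] b by blast
    \<comment> \<open>The weight may be infinite; a positive real below it is all that the estimate
      uses.\<close>
    obtain r where r: "0 < r" "ennreal r \<le> w a b \<alpha>"
      using a(2) by (cases "w a b \<alpha>") (auto intro: that[of 1] simp: top_greatest)
    have "Cauchy (\<lambda>m. x m \<alpha>)"
    proof (rule CauchyI)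
      fix \<epsilon> :: real assume \<epsilon>: "0 < \<epsilon>"
      have "(\<lambda>n. (1/2::real) ^ n) \<longlonglongrightarrow> 0" by (intro LIMSEQ_power_zero) simp
      then have "\<forall>\<^sub>F n in sequentially. (1/2::real) ^ n < \<epsilon> * r / 2"
        using \<epsilon> r by (intro order_tendstoD) auto
      then obtain n0 where n0: "\<And>n. n \<ge> n0 \<Longrightarrow> (1/2::real) ^ n < \<epsilon> * r / 2"
        by (auto simp: eventually_sequentially)
      obtain n1 :: nat where n1: "a \<le> real n1" using real_arch_simple by blast
      \<comment> \<open>\<open>n0\<close> makes the radius small, and \<open>n1\<close> makes the
        norm with index \<open>k N > N\<close> at least as strong as the one with index
        \<open>a\<close>.\<close>
      define N where "N = max n0 n1"
      have N: "norm (x m \<alpha> - x N \<alpha>) < \<epsilon> / 2" if "m \<ge> N" for m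
      proof -
        have "a \<le> k N" using n1 k[of N] by (simp add: N_def)
        then have "ennreal r \<le> w (k N) b \<alpha>"
          using mono_a[OF a(1) _ b \<alpha>] r(2) by (blast intro: order.trans)
        then have "ennreal (norm (x m \<alpha> - x N \<alpha>)) * ennreal r \<le> ennreal (e N)"
          using bd[OF that \<alpha>] by (blast intro: order.trans mult_left_mono zero_le)
        then have "norm (x m \<alpha> - x N \<alpha>) * r \<le> e N"
          using r(1) less_imp_le[OF e(1)] by (simp add: ennreal_mult[symmetric])
        also have "\<dots> < \<epsilon> * r / 2" using e(2)[of N] n0[of N] by (simp add: N_def)
        finally show ?thesis using r(1) by (simp add: field_simps)
      qed
      show "\<exists>M. \<forall>m\<ge>M. \<forall>n\<ge>M. norm (x m \<alpha> - x n \<alpha>) < \<epsilon>"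
      proof (intro exI[of _ N] allI impI)
        fix m n assume "m \<ge> N" "n \<ge> N"
        then show "norm (x m \<alpha> - x n \<alpha>) < \<epsilon>"
          using norm_diff_triangle_less[of "x m \<alpha>" "x N \<alpha>" "\<epsilon> / 2" "x n \<alpha>" "\<epsilon> / 2"] N[of m] N[of n]
          by (simp add: norm_minus_commute)
      qed
    qed
    then show ?thesis by (simp add: Cauchy_convergent_iff convergent_def)
  qed
  then obtain l where l: "\<And>\<alpha>. \<alpha> \<in> \<Lambda> \<Longrightarrow> (\<lambda>m. x m \<alpha>) \<longlonglongrightarrow> l \<alpha>" by metis
  define z where "z \<alpha> = (if \<alpha> \<in> \<Lambda> then l \<alpha> else 0)" for \<alpha>
  have zn: "ennreal (norm ((z - x n) \<alpha>)) * w (k n) b \<alpha> \<le> ennreal (e n)" if "\<alpha> \<in> \<Lambda>" for n \<alpha>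
    using weighted_limit_le[OF l[OF that] bd[of n _ \<alpha>]] that less_imp_le[OF e(1)] by (simp add: z_def)
  have zs: "z - x n \<in> seqs \<Lambda>" for n
    using ell_sup_seqs[OF xk[of n 0]] by (simp add: seqs_def z_def)
  have zk: "z \<in> ell_sup \<Lambda> (w (k n) b)" for n
    using vsub_add[OF vsub_ell_sup ell_supI[OF zs[of n] zn] xk[of n n]] by (simp only: diff_add_cancel)
  have "z \<in> topspace (Xb b)"
    unfolding topspace_Xb
  proof (intro INT_I)
    fix a :: real assume "a \<in> {0<..}"
    then have a: "0 < a" by simp
    obtain n :: nat where "a \<le> real n" using real_arch_simple by blast
    then have "a \<le> k n" using k[of n] by simp
    then have "ell_sup \<Lambda> (w (k n) b) \<subseteq> ell_sup \<Lambda> (w a b)"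
      by (intro sup_top_mono(1) mono_a a b)
    then show "z \<in> ell_sup \<Lambda> (w a b)" using zk[of n] by blast
  qed
  moreover have "nrm \<Lambda> (w (k n) b) (z - x n) \<le> e n" for n
    by (rule nrm_le[OF less_imp_le[OF e(1)] zn])
  ultimately show ?thesis by blast
qed

text \<open>Baire's argument with explicit balls. If the pointwise supremum \<open>q\<close> were
  not continuous, it would be unbounded on every ball, so nested balls could be chosen with some
  \<open>Q i > n\<close> on all of the ball number \<open>n + 1\<close>. A common point of the balls
  contradicts the pointwise bound.\<close>

lemma barrelled_Xb:
  assumes b: "0 < b" shows "barrelled_seq (Xb b)"
  unfolding barrelled_seq_def
proof (intro allI impI, elim conjE)
  fix Q :: "nat \<Rightarrow> ('i \<Rightarrow> complex) \<Rightarrow> real"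
  let ?E = "topspace (Xb b)"
  assume Q: "\<forall>n. seminorm_on ?E (Q n) \<and> continuous_map (Xb b) euclideanreal (Q n)"
    and bdd: "\<forall>c\<in>?E. bdd_above (range (\<lambda>n. Q n c))"
  define q where "q = (\<lambda>c. SUP n. Q n c)"
  note vE = lc_vsub[OF lc_Xb[OF b]]
  have Qs: "seminorm_on ?E (Q n)" and Qc: "continuous_map (Xb b) euclideanreal (Q n)" for n
    using Q by auto
  have sn: "seminorm_on ?E q"
    unfolding q_def by (rule seminorm_on_SUP[OF vE]) (use Q bdd in auto)
  have up: "\<forall>c\<in>?E. Q n c \<le> q c" for n
    unfolding q_def using bdd by (intro ballI cSUP_upper) auto
  have "\<exists>M>0. \<exists>a>0. \<forall>c\<in>?E. q c \<le> M * nrm \<Lambda> (w a b) c"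
  proof (rule ccontr)
    assume neg: "\<not> (\<exists>M>0. \<exists>a>0. \<forall>c\<in>?E. q c \<le> M * nrm \<Lambda> (w a b) c)"
    \<comment> \<open>A bound of \<open>q\<close> on one ball would give, by translation to 0 and
      homogeneity, the estimate excluded by \<open>neg\<close>.\<close>
    have A: "\<exists>y\<in>?E. nrm \<Lambda> (w k b) (y - x) \<le> \<epsilon> \<and> (\<exists>i. Q i y > N)"
      if x: "x \<in> ?E" and k: "0 < k" and \<epsilon>: "0 < \<epsilon>" for x k \<epsilon> and N :: real
    proof (rule ccontr)
      assume no: "\<not> ?thesis"
      have le: "q y \<le> N" if "y \<in> ?E" "nrm \<Lambda> (w k b) (y - x) \<le> \<epsilon>" for y
        unfolding q_def using no that by (intro cSUP_least) (auto simp: not_less)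
      \<comment> \<open>If \<open>q\<close> is at most \<open>N\<close> on the ball about
        \<open>x\<close>, it is at most \<open>\<bar>N\<bar> + \<bar>q x\<bar>\<close> on the ball
        of radius \<open>\<epsilon>\<close> about 0. Division by \<open>\<epsilon>\<close> rescales
        to the unit ball, and the summand 1 makes the inequality strict.\<close>
      define M where "M = (\<bar>N\<bar> + \<bar>q x\<bar>) / \<epsilon> + 1"
      have M: "0 < M" unfolding M_def using \<epsilon> by (intro add_nonneg_pos) auto
      have "q c \<le> M * nrm \<Lambda> (w k b) c" if c: "c \<in> ?E" for c
      proof (rule seminorm_bound_by_ball[OF vE sn seminorm_nrm_Xb[OF k] _ c M])
        fix c assume c: "c \<in> ?E" and n1: "nrm \<Lambda> (w k b) c < 1"
        let ?c = "\<lambda>\<alpha>. complex_of_real \<epsilon> * c \<alpha>"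
        have cE: "?c \<in> ?E" by (rule vsub_scale[OF vE c])
        have "nrm \<Lambda> (w k b) ?c = \<epsilon> * nrm \<Lambda> (w k b) c"
          using seminorm_on_scale[OF seminorm_nrm_Xb[OF k] c, of "complex_of_real \<epsilon>"] \<epsilon> by simp
        then have "nrm \<Lambda> (w k b) ?c \<le> \<epsilon>" using n1 \<epsilon> by simp
        moreover have "?c + x - x = ?c" by simp
        ultimately have "q (?c + x) \<le> N" using le[OF vsub_add[OF vE cE x]] by simp
        moreover have "q ?c \<le> q (?c + x) + q x"
        proof -
          have "q ?c \<le> q (?c + x) + q (?c - (?c + x))"
            by (rule seminorm_on_le_diff[OF vE sn cE vsub_add[OF vE cE x]])
          also have "?c - (?c + x) = 0 - x" by simp
          also have "q (0 - x) = q (x - 0)"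
            by (rule seminorm_on_minus_commute[OF vE sn vsub_0[OF vE] x])
          finally show ?thesis by (simp only: diff_0_right)
        qed
        ultimately have "q ?c \<le> \<bar>N\<bar> + \<bar>q x\<bar>" by linarith
        moreover have "q ?c = \<epsilon> * q c"
          using seminorm_on_scale[OF sn c, of "complex_of_real \<epsilon>"] \<epsilon> by simp
        ultimately have "q c \<le> (\<bar>N\<bar> + \<bar>q x\<bar>) / \<epsilon>" using \<epsilon> by (simp add: field_simps)
        then show "q c < M" by (simp add: M_def)
      qed
      then show False using neg k M by blast
    qed
    \<comment> \<open>A state consists of centre, index of the norm and radius. Indices above
      \<open>n\<close> are cofinal and radii up to \<open>(1/2) ^ n\<close> tend to 0, as
      \<open>Xb_nested_balls\<close> requires.\<close>
    define ok where "ok n s = (case s of (x, k, e) \<Rightarrow> x \<in> ?E \<and> real n < k \<and> 0 < e \<and> e \<le> (1/2::real) ^ n)"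
      for n :: nat and s :: "('i \<Rightarrow> complex) \<times> real \<times> real"
    define ball where "ball s = (case s of (x, k, e) \<Rightarrow> {c\<in>?E. nrm \<Lambda> (w k b) (c - x) \<le> e})"
      for s :: "('i \<Rightarrow> complex) \<times> real \<times> real"
    have step: "\<exists>s'. ok (Suc n) s' \<and> ball s' \<subseteq> ball s \<and> (\<exists>i. \<forall>c\<in>ball s'. Q i c > real n)"
      if s: "ok n s" for n s
    proof -
      obtain x k e where s': "s = (x, k, e)" "x \<in> ?E" "real n < k" "0 < e" "e \<le> (1/2) ^ n"
        using s by (auto simp: ok_def split: prod.splits)
      have k: "0 < k" using s'(3) by linarith
      obtain y i where y: "y \<in> ?E" "nrm \<Lambda> (w k b) (y - x) \<le> e / 2" "Q i y > real n"
        using A[OF s'(2) k, of "e / 2" "real n"] s'(4) by auto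
      obtain a M where a: "0 < a" "0 < M" "\<forall>c\<in>?E. Q i c \<le> M * nrm \<Lambda> (w a b) c"
        using Xb_dominated[OF b Qs Qc] by blast
      \<comment> \<open>\<open>k + 1\<close> keeps the index above \<open>Suc n\<close>, and
        \<open>a\<close> makes the new norm control \<open>Q i\<close>.\<close>
      define k' where "k' = max (k + 1) a"
      \<comment> \<open>On the new ball \<open>Q i\<close> falls below its value at \<open>y\<close>
        by at most half of the excess over \<open>n\<close>.\<close>
      define e' where "e' = min (e / 2) ((Q i y - real n) / (2 * M))"
      have e': "0 < e'" "e' \<le> e / 2" "M * e' < Q i y - real n"
      proof -
        show "0 < e'" using s'(4) y(3) a(2) by (simp add: e'_def)
        show "e' \<le> e / 2" by (simp add: e'_def)
        have "M * e' \<le> M * ((Q i y - real n) / (2 * M))"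
          using a(2) by (intro mult_left_mono) (auto simp: e'_def)
        also have "\<dots> = (Q i y - real n) / 2" using a(2) by simp
        also have "\<dots> < Q i y - real n" using y(3) by simp
        finally show "M * e' < Q i y - real n" .
      qed
      have k': "0 < k'" "k \<le> k'" "a \<le> k'" using k by (auto simp: k'_def)
      have mono: "nrm \<Lambda> (w a0 b) c \<le> nrm \<Lambda> (w k' b) c" if "0 < a0" "a0 \<le> k'" "c \<in> ?E" for a0 c
        using that k'(1) b by (intro sup_top_mono(2) mono_a) (auto simp: topspace_Xb)
      have in_ball: "c \<in> ball s \<and> Q i c > real n" if c: "c \<in> ball (y, k', e')" for c
      proof -
        have cE: "c \<in> ?E" and cn: "nrm \<Lambda> (w k' b) (c - y) \<le> e'" using c by (auto simp: ball_def)
        have d: "c - y \<in> ?E" by (rule vsub_diff[OF vE cE y(1)])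
        have "nrm \<Lambda> (w k b) (c - x) \<le> nrm \<Lambda> (w k b) (c - y) + nrm \<Lambda> (w k b) (y - x)"
          by (rule seminorm_on_triangle[OF vE seminorm_nrm_Xb[OF k] cE y(1) s'(2)])
        also have "\<dots> \<le> e" using mono[OF k k'(2) d] cn e' y(2) by linarith
        finally have 1: "c \<in> ball s" using cE by (simp add: ball_def s'(1))
        have "Q i y \<le> Q i c + Q i (y - c)" by (rule seminorm_on_le_diff[OF vE Qs y(1) cE])
        also have "Q i (y - c) = Q i (c - y)" by (rule seminorm_on_minus_commute[OF vE Qs y(1) cE])
        also have "Q i (c - y) \<le> M * nrm \<Lambda> (w a b) (c - y)" using a(3) d by blast
        also have "\<dots> \<le> M * e'" using mono[OF a(1) k'(3) d] cn a(2) by (intro mult_left_mono) auto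
        finally have "Q i c > real n" using e'(3) by linarith
        with 1 show ?thesis by blast
      qed
      have "ok (Suc n) (y, k', e')"
        using y(1) s'(3,5) e'(1,2) by (auto simp: ok_def k'_def)
      moreover have "ball (y, k', e') \<subseteq> ball s" "\<forall>c\<in>ball (y, k', e'). Q i c > real n"
        using in_ball by blast+
      ultimately show ?thesis by blast
    qed
    have "ok 0 (0, 1, 1)" using vsub_0[OF vE] by (simp add: ok_def)
    then obtain f where f: "\<And>n. ok n (f n)"
      "\<And>n. ball (f (Suc n)) \<subseteq> ball (f n) \<and> (\<exists>i. \<forall>c\<in>ball (f (Suc n)). Q i c > real n)"
      using dependent_nat_choice[of ok "\<lambda>n s s'. ball s' \<subseteq> ball s \<and> (\<exists>i. \<forall>c\<in>ball s'. Q i c > real n)"]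
        step by metis
    define x k e where "x n = fst (f n)" and "k n = fst (snd (f n))" and "e n = snd (snd (f n))" for n
    have f': "f n = (x n, k n, e n)" for n by (simp add: x_def k_def e_def)
    have ok: "x n \<in> ?E" "real n < k n" "0 < e n" "e n \<le> (1/2) ^ n" for n
      using f(1)[of n] by (auto simp: ok_def f')
    have kpos: "0 < k n" for n using ok(2)[of n] by linarith
    have sub: "ball (f m) \<subseteq> ball (f n)" if "n \<le> m" for n m
      using that by (rule lift_Suc_antimono_le[rotated]) (use f(2) in blast)
    have "x m \<in> ball (f m)" for m
      using ok(1,3)[of m] seminorm_on_0[OF vE seminorm_nrm_Xb[OF kpos]] by (simp add: ball_def f' less_imp_le)
    then have "x m \<in> ball (f n)" if "n \<le> m" for n m using sub[OF that] by blast
    then have nest: "nrm \<Lambda> (w (k n) b) (x m - x n) \<le> e n" if "n \<le> m" for n m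
      using that by (auto simp: ball_def f')
    obtain z where z: "z \<in> ?E" "\<forall>n. nrm \<Lambda> (w (k n) b) (z - x n) \<le> e n"
      using Xb_nested_balls[OF b ok nest] by blast
    have "z \<in> ball (f n)" for n using z by (simp add: ball_def f')
    then have "\<exists>i. Q i z > real n" for n using f(2)[of n] by blast
    then have "real n < q z" for n using up z(1) by (meson order.strict_trans2)
    moreover obtain n where "q z \<le> real n" using real_arch_simple by blast
    ultimately show False by (meson not_less)
  qed
  then obtain M a where "0 < M" "0 < a" "\<forall>c\<in>?E. q c \<le> M * nrm \<Lambda> (w a b) c" by blast
  then have "continuous_map (Xb b) euclideanreal q"
    by (intro Xb_continuousI[OF b _ sn, of a M]) auto
  then show "\<exists>q. seminorm_on ?E q \<and> continuous_map (Xb b) euclideanreal q \<and> (\<forall>n. \<forall>c\<in>?E. Q n c \<le> q c)"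
    using sn up by blast
qed

lemma barrelled_Csp: "barrelled_seq Csp"
  unfolding Csp_def
  by (rule barrelled_seq_ind_lim[OF lc_Xb _ barrelled_Xb]) (use lc_Csp in \<open>simp_all add: Csp_def\<close>)

end

section \<open>Coordinate functionals and finitely supported sequences\<close>

lemma seminorm_coordinate: "seminorm_on V (\<lambda>c. norm (c \<alpha>))"
  by (simp add: seminorm_on_def norm_triangle_ineq norm_mult)

context weights
begin

lemma continuous_coordinate_sup:
  assumes "\<alpha> \<in> \<Lambda>" "0 < w a b \<alpha>"
  shows "continuous_map (sup_top \<Lambda> (w a b)) euclideanreal (\<lambda>c. norm (c \<alpha>))"
proof -
  obtain r where r: "0 < r" "ennreal r \<le> w a b \<alpha>"
    using assms(2) by (cases "w a b \<alpha>") (auto intro: that[of 1] simp: top_greatest)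
  have "norm (c \<alpha>) \<le> (1 / r) * nrm \<Lambda> (w a b) c" if c: "c \<in> ell_sup \<Lambda> (w a b)" for c
  proof -
    have "ennreal (norm (c \<alpha>)) * ennreal r \<le> ennreal (nrm \<Lambda> (w a b) c)"
      using nrm_bound[OF c assms(1)] r(2) by (blast intro: order.trans mult_left_mono zero_le)
    then have "norm (c \<alpha>) * r \<le> nrm \<Lambda> (w a b) c"
      using r(1) by (simp add: ennreal_mult[symmetric] nrm_nonneg)
    then show ?thesis using r(1) by (simp add: field_simps)
  qed
  then show ?thesis by (intro sup_top_continuousI[OF seminorm_coordinate])
qed

text \<open>Coordinates separate points. \<open>pos_a\<close> provides one \<open>a\<close> for
  which the weight is positive for all \<open>b\<close>, which makes the coordinate continuous on
  every step of \<open>Ya a\<close>.\<close>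

lemma Hausdorff_Bsp: "Hausdorff_space Bsp"
proof (rule lc_Hausdorff[OF lc_Bsp])
  fix x assume x: "x \<in> topspace Bsp" "x \<noteq> 0"
  then obtain \<alpha> where \<alpha>: "x \<alpha> \<noteq> 0" by (auto simp: fun_eq_iff)
  have "x \<in> (\<Union>b\<in>{0<..}. ell_sup \<Lambda> (w 1 b))"
    using x(1) unfolding topspace_Bsp by (rule INT_D) simp
  then obtain b where "x \<in> ell_sup \<Lambda> (w 1 b)" by blast
  then have \<alpha>\<Lambda>: "\<alpha> \<in> \<Lambda>" using ell_sup_seqs \<alpha> by (auto simp: seqs_def)
  then obtain a where a: "0 < a" "\<forall>b>0. 0 < w a b \<alpha>" using pos_a by blast
  have "lim_seminorm (\<lambda>b. sup_top \<Lambda> (w a b)) (\<lambda>c. norm (c \<alpha>))"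
    unfolding lim_seminorm_def using a(2) \<alpha>\<Lambda>
    by (intro conjI seminorm_coordinate allI impI continuous_coordinate_sup) auto
  then have "continuous_map Bsp euclideanreal (\<lambda>c. norm (c \<alpha>))"
    by (intro lc_member_continuous[OF lc_Bsp] UN_I[of a]) (use a in auto)
  then show "\<exists>q. seminorm_on (topspace Bsp) q \<and> continuous_map Bsp euclideanreal q \<and> 0 < q x"
    using \<alpha> seminorm_coordinate by (intro exI[of _ "\<lambda>c. norm (c \<alpha>)"]) simp
qed

lemma Hausdorff_Csp: "Hausdorff_space Csp"
proof (rule lc_Hausdorff[OF lc_Csp])
  fix x assume x: "x \<in> topspace Csp" "x \<noteq> 0"
  then obtain \<alpha> where \<alpha>: "x \<alpha> \<noteq> 0" by (auto simp: fun_eq_iff)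
  obtain b where "x \<in> (\<Inter>a\<in>{0<..}. ell_sup \<Lambda> (w a b))"
    using x(1) unfolding topspace_Csp by blast
  then have "x \<in> ell_sup \<Lambda> (w 1 b)" by (rule INT_D) simp
  then have \<alpha>\<Lambda>: "\<alpha> \<in> \<Lambda>" using ell_sup_seqs \<alpha> by (auto simp: seqs_def)
  then obtain a where a: "0 < a" "\<forall>b>0. 0 < w a b \<alpha>" using pos_a by blast
  have "continuous_map (Xb b) euclideanreal (\<lambda>c. norm (c \<alpha>))" if "0 < b" for b
    using continuous_map_compose[OF Xb_in[OF a(1), of b] continuous_coordinate_sup[OF \<alpha>\<Lambda>]] a(2) that
    by (simp add: o_def)
  then have "lim_seminorm Xb (\<lambda>c. norm (c \<alpha>))"
    unfolding lim_seminorm_def by (intro conjI seminorm_coordinate) auto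
  then have "continuous_map Csp euclideanreal (\<lambda>c. norm (c \<alpha>))"
    by (intro lc_member_continuous[OF lc_Csp]) auto
  then show "\<exists>q. seminorm_on (topspace Csp) q \<and> continuous_map Csp euclideanreal q \<and> 0 < q x"
    using \<alpha> seminorm_coordinate by (intro exI[of _ "\<lambda>c. norm (c \<alpha>)"]) simp
qed

lemma ell0_subset_Xb:
  assumes "c \<in> ell0 \<Lambda>"
  shows "\<exists>b>0. c \<in> topspace (Xb b)"
proof -
  define F where "F = {\<alpha>. c \<alpha> \<noteq> 0}"
  have F: "finite F" "F \<subseteq> \<Lambda>" and cs: "c \<in> seqs \<Lambda>"
    using assms by (auto simp: ell0_def seqs_def F_def)
  have "\<exists>b. \<forall>\<alpha>\<in>\<Lambda>. 0 < b \<alpha> \<and> (\<forall>a>0. w a (b \<alpha>) \<alpha> < top)"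
    using finite_b by (intro bchoice) auto
  then obtain b where b: "\<And>\<alpha>. \<alpha> \<in> \<Lambda> \<Longrightarrow> 0 < b \<alpha>" "\<And>\<alpha> a. \<alpha> \<in> \<Lambda> \<Longrightarrow> 0 < a \<Longrightarrow> w a (b \<alpha>) \<alpha> < top"
    by blast
  \<comment> \<open>By \<open>finite_b\<close> each index of the support has a \<open>b\<close> that
    works for all \<open>a\<close>; the largest one serves the whole support, as weights decrease in
    \<open>b\<close>. The 1 covers the empty support.\<close>
  define b' where "b' = Max (insert 1 (b ` F))"
  have "1 \<le> b'" unfolding b'_def using F(1) by (intro Max_ge) auto
  then have b': "0 < b'" by simp
  have b'F: "b \<alpha> \<le> b'" if "\<alpha> \<in> F" for \<alpha>
    unfolding b'_def using F(1) that by (intro Max_ge) auto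
  have "c \<in> ell_sup \<Lambda> (w a b')" if a: "0 < a" for a
  proof -
    define m where "m = (\<Sum>\<alpha>\<in>F. ennreal (norm (c \<alpha>)) * w a b' \<alpha>)"
    have "ennreal (norm (c \<alpha>)) * w a b' \<alpha> < top" if "\<alpha> \<in> F" for \<alpha>
    proof -
      have "\<alpha> \<in> \<Lambda>" using that F by auto
      then have "w a b' \<alpha> < top"
        using mono_b[OF b(1) b'F[OF that] a] b(2) a by (blast intro: order.strict_trans1)
      then show ?thesis by (simp add: ennreal_mult_less_top)
    qed
    then have m: "m < top" unfolding m_def using F(1) by simp
    have "ennreal (norm (c \<alpha>)) * w a b' \<alpha> \<le> ennreal (enn2real m)" for \<alpha>
    proof (cases "\<alpha> \<in> F")
      case True
      then have "ennreal (norm (c \<alpha>)) * w a b' \<alpha> \<le> m"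
        unfolding m_def using F(1) by (intro member_le_sum) auto
      then show ?thesis using m by simp
    qed (simp add: F_def)
    then show ?thesis by (intro ell_supI[OF cs])
  qed
  then show ?thesis using b' by (intro exI[of _ b']) (simp add: topspace_Xb)
qed

lemma ell0_subset: "ell0 \<Lambda> \<subseteq> topspace Bsp" "ell0 \<Lambda> \<subseteq> topspace Csp"
proof -
  have "c \<in> topspace Bsp \<and> c \<in> topspace Csp" if c: "c \<in> ell0 \<Lambda>" for c
  proof -
    obtain b where "0 < b" "c \<in> topspace (Xb b)" using ell0_subset_Xb[OF c] by blast
    then show ?thesis by (auto simp: topspace_Bsp topspace_Csp topspace_Xb)
  qed
  then show "ell0 \<Lambda> \<subseteq> topspace Bsp" "ell0 \<Lambda> \<subseteq> topspace Csp" by auto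
qed

end

section \<open>Density of the finitely supported sequences\<close>

text \<open>In \<open>gain\<close> the shift \<open>\<phi>\<close> depends on \<open>b\<close> alone
  and \<open>\<psi>\<close> on \<open>a\<close> alone. This lets the comparison pass through a
  nested limit in either order: for \<open>Bsp\<close> the index \<open>\<psi> a\<close> is fixed
  before \<open>b\<close> is known, for \<open>Csp\<close> the index \<open>\<phi> b\<close> before
  \<open>a\<close> is known.\<close>

locale graded_weights = weights +
  fixes deg :: "'a \<Rightarrow> nat"
  assumes summable_deg: "(\<lambda>\<alpha>. (1 / 2 :: real) ^ deg \<alpha>) summable_on \<Lambda>"
    and finite_deg: "finite {\<alpha> \<in> \<Lambda>. deg \<alpha> \<le> n}"
    and gain: "1 \<le> R \<Longrightarrow> \<exists>\<phi> \<psi> :: real \<Rightarrow> real. \<forall>a>0. \<forall>b>0. 0 < \<phi> b \<and> 0 < \<psi> a \<and>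
      (\<exists>M. \<forall>\<alpha>\<in>\<Lambda>. ennreal (R ^ deg \<alpha>) * w a (\<phi> b) \<alpha> \<le> ennreal M * w (\<psi> a) b \<alpha>)"
begin

lemma gain':
  assumes R: "1 \<le> R"
  shows "\<exists>\<phi> \<psi> :: real \<Rightarrow> real. (\<forall>b>0. 0 < \<phi> b) \<and> (\<forall>a>0. 0 < \<psi> a) \<and>
    (\<forall>a>0. \<forall>b>0. \<exists>M\<ge>0. \<forall>\<alpha>\<in>\<Lambda>. w a (\<phi> b) \<alpha> \<le> ennreal (M * (1 / R) ^ deg \<alpha>) * w (\<psi> a) b \<alpha>)"
proof -
  obtain \<phi> \<psi> :: "real \<Rightarrow> real" where g: "\<forall>a>0. \<forall>b>0. 0 < \<phi> b \<and> 0 < \<psi> a \<and>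
      (\<exists>M. \<forall>\<alpha>\<in>\<Lambda>. ennreal (R ^ deg \<alpha>) * w a (\<phi> b) \<alpha> \<le> ennreal M * w (\<psi> a) b \<alpha>)"
    using gain[OF R] by blast
  have "\<exists>M\<ge>0. \<forall>\<alpha>\<in>\<Lambda>. w a (\<phi> b) \<alpha> \<le> ennreal (M * (1 / R) ^ deg \<alpha>) * w (\<psi> a) b \<alpha>"
    if ab: "0 < a" "0 < b" for a b
  proof -
    obtain M where M: "\<forall>\<alpha>\<in>\<Lambda>. ennreal (R ^ deg \<alpha>) * w a (\<phi> b) \<alpha> \<le> ennreal M * w (\<psi> a) b \<alpha>"
      using g ab by blast
    have "w a (\<phi> b) \<alpha> \<le> ennreal (max 0 M * (1 / R) ^ deg \<alpha>) * w (\<psi> a) b \<alpha>" if \<alpha>: "\<alpha> \<in> \<Lambda>" for \<alpha>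
    proof -
      have "w a (\<phi> b) \<alpha> = ennreal ((1 / R) ^ deg \<alpha> * R ^ deg \<alpha>) * w a (\<phi> b) \<alpha>"
        using R by (simp add: power_divide)
      also have "\<dots> = ennreal ((1 / R) ^ deg \<alpha>) * (ennreal (R ^ deg \<alpha>) * w a (\<phi> b) \<alpha>)"
        using R by (simp add: ennreal_mult mult.assoc)
      also have "\<dots> \<le> ennreal ((1 / R) ^ deg \<alpha>) * (ennreal M * w (\<psi> a) b \<alpha>)"
        using M \<alpha> by (intro mult_left_mono) auto
      also have "\<dots> \<le> ennreal ((1 / R) ^ deg \<alpha>) * (ennreal (max 0 M) * w (\<psi> a) b \<alpha>)"
        by (intro mult_left_mono mult_right_mono ennreal_leI) auto
      also have "\<dots> = ennreal (max 0 M * (1 / R) ^ deg \<alpha>) * w (\<psi> a) b \<alpha>"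
        using R by (simp add: ennreal_mult ac_simps)
      finally show ?thesis .
    qed
    then show ?thesis by (intro exI[of _ "max 0 M"]) auto
  qed
  moreover have "0 < \<phi> b" if "0 < b" for b using g that zero_less_one by blast
  moreover have "0 < \<psi> a" if "0 < a" for a using g that zero_less_one by blast
  ultimately show ?thesis by - (rule exI[of _ \<phi>], rule exI[of _ \<psi>], simp)
qed

definition trunc :: "nat \<Rightarrow> ('a \<Rightarrow> complex) \<Rightarrow> ('a \<Rightarrow> complex)" where
  "trunc n c = (\<lambda>\<alpha>. if \<alpha> \<in> \<Lambda> \<and> deg \<alpha> \<le> n then c \<alpha> else 0)"

lemma trunc_ell0: "trunc n c \<in> ell0 \<Lambda>"
  unfolding ell0_def
proof (intro CollectI conjI)
  show "trunc n c \<in> seqs \<Lambda>" by (simp add: seqs_def trunc_def)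
  show "finite {\<alpha>. trunc n c \<alpha> \<noteq> 0}"
    by (rule finite_subset[OF _ finite_deg[of n]]) (auto simp: trunc_def)
qed

text \<open>Only indices of degree above \<open>n\<close> contribute, and there the decay
  \<open>(1 / 2) ^ deg \<alpha>\<close> is at most \<open>(1 / 2) ^ n\<close>.\<close>

lemma trunc_error:
  assumes c: "c \<in> ell_sup \<Lambda> v'" and M: "0 \<le> M"
    and le: "\<And>\<alpha>. \<alpha> \<in> \<Lambda> \<Longrightarrow> v \<alpha> \<le> ennreal (M * (1 / 2) ^ deg \<alpha>) * v' \<alpha>"
  shows "trunc n c - c \<in> ell_sup \<Lambda> v" "nrm \<Lambda> v (trunc n c - c) \<le> M * (1 / 2) ^ n * nrm \<Lambda> v' c"
proof -
  have *: "ennreal (norm ((trunc n c - c) \<alpha>)) * v \<alpha> \<le> ennreal (M * (1 / 2) ^ n * nrm \<Lambda> v' c)"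
    if \<alpha>: "\<alpha> \<in> \<Lambda>" for \<alpha>
  proof (cases "deg \<alpha> \<le> n")
    case False
    then have "ennreal (norm ((trunc n c - c) \<alpha>)) * v \<alpha> = ennreal (norm (c \<alpha>)) * v \<alpha>"
      by (simp add: trunc_def)
    also have "\<dots> \<le> ennreal (norm (c \<alpha>)) * (ennreal (M * (1 / 2) ^ deg \<alpha>) * v' \<alpha>)"
      by (intro mult_left_mono le \<alpha>) simp
    also have "\<dots> = ennreal (M * (1 / 2) ^ deg \<alpha>) * (ennreal (norm (c \<alpha>)) * v' \<alpha>)"
      by (simp add: ac_simps)
    also have "\<dots> \<le> ennreal (M * (1 / 2) ^ n) * ennreal (nrm \<Lambda> v' c)"
      using False M by (intro mult_mono ennreal_leI mult_left_mono nrm_bound[OF c \<alpha>] power_decreasing) auto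
    also have "\<dots> = ennreal (M * (1 / 2) ^ n * nrm \<Lambda> v' c)"
      using M by (simp add: ennreal_mult nrm_nonneg)
    finally show ?thesis .
  qed (simp add: trunc_def \<alpha>)
  have s: "trunc n c - c \<in> seqs \<Lambda>" using ell_sup_seqs[OF c] by (simp add: seqs_def trunc_def)
  show "trunc n c - c \<in> ell_sup \<Lambda> v" by (rule ell_supI[OF s *])
  show "nrm \<Lambda> v (trunc n c - c) \<le> M * (1 / 2) ^ n * nrm \<Lambda> v' c"
    by (rule nrm_le[OF _ *]) (use M in \<open>simp_all add: nrm_nonneg\<close>)
qed

lemma ex_half_power_less: "\<exists>n. K * (1 / 2 :: real) ^ n < 1"
proof -
  have "(\<lambda>n. K * (1 / 2 :: real) ^ n) \<longlonglongrightarrow> K * 0"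
    by (intro tendsto_mult_left LIMSEQ_power_zero) simp
  then have "\<forall>\<^sub>F n in sequentially. K * (1 / 2 :: real) ^ n < 1" by (intro order_tendstoD(2)) auto
  then show ?thesis by (auto simp: eventually_sequentially)
qed

text \<open>The convergence of the truncations is measured not in the step from which
  \<open>c\<close> is taken but in the step \<open>w a (\<phi> b)\<close>. It is a step of
  \<open>Ya a\<close>, so the given seminorm is bounded there by a multiple of the norm.\<close>

lemma dense_Bsp: "topspace Bsp \<subseteq> Bsp closure_of ell0 \<Lambda>"
proof (rule lc_dense[OF lc_Bsp ell0_subset(1)])
  fix c q assume c: "c \<in> topspace Bsp"
    and "q \<in> (\<Union>a\<in>{0<..}. {q. lim_seminorm (\<lambda>b. sup_top \<Lambda> (w a b)) q})"
  then obtain a where a: "0 < a" "lim_seminorm (\<lambda>b. sup_top \<Lambda> (w a b)) q" by auto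
  \<comment> \<open>The numeral \<open>num.Bit0 num.One\<close> is 2, so the gain is used for
    \<open>R = 2\<close>.\<close>
  obtain \<phi> \<psi> :: "real \<Rightarrow> real" where G: "(\<forall>b>0. 0 < \<phi> b) \<and> (\<forall>a>0. 0 < \<psi> a) \<and>
    (\<forall>a>0. \<forall>b>0. \<exists>M\<ge>0. \<forall>\<alpha>\<in>\<Lambda>. w a (\<phi> b) \<alpha> \<le> ennreal (M * (1 / 2) ^ deg \<alpha>) * w (\<psi> a) b \<alpha>)"
    using gain'[OF one_le_numeral, of "num.Bit0 num.One"] by (elim exE)
  note \<phi> = G[THEN conjunct1, rule_format] G[THEN conjunct2, THEN conjunct1, rule_format]
    and g = G[THEN conjunct2, THEN conjunct2, rule_format]
  obtain b where b: "0 < b" "c \<in> ell_sup \<Lambda> (w (\<psi> a) b)" using c \<phi>(2)[OF a(1)] by (auto simp: topspace_Bsp)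
  obtain M where M: "0 \<le> M" "\<forall>\<alpha>\<in>\<Lambda>. w a (\<phi> b) \<alpha> \<le> ennreal (M * (1 / 2) ^ deg \<alpha>) * w (\<psi> a) b \<alpha>"
    using g[OF a(1) b(1)] by blast
  obtain K where K: "0 < K" "\<forall>c\<in>ell_sup \<Lambda> (w a (\<phi> b)). q c \<le> K * nrm \<Lambda> (w a (\<phi> b)) c"
    using sup_top_dominated lim_seminorm_restrict[OF a(2) \<phi>(1)[OF b(1)]] by (metis topspace_ell_top)
  obtain n where n: "K * M * nrm \<Lambda> (w (\<psi> a) b) c * (1 / 2) ^ n < 1" using ex_half_power_less by blast
  have "q (trunc n c - c) \<le> K * nrm \<Lambda> (w a (\<phi> b)) (trunc n c - c)"
    using K(2) trunc_error(1)[OF b(2) M(1) bspec[OF M(2)]] by blast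
  also have "\<dots> \<le> K * (M * (1 / 2) ^ n * nrm \<Lambda> (w (\<psi> a) b) c)"
    using K(1) trunc_error(2)[OF b(2) M(1) bspec[OF M(2)]] by (intro mult_left_mono) auto
  also have "\<dots> < 1" using n by (simp add: ac_simps)
  finally show "\<exists>c'\<in>ell0 \<Lambda>. q (c' - c) < 1" using trunc_ell0 by blast
qed

lemma dense_Csp: "topspace Csp \<subseteq> Csp closure_of ell0 \<Lambda>"
proof (rule lc_dense[OF lc_Csp ell0_subset(2)])
  fix c q assume c: "c \<in> topspace Csp" and "q \<in> {q. lim_seminorm Xb q}"
  then have q: "lim_seminorm Xb q" by simp
  obtain \<phi> \<psi> :: "real \<Rightarrow> real" where G: "(\<forall>b>0. 0 < \<phi> b) \<and> (\<forall>a>0. 0 < \<psi> a) \<and>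
    (\<forall>a>0. \<forall>b>0. \<exists>M\<ge>0. \<forall>\<alpha>\<in>\<Lambda>. w a (\<phi> b) \<alpha> \<le> ennreal (M * (1 / 2) ^ deg \<alpha>) * w (\<psi> a) b \<alpha>)"
    using gain'[OF one_le_numeral, of "num.Bit0 num.One"] by (elim exE)
  note \<phi> = G[THEN conjunct1, rule_format] G[THEN conjunct2, THEN conjunct1, rule_format]
    and g = G[THEN conjunct2, THEN conjunct2, rule_format]
  obtain b where b: "0 < b" "\<And>a. 0 < a \<Longrightarrow> c \<in> ell_sup \<Lambda> (w a b)" using c by (auto simp: topspace_Csp)
  \<comment> \<open>The error has to lie in all steps of one \<open>Xb\<close>; this works because
    \<open>\<phi> b\<close> is the same for all \<open>a\<close>.\<close>
  have d: "trunc n c - c \<in> topspace (Xb (\<phi> b))" for n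
    unfolding topspace_Xb
  proof (intro INT_I)
    fix a :: real assume "a \<in> {0<..}"
    then have a: "0 < a" by simp
    obtain M where M: "0 \<le> M" "\<forall>\<alpha>\<in>\<Lambda>. w a (\<phi> b) \<alpha> \<le> ennreal (M * (1 / 2) ^ deg \<alpha>) * w (\<psi> a) b \<alpha>"
      using g[OF a b(1)] by blast
    show "trunc n c - c \<in> ell_sup \<Lambda> (w a (\<phi> b))"
      by (rule trunc_error(1)[OF b(2)[OF \<phi>(2)[OF a]] M(1) bspec[OF M(2)]])
  qed
  obtain a K where K: "0 < a" "0 < K" "\<forall>c\<in>topspace (Xb (\<phi> b)). q c \<le> K * nrm \<Lambda> (w a (\<phi> b)) c"
    using Xb_dominated[OF \<phi>(1)[OF b(1)] lim_seminorm_restrict[OF q \<phi>(1)[OF b(1)]]] by blast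
  obtain M where M: "0 \<le> M" "\<forall>\<alpha>\<in>\<Lambda>. w a (\<phi> b) \<alpha> \<le> ennreal (M * (1 / 2) ^ deg \<alpha>) * w (\<psi> a) b \<alpha>"
    using g[OF K(1) b(1)] by blast
  obtain n where n: "K * M * nrm \<Lambda> (w (\<psi> a) b) c * (1 / 2) ^ n < 1" using ex_half_power_less by blast
  have "q (trunc n c - c) \<le> K * nrm \<Lambda> (w a (\<phi> b)) (trunc n c - c)" using K(3) d by blast
  also have "\<dots> \<le> K * (M * (1 / 2) ^ n * nrm \<Lambda> (w (\<psi> a) b) c)"
    using K(2) trunc_error(2)[OF b(2)[OF \<phi>(2)[OF K(1)]] M(1) bspec[OF M(2)]] by (intro mult_left_mono) auto
  also have "\<dots> < 1" using n by (simp add: ac_simps)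
  finally show "\<exists>c'\<in>ell0 \<Lambda>. q (c' - c) < 1" using trunc_ell0 by blast
qed

end

section \<open>Independence of the exponent\<close>

lemma epowr_mono: "x \<le> y \<Longrightarrow> 0 \<le> a \<Longrightarrow> epowr x a \<le> epowr y a"
  unfolding epowr_def
  by (auto simp: top_unique less_top intro!: ennreal_leI powr_mono2 enn2real_mono)

lemma epowr_ennreal: "0 \<le> x \<Longrightarrow> epowr (ennreal x) a = ennreal (x powr a)"
  by (simp add: epowr_def)

lemma epowr_inverse: "0 < a \<Longrightarrow> epowr (epowr x a) (1 / a) = x"
  by (cases x) (auto simp: epowr_def powr_powr)

lemma ell_top_inclusion:
  assumes M: "0 \<le> M" and le: "\<And>c. c \<in> seqs \<Lambda> \<Longrightarrow> wnorm p' \<Lambda> w' c \<le> ennreal M * wnorm p \<Lambda> w c"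
  shows "continuous_map (ell_top p \<Lambda> w) (ell_top p' \<Lambda> w') id"
  unfolding continuous_map_def
proof (intro conjI allI impI)
  have sub: "c \<in> ell_w p' \<Lambda> w'" if "c \<in> ell_w p \<Lambda> w" for c
  proof -
    have "ennreal M * wnorm p \<Lambda> w c < top" using that by (simp add: ell_w_def ennreal_mult_less_top)
    then show ?thesis using le[of c] that by (auto simp: ell_w_def intro: order.strict_trans1)
  qed
  show "id \<in> topspace (ell_top p \<Lambda> w) \<rightarrow> topspace (ell_top p' \<Lambda> w')" using sub by auto
  fix U assume U: "openin (ell_top p' \<Lambda> w') U"
  show "openin (ell_top p \<Lambda> w) {x \<in> topspace (ell_top p \<Lambda> w). id x \<in> U}"
    unfolding openin_ell_top
  proof (intro conjI ballI)
    fix c assume c: "c \<in> {x \<in> topspace (ell_top p \<Lambda> w). id x \<in> U}"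
    then obtain \<epsilon> where \<epsilon>: "0 < \<epsilon>" "\<forall>c'\<in>ell_w p' \<Lambda> w'. wnorm p' \<Lambda> w' (c' - c) < ennreal \<epsilon> \<longrightarrow> c' \<in> U"
      using U unfolding openin_ell_top by auto
    \<comment> \<open>The summand 1 covers \<open>M = 0\<close>.\<close>
    define \<delta> where "\<delta> = \<epsilon> / (M + 1)"
    have \<delta>: "0 < \<delta>" "M * \<delta> < \<epsilon>" using M \<epsilon>(1) by (auto simp: \<delta>_def field_simps)
    have "c' \<in> U" if c': "c' \<in> ell_w p \<Lambda> w" "wnorm p \<Lambda> w (c' - c) < ennreal \<delta>" for c'
    proof -
      have "c' - c \<in> seqs \<Lambda>" using c c' by (simp add: ell_w_def seqs_def)
      then have "wnorm p' \<Lambda> w' (c' - c) \<le> ennreal M * wnorm p \<Lambda> w (c' - c)" by (rule le)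
      also have "\<dots> \<le> ennreal M * ennreal \<delta>" using c'(2) by (intro mult_left_mono) auto
      also have "\<dots> < ennreal \<epsilon>" using M \<delta> \<epsilon>(1) by (simp add: ennreal_mult[symmetric] ennreal_less_iff)
      finally show ?thesis using \<epsilon>(2) sub[OF c'(1)] by blast
    qed
    then show "\<exists>\<epsilon>>0. \<forall>c'\<in>ell_w p \<Lambda> w. wnorm p \<Lambda> w (c' - c) < ennreal \<epsilon> \<longrightarrow>
        c' \<in> {x \<in> topspace (ell_top p \<Lambda> w). id x \<in> U}"
      using \<delta>(1) by (intro exI[of _ \<delta>]) auto
  qed auto
qed

lemma wnorm_sup_le_wnorm:
  assumes p: "0 < p" shows "wnorm top \<Lambda> w c \<le> wnorm p \<Lambda> w c"
proof (cases "p = top")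
  case False
  define r where "r = enn2real p"
  have r: "0 < r" using p False by (simp add: r_def enn2real_positive_iff less_top)
  show ?thesis
    unfolding wnorm_sup
  proof (rule SUP_least)
    fix \<alpha> assume \<alpha>: "\<alpha> \<in> \<Lambda>"
    let ?f = "\<lambda>\<alpha>. ennreal (norm (c \<alpha>)) * w \<alpha>"
    have "epowr (?f \<alpha>) r \<le> (\<Sum>\<^sub>\<infinity>\<alpha>\<in>\<Lambda>. epowr (?f \<alpha>) r)"
    proof -
      have "(\<Sum>\<^sub>\<infinity>\<alpha>\<in>{\<alpha>}. epowr (?f \<alpha>) r) \<le> (\<Sum>\<^sub>\<infinity>\<alpha>\<in>\<Lambda>. epowr (?f \<alpha>) r)"
        using \<alpha> by (intro infsum_mono_neutral nonneg_summable_on_complete) auto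
      then show ?thesis by simp
    qed
    then have "epowr (epowr (?f \<alpha>) r) (1 / r) \<le> epowr (\<Sum>\<^sub>\<infinity>\<alpha>\<in>\<Lambda>. epowr (?f \<alpha>) r) (1 / r)"
      using r by (intro epowr_mono) auto
    then show "?f \<alpha> \<le> wnorm p \<Lambda> w c"
      using False r by (simp add: wnorm_def lp_norm_def r_def[symmetric] epowr_inverse)
  qed
qed simp

text \<open>Each weighted term is at most \<open>g \<alpha>\<close> times the supremum norm, and
  \<open>g\<close> has a finite \<open>p\<close>-norm.\<close>

lemma wnorm_le_wnorm_sup:
  fixes g :: "'i \<Rightarrow> real"
  assumes p: "0 < p" "p \<noteq> top" and g: "\<And>\<alpha>. \<alpha> \<in> \<Lambda> \<Longrightarrow> 0 \<le> g \<alpha>"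
    and sum: "(\<lambda>\<alpha>. g \<alpha> powr enn2real p) summable_on \<Lambda>"
    and le: "\<And>\<alpha>. \<alpha> \<in> \<Lambda> \<Longrightarrow> w \<alpha> \<le> ennreal (g \<alpha>) * w' \<alpha>"
  shows "\<exists>M\<ge>0. \<forall>c. wnorm p \<Lambda> w c \<le> ennreal M * wnorm top \<Lambda> w' c"
proof -
  define r where "r = enn2real p"
  have r: "0 < r" using p by (simp add: r_def enn2real_positive_iff less_top)
  \<comment> \<open>With \<open>1 \<le> S\<close> the constant is positive, so the right side is
    infinite whenever the supremum norm is.\<close>
  define S where "S = 1 + (\<Sum>\<^sub>\<infinity>\<alpha>\<in>\<Lambda>. g \<alpha> powr r)"
  have S: "1 \<le> S" unfolding S_def by (simp add: infsum_nonneg)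
  have "wnorm p \<Lambda> w c \<le> ennreal (S powr (1 / r)) * wnorm top \<Lambda> w' c" for c
  proof (cases "wnorm top \<Lambda> w' c")
    case top
    then show ?thesis using S by (simp add: ennreal_mult_top)
  next
    case (real N)
    let ?f = "\<lambda>\<alpha>. ennreal (norm (c \<alpha>)) * w \<alpha>"
    have f: "?f \<alpha> \<le> ennreal (g \<alpha> * N)" if \<alpha>: "\<alpha> \<in> \<Lambda>" for \<alpha>
    proof -
      have "?f \<alpha> \<le> ennreal (norm (c \<alpha>)) * (ennreal (g \<alpha>) * w' \<alpha>)" by (intro mult_left_mono le \<alpha>) simp
      also have "\<dots> = ennreal (g \<alpha>) * (ennreal (norm (c \<alpha>)) * w' \<alpha>)" by (simp add: ac_simps)
      also have "\<dots> \<le> ennreal (g \<alpha>) * ennreal N"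
        unfolding real(2)[symmetric] wnorm_sup by (intro mult_left_mono SUP_upper \<alpha>) simp
      finally show ?thesis using g[OF \<alpha>] real(1) by (simp add: ennreal_mult)
    qed
    have e: "epowr (?f \<alpha>) r \<le> ennreal (g \<alpha> powr r * N powr r)" if \<alpha>: "\<alpha> \<in> \<Lambda>" for \<alpha>
    proof -
      have "epowr (?f \<alpha>) r \<le> epowr (ennreal (g \<alpha> * N)) r" using f[OF \<alpha>] r by (intro epowr_mono) auto
      then show ?thesis using g[OF \<alpha>] real(1) by (simp add: epowr_def powr_mult)
    qed
    have "(\<Sum>\<^sub>\<infinity>\<alpha>\<in>\<Lambda>. epowr (?f \<alpha>) r) \<le> ennreal (S * N powr r)"
    proof (rule infsum_le_finite_sums)
      fix F assume F: "finite F" "F \<subseteq> \<Lambda>"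
      have "(\<Sum>\<alpha>\<in>F. epowr (?f \<alpha>) r) \<le> (\<Sum>\<alpha>\<in>F. ennreal (g \<alpha> powr r * N powr r))"
        using F e by (intro sum_mono) auto
      also have "\<dots> = ennreal ((\<Sum>\<alpha>\<in>F. g \<alpha> powr r) * N powr r)"
        by (simp add: sum_distrib_right)
      also have "\<dots> \<le> ennreal (S * N powr r)"
        using finite_sum_le_infsum[OF sum F] unfolding S_def r_def
        by (intro ennreal_leI mult_right_mono) auto
      finally show "(\<Sum>\<alpha>\<in>F. epowr (?f \<alpha>) r) \<le> ennreal (S * N powr r)" .
    qed (rule nonneg_summable_on_complete, simp)
    then have "wnorm p \<Lambda> w c \<le> epowr (ennreal (S * N powr r)) (1 / r)"
      using p(2) r unfolding wnorm_def lp_norm_def r_def[symmetric] by (simp add: epowr_mono)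
    also have "\<dots> = ennreal ((S * N powr r) powr (1 / r))"
      using S by (intro epowr_ennreal) simp
    also have "\<dots> = ennreal (S powr (1 / r)) * ennreal N"
      using S r real(1) by (simp add: epowr_ennreal powr_mult powr_powr ennreal_mult)
    finally show ?thesis using real by simp
  qed
  then show ?thesis by (intro exI[of _ "S powr (1 / r)"]) auto
qed

lemma sup_inclusion: "0 < p \<Longrightarrow> continuous_map (ell_top p \<Lambda> w) (sup_top \<Lambda> w) id"
  by (rule ell_top_inclusion[of 1]) (simp_all add: wnorm_sup_le_wnorm)

context graded_weights
begin

lemma lp_inclusion:
  assumes p: "0 < p"
  shows "\<exists>\<phi> \<psi> :: real \<Rightarrow> real. (\<forall>b>0. 0 < \<phi> b) \<and> (\<forall>a>0. 0 < \<psi> a) \<and>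
    (\<forall>a>0. \<forall>b>0. continuous_map (sup_top \<Lambda> (w (\<psi> a) b)) (ell_top p \<Lambda> (w a (\<phi> b))) id)"
proof (cases "p = top")
  case True
  then show ?thesis by (intro exI[of _ "\<lambda>b. b"]) simp
next
  case False
  define r where "r = enn2real p"
  have r: "0 < r" using p False by (simp add: r_def enn2real_positive_iff less_top)
  \<comment> \<open>Chosen so that the \<open>r\<close>-th power of
    \<open>(1 / R) ^ deg \<alpha>\<close> is the summable
    \<open>(1 / 2) ^ deg \<alpha>\<close>.\<close>
  define R where "R = 2 powr (1 / r)"
  have R: "1 \<le> R" using r by (simp add: R_def ge_one_powr_ge_zero)
  obtain \<phi> \<psi> :: "real \<Rightarrow> real" where G: "(\<forall>b>0. 0 < \<phi> b) \<and> (\<forall>a>0. 0 < \<psi> a) \<and>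
    (\<forall>a>0. \<forall>b>0. \<exists>M\<ge>0. \<forall>\<alpha>\<in>\<Lambda>. w a (\<phi> b) \<alpha> \<le> ennreal (M * (1 / R) ^ deg \<alpha>) * w (\<psi> a) b \<alpha>)"
    using gain'[OF R] by (elim exE)
  note \<phi> = G[THEN conjunct1, rule_format] G[THEN conjunct2, THEN conjunct1, rule_format]
    and g = G[THEN conjunct2, THEN conjunct2, rule_format]
  show ?thesis
  proof (rule exI[of _ \<phi>], rule exI[of _ \<psi>], intro conjI allI impI \<phi>)
    fix a b :: real assume "0 < a" "0 < b"
    then obtain M where M: "0 \<le> M" "\<forall>\<alpha>\<in>\<Lambda>. w a (\<phi> b) \<alpha> \<le> ennreal (M * (1 / R) ^ deg \<alpha>) * w (\<psi> a) b \<alpha>"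
      using g by blast
    have "(M * (1 / R) ^ deg \<alpha>) powr r = M powr r * (1 / 2) ^ deg \<alpha>" for \<alpha>
    proof -
      have "(1 / R) powr r = 1 / 2" using r by (simp add: R_def powr_divide powr_powr)
      moreover have "((1 / R) ^ deg \<alpha>) powr r = ((1 / R) powr r) ^ deg \<alpha>"
        using R by (simp add: powr_realpow[symmetric] powr_powr mult.commute powr_divide)
      ultimately have "((1 / R) ^ deg \<alpha>) powr r = (1 / 2) ^ deg \<alpha>" by (simp only:)
      then show ?thesis using M(1) R by (simp only: powr_mult)
    qed
    then have s: "(\<lambda>\<alpha>. (M * (1 / R) ^ deg \<alpha>) powr enn2real p) summable_on \<Lambda>"
      using summable_on_cmult_right[OF summable_deg, of "M powr r"] by (simp add: r_def)
    obtain K where "0 \<le> K" "\<forall>c. wnorm p \<Lambda> (w a (\<phi> b)) c \<le> ennreal K * wnorm top \<Lambda> (w (\<psi> a) b) c"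
      using wnorm_le_wnorm_sup[OF p False _ s, of "w a (\<phi> b)" "w (\<psi> a) b"] M R by auto
    then show "continuous_map (sup_top \<Lambda> (w (\<psi> a) b)) (ell_top p \<Lambda> (w a (\<phi> b))) id"
      by (intro ell_top_inclusion) auto
  qed
qed

text \<open>The steps for \<open>p\<close> and for \<open>top\<close> are included in each other up
  to a shift of the parameters, and such a shift disappears in the limits.\<close>

lemma Bsp_lp:
  assumes p: "0 < p"
  shows "proj_lim (\<lambda>a. ind_lim (\<lambda>b. ell_top p \<Lambda> (w a b))) = Bsp"
proof -
  obtain \<phi> \<psi> :: "real \<Rightarrow> real" where G: "(\<forall>b>0. 0 < \<phi> b) \<and> (\<forall>a>0. 0 < \<psi> a) \<and>
    (\<forall>a>0. \<forall>b>0. continuous_map (sup_top \<Lambda> (w (\<psi> a) b)) (ell_top p \<Lambda> (w a (\<phi> b))) id)"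
    using lp_inclusion[OF p] by (elim exE)
  note \<phi> = G[THEN conjunct1, rule_format] G[THEN conjunct2, THEN conjunct1, rule_format]
    and c = G[THEN conjunct2, THEN conjunct2, rule_format]
  show ?thesis
    unfolding Bsp_def Ya_def
  proof (rule topology_eq_id)
    show "continuous_map (proj_lim (\<lambda>a. ind_lim (\<lambda>b. ell_top p \<Lambda> (w a b)))) (proj_lim (\<lambda>a. ind_lim (\<lambda>b. sup_top \<Lambda> (w a b)))) id"
      using sup_inclusion[OF p] by (intro proj_lim_mono exI conjI ind_lim_mono)
    show "continuous_map (proj_lim (\<lambda>a. ind_lim (\<lambda>b. sup_top \<Lambda> (w a b)))) (proj_lim (\<lambda>a. ind_lim (\<lambda>b. ell_top p \<Lambda> (w a b)))) id"
    proof (rule proj_lim_mono)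
      fix a :: real assume a: "0 < a"
      have "continuous_map (ind_lim (\<lambda>b. sup_top \<Lambda> (w (\<psi> a) b))) (ind_lim (\<lambda>b. ell_top p \<Lambda> (w a b))) id"
        using \<phi>(1) c[OF a] by (intro ind_lim_mono) blast
      then show "\<exists>a'>0. continuous_map (ind_lim (\<lambda>b. sup_top \<Lambda> (w a' b))) (ind_lim (\<lambda>b. ell_top p \<Lambda> (w a b))) id"
        using \<phi>(2)[OF a] by blast
    qed
  qed
qed

lemma Csp_lp:
  assumes p: "0 < p"
  shows "ind_lim (\<lambda>b. proj_lim (\<lambda>a. ell_top p \<Lambda> (w a b))) = Csp"
proof -
  obtain \<phi> \<psi> :: "real \<Rightarrow> real" where G: "(\<forall>b>0. 0 < \<phi> b) \<and> (\<forall>a>0. 0 < \<psi> a) \<and>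
    (\<forall>a>0. \<forall>b>0. continuous_map (sup_top \<Lambda> (w (\<psi> a) b)) (ell_top p \<Lambda> (w a (\<phi> b))) id)"
    using lp_inclusion[OF p] by (elim exE)
  note \<phi> = G[THEN conjunct1, rule_format] G[THEN conjunct2, THEN conjunct1, rule_format]
    and c = G[THEN conjunct2, THEN conjunct2, rule_format]
  show ?thesis
    unfolding Csp_def Xb_def
  proof (rule topology_eq_id)
    show "continuous_map (ind_lim (\<lambda>b. proj_lim (\<lambda>a. ell_top p \<Lambda> (w a b)))) (ind_lim (\<lambda>b. proj_lim (\<lambda>a. sup_top \<Lambda> (w a b)))) id"
      using sup_inclusion[OF p] by (intro proj_lim_mono exI conjI ind_lim_mono)
    show "continuous_map (ind_lim (\<lambda>b. proj_lim (\<lambda>a. sup_top \<Lambda> (w a b)))) (ind_lim (\<lambda>b. proj_lim (\<lambda>a. ell_top p \<Lambda> (w a b)))) id"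
    proof (rule ind_lim_mono)
      fix b :: real assume b: "0 < b"
      have "continuous_map (proj_lim (\<lambda>a. sup_top \<Lambda> (w a b))) (proj_lim (\<lambda>a. ell_top p \<Lambda> (w a (\<phi> b)))) id"
        using \<phi>(2) c[OF _ b] by (intro proj_lim_mono) blast
      then show "\<exists>b'>0. continuous_map (proj_lim (\<lambda>a. sup_top \<Lambda> (w a b))) (proj_lim (\<lambda>a. ell_top p \<Lambda> (w a b'))) id"
        using \<phi>(1)[OF b] by blast
    qed
  qed
qed

text \<open>\<open>ind_lim_const\<close> asks for a locally convex topology, and steps with
  \<open>p < 1\<close> do not show that their projective limit is one. The constant inductive limit
  is therefore dropped only after the passage to supremum norms.\<close>

lemma proj_lim_lp:
  assumes p: "0 < p" and const: "\<And>a b. w a b = v a"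
  shows "proj_lim (\<lambda>a. ell_top p \<Lambda> (v a)) = Csp"
proof -
  obtain \<phi> \<psi> :: "real \<Rightarrow> real" where G: "(\<forall>b>0. 0 < \<phi> b) \<and> (\<forall>a>0. 0 < \<psi> a) \<and>
    (\<forall>a>0. \<forall>b>0. continuous_map (sup_top \<Lambda> (w (\<psi> a) b)) (ell_top p \<Lambda> (w a (\<phi> b))) id)"
    using lp_inclusion[OF p] by (elim exE)
  note \<phi> = G[THEN conjunct1, rule_format] G[THEN conjunct2, THEN conjunct1, rule_format]
    and c = G[THEN conjunct2, THEN conjunct2, rule_format]
  have "proj_lim (\<lambda>a. ell_top p \<Lambda> (v a)) = proj_lim (\<lambda>a. sup_top \<Lambda> (v a))"
  proof (rule topology_eq_id)
    show "continuous_map (proj_lim (\<lambda>a. ell_top p \<Lambda> (v a))) (proj_lim (\<lambda>a. sup_top \<Lambda> (v a))) id"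
      using sup_inclusion[OF p] by (intro proj_lim_mono exI conjI)
    show "continuous_map (proj_lim (\<lambda>a. sup_top \<Lambda> (v a))) (proj_lim (\<lambda>a. ell_top p \<Lambda> (v a))) id"
      using \<phi>(2) c[OF _ zero_less_one] unfolding const by (intro proj_lim_mono) blast
  qed
  moreover have X: "Xb b = proj_lim (\<lambda>a. sup_top \<Lambda> (v a))" for b
    by (simp only: Xb_def const)
  then have "Csp = ind_lim (\<lambda>_. proj_lim (\<lambda>a. sup_top \<Lambda> (v a)))"
    unfolding Csp_def by (intro arg_cong[of _ _ ind_lim] ext)
  moreover have "\<dots> = proj_lim (\<lambda>a. sup_top \<Lambda> (v a))"
    by (rule ind_lim_const) (use lc_Xb[OF zero_less_one] in \<open>simp only: X\<close>)
  ultimately show ?thesis by simp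
qed

end

section \<open>The bilinear map between weighted spaces\<close>

lemma Lam_add: "\<alpha> \<in> Lam d \<Longrightarrow> \<gamma> \<in> Lam d \<Longrightarrow> \<alpha> + \<gamma> \<in> Lam d"
  by (auto simp: Lam_def multi_def)

lemma mdeg_add: "mdeg n (\<alpha> + \<gamma>) = mdeg n \<alpha> + mdeg n \<gamma>"
  by (simp add: mdeg_def sum.distrib)

lemma mbinom_le: "mbinom n (\<alpha> + \<gamma>) \<gamma> \<le> 2 ^ (mdeg n \<alpha> + mdeg n \<gamma>)"
proof -
  have "mbinom n (\<alpha> + \<gamma>) \<gamma> \<le> (\<Prod>i<n. 2 ^ (\<alpha> i + \<gamma> i))"
    unfolding mbinom_def by (intro prod_mono conjI) (auto simp: binomial_le_pow2)
  also have "\<dots> = 2 ^ (mdeg n \<alpha> + mdeg n \<gamma>)"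
    by (simp add: power_sum[symmetric] mdeg_def sum.distrib)
  finally show ?thesis .
qed

text \<open>The square root is discarded by \<open>sqrt y \<le> y\<close> for
  \<open>1 \<le> y\<close>: any geometric bound will do, since the weights absorb it.\<close>

lemma sqrt_binom2_le: "sqrt (real (binom2 d (\<alpha> + \<gamma>) \<gamma>)) \<le> 2 ^ (deg2 d \<alpha> + deg2 d \<gamma>)"
proof -
  have "binom2 d (\<alpha> + \<gamma>) \<gamma> \<le> 2 ^ (deg2 d \<alpha> + deg2 d \<gamma>)"
    unfolding binom2_def deg2_def fst_add snd_add
    using mult_le_mono[OF mbinom_le[of "fst d" "fst \<alpha>" "fst \<gamma>"] mbinom_le[of "snd d" "snd \<alpha>" "snd \<gamma>"]]
    by (simp add: power_add ac_simps)
  then have 1: "real (binom2 d (\<alpha> + \<gamma>) \<gamma>) \<le> 2 ^ (deg2 d \<alpha> + deg2 d \<gamma>)"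
    by (metis numeral_power_le_of_nat_cancel_iff of_nat_le_iff of_nat_numeral of_nat_power)
  have "sqrt (real (binom2 d (\<alpha> + \<gamma>) \<gamma>)) \<le> sqrt (2 ^ (deg2 d \<alpha> + deg2 d \<gamma>))"
    using 1 by (rule real_sqrt_le_mono)
  also have "\<dots> \<le> 2 ^ (deg2 d \<alpha> + deg2 d \<gamma>)"
  proof -
    have "sqrt y \<le> y" if "1 \<le> y" for y :: real
    proof -
      have "y * 1 \<le> y * y" using that by (intro mult_left_mono) auto
      then have "sqrt y \<le> sqrt (y * y)" by (intro real_sqrt_le_mono) simp
      then show ?thesis using that by simp
    qed
    then show ?thesis by simp
  qed
  finally show ?thesis .
qed

definition bterm :: "nat \<times> nat \<Rightarrow> (midx \<times> midx \<Rightarrow> complex) \<Rightarrow> (midx \<times> midx \<Rightarrow> complex) \<Rightarrow>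
    midx \<times> midx \<Rightarrow> midx \<times> midx \<Rightarrow> complex" where
  "bterm d c\<^sub>1 c\<^sub>2 \<alpha> \<gamma> = of_real (sqrt (real (binom2 d (\<alpha> + \<gamma>) \<gamma>))) * c\<^sub>1 \<gamma> * c\<^sub>2 (\<alpha> + \<gamma>)"

text \<open>\<open>infsum\<close> has the value 0 for a family that is not summable, so additivity
  of \<open>U_diamond\<close> in either variable is derived from this condition.\<close>

definition conv :: "nat \<times> nat \<Rightarrow> (midx \<times> midx \<Rightarrow> complex) \<Rightarrow> (midx \<times> midx \<Rightarrow> complex) \<Rightarrow>
    midx \<times> midx \<Rightarrow> bool" where
  "conv d c\<^sub>1 c\<^sub>2 \<alpha> \<longleftrightarrow> bterm d c\<^sub>1 c\<^sub>2 \<alpha> summable_on Lam d"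

lemma U_diamond_bterm:
  "U_diamond d t c\<^sub>1 c\<^sub>2 \<alpha> = (if \<alpha> \<in> Lam d then t ^ deg2 d \<alpha> * infsum (bterm d c\<^sub>1 c\<^sub>2 \<alpha>) (Lam d) else 0)"
  by (simp add: U_diamond_def bterm_def[abs_def])

lemma U_diamond_add1:
  assumes "\<And>\<alpha>. \<alpha> \<in> Lam d \<Longrightarrow> \<alpha> \<in> D \<Longrightarrow> conv d c\<^sub>1 c\<^sub>2 \<alpha>"
    "\<And>\<alpha>. \<alpha> \<in> Lam d \<Longrightarrow> \<alpha> \<in> D \<Longrightarrow> conv d c\<^sub>1' c\<^sub>2 \<alpha>" and "\<alpha> \<in> D"
  shows "U_diamond d t (c\<^sub>1 + c\<^sub>1') c\<^sub>2 \<alpha> = U_diamond d t c\<^sub>1 c\<^sub>2 \<alpha> + U_diamond d t c\<^sub>1' c\<^sub>2 \<alpha>"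
proof (cases "\<alpha> \<in> Lam d")
  case True
  have "bterm d (c\<^sub>1 + c\<^sub>1') c\<^sub>2 \<alpha> = (\<lambda>\<gamma>. bterm d c\<^sub>1 c\<^sub>2 \<alpha> \<gamma> + bterm d c\<^sub>1' c\<^sub>2 \<alpha> \<gamma>)"
    by (simp add: bterm_def fun_eq_iff algebra_simps)
  then show ?thesis
    using infsum_add[of "bterm d c\<^sub>1 c\<^sub>2 \<alpha>" "Lam d" "bterm d c\<^sub>1' c\<^sub>2 \<alpha>"] assms True
    by (simp add: U_diamond_bterm conv_def algebra_simps)
qed (simp add: U_diamond_bterm)

lemma U_diamond_add2:
  \<comment> \<open>\<open>D\<close> confines the claim to indices where both series converge; on a
    step whose target weights vanish somewhere only such a restricted form is available.\<close>
  assumes "\<And>\<alpha>. \<alpha> \<in> Lam d \<Longrightarrow> \<alpha> \<in> D \<Longrightarrow> conv d c\<^sub>1 c\<^sub>2 \<alpha>"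
    "\<And>\<alpha>. \<alpha> \<in> Lam d \<Longrightarrow> \<alpha> \<in> D \<Longrightarrow> conv d c\<^sub>1 c\<^sub>2' \<alpha>" and "\<alpha> \<in> D"
  shows "U_diamond d t c\<^sub>1 (c\<^sub>2 + c\<^sub>2') \<alpha> = U_diamond d t c\<^sub>1 c\<^sub>2 \<alpha> + U_diamond d t c\<^sub>1 c\<^sub>2' \<alpha>"
proof (cases "\<alpha> \<in> Lam d")
  case True
  have "bterm d c\<^sub>1 (c\<^sub>2 + c\<^sub>2') \<alpha> = (\<lambda>\<gamma>. bterm d c\<^sub>1 c\<^sub>2 \<alpha> \<gamma> + bterm d c\<^sub>1 c\<^sub>2' \<alpha> \<gamma>)"
    by (simp add: bterm_def fun_eq_iff algebra_simps)
  then show ?thesis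
    using infsum_add[of "bterm d c\<^sub>1 c\<^sub>2 \<alpha>" "Lam d" "bterm d c\<^sub>1 c\<^sub>2' \<alpha>"] assms True
    by (simp add: U_diamond_bterm conv_def algebra_simps)
qed (simp add: U_diamond_bterm)

text \<open>In contrast to additivity this holds without convergence, since a nonzero factor
  preserves divergence and with it the default value 0 of \<open>infsum\<close>.\<close>

lemma U_diamond_scale1: "U_diamond d t (\<lambda>\<gamma>. a * c\<^sub>1 \<gamma>) c\<^sub>2 = (\<lambda>\<alpha>. a * U_diamond d t c\<^sub>1 c\<^sub>2 \<alpha>)"
proof -
  have "bterm d (\<lambda>\<gamma>. a * c\<^sub>1 \<gamma>) c\<^sub>2 \<alpha> = (\<lambda>\<gamma>. a * bterm d c\<^sub>1 c\<^sub>2 \<alpha> \<gamma>)" for \<alpha>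
    by (simp add: bterm_def fun_eq_iff)
  then show ?thesis by (intro ext) (simp add: U_diamond_bterm infsum_cmult_right')
qed

lemma U_diamond_scale2: "U_diamond d t c\<^sub>1 (\<lambda>\<gamma>. a * c\<^sub>2 \<gamma>) = (\<lambda>\<alpha>. a * U_diamond d t c\<^sub>1 c\<^sub>2 \<alpha>)"
proof -
  have "bterm d c\<^sub>1 (\<lambda>\<gamma>. a * c\<^sub>2 \<gamma>) \<alpha> = (\<lambda>\<gamma>. a * bterm d c\<^sub>1 c\<^sub>2 \<alpha> \<gamma>)" for \<alpha>
    by (simp add: bterm_def fun_eq_iff)
  then show ?thesis by (intro ext) (simp add: U_diamond_bterm infsum_cmult_right')
qed

lemma U_diamond_seqs: "U_diamond d t c\<^sub>1 c\<^sub>2 \<in> seqs (Lam d)"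
  by (simp add: seqs_def U_diamond_def)

lemma lin_on_U1:
  assumes "\<And>c \<alpha>. c \<in> V \<Longrightarrow> \<alpha> \<in> Lam d \<Longrightarrow> conv d c c\<^sub>2 \<alpha>"
  shows "lin_on V (\<lambda>c. U_diamond d t c c\<^sub>2)"
  unfolding lin_on_def
proof (intro conjI ballI allI U_diamond_scale1 ext)
  fix c c' \<alpha> assume "c \<in> V" "c' \<in> V"
  then show "U_diamond d t (c + c') c\<^sub>2 \<alpha> = (U_diamond d t c c\<^sub>2 + U_diamond d t c' c\<^sub>2) \<alpha>"
    using U_diamond_add1[of d UNIV c c\<^sub>2 c' \<alpha> t] assms by simp
qed

lemma lin_on_U2:
  assumes "\<And>c \<alpha>. c \<in> V \<Longrightarrow> \<alpha> \<in> Lam d \<Longrightarrow> conv d c\<^sub>1 c \<alpha>"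
  shows "lin_on V (U_diamond d t c\<^sub>1)"
  unfolding lin_on_def
proof (intro conjI ballI allI U_diamond_scale2 ext)
  fix c c' \<alpha> assume "c \<in> V" "c' \<in> V"
  then show "U_diamond d t c\<^sub>1 (c + c') \<alpha> = (U_diamond d t c\<^sub>1 c + U_diamond d t c\<^sub>1 c') \<alpha>"
    using U_diamond_add2[of d UNIV c\<^sub>1 c c' \<alpha> t] assms by simp
qed

text \<open>The base \<open>4 * T\<close> is spent as follows: \<open>T\<close> bounds the powers of
  \<open>t\<close>, one factor 2 bounds the binomial coefficient, and the other leaves the decay
  \<open>(1 / 2) ^ deg2 d \<gamma>\<close> that sums the series.\<close>

lemma bterm_estimate:
  fixes M N\<^sub>1 N\<^sub>2 :: real and v x y :: ennreal
  assumes T: "1 \<le> T" and M: "0 \<le> M" "0 \<le> N\<^sub>1" "0 \<le> N\<^sub>2"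
    and c1: "ennreal (norm (c\<^sub>1 \<gamma>)) * x \<le> ennreal N\<^sub>1"
    and c2: "ennreal (norm (c\<^sub>2 (\<alpha> + \<gamma>))) * y \<le> ennreal N\<^sub>2"
    and le: "c\<^sub>1 \<gamma> = 0 \<or> c\<^sub>2 (\<alpha> + \<gamma>) = 0 \<or>
      ennreal ((4 * T) ^ (deg2 d \<alpha> + deg2 d \<gamma>)) * v \<le> ennreal M * (x * y)"
  shows "ennreal (T ^ deg2 d \<alpha> * norm (bterm d c\<^sub>1 c\<^sub>2 \<alpha> \<gamma>)) * v
    \<le> ennreal (M * N\<^sub>1 * N\<^sub>2 * (1 / 2) ^ deg2 d \<gamma>)"
proof (cases "c\<^sub>1 \<gamma> = 0 \<or> c\<^sub>2 (\<alpha> + \<gamma>) = 0")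
  case True
  then show ?thesis by (auto simp: bterm_def)
next
  case False
  define m n where "m = deg2 d \<alpha>" and "n = deg2 d \<gamma>"
  define p q where "p = norm (c\<^sub>1 \<gamma>)" and "q = norm (c\<^sub>2 (\<alpha> + \<gamma>))"
  have pq: "0 \<le> p" "0 \<le> q" by (simp_all add: p_def q_def)
  have "T ^ m * sqrt (real (binom2 d (\<alpha> + \<gamma>) \<gamma>)) \<le> T ^ m * 2 ^ (m + n)"
    using sqrt_binom2_le[of d \<alpha> \<gamma>] T by (intro mult_left_mono) (auto simp: m_def n_def)
  also have "\<dots> \<le> T ^ (m + n) * 2 ^ (m + n)"
    using T by (intro mult_right_mono power_increasing) auto
  also have "\<dots> \<le> (1 / 2) ^ n * (4 * T) ^ (m + n)"
  proof -
    have "(4 * T) ^ (m + n) = T ^ (m + n) * 2 ^ (m + n) * 2 ^ m * 2 ^ n"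
    proof -
      have "(4 * T) ^ (m + n) = (T * 2 * 2) ^ (m + n)" by (simp add: mult.commute)
      also have "\<dots> = T ^ (m + n) * 2 ^ (m + n) * 2 ^ (m + n)" by (simp only: power_mult_distrib)
      also have "\<dots> = T ^ (m + n) * 2 ^ (m + n) * 2 ^ m * 2 ^ n" by (simp only: power_add mult.assoc)
      finally show ?thesis .
    qed
    then have "(1 / 2) ^ n * (4 * T) ^ (m + n) = T ^ (m + n) * 2 ^ (m + n) * 2 ^ m * ((1 / 2) ^ n * 2 ^ n)"
      by (simp only: mult_ac)
    moreover have "(1 / 2 :: real) ^ n * 2 ^ n = 1" by (simp add: power_divide)
    moreover have "T ^ (m + n) * 2 ^ (m + n) \<le> T ^ (m + n) * 2 ^ (m + n) * 2 ^ m"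
      using T by simp
    ultimately show ?thesis by (simp only: mult_1_right)
  qed
  finally have K: "T ^ m * sqrt (real (binom2 d (\<alpha> + \<gamma>) \<gamma>)) \<le> (1 / 2) ^ n * (4 * T) ^ (m + n)" .
  have "T ^ m * norm (bterm d c\<^sub>1 c\<^sub>2 \<alpha> \<gamma>) = (T ^ m * sqrt (real (binom2 d (\<alpha> + \<gamma>) \<gamma>))) * (p * q)"
    by (simp add: bterm_def norm_mult p_def q_def)
  also have "\<dots> \<le> ((1 / 2) ^ n * (4 * T) ^ (m + n)) * (p * q)"
    using K pq by (intro mult_right_mono) auto
  finally have "ennreal (T ^ m * norm (bterm d c\<^sub>1 c\<^sub>2 \<alpha> \<gamma>)) * v \<le>
      ennreal (((1 / 2) ^ n * (4 * T) ^ (m + n)) * (p * q)) * v"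
    by (intro mult_right_mono ennreal_leI) auto
  also have "\<dots> = ennreal ((1 / 2) ^ n * (p * q)) * (ennreal ((4 * T) ^ (m + n)) * v)"
    using T pq by (simp add: ennreal_mult ac_simps)
  also have "\<dots> \<le> ennreal ((1 / 2) ^ n * (p * q)) * (ennreal M * (x * y))"
    using le False by (intro mult_left_mono) (auto simp: m_def n_def)
  also have "\<dots> = ennreal (M * (1 / 2) ^ n) * ((ennreal p * x) * (ennreal q * y))"
    using M pq by (simp add: ennreal_mult ac_simps)
  also have "\<dots> \<le> ennreal (M * (1 / 2) ^ n) * (ennreal N\<^sub>1 * ennreal N\<^sub>2)"
    using c1 c2 by (intro mult_left_mono mult_mono) (auto simp: p_def q_def)
  also have "\<dots> = ennreal (M * N\<^sub>1 * N\<^sub>2 * (1 / 2) ^ n)"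
    using M by (simp add: ennreal_mult ac_simps)
  finally show ?thesis by (simp add: m_def n_def)
qed

text \<open>The geometric decay of the terms sums to a constant independent of
  \<open>\<alpha>\<close>, as a supremum norm demands. For \<open>v = 0\<close> the estimate is
  trivial and says nothing about convergence, hence the condition in the first claim.\<close>

lemma U_diamond_estimate:
  fixes M N\<^sub>1 N\<^sub>2 :: real and v :: ennreal and x y :: "midx \<times> midx \<Rightarrow> ennreal"
  assumes \<alpha>: "\<alpha> \<in> Lam d" and sum: "(\<lambda>\<gamma>. (1 / 2 :: real) ^ deg2 d \<gamma>) summable_on Lam d"
    and M: "0 \<le> M" "0 \<le> N\<^sub>1" "0 \<le> N\<^sub>2"
    and c1: "\<And>\<gamma>. \<gamma> \<in> Lam d \<Longrightarrow> ennreal (norm (c\<^sub>1 \<gamma>)) * x \<gamma> \<le> ennreal N\<^sub>1"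
    and c2: "\<And>\<gamma>. \<gamma> \<in> Lam d \<Longrightarrow> ennreal (norm (c\<^sub>2 (\<alpha> + \<gamma>))) * y \<gamma> \<le> ennreal N\<^sub>2"
    and le: "\<And>\<gamma>. \<gamma> \<in> Lam d \<Longrightarrow> c\<^sub>1 \<gamma> = 0 \<or> c\<^sub>2 (\<alpha> + \<gamma>) = 0 \<or>
      ennreal ((4 * max 1 (norm t)) ^ (deg2 d \<alpha> + deg2 d \<gamma>)) * v \<le> ennreal M * (x \<gamma> * y \<gamma>)"
  shows "0 < v \<Longrightarrow> conv d c\<^sub>1 c\<^sub>2 \<alpha>"
    "ennreal (norm (U_diamond d t c\<^sub>1 c\<^sub>2 \<alpha>)) * v \<le>
      ennreal (M * (\<Sum>\<^sub>\<infinity>\<gamma>\<in>Lam d. (1 / 2) ^ deg2 d \<gamma>) * N\<^sub>1 * N\<^sub>2)"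
proof -
  define T where "T = max 1 (norm t)"
  define B where "B = M * N\<^sub>1 * N\<^sub>2"
  have T: "1 \<le> T" "norm t \<le> T" by (auto simp: T_def)
  have B: "0 \<le> B" using M by (simp add: B_def)
  have bd: "ennreal (T ^ deg2 d \<alpha> * norm (bterm d c\<^sub>1 c\<^sub>2 \<alpha> \<gamma>)) * v \<le> ennreal (B * (1 / 2) ^ deg2 d \<gamma>)"
    if "\<gamma> \<in> Lam d" for \<gamma>
    unfolding B_def T_def 
    by (rule bterm_estimate[where c\<^sub>1 = c\<^sub>1 and c\<^sub>2 = c\<^sub>2 and \<alpha> = \<alpha> and \<gamma> = \<gamma>,
        OF _ M c1[OF that] c2[OF that] le[OF that]]) simp
  have "(0 < v \<longrightarrow> conv d c\<^sub>1 c\<^sub>2 \<alpha>) \<and> ennreal (norm (U_diamond d t c\<^sub>1 c\<^sub>2 \<alpha>)) * v \<le>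
      ennreal (B * (\<Sum>\<^sub>\<infinity>\<gamma>\<in>Lam d. (1 / 2) ^ deg2 d \<gamma>))"
  proof (cases v)
    case top
    \<comment> \<open>A finite bound under an infinite weight leaves only zero terms.\<close>
    have "bterm d c\<^sub>1 c\<^sub>2 \<alpha> \<gamma> = 0" if "\<gamma> \<in> Lam d" for \<gamma>
      using bd[OF that] T(1) unfolding top by (auto simp: ennreal_mult_top top_unique mult_le_0_iff split: if_splits)
    then have "conv d c\<^sub>1 c\<^sub>2 \<alpha>" "U_diamond d t c\<^sub>1 c\<^sub>2 \<alpha> = 0"
      by (auto simp: conv_def U_diamond_bterm infsum_0 intro: summable_on_0)
    then show ?thesis by simp
  next
    case (real r)
    show ?thesis
    proof (cases "r = 0")
      case False
      then have r: "0 < r" using real by simp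
      define S where "S = (\<Sum>\<^sub>\<infinity>\<gamma>\<in>Lam d. (1 / 2 :: real) ^ deg2 d \<gamma>)"
      have b: "T ^ deg2 d \<alpha> * norm (bterm d c\<^sub>1 c\<^sub>2 \<alpha> \<gamma>) \<le> (B / r) * (1 / 2) ^ deg2 d \<gamma>" if "\<gamma> \<in> Lam d" for \<gamma>
      proof -
        have "(T ^ deg2 d \<alpha> * norm (bterm d c\<^sub>1 c\<^sub>2 \<alpha> \<gamma>)) * r \<le> B * (1 / 2) ^ deg2 d \<gamma>"
          using bd[OF that] real B T(1) by (simp add: ennreal_mult[symmetric])
        then show ?thesis using r by (simp add: field_simps)
      qed
      have b': "norm (bterm d c\<^sub>1 c\<^sub>2 \<alpha> \<gamma>) \<le> (B / r) * (1 / 2) ^ deg2 d \<gamma>" if "\<gamma> \<in> Lam d" for \<gamma>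
      proof -
        have "1 * norm (bterm d c\<^sub>1 c\<^sub>2 \<alpha> \<gamma>) \<le> T ^ deg2 d \<alpha> * norm (bterm d c\<^sub>1 c\<^sub>2 \<alpha> \<gamma>)"
          using T by (intro mult_right_mono one_le_power) auto
        then show ?thesis using b[OF that] by simp
      qed
      have s: "(\<lambda>\<gamma>. (B / r) * (1 / 2) ^ deg2 d \<gamma>) summable_on Lam d"
        by (rule summable_on_cmult_right[OF sum])
      have abs: "(\<lambda>\<gamma>. norm (bterm d c\<^sub>1 c\<^sub>2 \<alpha> \<gamma>)) summable_on Lam d"
        by (rule Infinite_Sum.abs_summable_on_comparison_test'[where f = "bterm d c\<^sub>1 c\<^sub>2 \<alpha>", OF s b'])
      then have conv: "conv d c\<^sub>1 c\<^sub>2 \<alpha>" unfolding conv_def by (rule abs_summable_summable)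
      have "norm (U_diamond d t c\<^sub>1 c\<^sub>2 \<alpha>) = norm t ^ deg2 d \<alpha> * norm (infsum (bterm d c\<^sub>1 c\<^sub>2 \<alpha>) (Lam d))"
        using \<alpha> by (simp add: U_diamond_bterm norm_mult norm_power)
      also have "\<dots> \<le> T ^ deg2 d \<alpha> * infsum (\<lambda>\<gamma>. norm (bterm d c\<^sub>1 c\<^sub>2 \<alpha> \<gamma>)) (Lam d)"
        using T norm_infsum_bound[OF abs] by (intro mult_mono power_mono) auto
      also have "\<dots> = infsum (\<lambda>\<gamma>. T ^ deg2 d \<alpha> * norm (bterm d c\<^sub>1 c\<^sub>2 \<alpha> \<gamma>)) (Lam d)"
        by (simp add: infsum_cmult_right')
      also have "\<dots> \<le> infsum (\<lambda>\<gamma>. (B / r) * (1 / 2) ^ deg2 d \<gamma>) (Lam d)"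
        by (rule infsum_mono[OF summable_on_cmult_right[OF abs] s b])
      also have "\<dots> = (B / r) * S" unfolding S_def by (rule infsum_cmult_right')
      finally have "norm (U_diamond d t c\<^sub>1 c\<^sub>2 \<alpha>) * r \<le> B * S" using r by (simp add: field_simps)
      then show ?thesis using conv real by (simp add: ennreal_mult[symmetric] ennreal_leI S_def)
    qed (use real in simp)
  qed
  then show "0 < v \<Longrightarrow> conv d c\<^sub>1 c\<^sub>2 \<alpha>"
    "ennreal (norm (U_diamond d t c\<^sub>1 c\<^sub>2 \<alpha>)) * v \<le>
      ennreal (M * (\<Sum>\<^sub>\<infinity>\<gamma>\<in>Lam d. (1 / 2) ^ deg2 d \<gamma>) * N\<^sub>1 * N\<^sub>2)"
    by (simp_all add: B_def ac_simps)
qed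

section \<open>Continuity of the bilinear map between the limits\<close>

lemma continuous_map_sup_top:
  assumes X: "lc X P" and f: "lin_on (topspace X) f" "\<And>c. c \<in> topspace X \<Longrightarrow> f c \<in> seqs \<Lambda>"
    and p: "seminorm_on (topspace X) p" "continuous_map X euclideanreal p" and K: "0 \<le> K"
    and bd: "\<And>c \<alpha>. c \<in> topspace X \<Longrightarrow> \<alpha> \<in> \<Lambda> \<Longrightarrow> ennreal (norm (f c \<alpha>)) * v \<alpha> \<le> ennreal (K * p c)"
  shows "continuous_map X (sup_top \<Lambda> v) f"
proof (rule lc_continuous_linear[OF X lc_sup_top f(1)])
  show fv: "f \<in> topspace X \<rightarrow> topspace (sup_top \<Lambda> v)"
    unfolding topspace_ell_top by (intro Pi_I ell_supI[OF f(2) bd])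
  fix q assume "q \<in> nrms \<Lambda> v"
  then obtain M where M: "0 < M" "q = (\<lambda>c. M * nrm \<Lambda> v c)" by (auto simp: nrms_def)
  have sn: "seminorm_on (topspace X) (\<lambda>c. q (f c))"
    using lc_seminorm[OF lc_sup_top \<open>q \<in> nrms \<Lambda> v\<close>] by (rule seminorm_on_compose[OF _ f(1) fv])
  obtain p' where p': "p' \<in> P" "\<forall>c\<in>topspace X. p c \<le> p' c" using lc_dominated[OF X p] ..
  \<comment> \<open>The summand 1 is there because \<open>lc_multiple\<close> asks for a positive
    factor and \<open>K\<close> may be 0.\<close>
  obtain p'' where p'': "p'' \<in> P" "\<forall>c\<in>topspace X. (M * K + 1) * p' c \<le> p'' c"
    using lc_multiple[OF X p'(1), of "M * K + 1"] M K by (auto simp: add_nonneg_pos)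
  have "q (f c) \<le> p'' c" if c: "c \<in> topspace X" for c
  proof -
    have pc: "0 \<le> p c" by (rule seminorm_on_nonneg[OF p(1) c])
    have "nrm \<Lambda> v (f c) \<le> K * p c" using K pc by (intro nrm_le bd c) auto
    then have "q (f c) \<le> M * (K * p c)" using M by simp
    also have "\<dots> \<le> (M * K + 1) * p c" using pc by (simp add: algebra_simps)
    also have "\<dots> \<le> (M * K + 1) * p' c" using p'(2) c M K by (intro mult_left_mono) auto
    also have "\<dots> \<le> p'' c" using p''(2) c by blast
    finally show ?thesis .
  qed
  then have "\<exists>q'\<in>P. \<forall>c\<in>topspace X. q (f c) \<le> q' c" using p''(1) by (intro bexI[of _ p''] ballI)
  then show "continuous_map X euclideanreal (\<lambda>c. q (f c))"
    using lc_continuous_seminorm[OF X sn] by simp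
qed

lemma ell_sup_top_zero:
  assumes "c \<in> ell_sup \<Lambda> v" "\<alpha> \<in> \<Lambda>" "v \<alpha> = top"
  shows "c \<alpha> = 0"
  using nrm_bound[OF assms(1,2)] assms(3) by (auto simp: ennreal_mult_top top_unique split: if_splits)

text \<open>These bounds say that \<open>U_diamond\<close> maps a pair of steps into a step; the exceptional
  alternatives are those in which one of the two factors of a term of the series vanishes.\<close>

definition BC_bound :: "nat \<times> nat \<Rightarrow> (real \<Rightarrow> real \<Rightarrow> midx \<times> midx \<Rightarrow> ennreal) \<Rightarrow>
    (real \<Rightarrow> real \<Rightarrow> midx \<times> midx \<Rightarrow> ennreal) \<Rightarrow>
    real \<Rightarrow> real \<Rightarrow> real \<Rightarrow> real \<Rightarrow> real \<Rightarrow> real \<Rightarrow> real \<Rightarrow> real \<Rightarrow> bool" where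
  "BC_bound d u w R a\<^sub>1 b\<^sub>1 a\<^sub>2 b\<^sub>2 a b M \<longleftrightarrow> (\<forall>\<alpha>\<in>Lam d. \<forall>\<gamma>\<in>Lam d. (\<exists>a'>0. w a' b\<^sub>2 (\<alpha> + \<gamma>) = top) \<or> u a\<^sub>1 b\<^sub>1 \<gamma> = top \<or>
        ennreal (R ^ (deg2 d \<alpha> + deg2 d \<gamma>)) * w a b \<alpha> \<le> ennreal M * (u a\<^sub>1 b\<^sub>1 \<gamma> * w a\<^sub>2 b\<^sub>2 (\<alpha> + \<gamma>)))"

definition CB_bound :: "nat \<times> nat \<Rightarrow> (real \<Rightarrow> real \<Rightarrow> midx \<times> midx \<Rightarrow> ennreal) \<Rightarrow>
    (real \<Rightarrow> real \<Rightarrow> midx \<times> midx \<Rightarrow> ennreal) \<Rightarrow>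
    real \<Rightarrow> real \<Rightarrow> real \<Rightarrow> real \<Rightarrow> real \<Rightarrow> real \<Rightarrow> real \<Rightarrow> real \<Rightarrow> bool" where
  "CB_bound d u w R a\<^sub>1 b\<^sub>1 a\<^sub>2 b\<^sub>2 a b M \<longleftrightarrow> (\<forall>\<alpha>\<in>Lam d. \<forall>\<gamma>\<in>Lam d. (\<exists>a'>0. u a' b\<^sub>1 \<gamma> = top) \<or> w a\<^sub>2 b\<^sub>2 (\<alpha> + \<gamma>) = top \<or>
        ennreal (R ^ (deg2 d \<alpha> + deg2 d \<gamma>)) * w a b \<alpha> \<le> ennreal M * (u a\<^sub>1 b\<^sub>1 \<gamma> * w a\<^sub>2 b\<^sub>2 (\<alpha> + \<gamma>)))"

text \<open>The order of the quantifiers is that of the limits. In \<open>kernel_BC\<close> the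
  second argument fixes \<open>b\<^sub>2\<close>; then \<open>a\<^sub>1\<close> and the target step
  \<open>b\<close> are chosen before the first argument reveals \<open>b\<^sub>1\<close> and before
  the target seminorm \<open>a\<close> is given. In \<open>kernel_CB\<close> the first argument and
  the target fix \<open>b\<^sub>1\<close> and \<open>a\<close>, and \<open>a\<^sub>2\<close> is
  chosen before the second argument reveals \<open>b\<^sub>2\<close>.\<close>

locale kernel = U: graded_weights "Lam d" u "deg2 d" + W: graded_weights "Lam d" w "deg2 d"
  for d :: "nat \<times> nat" and u w :: "real \<Rightarrow> real \<Rightarrow> midx \<times> midx \<Rightarrow> ennreal" +
  assumes kernel_BC: "1 \<le> R \<Longrightarrow> 0 < b\<^sub>2 \<Longrightarrow> \<exists>a\<^sub>1>0. \<exists>b>0. \<forall>b\<^sub>1>0. \<forall>a>0. \<exists>a\<^sub>2>0. \<exists>M\<ge>0.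
      BC_bound d u w R a\<^sub>1 b\<^sub>1 a\<^sub>2 b\<^sub>2 a b M"
    and kernel_CB: "1 \<le> R \<Longrightarrow> 0 < b\<^sub>1 \<Longrightarrow> 0 < a \<Longrightarrow> \<exists>a\<^sub>2>0. \<forall>b\<^sub>2>0. \<exists>a\<^sub>1>0. \<exists>b>0. \<exists>M\<ge>0.
      CB_bound d u w R a\<^sub>1 b\<^sub>1 a\<^sub>2 b\<^sub>2 a b M"
begin

definition step_bound :: "complex \<Rightarrow> real \<Rightarrow> real \<Rightarrow> real \<Rightarrow> real \<Rightarrow> real \<Rightarrow> real \<Rightarrow> real \<Rightarrow>
    (midx \<times> midx \<Rightarrow> complex) \<Rightarrow> (midx \<times> midx \<Rightarrow> complex) \<Rightarrow> bool" where
  "step_bound t a\<^sub>1 b\<^sub>1 a\<^sub>2 b\<^sub>2 a b K c\<^sub>1 c\<^sub>2 \<longleftrightarrow> (\<forall>\<alpha>\<in>Lam d. (0 < w a b \<alpha> \<longrightarrow> conv d c\<^sub>1 c\<^sub>2 \<alpha>) \<and>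
     ennreal (norm (U_diamond d t c\<^sub>1 c\<^sub>2 \<alpha>)) * w a b \<alpha> \<le>
       ennreal (K * nrm (Lam d) (u a\<^sub>1 b\<^sub>1) c\<^sub>1 * nrm (Lam d) (w a\<^sub>2 b\<^sub>2) c\<^sub>2))"

lemma step_boundI:
  assumes M: "0 \<le> M" and c1: "c\<^sub>1 \<in> ell_sup (Lam d) (u a\<^sub>1 b\<^sub>1)" and c2: "c\<^sub>2 \<in> ell_sup (Lam d) (w a\<^sub>2 b\<^sub>2)"
    and le: "\<And>\<alpha> \<gamma>. \<alpha> \<in> Lam d \<Longrightarrow> \<gamma> \<in> Lam d \<Longrightarrow> c\<^sub>1 \<gamma> = 0 \<or> c\<^sub>2 (\<alpha> + \<gamma>) = 0 \<or>
        ennreal ((4 * max 1 (norm t)) ^ (deg2 d \<alpha> + deg2 d \<gamma>)) * w a b \<alpha> \<le>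
        ennreal M * (u a\<^sub>1 b\<^sub>1 \<gamma> * w a\<^sub>2 b\<^sub>2 (\<alpha> + \<gamma>))"
  shows "step_bound t a\<^sub>1 b\<^sub>1 a\<^sub>2 b\<^sub>2 a b (M * (\<Sum>\<^sub>\<infinity>\<gamma>\<in>Lam d. (1 / 2) ^ deg2 d \<gamma>)) c\<^sub>1 c\<^sub>2"
  unfolding step_bound_def
proof (intro ballI conjI impI)
  fix \<alpha> assume \<alpha>: "\<alpha> \<in> Lam d"
  note est = U_diamond_estimate[where x = "u a\<^sub>1 b\<^sub>1" and y = "\<lambda>\<gamma>. w a\<^sub>2 b\<^sub>2 (\<alpha> + \<gamma>)" and v = "w a b \<alpha>"
      and c\<^sub>1 = c\<^sub>1 and c\<^sub>2 = c\<^sub>2 and t = t,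
      OF \<alpha> U.summable_deg M nrm_nonneg nrm_nonneg nrm_bound[OF c1] nrm_bound[OF c2 Lam_add[OF \<alpha>]] le[OF \<alpha>]]
  show "0 < w a b \<alpha> \<Longrightarrow> conv d c\<^sub>1 c\<^sub>2 \<alpha>" by (rule est(1))
  show "ennreal (norm (U_diamond d t c\<^sub>1 c\<^sub>2 \<alpha>)) * w a b \<alpha> \<le>
    ennreal (M * (\<Sum>\<^sub>\<infinity>\<gamma>\<in>Lam d. (1 / 2) ^ deg2 d \<gamma>) * nrm (Lam d) (u a\<^sub>1 b\<^sub>1) c\<^sub>1 * nrm (Lam d) (w a\<^sub>2 b\<^sub>2) c\<^sub>2)"
    by (rule est(2))
qed

lemma weight_sum_nonneg: "0 \<le> (\<Sum>\<^sub>\<infinity>\<gamma>\<in>Lam d. (1 / 2 :: real) ^ deg2 d \<gamma>)"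
  by (simp add: infsum_nonneg)

lemma bound_BC:
  assumes b2: "0 < b\<^sub>2"
  shows "\<exists>a\<^sub>1>0. \<exists>b>0. \<forall>b\<^sub>1>0. \<forall>a>0. \<exists>a\<^sub>2>0. \<exists>K\<ge>0. \<forall>c\<^sub>1\<in>ell_sup (Lam d) (u a\<^sub>1 b\<^sub>1). \<forall>c\<^sub>2\<in>topspace (W.Xb b\<^sub>2).
    step_bound t a\<^sub>1 b\<^sub>1 a\<^sub>2 b\<^sub>2 a b K c\<^sub>1 c\<^sub>2"
proof -
  define R where "R = 4 * max 1 (norm t)"
  have R: "1 \<le> R" by (simp add: R_def)
  obtain a\<^sub>1 b where ab: "0 < a\<^sub>1" "0 < b" and k: "\<forall>b\<^sub>1>0. \<forall>a>0. \<exists>a\<^sub>2>0. \<exists>M\<ge>0.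
      BC_bound d u w R a\<^sub>1 b\<^sub>1 a\<^sub>2 b\<^sub>2 a b M"
    using kernel_BC[OF R b2] by blast
  show ?thesis
  proof (rule exI[of _ a\<^sub>1], intro conjI ab, rule exI[of _ b], intro conjI ab allI impI)
    fix b\<^sub>1 a :: real assume "0 < b\<^sub>1" "0 < a"
    with k obtain a\<^sub>2 M where M: "0 < a\<^sub>2" "0 \<le> M" and le: "BC_bound d u w R a\<^sub>1 b\<^sub>1 a\<^sub>2 b\<^sub>2 a b M"
      by blast
    have "step_bound t a\<^sub>1 b\<^sub>1 a\<^sub>2 b\<^sub>2 a b (M * (\<Sum>\<^sub>\<infinity>\<gamma>\<in>Lam d. (1 / 2) ^ deg2 d \<gamma>)) c\<^sub>1 c\<^sub>2"
      if c1: "c\<^sub>1 \<in> ell_sup (Lam d) (u a\<^sub>1 b\<^sub>1)" and c2: "c\<^sub>2 \<in> topspace (W.Xb b\<^sub>2)" for c\<^sub>1 c\<^sub>2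
    proof (rule step_boundI[OF M(2) c1])
      \<comment> \<open>An element of \<open>Xb b\<^sub>2\<close> lies in the steps for all
        \<open>a'\<close>, so it vanishes wherever one of these weights is infinite. This is the
        first alternative in \<open>BC_bound\<close>.\<close>
      have c2': "c\<^sub>2 \<in> ell_sup (Lam d) (w a' b\<^sub>2)" if "0 < a'" for a'
        using c2 that by (simp add: W.topspace_Xb)
      show "c\<^sub>2 \<in> ell_sup (Lam d) (w a\<^sub>2 b\<^sub>2)" by (rule c2'[OF M(1)])
      fix \<alpha> \<gamma> assume \<alpha>: "\<alpha> \<in> Lam d" and \<gamma>: "\<gamma> \<in> Lam d"
      show "c\<^sub>1 \<gamma> = 0 \<or> c\<^sub>2 (\<alpha> + \<gamma>) = 0 \<or>
        ennreal ((4 * max 1 (norm t)) ^ (deg2 d \<alpha> + deg2 d \<gamma>)) * w a b \<alpha> \<le>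
        ennreal M * (u a\<^sub>1 b\<^sub>1 \<gamma> * w a\<^sub>2 b\<^sub>2 (\<alpha> + \<gamma>))"
        using le[unfolded BC_bound_def, rule_format, OF \<alpha> \<gamma>] ell_sup_top_zero[OF c1 \<gamma>] ell_sup_top_zero[OF c2' Lam_add[OF \<alpha> \<gamma>]]
        unfolding R_def by blast
    qed
    then show "\<exists>a\<^sub>2>0. \<exists>K\<ge>0. \<forall>c\<^sub>1\<in>ell_sup (Lam d) (u a\<^sub>1 b\<^sub>1). \<forall>c\<^sub>2\<in>topspace (W.Xb b\<^sub>2).
        step_bound t a\<^sub>1 b\<^sub>1 a\<^sub>2 b\<^sub>2 a b K c\<^sub>1 c\<^sub>2"
      using M mult_nonneg_nonneg[OF M(2) weight_sum_nonneg] by blast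
  qed
qed

lemma bound_CB:
  assumes b1: "0 < b\<^sub>1" and a: "0 < a"
  shows "\<exists>a\<^sub>2>0. \<forall>b\<^sub>2>0. \<exists>a\<^sub>1>0. \<exists>b>0. \<exists>K\<ge>0. \<forall>c\<^sub>1\<in>topspace (U.Xb b\<^sub>1). \<forall>c\<^sub>2\<in>ell_sup (Lam d) (w a\<^sub>2 b\<^sub>2).
    step_bound t a\<^sub>1 b\<^sub>1 a\<^sub>2 b\<^sub>2 a b K c\<^sub>1 c\<^sub>2"
proof -
  define R where "R = 4 * max 1 (norm t)"
  have R: "1 \<le> R" by (simp add: R_def)
  obtain a\<^sub>2 where a2: "0 < a\<^sub>2" and k: "\<forall>b\<^sub>2>0. \<exists>a\<^sub>1>0. \<exists>b>0. \<exists>M\<ge>0.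
      CB_bound d u w R a\<^sub>1 b\<^sub>1 a\<^sub>2 b\<^sub>2 a b M"
    using kernel_CB[OF R b1 a] by blast
  show ?thesis
  proof (rule exI[of _ a\<^sub>2], intro conjI a2 allI impI)
    fix b\<^sub>2 :: real assume "0 < b\<^sub>2"
    with k obtain a\<^sub>1 b M where M: "0 < a\<^sub>1" "0 < b" "0 \<le> M" and le: "CB_bound d u w R a\<^sub>1 b\<^sub>1 a\<^sub>2 b\<^sub>2 a b M"
      by blast
    have "step_bound t a\<^sub>1 b\<^sub>1 a\<^sub>2 b\<^sub>2 a b (M * (\<Sum>\<^sub>\<infinity>\<gamma>\<in>Lam d. (1 / 2) ^ deg2 d \<gamma>)) c\<^sub>1 c\<^sub>2"
      if c1: "c\<^sub>1 \<in> topspace (U.Xb b\<^sub>1)" and c2: "c\<^sub>2 \<in> ell_sup (Lam d) (w a\<^sub>2 b\<^sub>2)" for c\<^sub>1 c\<^sub>2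
    proof (rule step_boundI[OF M(3) _ c2])
      have c1': "c\<^sub>1 \<in> ell_sup (Lam d) (u a' b\<^sub>1)" if "0 < a'" for a'
        using c1 that by (simp add: U.topspace_Xb)
      show "c\<^sub>1 \<in> ell_sup (Lam d) (u a\<^sub>1 b\<^sub>1)" by (rule c1'[OF M(1)])
      fix \<alpha> \<gamma> assume \<alpha>: "\<alpha> \<in> Lam d" and \<gamma>: "\<gamma> \<in> Lam d"
      show "c\<^sub>1 \<gamma> = 0 \<or> c\<^sub>2 (\<alpha> + \<gamma>) = 0 \<or>
        ennreal ((4 * max 1 (norm t)) ^ (deg2 d \<alpha> + deg2 d \<gamma>)) * w a b \<alpha> \<le>
        ennreal M * (u a\<^sub>1 b\<^sub>1 \<gamma> * w a\<^sub>2 b\<^sub>2 (\<alpha> + \<gamma>))"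
        using le[unfolded CB_bound_def, rule_format, OF \<alpha> \<gamma>] ell_sup_top_zero[OF c1' \<gamma>] ell_sup_top_zero[OF c2 Lam_add[OF \<alpha> \<gamma>]]
        unfolding R_def by blast
    qed
    then show "\<exists>a\<^sub>1>0. \<exists>b>0. \<exists>K\<ge>0. \<forall>c\<^sub>1\<in>topspace (U.Xb b\<^sub>1). \<forall>c\<^sub>2\<in>ell_sup (Lam d) (w a\<^sub>2 b\<^sub>2).
        step_bound t a\<^sub>1 b\<^sub>1 a\<^sub>2 b\<^sub>2 a b K c\<^sub>1 c\<^sub>2"
      using M mult_nonneg_nonneg[OF M(3) weight_sum_nonneg] by blast
  qed
qed

lemma step_bound_conv: "step_bound t a\<^sub>1 b\<^sub>1 a\<^sub>2 b\<^sub>2 a b K c\<^sub>1 c\<^sub>2 \<Longrightarrow> \<alpha> \<in> Lam d \<Longrightarrow> 0 < w a b \<alpha> \<Longrightarrow> conv d c\<^sub>1 c\<^sub>2 \<alpha>"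
  by (simp add: step_bound_def)

lemma step_bound_le: "step_bound t a\<^sub>1 b\<^sub>1 a\<^sub>2 b\<^sub>2 a b K c\<^sub>1 c\<^sub>2 \<Longrightarrow> \<alpha> \<in> Lam d \<Longrightarrow>
  ennreal (norm (U_diamond d t c\<^sub>1 c\<^sub>2 \<alpha>)) * w a b \<alpha> \<le>
       ennreal (K * nrm (Lam d) (u a\<^sub>1 b\<^sub>1) c\<^sub>1 * nrm (Lam d) (w a\<^sub>2 b\<^sub>2) c\<^sub>2)"
  by (simp add: step_bound_def)

lemma Csp_cases:
  assumes "c \<in> topspace W.Csp" obtains b where "0 < b" "c \<in> topspace (W.Xb b)"
  using assms by (auto simp: W.topspace_Csp W.topspace_Xb)

text \<open>Convergence does not involve \<open>t\<close>, so the bounds are used with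
  \<open>t = 0\<close>. The step bound yields convergence only at positive target weight, and
  \<open>pos_a\<close> makes the weight at \<open>\<alpha>\<close> positive.\<close>

lemma conv_BC:
  assumes c1: "c\<^sub>1 \<in> topspace U.Bsp" and c2: "c\<^sub>2 \<in> topspace W.Csp" and \<alpha>: "\<alpha> \<in> Lam d"
  shows "conv d c\<^sub>1 c\<^sub>2 \<alpha>"
proof -
  obtain b\<^sub>2 where b2: "0 < b\<^sub>2" "c\<^sub>2 \<in> topspace (W.Xb b\<^sub>2)" using c2 by (rule Csp_cases)
  obtain a\<^sub>1 b where ab: "0 < a\<^sub>1" "0 < b" and k: "\<forall>b\<^sub>1>0. \<forall>a>0. \<exists>a\<^sub>2>0. \<exists>K\<ge>0.
      \<forall>c\<^sub>1\<in>ell_sup (Lam d) (u a\<^sub>1 b\<^sub>1). \<forall>c\<^sub>2\<in>topspace (W.Xb b\<^sub>2). step_bound 0 a\<^sub>1 b\<^sub>1 a\<^sub>2 b\<^sub>2 a b K c\<^sub>1 c\<^sub>2"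
    using bound_BC[OF b2(1), of 0] by blast
  obtain b\<^sub>1 where b1: "0 < b\<^sub>1" "c\<^sub>1 \<in> ell_sup (Lam d) (u a\<^sub>1 b\<^sub>1)"
    using c1 ab(1) by (auto simp: U.topspace_Bsp)
  obtain a where a: "0 < a" "0 < w a b \<alpha>" using W.pos_a[OF \<alpha>] ab(2) by blast
  obtain a\<^sub>2 K where "step_bound 0 a\<^sub>1 b\<^sub>1 a\<^sub>2 b\<^sub>2 a b K c\<^sub>1 c\<^sub>2" using k b1 a(1) b2(2) by blast
  then show ?thesis using \<alpha> a(2) by (rule step_bound_conv)
qed

text \<open>Here \<open>a\<close> is chosen before \<open>b\<close> is known, so the weight has to
  be positive for all \<open>b\<close> at once, as \<open>pos_a\<close> grants.\<close>

lemma conv_CB: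
  assumes c1: "c\<^sub>1 \<in> topspace U.Csp" and c2: "c\<^sub>2 \<in> topspace W.Bsp" and \<alpha>: "\<alpha> \<in> Lam d"
  shows "conv d c\<^sub>1 c\<^sub>2 \<alpha>"
proof -
  obtain b\<^sub>1 where b1: "0 < b\<^sub>1" "c\<^sub>1 \<in> topspace (U.Xb b\<^sub>1)"
    using c1 by (auto simp: U.topspace_Csp U.topspace_Xb)
  obtain a where a: "0 < a" "\<forall>b>0. 0 < w a b \<alpha>" using W.pos_a[OF \<alpha>] by blast
  obtain a\<^sub>2 where a2: "0 < a\<^sub>2" and k: "\<forall>b\<^sub>2>0. \<exists>a\<^sub>1>0. \<exists>b>0. \<exists>K\<ge>0. \<forall>c\<^sub>1\<in>topspace (U.Xb b\<^sub>1).
      \<forall>c\<^sub>2\<in>ell_sup (Lam d) (w a\<^sub>2 b\<^sub>2). step_bound 0 a\<^sub>1 b\<^sub>1 a\<^sub>2 b\<^sub>2 a b K c\<^sub>1 c\<^sub>2"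
    using bound_CB[OF b1(1) a(1), of 0] by blast
  obtain b\<^sub>2 where b2: "0 < b\<^sub>2" "c\<^sub>2 \<in> ell_sup (Lam d) (w a\<^sub>2 b\<^sub>2)"
    using c2 a2 by (auto simp: W.topspace_Bsp)
  obtain a\<^sub>1 b K where "0 < b" "step_bound 0 a\<^sub>1 b\<^sub>1 a\<^sub>2 b\<^sub>2 a b K c\<^sub>1 c\<^sub>2" using k b1(2) b2 by blast
  then show ?thesis using step_bound_conv \<alpha> a(2) by blast
qed

text \<open>For a fixed second argument the map factors through \<open>Ya a\<^sub>1\<close> and one
  step \<open>Xb b\<close>; for a fixed first argument it sends \<open>Xb b\<^sub>2\<close> into
  \<open>Xb b\<close>. Both rest on the choice of \<open>b\<close> from \<open>b\<^sub>2\<close>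
  alone.\<close>

lemma separately_continuous_BC: "separately_continuous U.Bsp W.Csp W.Csp (U_diamond d t)"
  unfolding separately_continuous_def
proof (intro conjI ballI)
  fix c\<^sub>2 assume c2: "c\<^sub>2 \<in> topspace W.Csp"
  then obtain b\<^sub>2 where b2: "0 < b\<^sub>2" "c\<^sub>2 \<in> topspace (W.Xb b\<^sub>2)" by (rule Csp_cases)
  obtain a\<^sub>1 b where ab: "0 < a\<^sub>1" "0 < b" and k: "\<forall>b\<^sub>1>0. \<forall>a>0. \<exists>a\<^sub>2>0. \<exists>K\<ge>0.
      \<forall>c\<^sub>1\<in>ell_sup (Lam d) (u a\<^sub>1 b\<^sub>1). \<forall>c\<^sub>2\<in>topspace (W.Xb b\<^sub>2). step_bound t a\<^sub>1 b\<^sub>1 a\<^sub>2 b\<^sub>2 a b K c\<^sub>1 c\<^sub>2"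
    using bound_BC[OF b2(1), of t] by blast
  \<comment> \<open>Linearity is required on all of \<open>Ya a\<^sub>1\<close>, beyond
    \<open>Bsp\<close>. It holds because \<open>a\<close> may be any index once \<open>b\<close> is
    fixed, in particular one for which the target weight at \<open>\<alpha>\<close> is
    positive.\<close>
  have lin: "lin_on (topspace (U.Ya a\<^sub>1)) (\<lambda>c. U_diamond d t c c\<^sub>2)"
  proof (rule lin_on_U1)
    fix c\<^sub>1 \<alpha> assume "c\<^sub>1 \<in> topspace (U.Ya a\<^sub>1)" and \<alpha>: "\<alpha> \<in> Lam d"
    then obtain b\<^sub>1 where b1: "0 < b\<^sub>1" "c\<^sub>1 \<in> ell_sup (Lam d) (u a\<^sub>1 b\<^sub>1)" by (auto simp: U.topspace_Ya)
    obtain a where a: "0 < a" "0 < w a b \<alpha>" using W.pos_a[OF \<alpha>] ab(2) by blast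
    obtain a\<^sub>2 K where "step_bound t a\<^sub>1 b\<^sub>1 a\<^sub>2 b\<^sub>2 a b K c\<^sub>1 c\<^sub>2" using k b1 a(1) b2(2) by blast
    then show "conv d c\<^sub>1 c\<^sub>2 \<alpha>" using \<alpha> a(2) by (rule step_bound_conv)
  qed
  have "continuous_map (U.Ya a\<^sub>1) (W.Xb b) (\<lambda>c. U_diamond d t c c\<^sub>2)"
    unfolding U.Ya_def
  proof (rule continuous_map_ind_lim_linear[OF U.lc_Ya[OF ab(1), unfolded U.Ya_def] W.lc_Xb[OF ab(2)]])
    show "lin_on (\<Union>r\<in>{0<..}. topspace (sup_top (Lam d) (u a\<^sub>1 r))) (\<lambda>c. U_diamond d t c c\<^sub>2)"
      using lin by (simp add: U.topspace_Ya)
    fix b\<^sub>1 :: real assume b1: "0 < b\<^sub>1"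
    show "continuous_map (sup_top (Lam d) (u a\<^sub>1 b\<^sub>1)) (W.Xb b) (\<lambda>c. U_diamond d t c c\<^sub>2)"
      unfolding W.Xb_def
    proof (rule continuous_map_proj_lim)
      fix a :: real assume a: "0 < a"
      obtain a\<^sub>2 K where K: "0 < a\<^sub>2" "0 \<le> K" "\<forall>c\<^sub>1\<in>ell_sup (Lam d) (u a\<^sub>1 b\<^sub>1). \<forall>c\<^sub>2\<in>topspace (W.Xb b\<^sub>2).
          step_bound t a\<^sub>1 b\<^sub>1 a\<^sub>2 b\<^sub>2 a b K c\<^sub>1 c\<^sub>2" using k b1 a by blast
      show "continuous_map (sup_top (Lam d) (u a\<^sub>1 b\<^sub>1)) (sup_top (Lam d) (w a b)) (\<lambda>c. U_diamond d t c c\<^sub>2)"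
      proof (rule continuous_map_sup_top[OF lc_sup_top, where p = "nrm (Lam d) (u a\<^sub>1 b\<^sub>1)"
            and K = "K * nrm (Lam d) (w a\<^sub>2 b\<^sub>2) c\<^sub>2"])
        show "lin_on (topspace (sup_top (Lam d) (u a\<^sub>1 b\<^sub>1))) (\<lambda>c. U_diamond d t c c\<^sub>2)"
          by (rule lin_on_subset[OF lin]) (use b1 in \<open>auto simp: U.topspace_Ya\<close>)
        fix c \<alpha> assume "c \<in> topspace (sup_top (Lam d) (u a\<^sub>1 b\<^sub>1))" and \<alpha>: "\<alpha> \<in> Lam d"
        then have "step_bound t a\<^sub>1 b\<^sub>1 a\<^sub>2 b\<^sub>2 a b K c c\<^sub>2" using K(3) b2(2) by simp
        from step_bound_le[OF this \<alpha>]
        show "ennreal (norm (U_diamond d t c c\<^sub>2 \<alpha>)) * w a b \<alpha> \<le>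
            ennreal (K * nrm (Lam d) (w a\<^sub>2 b\<^sub>2) c\<^sub>2 * nrm (Lam d) (u a\<^sub>1 b\<^sub>1) c)" by (simp add: ac_simps)
      qed (use K(2) in \<open>simp_all add: U_diamond_seqs seminorm_nrm continuous_nrm nrm_nonneg\<close>)
    qed
  qed
  from continuous_map_compose[OF continuous_map_compose[OF U.Bsp_in[OF ab(1)] this] W.Csp_in[OF ab(2)]]
  show "continuous_map U.Bsp W.Csp (\<lambda>c. U_diamond d t c c\<^sub>2)" by (simp add: o_def)
next
  fix c\<^sub>1 assume c1: "c\<^sub>1 \<in> topspace U.Bsp"
  have lin: "lin_on (topspace W.Csp) (U_diamond d t c\<^sub>1)"
    by (rule lin_on_U2) (rule conv_BC[OF c1])
  show "continuous_map W.Csp W.Csp (U_diamond d t c\<^sub>1)"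
    unfolding W.Csp_def
  proof (rule continuous_map_ind_lim_linear)
    show "lc (ind_lim W.Xb) {q. lim_seminorm W.Xb q}" "lc (ind_lim W.Xb) {q. lim_seminorm W.Xb q}"
      using W.lc_Csp by (simp_all add: W.Csp_def)
    show "lin_on (\<Union>r\<in>{0<..}. topspace (W.Xb r)) (U_diamond d t c\<^sub>1)"
      using lin by (simp add: W.topspace_Csp W.topspace_Xb)
    fix b\<^sub>2 :: real assume b2: "0 < b\<^sub>2"
    obtain a\<^sub>1 b where ab: "0 < a\<^sub>1" "0 < b" and k: "\<forall>b\<^sub>1>0. \<forall>a>0. \<exists>a\<^sub>2>0. \<exists>K\<ge>0.
        \<forall>c\<^sub>1\<in>ell_sup (Lam d) (u a\<^sub>1 b\<^sub>1). \<forall>c\<^sub>2\<in>topspace (W.Xb b\<^sub>2). step_bound t a\<^sub>1 b\<^sub>1 a\<^sub>2 b\<^sub>2 a b K c\<^sub>1 c\<^sub>2"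
      using bound_BC[OF b2, of t] by blast
    obtain b\<^sub>1 where b1: "0 < b\<^sub>1" "c\<^sub>1 \<in> ell_sup (Lam d) (u a\<^sub>1 b\<^sub>1)"
      using c1 ab(1) by (auto simp: U.topspace_Bsp)
    have "continuous_map (W.Xb b\<^sub>2) (W.Xb b) (U_diamond d t c\<^sub>1)"
      unfolding W.Xb_def[of b]
    proof (rule continuous_map_proj_lim)
      fix a :: real assume a: "0 < a"
      obtain a\<^sub>2 K where K: "0 < a\<^sub>2" "0 \<le> K" "\<forall>c\<^sub>1\<in>ell_sup (Lam d) (u a\<^sub>1 b\<^sub>1). \<forall>c\<^sub>2\<in>topspace (W.Xb b\<^sub>2).
          step_bound t a\<^sub>1 b\<^sub>1 a\<^sub>2 b\<^sub>2 a b K c\<^sub>1 c\<^sub>2" using k[rule_format, OF b1(1) a] by blast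
      show "continuous_map (W.Xb b\<^sub>2) (sup_top (Lam d) (w a b)) (U_diamond d t c\<^sub>1)"
      proof (rule continuous_map_sup_top[OF W.lc_Xb[OF b2], where p = "nrm (Lam d) (w a\<^sub>2 b\<^sub>2)"
            and K = "K * nrm (Lam d) (u a\<^sub>1 b\<^sub>1) c\<^sub>1"])
        show "lin_on (topspace (W.Xb b\<^sub>2)) (U_diamond d t c\<^sub>1)"
          by (rule lin_on_subset[OF lin]) (use b2 in \<open>auto simp: W.topspace_Csp W.topspace_Xb\<close>)
        show "seminorm_on (topspace (W.Xb b\<^sub>2)) (nrm (Lam d) (w a\<^sub>2 b\<^sub>2))" by (rule W.seminorm_nrm_Xb[OF K(1)])
        show "continuous_map (W.Xb b\<^sub>2) euclideanreal (nrm (Lam d) (w a\<^sub>2 b\<^sub>2))"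
          using continuous_map_compose[OF W.Xb_in[OF K(1), of b\<^sub>2] continuous_nrm] by simp
        fix c \<alpha> assume "c \<in> topspace (W.Xb b\<^sub>2)" and \<alpha>: "\<alpha> \<in> Lam d"
        then have "step_bound t a\<^sub>1 b\<^sub>1 a\<^sub>2 b\<^sub>2 a b K c\<^sub>1 c" using K(3) b1(2) by blast
        from step_bound_le[OF this \<alpha>]
        show "ennreal (norm (U_diamond d t c\<^sub>1 c \<alpha>)) * w a b \<alpha> \<le>
            ennreal (K * nrm (Lam d) (u a\<^sub>1 b\<^sub>1) c\<^sub>1 * nrm (Lam d) (w a\<^sub>2 b\<^sub>2) c)" .
      qed (use K(2) in \<open>simp_all add: U_diamond_seqs nrm_nonneg\<close>)
    qed
    from continuous_map_compose[OF this W.Csp_in[OF ab(2)]]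
    show "continuous_map (W.Xb b\<^sub>2) (ind_lim W.Xb) (U_diamond d t c\<^sub>1)" by (simp add: W.Csp_def o_def)
  qed
qed

theorem extendable_BC: "U_extendable d t U.Bsp W.Csp W.Csp"
  unfolding U_extendable_def
proof (rule uniquely_extendableI[OF U.ell0_subset(1) W.ell0_subset(2) W.ell0_subset(2)
      U.dense_Bsp W.dense_Csp W.Hausdorff_Csp separately_continuous_BC])
  show "jointly_sequentially_continuous U.Bsp W.Csp W.Csp (U_diamond d t)"
  proof (rule jointly_sequentially_continuous_bilinear[OF U.lc_Bsp W.lc_Csp W.lc_Csp _ _
        separately_continuous_BC W.barrelled_Csp])
    show "lin_on (topspace W.Csp) (U_diamond d t x)" if "x \<in> topspace U.Bsp" for x
      by (rule lin_on_U2) (rule conv_BC[OF that])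
    show "lin_on (topspace U.Bsp) (\<lambda>x. U_diamond d t x y)" if "y \<in> topspace W.Csp" for y
      by (rule lin_on_U1) (rule conv_BC[OF _ that])
  qed
qed

text \<open>The map \<open>U_diamond d t c\<^sub>1\<close> need not be linear on the larger space \<open>Ya a\<^sub>2\<close>, as its series may
  diverge there at the indices where the weights of \<open>Ya a\<close> vanish. Continuous seminorms
  on \<open>Ya a\<close> do not see these indices, which may therefore be removed.\<close>

lemma separately_continuous_CB: "separately_continuous U.Csp W.Bsp W.Bsp (U_diamond d t)"
  unfolding separately_continuous_def
proof (intro conjI ballI)
  fix c\<^sub>2 assume c2: "c\<^sub>2 \<in> topspace W.Bsp"
  have lin: "lin_on (topspace U.Csp) (\<lambda>c. U_diamond d t c c\<^sub>2)"
    by (rule lin_on_U1) (rule conv_CB[OF _ c2])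
  show "continuous_map U.Csp W.Bsp (\<lambda>c. U_diamond d t c c\<^sub>2)"
    unfolding U.Csp_def
  proof (rule continuous_map_ind_lim_linear[OF _ W.lc_Bsp])
    show "lc (ind_lim U.Xb) {q. lim_seminorm U.Xb q}"
      using U.lc_Csp by (simp add: U.Csp_def)
    show "lin_on (\<Union>r\<in>{0<..}. topspace (U.Xb r)) (\<lambda>c. U_diamond d t c c\<^sub>2)"
      using lin by (simp add: U.topspace_Csp U.topspace_Xb)
    fix b\<^sub>1 :: real assume b1: "0 < b\<^sub>1"
    show "continuous_map (U.Xb b\<^sub>1) W.Bsp (\<lambda>c. U_diamond d t c c\<^sub>2)"
      unfolding W.Bsp_def
    proof (rule continuous_map_proj_lim)
      fix a :: real assume a: "0 < a"
      obtain a\<^sub>2 where a2: "0 < a\<^sub>2" and k: "\<forall>b\<^sub>2>0. \<exists>a\<^sub>1>0. \<exists>b>0. \<exists>K\<ge>0. \<forall>c\<^sub>1\<in>topspace (U.Xb b\<^sub>1).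
          \<forall>c\<^sub>2\<in>ell_sup (Lam d) (w a\<^sub>2 b\<^sub>2). step_bound t a\<^sub>1 b\<^sub>1 a\<^sub>2 b\<^sub>2 a b K c\<^sub>1 c\<^sub>2"
        using bound_CB[OF b1 a, of t] by blast
      obtain b\<^sub>2 where b2: "0 < b\<^sub>2" "c\<^sub>2 \<in> ell_sup (Lam d) (w a\<^sub>2 b\<^sub>2)"
        using c2 a2 by (auto simp: W.topspace_Bsp)
      obtain a\<^sub>1 b K where K: "0 < a\<^sub>1" "0 < b" "0 \<le> K" "\<forall>c\<^sub>1\<in>topspace (U.Xb b\<^sub>1).
          \<forall>c\<^sub>2\<in>ell_sup (Lam d) (w a\<^sub>2 b\<^sub>2). step_bound t a\<^sub>1 b\<^sub>1 a\<^sub>2 b\<^sub>2 a b K c\<^sub>1 c\<^sub>2" using k b2(1) by blast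
      have "continuous_map (U.Xb b\<^sub>1) (sup_top (Lam d) (w a b)) (\<lambda>c. U_diamond d t c c\<^sub>2)"
      proof (rule continuous_map_sup_top[OF U.lc_Xb[OF b1], where p = "nrm (Lam d) (u a\<^sub>1 b\<^sub>1)"
            and K = "K * nrm (Lam d) (w a\<^sub>2 b\<^sub>2) c\<^sub>2"])
        show "lin_on (topspace (U.Xb b\<^sub>1)) (\<lambda>c. U_diamond d t c c\<^sub>2)"
          by (rule lin_on_subset[OF lin]) (use b1 in \<open>auto simp: U.topspace_Csp U.topspace_Xb\<close>)
        show "seminorm_on (topspace (U.Xb b\<^sub>1)) (nrm (Lam d) (u a\<^sub>1 b\<^sub>1))" by (rule U.seminorm_nrm_Xb[OF K(1)])
        show "continuous_map (U.Xb b\<^sub>1) euclideanreal (nrm (Lam d) (u a\<^sub>1 b\<^sub>1))"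
          using continuous_map_compose[OF U.Xb_in[OF K(1), of b\<^sub>1] continuous_nrm] by simp
        fix c \<alpha> assume "c \<in> topspace (U.Xb b\<^sub>1)" and \<alpha>: "\<alpha> \<in> Lam d"
        then have "step_bound t a\<^sub>1 b\<^sub>1 a\<^sub>2 b\<^sub>2 a b K c c\<^sub>2" using K(4) b2(2) by blast
        from step_bound_le[OF this \<alpha>]
        show "ennreal (norm (U_diamond d t c c\<^sub>2 \<alpha>)) * w a b \<alpha> \<le>
            ennreal (K * nrm (Lam d) (w a\<^sub>2 b\<^sub>2) c\<^sub>2 * nrm (Lam d) (u a\<^sub>1 b\<^sub>1) c)" by (simp add: ac_simps)
      qed (use K(3) in \<open>simp_all add: U_diamond_seqs nrm_nonneg\<close>)
      from continuous_map_compose[OF this W.Ya_in[OF K(2)]]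
      show "continuous_map (U.Xb b\<^sub>1) (W.Ya a) (\<lambda>c. U_diamond d t c c\<^sub>2)" by (simp add: o_def)
    qed
  qed
next
  fix c\<^sub>1 assume c1: "c\<^sub>1 \<in> topspace U.Csp"
  then obtain b\<^sub>1 where b1: "0 < b\<^sub>1" "c\<^sub>1 \<in> topspace (U.Xb b\<^sub>1)"
    by (auto simp: U.topspace_Csp U.topspace_Xb)
  have lin: "lin_on (topspace W.Bsp) (U_diamond d t c\<^sub>1)"
    by (rule lin_on_U2) (rule conv_CB[OF c1])
  show "continuous_map W.Bsp W.Bsp (U_diamond d t c\<^sub>1)"
    unfolding W.Bsp_def
  proof (rule continuous_map_proj_lim, fold W.Bsp_def)
    fix a :: real assume a: "0 < a"
    obtain a\<^sub>2 where a2: "0 < a\<^sub>2" and k: "\<forall>b\<^sub>2>0. \<exists>a\<^sub>1>0. \<exists>b>0. \<exists>K\<ge>0. \<forall>c\<^sub>1\<in>topspace (U.Xb b\<^sub>1).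
        \<forall>c\<^sub>2\<in>ell_sup (Lam d) (w a\<^sub>2 b\<^sub>2). step_bound t a\<^sub>1 b\<^sub>1 a\<^sub>2 b\<^sub>2 a b K c\<^sub>1 c\<^sub>2"
      using bound_CB[OF b1(1) a, of t] by blast
    \<comment> \<open>By \<open>zero_b\<close> this set is the same for every \<open>b\<close>, so
      it may be defined with \<open>b = 1\<close>.\<close>
    define D where "D = {\<alpha> \<in> Lam d. 0 < w a 1 \<alpha>}"
    have D: "\<alpha> \<in> D \<longleftrightarrow> 0 < w a b \<alpha>" if "\<alpha> \<in> Lam d" "0 < b" for \<alpha> b
      using W.zero_b[OF a that(2) zero_less_one that(1)] W.zero_b[OF a zero_less_one that(2,1)] that(1)
      by (auto simp: D_def zero_less_iff_neq_zero)
    \<comment> \<open>\<open>g\<close> is \<open>U_diamond\<close> with the entries outside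
      \<open>D\<close> erased. It is linear and continuous on all of
      \<open>Ya a\<^sub>2\<close>.\<close>
    define g where "g c = (\<lambda>\<alpha>. if \<alpha> \<in> D then U_diamond d t c\<^sub>1 c \<alpha> else 0)" for c
    have g_seqs: "g c \<in> seqs (Lam d)" for c by (simp add: seqs_def g_def D_def)
    have conv: "conv d c\<^sub>1 c \<alpha>" if c: "c \<in> topspace (W.Ya a\<^sub>2)" and \<alpha>: "\<alpha> \<in> Lam d" "\<alpha> \<in> D" for c \<alpha>
    proof -
      obtain b\<^sub>2 where b2: "0 < b\<^sub>2" "c \<in> ell_sup (Lam d) (w a\<^sub>2 b\<^sub>2)" using c by (auto simp: W.topspace_Ya)
      obtain a\<^sub>1 b K where K: "0 < b" "step_bound t a\<^sub>1 b\<^sub>1 a\<^sub>2 b\<^sub>2 a b K c\<^sub>1 c" using k b1(2) b2 by blast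
      show ?thesis using D[OF \<alpha>(1) K(1)] \<alpha>(2) by (intro step_bound_conv[OF K(2) \<alpha>(1)]) simp
    qed
    have g_lin: "lin_on (topspace (W.Ya a\<^sub>2)) g"
      unfolding lin_on_def
    proof (intro conjI ballI allI ext)
      fix c \<alpha> and z :: complex
      show "g (\<lambda>\<alpha>. z * c \<alpha>) \<alpha> = z * g c \<alpha>" by (simp add: g_def U_diamond_scale2)
      fix c' assume c: "c \<in> topspace (W.Ya a\<^sub>2)" "c' \<in> topspace (W.Ya a\<^sub>2)"
      show "g (c + c') \<alpha> = (g c + g c') \<alpha>"
        using U_diamond_add2[where D = D and \<alpha> = \<alpha> and d = d and t = t, OF conv[OF c(1)] conv[OF c(2)]]
        by (simp add: g_def)
    qed
    have g_cont: "continuous_map (W.Ya a\<^sub>2) (W.Ya a) g"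
      unfolding W.Ya_def[of a\<^sub>2]
    proof (rule continuous_map_ind_lim_linear[OF W.lc_Ya[OF a2, unfolded W.Ya_def] W.lc_Ya[OF a]])
      show "lin_on (\<Union>r\<in>{0<..}. topspace (sup_top (Lam d) (w a\<^sub>2 r))) g"
        using g_lin by (simp add: W.topspace_Ya)
      fix b\<^sub>2 :: real assume b2: "0 < b\<^sub>2"
      obtain a\<^sub>1 b K where K: "0 < a\<^sub>1" "0 < b" "0 \<le> K" "\<forall>c\<^sub>1\<in>topspace (U.Xb b\<^sub>1).
          \<forall>c\<^sub>2\<in>ell_sup (Lam d) (w a\<^sub>2 b\<^sub>2). step_bound t a\<^sub>1 b\<^sub>1 a\<^sub>2 b\<^sub>2 a b K c\<^sub>1 c\<^sub>2" using k b2 by blast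
      have "continuous_map (sup_top (Lam d) (w a\<^sub>2 b\<^sub>2)) (sup_top (Lam d) (w a b)) g"
      proof (rule continuous_map_sup_top[OF lc_sup_top, where p = "nrm (Lam d) (w a\<^sub>2 b\<^sub>2)"
            and K = "K * nrm (Lam d) (u a\<^sub>1 b\<^sub>1) c\<^sub>1"])
        show "lin_on (topspace (sup_top (Lam d) (w a\<^sub>2 b\<^sub>2))) g"
          by (rule lin_on_subset[OF g_lin]) (use b2 in \<open>auto simp: W.topspace_Ya\<close>)
        fix c \<alpha> assume "c \<in> topspace (sup_top (Lam d) (w a\<^sub>2 b\<^sub>2))" and \<alpha>: "\<alpha> \<in> Lam d"
        then have "step_bound t a\<^sub>1 b\<^sub>1 a\<^sub>2 b\<^sub>2 a b K c\<^sub>1 c" using K(4) b1(2) by simp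
        from step_bound_le[OF this \<alpha>]
        show "ennreal (norm (g c \<alpha>)) * w a b \<alpha> \<le>
            ennreal (K * nrm (Lam d) (u a\<^sub>1 b\<^sub>1) c\<^sub>1 * nrm (Lam d) (w a\<^sub>2 b\<^sub>2) c)" by (simp add: g_def)
      qed (use K(3) in \<open>simp_all add: g_seqs seminorm_nrm continuous_nrm nrm_nonneg\<close>)
      from continuous_map_compose[OF this W.Ya_in[OF K(2)]]
      show "continuous_map (sup_top (Lam d) (w a\<^sub>2 b\<^sub>2)) (W.Ya a) g" by (simp add: o_def)
    qed
    have f_in: "U_diamond d t c\<^sub>1 c \<in> topspace (W.Ya a)" if c: "c \<in> topspace W.Bsp" for c
    proof -
      obtain b\<^sub>2 where b2: "0 < b\<^sub>2" "c \<in> ell_sup (Lam d) (w a\<^sub>2 b\<^sub>2)" using c a2 by (auto simp: W.topspace_Bsp)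
      obtain a\<^sub>1 b K where K: "0 < b" "step_bound t a\<^sub>1 b\<^sub>1 a\<^sub>2 b\<^sub>2 a b K c\<^sub>1 c" using k b1(2) b2 by blast
      have "U_diamond d t c\<^sub>1 c \<in> ell_sup (Lam d) (w a b)"
        by (rule ell_supI[OF U_diamond_seqs step_bound_le[OF K(2)]])
      then show ?thesis using K(1) by (auto simp: W.topspace_Ya)
    qed
    have Bsp_Ya: "c \<in> topspace (W.Ya a\<^sub>2)" if "c \<in> topspace W.Bsp" for c
      using that a2 by (auto simp: W.topspace_Bsp W.topspace_Ya)
    have g_in: "g c \<in> topspace (W.Ya a)" if "c \<in> topspace W.Bsp" for c
      using g_cont Bsp_Ya[OF that] by (auto simp: continuous_map_def)
    show "continuous_map W.Bsp (W.Ya a) (U_diamond d t c\<^sub>1)"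
    proof (rule lc_continuous_linear[OF W.lc_Bsp W.lc_Ya[OF a] lin])
      show "U_diamond d t c\<^sub>1 \<in> topspace W.Bsp \<rightarrow> topspace (W.Ya a)" using f_in by blast
      fix q assume q: "q \<in> {q. lim_seminorm (\<lambda>b. sup_top (Lam d) (w a b)) q}"
      note sq = lc_seminorm[OF W.lc_Ya[OF a] q] and vs = lc_vsub[OF W.lc_Ya[OF a]]
      \<comment> \<open>On each step \<open>q\<close> is bounded by a multiple of the norm, and the
        norm vanishes on sequences that are 0 on \<open>D\<close>.\<close>
      have zero: "q z = 0" if z: "z \<in> topspace (W.Ya a)" "\<And>\<alpha>. \<alpha> \<in> D \<Longrightarrow> z \<alpha> = 0" for z
      proof -
        obtain b where b: "0 < b" "z \<in> ell_sup (Lam d) (w a b)" using z(1) by (auto simp: W.topspace_Ya)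
        have "seminorm_on (ell_sup (Lam d) (w a b)) q" "continuous_map (sup_top (Lam d) (w a b)) euclideanreal q"
          using q lim_seminorm_restrict[of "\<lambda>b. sup_top (Lam d) (w a b)" q b] b(1) by simp_all
        then obtain M where M: "0 < M" "\<forall>c\<in>ell_sup (Lam d) (w a b). q c \<le> M * nrm (Lam d) (w a b) c"
          using sup_top_dominated by blast
        have "nrm (Lam d) (w a b) z \<le> 0"
        proof (rule nrm_le)
          fix \<alpha> assume \<alpha>: "\<alpha> \<in> Lam d"
          have "z \<alpha> = 0 \<or> w a b \<alpha> = 0"
            using D[OF \<alpha> b(1)] z(2)[of \<alpha>] by (auto simp: zero_less_iff_neq_zero)
          then show "ennreal (norm (z \<alpha>)) * w a b \<alpha> \<le> ennreal 0" by auto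
        qed simp
        then have "q z \<le> 0" using M b(2) mult_nonneg_nonpos[of M "nrm (Lam d) (w a b) z"] by force
        then show ?thesis using seminorm_on_nonneg[OF sq z(1)] by simp
      qed
      have eq: "q (g c) = q (U_diamond d t c\<^sub>1 c)" if c: "c \<in> topspace W.Bsp" for c
      proof -
        let ?f = "U_diamond d t c\<^sub>1 c"
        have "q (g c - ?f) = 0" "q (?f - g c) = 0"
          by (rule zero[OF vsub_diff[OF vs g_in[OF c] f_in[OF c]]], simp add: g_def)
             (rule zero[OF vsub_diff[OF vs f_in[OF c] g_in[OF c]]], simp add: g_def)
        then show ?thesis
          using seminorm_on_le_diff[OF vs sq g_in[OF c] f_in[OF c]]
            seminorm_on_le_diff[OF vs sq f_in[OF c] g_in[OF c]] by linarith
      qed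
      \<comment> \<open>By \<open>eq\<close> the seminorm of
        \<open>U_diamond d t c\<^sub>1 c\<close> agrees on \<open>Bsp\<close> with this continuous
        function.\<close>
      have "continuous_map W.Bsp euclideanreal (q \<circ> (g \<circ> id))"
        by (rule continuous_map_compose[OF continuous_map_compose[OF W.Bsp_in[OF a2] g_cont]
              lc_member_continuous[OF W.lc_Ya[OF a] q]])
      then show "continuous_map W.Bsp euclideanreal (\<lambda>c. q (U_diamond d t c\<^sub>1 c))"
        by (rule continuous_map_eq) (simp add: eq)
    qed
  qed
qed

theorem extendable_CB: "U_extendable d t U.Csp W.Bsp W.Bsp"
  unfolding U_extendable_def
proof (rule uniquely_extendableI[OF U.ell0_subset(2) W.ell0_subset(1) W.ell0_subset(1)
      U.dense_Csp W.dense_Bsp W.Hausdorff_Bsp separately_continuous_CB])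
  show "jointly_sequentially_continuous U.Csp W.Bsp W.Bsp (U_diamond d t)"
  proof (rule jointly_sequentially_continuous_bilinear'[OF U.lc_Csp W.lc_Bsp W.lc_Bsp _ _
        separately_continuous_CB U.barrelled_Csp])
    show "lin_on (topspace W.Bsp) (U_diamond d t x)" if "x \<in> topspace U.Csp" for x
      by (rule lin_on_U2) (rule conv_CB[OF that])
    show "lin_on (topspace U.Csp) (\<lambda>x. U_diamond d t x y)" if "y \<in> topspace W.Bsp" for y
      by (rule lin_on_U1) (rule conv_CB[OF _ that])
  qed
qed

end

section \<open>Product weights\<close>

text \<open>The sum is a product of \<open>n\<close> geometric series; the bijection in the
  induction step separates the last coordinate.\<close>

lemma summable_multi: "(\<lambda>\<alpha>. (1 / 2 :: real) ^ mdeg n \<alpha>) summable_on multi n"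
proof (induction n)
  case 0
  have "multi 0 = {\<lambda>_. 0}" by (auto simp: multi_def)
  then show ?case by simp
next
  case (Suc n)
  let ?h = "\<lambda>(\<alpha>, k). \<alpha>(n := k :: nat)"
  have bij: "bij_betw ?h (multi n \<times> UNIV) (multi (Suc n))"
  proof (rule bij_betw_byWitness[where f' = "\<lambda>\<alpha>. (\<alpha>(n := 0), \<alpha> n)"])
    show "\<forall>a\<in>multi n \<times> UNIV. (\<lambda>\<alpha>. (\<alpha>(n := 0), \<alpha> n)) (?h a) = a"
      by (auto simp: multi_def fun_eq_iff)
  qed (auto simp: multi_def)
  have geo: "((\<lambda>k. (1 / 2 :: real) ^ k) has_sum 2) UNIV"
  proof -
    have "(\<lambda>k. (1 / 2 :: real) ^ k) sums (1 / (1 - 1 / 2))" by (rule geometric_sums) simp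
    then show ?thesis
      by (intro norm_summable_imp_has_sum) (auto simp: power_abs summable_geometric)
  qed
  have "(\<lambda>a. (1 / 2 :: real) ^ mdeg (Suc n) (?h a)) summable_on multi n \<times> UNIV"
  proof (rule summable_on_SigmaI)
    fix \<alpha> :: midx
    have "mdeg (Suc n) (?h (\<alpha>, k)) = mdeg n \<alpha> + k" for k by (simp add: mdeg_def)
    then show "((\<lambda>k. (1 / 2 :: real) ^ mdeg (Suc n) (?h (\<alpha>, k))) has_sum (1 / 2) ^ mdeg n \<alpha> * 2) UNIV"
      using has_sum_cmult_right[OF geo, of "(1 / 2) ^ mdeg n \<alpha>"] by (simp add: power_add)
    show "(\<lambda>\<alpha>. (1 / 2) ^ mdeg n \<alpha> * (2 :: real)) summable_on multi n"
      by (rule summable_on_cmult_left[OF Suc.IH])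
  qed auto
  then show ?case
    using summable_on_reindex_bij_betw[OF bij, of "\<lambda>\<alpha>. (1 / 2 :: real) ^ mdeg (Suc n) \<alpha>"] by simp
qed

lemma summable_Lam: "(\<lambda>\<alpha>. (1 / 2 :: real) ^ deg2 d \<alpha>) summable_on Lam d"
  unfolding Lam_def
proof (rule summable_on_SigmaI)
  fix \<alpha> :: midx
  show "((\<lambda>\<beta>. (1 / 2 :: real) ^ deg2 d (\<alpha>, \<beta>)) has_sum
      (1 / 2) ^ mdeg (fst d) \<alpha> * infsum (\<lambda>\<beta>. (1 / 2) ^ mdeg (snd d) \<beta>) (multi (snd d))) (multi (snd d))"
    using has_sum_cmult_right[OF has_sum_infsum[OF summable_multi], of "(1 / 2) ^ mdeg (fst d) \<alpha>" "snd d"]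
    by (simp add: deg2_def power_add)
  show "(\<lambda>\<alpha>. (1 / 2) ^ mdeg (fst d) \<alpha> * infsum (\<lambda>\<beta>. (1 / 2 :: real) ^ mdeg (snd d) \<beta>) (multi (snd d)))
      summable_on multi (fst d)"
    by (rule summable_on_cmult_left[OF summable_multi])
qed auto

lemma finite_multi: "finite {\<alpha> \<in> multi m. mdeg m \<alpha> \<le> n}"
proof (rule finite_subset)
  show "finite {f :: midx. \<forall>x. (x \<in> {..<m} \<longrightarrow> f x \<in> {..n}) \<and> (x \<notin> {..<m} \<longrightarrow> f x = 0)}"
    by (intro finite_set_of_finite_funs) auto
  have "\<alpha> x \<le> n" if "mdeg m \<alpha> \<le> n" "x < m" for \<alpha> :: midx and x
    using member_le_sum[of x "{..<m}" \<alpha>] that by (simp add: mdeg_def)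
  then show "{\<alpha> \<in> multi m. mdeg m \<alpha> \<le> n} \<subseteq>
      {f. \<forall>x. (x \<in> {..<m} \<longrightarrow> f x \<in> {..n}) \<and> (x \<notin> {..<m} \<longrightarrow> f x = 0)}"
    by (auto simp: multi_def)
qed

lemma finite_Lam: "finite {\<alpha> \<in> Lam d. deg2 d \<alpha> \<le> n}"
proof (rule finite_subset)
  show "finite ({\<alpha> \<in> multi (fst d). mdeg (fst d) \<alpha> \<le> n} \<times> {\<alpha> \<in> multi (snd d). mdeg (snd d) \<alpha> \<le> n})"
    by (intro finite_cartesian_product finite_multi)
qed (auto simp: Lam_def deg2_def)

section \<open>Reciprocals in inequalities with infinite values\<close>

lemma ennreal_inverse_antimono: "x \<le> y \<Longrightarrow> inverse y \<le> inverse (x :: ennreal)"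
proof (cases "x = 0 \<or> y = top")
  case False
  assume le: "x \<le> y"
  then have "x \<noteq> top" using False by (auto simp: top_unique)
  then obtain x' y' where "x = ennreal x'" "0 < x'" "y = ennreal y'"
    using False by (cases x; cases y) (auto simp: less_le)
  moreover from this have "x' \<le> y'" using le by (cases "0 \<le> y'") (auto simp: ennreal_neg)
  ultimately show ?thesis by (simp add: inverse_ennreal ennreal_leI le_imp_inverse_le)
qed auto

text \<open>An infinite \<open>y\<close> makes the left side 0; otherwise the hypothesis forces
  \<open>x\<close> to be finite, and the claim is an inequality of positive reals.\<close>

lemma ennreal_inverse_bound:
  fixes x y z :: ennreal
  assumes le: "ennreal r * x \<le> ennreal M * (y * z)" and r: "0 < r" and M: "0 \<le> M"
    and pos: "0 < x" "0 < y" "0 < z" "z \<noteq> top"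
  shows "ennreal r * inverse y \<le> ennreal M * (z * inverse x)"
proof (cases "y = top")
  case False
  then obtain y' z' where y: "y = ennreal y'" "0 < y'" and z: "z = ennreal z'" "0 < z'"
    using pos by (cases y; cases z) auto
  have "ennreal M * (y * z) < top" using y z by (simp add: ennreal_mult_less_top)
  then have "ennreal r * x < top" using le by (rule order.strict_trans1[rotated])
  then have "x \<noteq> top" using r by (auto simp: ennreal_mult_less_top)
  then obtain x' where x: "x = ennreal x'" "0 < x'" using pos(1) by (cases x) auto
  have "r * x' \<le> M * (y' * z')"
    using le r M x(2) y(2) z(2) unfolding x y z by (simp add: ennreal_mult[symmetric])
  then have "r * inverse y' \<le> M * (z' * inverse x')"
    using x(2) y(2) by (simp add: field_simps)
  then show ?thesis
    using r M x(2) y(2) z(2) unfolding x y z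
    by (simp add: inverse_ennreal ennreal_mult[symmetric] ennreal_leI)
qed simp

text \<open>A finite right side together with positive \<open>x\<close> and \<open>y\<close> forces
  both of them to be finite.\<close>

lemma ennreal_inverse_bound':
  fixes x y z :: ennreal
  assumes le: "ennreal r * (x * y) \<le> ennreal M * z" and r: "0 < r" and M: "0 \<le> M"
    and pos: "0 < x" "0 < y" "z \<noteq> top"
  shows "y \<noteq> top" "ennreal r * x \<le> ennreal M * (inverse y * z)"
proof -
  have "ennreal M * z < top" using pos(3) by (simp add: ennreal_mult_less_top less_top)
  then have "ennreal r * (x * y) < top" using le by (rule order.strict_trans1[rotated])
  then have "x * y < top" using r by (auto simp: ennreal_mult_less_top)
  then have xy: "x \<noteq> top" "y \<noteq> top" using pos by (auto simp: ennreal_mult_less_top)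
  then obtain x' y' z' where x: "x = ennreal x'" "0 < x'" and y: "y = ennreal y'" "0 < y'"
    and z: "z = ennreal z'" "0 \<le> z'"
    using pos by (cases x; cases y; cases z) auto
  show "y \<noteq> top" by (rule xy)
  have "r * (x' * y') \<le> M * z'"
    using le r M x(2) y(2) z(2) unfolding x y z by (simp add: ennreal_mult[symmetric])
  then have "r * x' \<le> M * (inverse y' * z')"
    using y(2) by (simp add: field_simps)
  then show "ennreal r * x \<le> ennreal M * (inverse y * z)"
    using r M x(2) y(2) z(2) unfolding x y z
    by (simp add: inverse_ennreal ennreal_mult[symmetric] ennreal_leI)
qed

text \<open>The factor \<open>R\<close> absorbs \<open>t\<close>, the binomial coefficients and the geometric decay that makes the
  series summable.\<close>

definition super_at :: "nat \<Rightarrow> (real \<Rightarrow> midx \<Rightarrow> ennreal) \<Rightarrow> real \<Rightarrow> real \<Rightarrow> real \<Rightarrow> real \<Rightarrow> bool" where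
  "super_at n I R c b M \<longleftrightarrow>
     (\<forall>\<alpha> \<gamma>. ennreal (R ^ (mdeg n \<alpha> + mdeg n \<gamma>)) * (I c \<alpha> * I c \<gamma>) \<le> ennreal M * I b (\<alpha> + \<gamma>))"

definition sub_at :: "nat \<Rightarrow> (real \<Rightarrow> midx \<Rightarrow> ennreal) \<Rightarrow> real \<Rightarrow> real \<Rightarrow> real \<Rightarrow> real \<Rightarrow> bool" where
  "sub_at n I R a c M \<longleftrightarrow>
     (\<forall>\<alpha> \<gamma>. ennreal (R ^ (mdeg n \<alpha> + mdeg n \<gamma>)) * I a (\<alpha> + \<gamma>) \<le> ennreal M * (I c \<alpha> * I c \<gamma>))"

text \<open>Instances are \<open>vtheta\<close>, with its parameter reversed where it increases, and
  \<open>1 / vtheta\<close>. Infinite values occur for the index 0 only, where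
  \<open>I r \<alpha>\<close> becomes finite as soon as \<open>r\<close> reaches the degree; hence
  the form of \<open>fin\<close>.\<close>

locale factor =
  fixes n :: nat and I :: "real \<Rightarrow> midx \<Rightarrow> ennreal"
  assumes anti: "0 < r \<Longrightarrow> r \<le> r' \<Longrightarrow> I r' \<alpha> \<le> I r \<alpha>"
    and pos: "0 < r \<Longrightarrow> 0 < I r \<alpha>"
    and fin: "\<exists>r>0. I r \<alpha> < top"
    and one: "0 < r \<Longrightarrow> I r 0 = 1"
    and super: "1 \<le> R \<Longrightarrow> 0 < b \<Longrightarrow> \<exists>c>0. \<exists>M\<ge>0. super_at n I R c b M"
    and sub: "1 \<le> R \<Longrightarrow> 0 < c \<Longrightarrow> \<exists>a>0. \<exists>M\<ge>0. sub_at n I R a c M"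
begin

lemma super_at_mono:
  assumes "super_at n I R c b M" "0 < c" "c \<le> c'" "M \<le> M'"
  shows "super_at n I R c' b M'"
  unfolding super_at_def
proof (intro allI)
  fix \<alpha> \<gamma>
  have "ennreal (R ^ (mdeg n \<alpha> + mdeg n \<gamma>)) * (I c' \<alpha> * I c' \<gamma>) \<le>
      ennreal (R ^ (mdeg n \<alpha> + mdeg n \<gamma>)) * (I c \<alpha> * I c \<gamma>)"
    using assms(2,3) by (intro mult_left_mono mult_mono anti) auto
  also have "\<dots> \<le> ennreal M * I b (\<alpha> + \<gamma>)" using assms(1) by (simp add: super_at_def)
  also have "\<dots> \<le> ennreal M' * I b (\<alpha> + \<gamma>)" using assms(4) by (intro mult_right_mono ennreal_leI) auto
  finally show "ennreal (R ^ (mdeg n \<alpha> + mdeg n \<gamma>)) * (I c' \<alpha> * I c' \<gamma>) \<le> ennreal M' * I b (\<alpha> + \<gamma>)" .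
qed

lemma sub_at_mono:
  assumes "sub_at n I R a c M" "0 < a" "a \<le> a'" "M \<le> M'"
  shows "sub_at n I R a' c M'"
  unfolding sub_at_def
proof (intro allI)
  fix \<alpha> \<gamma>
  have "ennreal (R ^ (mdeg n \<alpha> + mdeg n \<gamma>)) * I a' (\<alpha> + \<gamma>) \<le>
      ennreal (R ^ (mdeg n \<alpha> + mdeg n \<gamma>)) * I a (\<alpha> + \<gamma>)"
    using assms(2,3) by (intro mult_left_mono anti) auto
  also have "\<dots> \<le> ennreal M * (I c \<alpha> * I c \<gamma>)" using assms(1) by (simp add: sub_at_def)
  also have "\<dots> \<le> ennreal M' * (I c \<alpha> * I c \<gamma>)" using assms(4) by (intro mult_right_mono ennreal_leI) auto
  finally show "ennreal (R ^ (mdeg n \<alpha> + mdeg n \<gamma>)) * I a' (\<alpha> + \<gamma>) \<le> ennreal M' * (I c \<alpha> * I c \<gamma>)" .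
qed

end

text \<open>The flag says how a variable enters a weight: with \<open>I\<close>, in the parameter \<open>b\<close> of the inductive
  limit, or with \<open>1/I\<close>, in the parameter \<open>a\<close> of the projective limit. The \<open>\<A>\<close>-, \<open>\<B>\<close>- and
  \<open>\<C>\<close>-spaces are the four combinations of flags, and a space and its \<open>\<star>\<close>-version have
  opposite flags.\<close>

definition fw :: "bool \<Rightarrow> (real \<Rightarrow> midx \<Rightarrow> ennreal) \<Rightarrow> real \<Rightarrow> real \<Rightarrow> midx \<Rightarrow> ennreal" where
  "fw k I a b \<alpha> = (if k then I b \<alpha> else inverse (I a \<alpha>))"

definition pw :: "bool \<Rightarrow> bool \<Rightarrow> (real \<Rightarrow> midx \<Rightarrow> ennreal) \<Rightarrow> (real \<Rightarrow> midx \<Rightarrow> ennreal) \<Rightarrow>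
    real \<Rightarrow> real \<Rightarrow> midx \<times> midx \<Rightarrow> ennreal" where
  "pw k\<^sub>2 k\<^sub>1 I\<^sub>2 I\<^sub>1 a b \<alpha> = fw k\<^sub>2 I\<^sub>2 a b (fst \<alpha>) * fw k\<^sub>1 I\<^sub>1 a b (snd \<alpha>)"

section \<open>Weights of one variable with a flag\<close>

context factor
begin

lemma fw_mono_a: "0 < a \<Longrightarrow> a \<le> a' \<Longrightarrow> fw k I a b \<alpha> \<le> fw k I a' b \<alpha>"
  by (auto simp: fw_def intro!: ennreal_inverse_antimono anti)

lemma fw_mono_b: "0 < b \<Longrightarrow> b \<le> b' \<Longrightarrow> fw k I a b' \<alpha> \<le> fw k I a b \<alpha>"
  by (auto simp: fw_def intro!: anti)

lemma fw_finite:
  obtains b where "0 < b" "\<And>a b'. 0 < a \<Longrightarrow> b \<le> b' \<Longrightarrow> fw k I a b' \<alpha> < top"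
proof -
  obtain b where b: "0 < b" "I b \<alpha> < top" using fin by blast
  have "fw k I a b' \<alpha> < top" if "0 < a" "b \<le> b'" for a b'
    using order.strict_trans1[OF anti[OF b(1) that(2)] b(2)] pos[OF that(1), of \<alpha>]
    by (auto simp: fw_def less_top[symmetric])
  then show thesis using that b(1) by blast
qed

lemma fw_pos:
  obtains a where "0 < a" "\<And>a' b. 0 < b \<Longrightarrow> a \<le> a' \<Longrightarrow> 0 < fw k I a' b \<alpha>"
proof -
  obtain a where a: "0 < a" "I a \<alpha> < top" using fin by blast
  have "0 < fw k I a' b \<alpha>" if "0 < b" "a \<le> a'" for a' b
    using order.strict_trans1[OF anti[OF a(1) that(2)] a(2)] pos[OF that(1), of \<alpha>]
    by (auto simp: fw_def ennreal_inverse_positive)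
  then show thesis using that a(1) by blast
qed

lemma fw_zero: "0 < b \<Longrightarrow> 0 < b' \<Longrightarrow> fw k I a b \<alpha> = 0 \<Longrightarrow> fw k I a b' \<alpha> = 0"
  using pos[of b \<alpha>] by (auto simp: fw_def split: if_splits)

lemma fw_gain:
  assumes R: "1 \<le> R" and c: "0 < c" "super_at n I R c b M" and a': "0 < a'" "sub_at n I R a' a M"
    and ab: "0 < a" "0 < b" and M: "0 \<le> M"
  shows "ennreal (R ^ mdeg n \<alpha>) * fw k I a c \<alpha> \<le> ennreal M * fw k I a' b \<alpha>"
proof (cases k)
  case True
  have "ennreal (R ^ (mdeg n \<alpha> + mdeg n 0)) * (I c \<alpha> * I c 0) \<le> ennreal M * I b (\<alpha> + 0)"
    using c(2) unfolding super_at_def by blast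
  then show ?thesis using True c(1) by (simp add: fw_def one mdeg_def)
next
  case False
  have "ennreal (R ^ (mdeg n \<alpha> + mdeg n 0)) * I a' (\<alpha> + 0) \<le> ennreal M * (I a \<alpha> * I a 0)"
    using a'(2) unfolding sub_at_def by blast
  then have "ennreal (R ^ mdeg n \<alpha>) * I a' \<alpha> \<le> ennreal M * (I a \<alpha> * 1)"
    using ab(1) by (simp add: one mdeg_def)
  then have "ennreal (R ^ mdeg n \<alpha>) * inverse (I a \<alpha>) \<le> ennreal M * (1 * inverse (I a' \<alpha>))"
    using R M a'(1) ab(1) by (intro ennreal_inverse_bound pos) auto
  then show ?thesis using False by (simp add: fw_def)
qed

text \<open>For \<open>k\<close> this is \<open>sub_at\<close> at the index \<open>e\<close>, which
  is at least \<open>b\<^sub>1\<close> and \<open>a\<close>, after taking reciprocals; for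
  \<open>\<not> k\<close> it is \<open>super_at\<close> with one value of \<open>I\<close> moved
  across. The positivity claims serve to exclude infinity times 0 when two variables are
  combined.\<close>

lemma fw_kernel:
  assumes R: "1 \<le> R" and M: "0 \<le> M" and S: "0 < c" "super_at n I R c b\<^sub>2 M"
    and T: "0 < a\<^sub>2" "sub_at n I R a\<^sub>2 e M" "b\<^sub>1 \<le> e" "a \<le> e"
    and pos': "0 < b\<^sub>1" "0 < a" "0 < b\<^sub>2"
  shows "(k \<and> I b\<^sub>1 \<gamma> = top) \<or> (\<not> k \<and> I b\<^sub>2 (\<alpha> + \<gamma>) = top) \<or>
    (0 < fw k I c b\<^sub>1 \<gamma> \<and> (0 < fw (\<not> k) I a c \<alpha> \<longrightarrow> 0 < fw (\<not> k) I a\<^sub>2 b\<^sub>2 (\<alpha> + \<gamma>)) \<and>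
     ennreal (R ^ (mdeg n \<alpha> + mdeg n \<gamma>)) * fw (\<not> k) I a c \<alpha> \<le>
       ennreal M * (fw k I c b\<^sub>1 \<gamma> * fw (\<not> k) I a\<^sub>2 b\<^sub>2 (\<alpha> + \<gamma>)))"
proof -
  define r where "r = R ^ (mdeg n \<alpha> + mdeg n \<gamma>)"
  have r: "0 < r" using R by (simp add: r_def)
  show ?thesis
  proof (cases k)
    case True
    have "ennreal r * I a\<^sub>2 (\<alpha> + \<gamma>) \<le> ennreal M * (I e \<alpha> * I e \<gamma>)"
      using T(2) by (simp add: sub_at_def r_def)
    also have "\<dots> \<le> ennreal M * (I a \<alpha> * I b\<^sub>1 \<gamma>)"
      using T(3,4) pos' by (intro mult_left_mono mult_mono anti) auto
    finally have le: "ennreal r * I a\<^sub>2 (\<alpha> + \<gamma>) \<le> ennreal M * (I a \<alpha> * I b\<^sub>1 \<gamma>)" .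
    have "0 < inverse (I a\<^sub>2 (\<alpha> + \<gamma>))" if "I b\<^sub>1 \<gamma> \<noteq> top" "0 < inverse (I a \<alpha>)"
    proof -
      have "ennreal M * (I a \<alpha> * I b\<^sub>1 \<gamma>) < top"
        using that by (simp add: ennreal_mult_less_top ennreal_inverse_positive less_top)
      then have "ennreal r * I a\<^sub>2 (\<alpha> + \<gamma>) < top" using le by (rule order.strict_trans1[rotated])
      then show ?thesis using r by (auto simp: ennreal_mult_less_top ennreal_inverse_positive)
    qed
    moreover have "ennreal r * inverse (I a \<alpha>) \<le> ennreal M * (I b\<^sub>1 \<gamma> * inverse (I a\<^sub>2 (\<alpha> + \<gamma>)))"
      if "I b\<^sub>1 \<gamma> \<noteq> top"
      by (rule ennreal_inverse_bound[OF le r M]) (use pos T(1) pos' that in auto)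
    ultimately show ?thesis using True pos[OF pos'(1)] by (auto simp: fw_def r_def)
  next
    case False
    have le: "ennreal r * (I c \<alpha> * I c \<gamma>) \<le> ennreal M * I b\<^sub>2 (\<alpha> + \<gamma>)"
      using S(2) by (simp add: super_at_def r_def)
    have "I c \<gamma> \<noteq> top" "ennreal r * I c \<alpha> \<le> ennreal M * (inverse (I c \<gamma>) * I b\<^sub>2 (\<alpha> + \<gamma>))"
      if "I b\<^sub>2 (\<alpha> + \<gamma>) \<noteq> top"
      by (rule ennreal_inverse_bound'[OF le r M pos[OF S(1)] pos[OF S(1)] that])+
    then show ?thesis using False pos[OF pos'(3)] by (auto simp: fw_def r_def ennreal_inverse_positive)
  qed
qed

end

section \<open>Products over the two variables\<close>

locale factors = F2: factor "fst d" I\<^sub>2 + F1: factor "snd d" I\<^sub>1 for d I\<^sub>2 I\<^sub>1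
begin

lemma super_both:
  assumes "1 \<le> R" "0 < b"
  shows "\<exists>c>0. \<exists>M\<ge>0. super_at (fst d) I\<^sub>2 R c b M \<and> super_at (snd d) I\<^sub>1 R c b M"
proof -
  obtain c\<^sub>2 M\<^sub>2 where 2: "0 < c\<^sub>2" "0 \<le> M\<^sub>2" "super_at (fst d) I\<^sub>2 R c\<^sub>2 b M\<^sub>2" using F2.super[OF assms] by blast
  obtain c\<^sub>1 M\<^sub>1 where 1: "0 < c\<^sub>1" "0 \<le> M\<^sub>1" "super_at (snd d) I\<^sub>1 R c\<^sub>1 b M\<^sub>1" using F1.super[OF assms] by blast
  have "super_at (fst d) I\<^sub>2 R (max c\<^sub>2 c\<^sub>1) b (max M\<^sub>2 M\<^sub>1)"
    by (rule F2.super_at_mono[OF 2(3,1)]) auto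
  moreover have "super_at (snd d) I\<^sub>1 R (max c\<^sub>2 c\<^sub>1) b (max M\<^sub>2 M\<^sub>1)"
    by (rule F1.super_at_mono[OF 1(3,1)]) auto
  ultimately show ?thesis using 1 2 by (intro exI[of _ "max c\<^sub>2 c\<^sub>1"] conjI exI[of _ "max M\<^sub>2 M\<^sub>1"]) auto
qed

lemma sub_both:
  assumes "1 \<le> R" "0 < c"
  shows "\<exists>a>0. \<exists>M\<ge>0. sub_at (fst d) I\<^sub>2 R a c M \<and> sub_at (snd d) I\<^sub>1 R a c M"
proof -
  obtain c\<^sub>2 M\<^sub>2 where 2: "0 < c\<^sub>2" "0 \<le> M\<^sub>2" "sub_at (fst d) I\<^sub>2 R c\<^sub>2 c M\<^sub>2" using F2.sub[OF assms] by blast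
  obtain c\<^sub>1 M\<^sub>1 where 1: "0 < c\<^sub>1" "0 \<le> M\<^sub>1" "sub_at (snd d) I\<^sub>1 R c\<^sub>1 c M\<^sub>1" using F1.sub[OF assms] by blast
  have "sub_at (fst d) I\<^sub>2 R (max c\<^sub>2 c\<^sub>1) c (max M\<^sub>2 M\<^sub>1)"
    by (rule F2.sub_at_mono[OF 2(3,1)]) auto
  moreover have "sub_at (snd d) I\<^sub>1 R (max c\<^sub>2 c\<^sub>1) c (max M\<^sub>2 M\<^sub>1)"
    by (rule F1.sub_at_mono[OF 1(3,1)]) auto
  ultimately show ?thesis using 1 2 by (intro exI[of _ "max c\<^sub>2 c\<^sub>1"] conjI exI[of _ "max M\<^sub>2 M\<^sub>1"]) auto
qed

lemma mult_weighted_le: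
  fixes A A' B B' :: ennreal
  assumes "ennreal x * A \<le> ennreal M * B" "ennreal y * A' \<le> ennreal M' * B'"
    and "0 \<le> x" "0 \<le> y" "0 \<le> M" "0 \<le> M'"
  shows "ennreal (x * y) * (A * A') \<le> ennreal (M * M') * (B * B')"
  using mult_mono[OF assms(1,2)] assms(3-) by (simp add: ennreal_mult ac_simps)

lemma pw_gain:
  assumes R: "1 \<le> R"
  shows "\<exists>\<phi> \<psi> :: real \<Rightarrow> real. \<forall>a>0. \<forall>b>0. 0 < \<phi> b \<and> 0 < \<psi> a \<and>
    (\<exists>M. \<forall>\<alpha>\<in>Lam d. ennreal (R ^ deg2 d \<alpha>) * pw k\<^sub>2 k\<^sub>1 I\<^sub>2 I\<^sub>1 a (\<phi> b) \<alpha> \<le>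
      ennreal M * pw k\<^sub>2 k\<^sub>1 I\<^sub>2 I\<^sub>1 (\<psi> a) b \<alpha>)"
proof -
  \<comment> \<open>One choice function for each parameter, so that \<open>\<phi>\<close> is
    independent of \<open>a\<close> and \<open>\<psi>\<close> of \<open>b\<close>.\<close>
  have "\<exists>\<phi>. \<forall>b>0. 0 < \<phi> b \<and> (\<exists>M\<ge>0. super_at (fst d) I\<^sub>2 R (\<phi> b) b M \<and> super_at (snd d) I\<^sub>1 R (\<phi> b) b M)"
    using super_both[OF R] by (intro choice) blast
  then obtain \<phi> where \<phi>: "\<forall>b>0. 0 < \<phi> b \<and> (\<exists>M\<ge>0. super_at (fst d) I\<^sub>2 R (\<phi> b) b M \<and> super_at (snd d) I\<^sub>1 R (\<phi> b) b M)" ..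
  have "\<exists>\<psi>. \<forall>a>0. 0 < \<psi> a \<and> (\<exists>M\<ge>0. sub_at (fst d) I\<^sub>2 R (\<psi> a) a M \<and> sub_at (snd d) I\<^sub>1 R (\<psi> a) a M)"
    using sub_both[OF R] by (intro choice) blast
  then obtain \<psi> where \<psi>: "\<forall>a>0. 0 < \<psi> a \<and> (\<exists>M\<ge>0. sub_at (fst d) I\<^sub>2 R (\<psi> a) a M \<and> sub_at (snd d) I\<^sub>1 R (\<psi> a) a M)" ..
  have "\<exists>M. \<forall>\<alpha>\<in>Lam d. ennreal (R ^ deg2 d \<alpha>) * pw k\<^sub>2 k\<^sub>1 I\<^sub>2 I\<^sub>1 a (\<phi> b) \<alpha> \<le>
      ennreal M * pw k\<^sub>2 k\<^sub>1 I\<^sub>2 I\<^sub>1 (\<psi> a) b \<alpha>" if ab: "0 < a" "0 < b" for a b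
  proof -
    obtain M where M: "0 < \<phi> b" "0 \<le> M" "super_at (fst d) I\<^sub>2 R (\<phi> b) b M" "super_at (snd d) I\<^sub>1 R (\<phi> b) b M"
      using \<phi> ab(2) by blast
    obtain N where N: "0 < \<psi> a" "0 \<le> N" "sub_at (fst d) I\<^sub>2 R (\<psi> a) a N" "sub_at (snd d) I\<^sub>1 R (\<psi> a) a N"
      using \<psi> ab(1) by blast
    define K where "K = max M N"
    have K: "0 \<le> K" using M by (simp add: K_def)
    have 2: "super_at (fst d) I\<^sub>2 R (\<phi> b) b K" "sub_at (fst d) I\<^sub>2 R (\<psi> a) a K"
      by (rule F2.super_at_mono[OF M(3,1)] F2.sub_at_mono[OF N(3,1)]; simp add: K_def)+
    have 1: "super_at (snd d) I\<^sub>1 R (\<phi> b) b K" "sub_at (snd d) I\<^sub>1 R (\<psi> a) a K"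
      by (rule F1.super_at_mono[OF M(4,1)] F1.sub_at_mono[OF N(4,1)]; simp add: K_def)+
    have "ennreal (R ^ deg2 d \<alpha>) * pw k\<^sub>2 k\<^sub>1 I\<^sub>2 I\<^sub>1 a (\<phi> b) \<alpha> \<le> ennreal (K * K) * pw k\<^sub>2 k\<^sub>1 I\<^sub>2 I\<^sub>1 (\<psi> a) b \<alpha>" for \<alpha>
      unfolding pw_def deg2_def power_add
      by (rule mult_weighted_le[OF F2.fw_gain[OF R M(1) 2(1) N(1) 2(2) ab K]
            F1.fw_gain[OF R M(1) 1(1) N(1) 1(2) ab K]]) (use R K in auto)
    then show ?thesis by blast
  qed
  then have "\<forall>a>0. \<forall>b>0. 0 < \<phi> b \<and> 0 < \<psi> a \<and>
    (\<exists>M. \<forall>\<alpha>\<in>Lam d. ennreal (R ^ deg2 d \<alpha>) * pw k\<^sub>2 k\<^sub>1 I\<^sub>2 I\<^sub>1 a (\<phi> b) \<alpha> \<le>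
      ennreal M * pw k\<^sub>2 k\<^sub>1 I\<^sub>2 I\<^sub>1 (\<psi> a) b \<alpha>)"
    using \<phi> \<psi> by blast
  then show ?thesis by (intro exI)
qed

lemma graded_weights_pw: "graded_weights (Lam d) (pw k\<^sub>2 k\<^sub>1 I\<^sub>2 I\<^sub>1) (deg2 d)"
proof
  fix a a' b :: real and \<alpha> assume "0 < a" "a \<le> a'" "0 < b"
  then show "pw k\<^sub>2 k\<^sub>1 I\<^sub>2 I\<^sub>1 a b \<alpha> \<le> pw k\<^sub>2 k\<^sub>1 I\<^sub>2 I\<^sub>1 a' b \<alpha>"
    unfolding pw_def by (intro mult_mono F2.fw_mono_a F1.fw_mono_a) auto
next
  fix a b b' :: real and \<alpha> assume "0 < b" "b \<le> b'" "0 < a"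
  then show "pw k\<^sub>2 k\<^sub>1 I\<^sub>2 I\<^sub>1 a b' \<alpha> \<le> pw k\<^sub>2 k\<^sub>1 I\<^sub>2 I\<^sub>1 a b \<alpha>"
    unfolding pw_def by (intro mult_mono F2.fw_mono_b F1.fw_mono_b) auto
next
  fix \<alpha> :: "midx \<times> midx"
  obtain b where b: "0 < b" "\<And>a b'. 0 < a \<Longrightarrow> b \<le> b' \<Longrightarrow> fw k\<^sub>2 I\<^sub>2 a b' (fst \<alpha>) < top"
    using F2.fw_finite by metis
  obtain b' where b': "0 < b'" "\<And>a b. 0 < a \<Longrightarrow> b' \<le> b \<Longrightarrow> fw k\<^sub>1 I\<^sub>1 a b (snd \<alpha>) < top"
    using F1.fw_finite by metis
  show "\<exists>b>0. \<forall>a>0. pw k\<^sub>2 k\<^sub>1 I\<^sub>2 I\<^sub>1 a b \<alpha> < top"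
    using b b' by (intro exI[of _ "max b b'"]) (auto simp: pw_def ennreal_mult_less_top)
next
  fix \<alpha> :: "midx \<times> midx"
  obtain a where a: "0 < a" "\<And>a' b. 0 < b \<Longrightarrow> a \<le> a' \<Longrightarrow> 0 < fw k\<^sub>2 I\<^sub>2 a' b (fst \<alpha>)"
    using F2.fw_pos by metis
  obtain a' where a': "0 < a'" "\<And>a b. 0 < b \<Longrightarrow> a' \<le> a \<Longrightarrow> 0 < fw k\<^sub>1 I\<^sub>1 a b (snd \<alpha>)"
    using F1.fw_pos by metis
  show "\<exists>a>0. \<forall>b>0. 0 < pw k\<^sub>2 k\<^sub>1 I\<^sub>2 I\<^sub>1 a b \<alpha>"
    using a a' by (intro exI[of _ "max a a'"]) (auto simp: pw_def ennreal_zero_less_mult_iff)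
next
  fix a b b' :: real and \<alpha> assume "0 < b" "0 < b'" "pw k\<^sub>2 k\<^sub>1 I\<^sub>2 I\<^sub>1 a b \<alpha> = 0"
  then show "pw k\<^sub>2 k\<^sub>1 I\<^sub>2 I\<^sub>1 a b' \<alpha> = 0"
    using F2.fw_zero[of b b' k\<^sub>2 a "fst \<alpha>"] F1.fw_zero[of b b' k\<^sub>1 a "snd \<alpha>"] by (auto simp: pw_def)
qed (rule summable_Lam finite_Lam pw_gain | assumption)+

text \<open>The bounds of the two variables are multiplied, with trouble only where a factor is
  infinite and another may be 0. The conditions \<open>P\<^sub>2\<close>, \<open>P\<^sub>1\<close>
  mark an infinite factor of the first weight, \<open>Q\<^sub>2\<close>, \<open>Q\<^sub>1\<close>
  one of the second.\<close>

lemma pw_kernel: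
  assumes R: "1 \<le> R" and M: "0 \<le> M"
    and S: "0 < c" "super_at (fst d) I\<^sub>2 R c b\<^sub>2 M" "super_at (snd d) I\<^sub>1 R c b\<^sub>2 M"
    and T: "0 < a\<^sub>2" "sub_at (fst d) I\<^sub>2 R a\<^sub>2 e M" "sub_at (snd d) I\<^sub>1 R a\<^sub>2 e M" "b\<^sub>1 \<le> e" "a \<le> e"
    and pos: "0 < b\<^sub>1" "0 < a" "0 < b\<^sub>2"
  shows "BC_bound d (pw k\<^sub>2 k\<^sub>1 I\<^sub>2 I\<^sub>1) (pw (\<not> k\<^sub>2) (\<not> k\<^sub>1) I\<^sub>2 I\<^sub>1) R c b\<^sub>1 a\<^sub>2 b\<^sub>2 a c (M * M)"
    and "CB_bound d (pw k\<^sub>2 k\<^sub>1 I\<^sub>2 I\<^sub>1) (pw (\<not> k\<^sub>2) (\<not> k\<^sub>1) I\<^sub>2 I\<^sub>1) R c b\<^sub>1 a\<^sub>2 b\<^sub>2 a c (M * M)"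
proof -
  let ?u = "pw k\<^sub>2 k\<^sub>1 I\<^sub>2 I\<^sub>1" and ?w = "pw (\<not> k\<^sub>2) (\<not> k\<^sub>1) I\<^sub>2 I\<^sub>1"
  have R0: "0 \<le> R" using R by simp
  have both: "((\<exists>a'>0. ?w a' b\<^sub>2 (\<alpha> + \<gamma>) = top) \<or> ?u c b\<^sub>1 \<gamma> = top \<or>
        ennreal (R ^ (deg2 d \<alpha> + deg2 d \<gamma>)) * ?w a c \<alpha> \<le> ennreal (M * M) * (?u c b\<^sub>1 \<gamma> * ?w a\<^sub>2 b\<^sub>2 (\<alpha> + \<gamma>))) \<and>
      ((\<exists>a'>0. ?u a' b\<^sub>1 \<gamma> = top) \<or> ?w a\<^sub>2 b\<^sub>2 (\<alpha> + \<gamma>) = top \<or>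
        ennreal (R ^ (deg2 d \<alpha> + deg2 d \<gamma>)) * ?w a c \<alpha> \<le> ennreal (M * M) * (?u c b\<^sub>1 \<gamma> * ?w a\<^sub>2 b\<^sub>2 (\<alpha> + \<gamma>)))"
    (is "?BC \<and> ?CB") for \<alpha> \<gamma>
  proof -
    define X\<^sub>2 Y\<^sub>2 Z\<^sub>2 where "X\<^sub>2 = fw k\<^sub>2 I\<^sub>2 c b\<^sub>1 (fst \<gamma>)" and "Y\<^sub>2 = fw (\<not> k\<^sub>2) I\<^sub>2 a\<^sub>2 b\<^sub>2 (fst \<alpha> + fst \<gamma>)"
      and "Z\<^sub>2 = fw (\<not> k\<^sub>2) I\<^sub>2 a c (fst \<alpha>)"
    define X\<^sub>1 Y\<^sub>1 Z\<^sub>1 where "X\<^sub>1 = fw k\<^sub>1 I\<^sub>1 c b\<^sub>1 (snd \<gamma>)" and "Y\<^sub>1 = fw (\<not> k\<^sub>1) I\<^sub>1 a\<^sub>2 b\<^sub>2 (snd \<alpha> + snd \<gamma>)"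
      and "Z\<^sub>1 = fw (\<not> k\<^sub>1) I\<^sub>1 a c (snd \<alpha>)"
    define r\<^sub>2 r\<^sub>1 where "r\<^sub>2 = R ^ (mdeg (fst d) (fst \<alpha>) + mdeg (fst d) (fst \<gamma>))"
      and "r\<^sub>1 = R ^ (mdeg (snd d) (snd \<alpha>) + mdeg (snd d) (snd \<gamma>))"
    have u: "?u c b\<^sub>1 \<gamma> = X\<^sub>2 * X\<^sub>1" and w: "?w a\<^sub>2 b\<^sub>2 (\<alpha> + \<gamma>) = Y\<^sub>2 * Y\<^sub>1" and z: "?w a c \<alpha> = Z\<^sub>2 * Z\<^sub>1"
      and r: "R ^ (deg2 d \<alpha> + deg2 d \<gamma>) = r\<^sub>2 * r\<^sub>1"
      by (simp_all add: pw_def X\<^sub>2_def X\<^sub>1_def Y\<^sub>2_def Y\<^sub>1_def Z\<^sub>2_def Z\<^sub>1_def r\<^sub>2_def r\<^sub>1_def deg2_def power_add)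
    define P\<^sub>2 Q\<^sub>2 where "P\<^sub>2 \<longleftrightarrow> k\<^sub>2 \<and> I\<^sub>2 b\<^sub>1 (fst \<gamma>) = top" and "Q\<^sub>2 \<longleftrightarrow> \<not> k\<^sub>2 \<and> I\<^sub>2 b\<^sub>2 (fst \<alpha> + fst \<gamma>) = top"
    define P\<^sub>1 Q\<^sub>1 where "P\<^sub>1 \<longleftrightarrow> k\<^sub>1 \<and> I\<^sub>1 b\<^sub>1 (snd \<gamma>) = top" and "Q\<^sub>1 \<longleftrightarrow> \<not> k\<^sub>1 \<and> I\<^sub>1 b\<^sub>2 (snd \<alpha> + snd \<gamma>) = top"
    have 2: "P\<^sub>2 \<or> Q\<^sub>2 \<or> 0 < X\<^sub>2 \<and> (0 < Z\<^sub>2 \<longrightarrow> 0 < Y\<^sub>2) \<and> ennreal r\<^sub>2 * Z\<^sub>2 \<le> ennreal M * (X\<^sub>2 * Y\<^sub>2)"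
      unfolding P\<^sub>2_def Q\<^sub>2_def X\<^sub>2_def Y\<^sub>2_def Z\<^sub>2_def r\<^sub>2_def
      by (rule F2.fw_kernel[OF R M S(1,2) T(1,2,4,5) pos])
    have 1: "P\<^sub>1 \<or> Q\<^sub>1 \<or> 0 < X\<^sub>1 \<and> (0 < Z\<^sub>1 \<longrightarrow> 0 < Y\<^sub>1) \<and> ennreal r\<^sub>1 * Z\<^sub>1 \<le> ennreal M * (X\<^sub>1 * Y\<^sub>1)"
      unfolding P\<^sub>1_def Q\<^sub>1_def X\<^sub>1_def Y\<^sub>1_def Z\<^sub>1_def r\<^sub>1_def
      by (rule F1.fw_kernel[OF R M S(1,3) T(1,3,4,5) pos])
    have P2: "P\<^sub>2 \<Longrightarrow> fw k\<^sub>2 I\<^sub>2 a' b\<^sub>1 (fst \<gamma>) = top" and P1: "P\<^sub>1 \<Longrightarrow> fw k\<^sub>1 I\<^sub>1 a' b\<^sub>1 (snd \<gamma>) = top"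
      and Q2: "Q\<^sub>2 \<Longrightarrow> fw (\<not> k\<^sub>2) I\<^sub>2 a' b\<^sub>2 (fst \<alpha> + fst \<gamma>) = top"
      and Q1: "Q\<^sub>1 \<Longrightarrow> fw (\<not> k\<^sub>1) I\<^sub>1 a' b\<^sub>2 (snd \<alpha> + snd \<gamma>) = top" for a'
      by (simp_all add: P\<^sub>2_def P\<^sub>1_def Q\<^sub>2_def Q\<^sub>1_def fw_def)
    have PQ: "\<not> (P\<^sub>2 \<and> Q\<^sub>2)" "\<not> (P\<^sub>1 \<and> Q\<^sub>1)" by (simp_all add: P\<^sub>2_def P\<^sub>1_def Q\<^sub>2_def Q\<^sub>1_def)
    have PX: "P\<^sub>2 \<Longrightarrow> 0 < X\<^sub>2" "P\<^sub>1 \<Longrightarrow> 0 < X\<^sub>1" using P2[of c] P1[of c] by (simp_all add: X\<^sub>2_def X\<^sub>1_def)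
    have QY: "Q\<^sub>2 \<Longrightarrow> 0 < Y\<^sub>2" "Q\<^sub>1 \<Longrightarrow> 0 < Y\<^sub>1" using Q2[of a\<^sub>2] Q1[of a\<^sub>2] by (simp_all add: Y\<^sub>2_def Y\<^sub>1_def)
    have topm: "x * y = top" if "x = top \<and> 0 < y \<or> y = top \<and> 0 < x" for x y :: ennreal
      using that by (auto simp: ennreal_top_mult ennreal_mult_top)
    have bound: "ennreal (r\<^sub>2 * r\<^sub>1) * (Z\<^sub>2 * Z\<^sub>1) \<le> ennreal (M * M) * ((X\<^sub>2 * X\<^sub>1) * (Y\<^sub>2 * Y\<^sub>1))"
      if "ennreal r\<^sub>2 * Z\<^sub>2 \<le> ennreal M * (X\<^sub>2 * Y\<^sub>2)" "ennreal r\<^sub>1 * Z\<^sub>1 \<le> ennreal M * (X\<^sub>1 * Y\<^sub>1)"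
      using mult_weighted_le[OF that] R0 M by (simp add: r\<^sub>2_def r\<^sub>1_def ac_simps)
    \<comment> \<open>For large \<open>a'\<close> the other factor is positive, so the whole product
      is infinite. This is why the alternative in \<open>BC_bound\<close> speaks of some
      \<open>a'\<close> instead of the given index.\<close>
    have wtop: "\<exists>a'>0. ?w a' b\<^sub>2 (\<alpha> + \<gamma>) = top" if "Q\<^sub>2 \<or> Q\<^sub>1"
    proof -
      obtain a2 where a2: "0 < a2" "\<And>a' b. 0 < b \<Longrightarrow> a2 \<le> a' \<Longrightarrow> 0 < fw (\<not> k\<^sub>2) I\<^sub>2 a' b (fst \<alpha> + fst \<gamma>)"
        using F2.fw_pos by metis
      obtain a1 where a1: "0 < a1" "\<And>a' b. 0 < b \<Longrightarrow> a1 \<le> a' \<Longrightarrow> 0 < fw (\<not> k\<^sub>1) I\<^sub>1 a' b (snd \<alpha> + snd \<gamma>)"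
        using F1.fw_pos by metis
      have "?w (max a2 a1) b\<^sub>2 (\<alpha> + \<gamma>) = top"
        using that Q2[of "max a2 a1"] Q1[of "max a2 a1"] a2(2)[OF pos(3), of "max a2 a1"] a1(2)[OF pos(3), of "max a2 a1"]
        unfolding pw_def by (intro topm) auto
      then show ?thesis using a2(1) by (intro exI[of _ "max a2 a1"]) auto
    qed
    have utop: "\<exists>a'>0. ?u a' b\<^sub>1 \<gamma> = top" if "P\<^sub>2 \<or> P\<^sub>1"
    proof -
      obtain a2 where a2: "0 < a2" "\<And>a' b. 0 < b \<Longrightarrow> a2 \<le> a' \<Longrightarrow> 0 < fw k\<^sub>2 I\<^sub>2 a' b (fst \<gamma>)"
        using F2.fw_pos by metis
      obtain a1 where a1: "0 < a1" "\<And>a' b. 0 < b \<Longrightarrow> a1 \<le> a' \<Longrightarrow> 0 < fw k\<^sub>1 I\<^sub>1 a' b (snd \<gamma>)"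
        using F1.fw_pos by metis
      have "?u (max a2 a1) b\<^sub>1 \<gamma> = top"
        using that P2[of "max a2 a1"] P1[of "max a2 a1"] a2(2)[OF pos(1), of "max a2 a1"] a1(2)[OF pos(1), of "max a2 a1"]
        unfolding pw_def by (intro topm) auto
      then show ?thesis using a2(1) by (intro exI[of _ "max a2 a1"]) auto
    qed
    have ?BC
    proof (cases "Q\<^sub>2 \<or> Q\<^sub>1")
      case True
      then show ?thesis using wtop by blast
    next
      case nQ: False
      show ?thesis
      proof (cases "P\<^sub>2 \<or> P\<^sub>1")
        case True
        \<comment> \<open>Without \<open>Q\<^sub>2\<close> and \<open>Q\<^sub>1\<close> both factors
          of the first weight are positive, so one infinite factor makes it infinite.\<close>
        have "0 < X\<^sub>2" "0 < X\<^sub>1" using 1 2 nQ PX by blast+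
        then have "X\<^sub>2 * X\<^sub>1 = top" using True P2[of c] P1[of c] by (intro topm) (auto simp: X\<^sub>2_def X\<^sub>1_def)
        then show ?thesis by (simp add: u)
      next
        case False
        then show ?thesis using 1 2 nQ bound by (simp add: u w z r)
      qed
    qed
    moreover have ?CB
    proof (cases "P\<^sub>2 \<or> P\<^sub>1")
      case True
      then show ?thesis using utop by blast
    next
      case nP: False
      show ?thesis
      \<comment> \<open>A vanishing target weight leaves nothing to show; otherwise both factors of
        the second weight at \<open>\<alpha> + \<gamma>\<close> are positive, and one infinite
        factor makes it infinite.\<close>
      proof (cases "Z\<^sub>2 = 0 \<or> Z\<^sub>1 = 0")
        case True
        then show ?thesis by (auto simp: z)
      next
        case False
        then have Y: "0 < Y\<^sub>2" "0 < Y\<^sub>1" using 1 2 nP QY by (auto simp: zero_less_iff_neq_zero)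
        show ?thesis
        proof (cases "Q\<^sub>2 \<or> Q\<^sub>1")
          case True
          then have "Y\<^sub>2 * Y\<^sub>1 = top" using Y Q2[of a\<^sub>2] Q1[of a\<^sub>2] by (intro topm) (auto simp: Y\<^sub>2_def Y\<^sub>1_def)
          then show ?thesis by (simp add: w)
        next
          case False
          then show ?thesis using 1 2 nP bound by (simp add: u w z r)
        qed
      qed
    qed
    ultimately show "?BC \<and> ?CB" ..
  qed
  show "BC_bound d ?u ?w R c b\<^sub>1 a\<^sub>2 b\<^sub>2 a c (M * M)" unfolding BC_bound_def using both by blast
  show "CB_bound d ?u ?w R c b\<^sub>1 a\<^sub>2 b\<^sub>2 a c (M * M)" unfolding CB_bound_def using both by blast
qed

lemma pw_kernel_ex:
  assumes R: "1 \<le> R" and S: "0 < c" "0 \<le> N" "super_at (fst d) I\<^sub>2 R c b\<^sub>2 N" "super_at (snd d) I\<^sub>1 R c b\<^sub>2 N"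
    and T: "0 < a\<^sub>2" "0 \<le> N'" "sub_at (fst d) I\<^sub>2 R a\<^sub>2 (max b\<^sub>1 a) N'" "sub_at (snd d) I\<^sub>1 R a\<^sub>2 (max b\<^sub>1 a) N'"
    and pos: "0 < b\<^sub>1" "0 < a" "0 < b\<^sub>2"
  shows "\<exists>M\<ge>0. BC_bound d (pw k\<^sub>2 k\<^sub>1 I\<^sub>2 I\<^sub>1) (pw (\<not> k\<^sub>2) (\<not> k\<^sub>1) I\<^sub>2 I\<^sub>1) R c b\<^sub>1 a\<^sub>2 b\<^sub>2 a c M \<and>
    CB_bound d (pw k\<^sub>2 k\<^sub>1 I\<^sub>2 I\<^sub>1) (pw (\<not> k\<^sub>2) (\<not> k\<^sub>1) I\<^sub>2 I\<^sub>1) R c b\<^sub>1 a\<^sub>2 b\<^sub>2 a c M"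
proof -
  define K where "K = max N N'"
  have K: "0 \<le> K" using S by (simp add: K_def)
  have "super_at (fst d) I\<^sub>2 R c b\<^sub>2 K" "super_at (snd d) I\<^sub>1 R c b\<^sub>2 K"
    "sub_at (fst d) I\<^sub>2 R a\<^sub>2 (max b\<^sub>1 a) K" "sub_at (snd d) I\<^sub>1 R a\<^sub>2 (max b\<^sub>1 a) K"
    using F2.super_at_mono[OF S(3,1)] F1.super_at_mono[OF S(4,1)] F2.sub_at_mono[OF T(3,1)] F1.sub_at_mono[OF T(4,1)]
    by (simp_all add: K_def)
  then show ?thesis
    using pw_kernel[OF R K S(1) _ _ T(1) _ _ _ _ pos, of "max b\<^sub>1 a"] K
    by (intro exI[of _ "K * K"]) simp
qed

text \<open>The index \<open>c\<close> from \<open>super_both\<close> depends on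
  \<open>b\<^sub>2\<close> alone and serves as both \<open>a\<^sub>1\<close> and \<open>b\<close>,
  while \<open>a\<^sub>2\<close> from \<open>sub_both\<close> depends on \<open>b\<^sub>1\<close>
  and \<open>a\<close> alone. Therefore the same witnesses fit both orders of quantifiers.\<close>

lemma kernel_pw: "kernel d (pw k\<^sub>2 k\<^sub>1 I\<^sub>2 I\<^sub>1) (pw (\<not> k\<^sub>2) (\<not> k\<^sub>1) I\<^sub>2 I\<^sub>1)"
proof (intro kernel.intro kernel_axioms.intro graded_weights_pw)
  let ?u = "pw k\<^sub>2 k\<^sub>1 I\<^sub>2 I\<^sub>1" and ?w = "pw (\<not> k\<^sub>2) (\<not> k\<^sub>1) I\<^sub>2 I\<^sub>1"
  fix R b\<^sub>2 :: real assume R: "1 \<le> R" and b2: "0 < b\<^sub>2"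
  obtain c N where S: "0 < c" "0 \<le> N" "super_at (fst d) I\<^sub>2 R c b\<^sub>2 N" "super_at (snd d) I\<^sub>1 R c b\<^sub>2 N"
    using super_both[OF R b2] by blast
  have "\<exists>a\<^sub>2>0. \<exists>M\<ge>0. BC_bound d ?u ?w R c b\<^sub>1 a\<^sub>2 b\<^sub>2 a c M" if ab: "0 < b\<^sub>1" "0 < a" for b\<^sub>1 a
  proof -
    have "0 < max b\<^sub>1 a" using ab by simp
    then obtain a\<^sub>2 N' where T: "0 < a\<^sub>2" "0 \<le> N'" "sub_at (fst d) I\<^sub>2 R a\<^sub>2 (max b\<^sub>1 a) N'" "sub_at (snd d) I\<^sub>1 R a\<^sub>2 (max b\<^sub>1 a) N'"
      using sub_both[OF R] by blast
    show ?thesis using pw_kernel_ex[OF R S T ab b2] T(1) by blast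
  qed
  then show "\<exists>a\<^sub>1>0. \<exists>b>0. \<forall>b\<^sub>1>0. \<forall>a>0. \<exists>a\<^sub>2>0. \<exists>M\<ge>0. BC_bound d ?u ?w R a\<^sub>1 b\<^sub>1 a\<^sub>2 b\<^sub>2 a b M"
    using S(1) by blast
next
  let ?u = "pw k\<^sub>2 k\<^sub>1 I\<^sub>2 I\<^sub>1" and ?w = "pw (\<not> k\<^sub>2) (\<not> k\<^sub>1) I\<^sub>2 I\<^sub>1"
  fix R b\<^sub>1 a :: real assume R: "1 \<le> R" and ab: "0 < b\<^sub>1" "0 < a"
  have "0 < max b\<^sub>1 a" using ab by simp
  then obtain a\<^sub>2 N' where T: "0 < a\<^sub>2" "0 \<le> N'" "sub_at (fst d) I\<^sub>2 R a\<^sub>2 (max b\<^sub>1 a) N'" "sub_at (snd d) I\<^sub>1 R a\<^sub>2 (max b\<^sub>1 a) N'"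
    using sub_both[OF R] by blast
  have "\<exists>a\<^sub>1>0. \<exists>b>0. \<exists>M\<ge>0. CB_bound d ?u ?w R a\<^sub>1 b\<^sub>1 a\<^sub>2 b\<^sub>2 a b M" if b2: "0 < b\<^sub>2" for b\<^sub>2
  proof -
    obtain c N where S: "0 < c" "0 \<le> N" "super_at (fst d) I\<^sub>2 R c b\<^sub>2 N" "super_at (snd d) I\<^sub>1 R c b\<^sub>2 N"
      using super_both[OF R b2] by blast
    show ?thesis using pw_kernel_ex[OF R S T ab b2] S(1) by blast
  qed
  then show "\<exists>a\<^sub>2>0. \<forall>b\<^sub>2>0. \<exists>a\<^sub>1>0. \<exists>b>0. \<exists>M\<ge>0. CB_bound d ?u ?w R a\<^sub>1 b\<^sub>1 a\<^sub>2 b\<^sub>2 a b M"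
    using T(1) by blast
qed

lemma extendable_pw:
  assumes p: "0 < p" and k': "k\<^sub>2' = (\<not> k\<^sub>2)" "k\<^sub>1' = (\<not> k\<^sub>1)"
  shows "U_extendable d t (proj_lim (\<lambda>a. ind_lim (\<lambda>b. ell_top p (Lam d) (pw k\<^sub>2 k\<^sub>1 I\<^sub>2 I\<^sub>1 a b))))
      (ind_lim (\<lambda>b. proj_lim (\<lambda>a. ell_top p (Lam d) (pw k\<^sub>2' k\<^sub>1' I\<^sub>2 I\<^sub>1 a b))))
      (ind_lim (\<lambda>b. proj_lim (\<lambda>a. ell_top p (Lam d) (pw k\<^sub>2' k\<^sub>1' I\<^sub>2 I\<^sub>1 a b))))"
    and "U_extendable d t (ind_lim (\<lambda>b. proj_lim (\<lambda>a. ell_top p (Lam d) (pw k\<^sub>2 k\<^sub>1 I\<^sub>2 I\<^sub>1 a b))))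
      (proj_lim (\<lambda>a. ind_lim (\<lambda>b. ell_top p (Lam d) (pw k\<^sub>2' k\<^sub>1' I\<^sub>2 I\<^sub>1 a b))))
      (proj_lim (\<lambda>a. ind_lim (\<lambda>b. ell_top p (Lam d) (pw k\<^sub>2' k\<^sub>1' I\<^sub>2 I\<^sub>1 a b))))"
  unfolding k' graded_weights.Bsp_lp[OF graded_weights_pw p] graded_weights.Csp_lp[OF graded_weights_pw p]
  by (rule kernel.extendable_BC[OF kernel_pw] kernel.extendable_CB[OF kernel_pw])+

text \<open>Weights with both flags true do not depend on \<open>a\<close>, and a constant
  projective limit disappears in either position.\<close>

lemma ind_lim_pw: "ind_lim (\<lambda>b. proj_lim (\<lambda>a. ell_top p (Lam d) (pw True True I\<^sub>2 I\<^sub>1 a b))) =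
    ind_lim (\<lambda>b. ell_top p (Lam d) (\<lambda>\<alpha>. I\<^sub>2 b (fst \<alpha>) * I\<^sub>1 b (snd \<alpha>)))"
  "proj_lim (\<lambda>a. ind_lim (\<lambda>b. ell_top p (Lam d) (pw True True I\<^sub>2 I\<^sub>1 a b))) =
    ind_lim (\<lambda>b. ell_top p (Lam d) (\<lambda>\<alpha>. I\<^sub>2 b (fst \<alpha>) * I\<^sub>1 b (snd \<alpha>)))"
  by (simp_all add: pw_def[abs_def] fw_def proj_lim_const)

lemma proj_lim_pw:
  assumes p: "0 < p"
  shows "ind_lim (\<lambda>b. proj_lim (\<lambda>a. ell_top p (Lam d) (pw False False I\<^sub>2 I\<^sub>1 a b))) =
    proj_lim (\<lambda>a. ell_top p (Lam d) (\<lambda>\<alpha>. inverse (I\<^sub>2 a (fst \<alpha>)) * inverse (I\<^sub>1 a (snd \<alpha>))))"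
  unfolding graded_weights.Csp_lp[OF graded_weights_pw p]
  by (rule graded_weights.proj_lim_lp[OF graded_weights_pw p, symmetric]) (simp add: pw_def[abs_def] fw_def)

text \<open>\<open>A\<close> is read as a space of kind \<open>Bsp\<close> with flags true and
  \<open>A'\<close> as one of kind \<open>Csp\<close> with flags false, so the two claims are the
  two kinds of pairs in \<open>extendable_pw\<close>.\<close>

theorem extendable_A:
  assumes p: "0 < p"
  defines "A \<equiv> ind_lim (\<lambda>r. ell_top p (Lam d) (\<lambda>\<alpha>. I\<^sub>2 r (fst \<alpha>) * I\<^sub>1 r (snd \<alpha>)))"
    and "A' \<equiv> proj_lim (\<lambda>r. ell_top p (Lam d) (\<lambda>\<alpha>. inverse (I\<^sub>2 r (fst \<alpha>)) * inverse (I\<^sub>1 r (snd \<alpha>))))"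
  shows "U_extendable d t A A' A'" "U_extendable d t A' A A"
  using extendable_pw[OF p, of False True False True t] extendable_pw[OF p, of True False True False t]
  unfolding ind_lim_pw proj_lim_pw[OF p] A_def A'_def by simp_all

theorem extendable_B_C:
  assumes p: "0 < p"
  defines "B \<equiv> proj_lim (\<lambda>a. ind_lim (\<lambda>b. ell_top p (Lam d) (\<lambda>\<alpha>. I\<^sub>2 b (fst \<alpha>) * inverse (I\<^sub>1 a (snd \<alpha>)))))"
    and "C \<equiv> ind_lim (\<lambda>b. proj_lim (\<lambda>a. ell_top p (Lam d) (\<lambda>\<alpha>. I\<^sub>2 b (fst \<alpha>) * inverse (I\<^sub>1 a (snd \<alpha>)))))"
    and "B' \<equiv> proj_lim (\<lambda>a. ind_lim (\<lambda>b. ell_top p (Lam d) (\<lambda>\<alpha>. I\<^sub>1 b (snd \<alpha>) * inverse (I\<^sub>2 a (fst \<alpha>)))))"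
    and "C' \<equiv> ind_lim (\<lambda>b. proj_lim (\<lambda>a. ell_top p (Lam d) (\<lambda>\<alpha>. I\<^sub>1 b (snd \<alpha>) * inverse (I\<^sub>2 a (fst \<alpha>)))))"
  shows "U_extendable d t B C' C'" "U_extendable d t B' C C" "U_extendable d t C B' B'" "U_extendable d t C' B B"
proof -
  have 1: "(\<lambda>\<alpha>. I\<^sub>2 b (fst \<alpha>) * inverse (I\<^sub>1 a (snd \<alpha>))) = pw True False I\<^sub>2 I\<^sub>1 a b" for a b
    by (simp add: pw_def[abs_def] fw_def)
  have 2: "(\<lambda>\<alpha>. I\<^sub>1 b (snd \<alpha>) * inverse (I\<^sub>2 a (fst \<alpha>))) = pw False True I\<^sub>2 I\<^sub>1 a b" for a b
    by (simp add: pw_def[abs_def] fw_def mult.commute)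
  show "U_extendable d t B C' C'" "U_extendable d t C B' B'"
    unfolding assms(2-) 1 2 by (rule extendable_pw[OF p]; simp)+
  show "U_extendable d t B' C C" "U_extendable d t C' B B"
    unfolding assms(2-) 1 2 by (rule extendable_pw[OF p]; simp)+
qed

end

section \<open>The weights of the theorem\<close>

lemma ex2I: "0 < x \<Longrightarrow> 0 \<le> y \<Longrightarrow> P x y \<Longrightarrow> \<exists>x>0. \<exists>y\<ge>0. P x y" for x y :: real
  by blast

lemma factor_realI:
  assumes I: "\<And>r \<alpha>. 0 < r \<Longrightarrow> I r \<alpha> = ennreal (g r \<alpha>)"
    and pos: "\<And>r \<alpha>. 0 < r \<Longrightarrow> 0 < g r \<alpha>"
    and anti: "\<And>r r' \<alpha>. 0 < r \<Longrightarrow> r \<le> r' \<Longrightarrow> g r' \<alpha> \<le> g r \<alpha>"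
    and one: "\<And>r. 0 < r \<Longrightarrow> g r 0 = 1"
    and super: "\<And>R b. 1 \<le> R \<Longrightarrow> 0 < b \<Longrightarrow> \<exists>c>0. \<exists>M\<ge>0. \<forall>\<alpha> \<gamma>.
      R ^ (mdeg n \<alpha> + mdeg n \<gamma>) * (g c \<alpha> * g c \<gamma>) \<le> M * g b (\<alpha> + \<gamma>)"
    and sub: "\<And>R c. 1 \<le> R \<Longrightarrow> 0 < c \<Longrightarrow> \<exists>a>0. \<exists>M\<ge>0. \<forall>\<alpha> \<gamma>.
      R ^ (mdeg n \<alpha> + mdeg n \<gamma>) * g a (\<alpha> + \<gamma>) \<le> M * (g c \<alpha> * g c \<gamma>)"
  shows "factor n I"
proof
  fix R b :: real assume R: "1 \<le> R" and b: "0 < b"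
  obtain c M where c: "0 < c" "0 \<le> M"
    "\<forall>\<alpha> \<gamma>. R ^ (mdeg n \<alpha> + mdeg n \<gamma>) * (g c \<alpha> * g c \<gamma>) \<le> M * g b (\<alpha> + \<gamma>)"
    using super[OF R b] by blast
  have "super_at n I R c b M"
    unfolding super_at_def
  proof (intro allI)
    fix \<alpha> \<gamma>
    have "ennreal (R ^ (mdeg n \<alpha> + mdeg n \<gamma>)) * (I c \<alpha> * I c \<gamma>) =
        ennreal (R ^ (mdeg n \<alpha> + mdeg n \<gamma>) * (g c \<alpha> * g c \<gamma>))"
      using R less_imp_le[OF pos[OF c(1)]] by (simp add: I[OF c(1)] ennreal_mult)
    also have "\<dots> \<le> ennreal (M * g b (\<alpha> + \<gamma>))" using c(3) by (intro ennreal_leI) blast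
    also have "\<dots> = ennreal M * I b (\<alpha> + \<gamma>)"
      using c(2) less_imp_le[OF pos[OF b]] by (simp add: I[OF b] ennreal_mult)
    finally show "ennreal (R ^ (mdeg n \<alpha> + mdeg n \<gamma>)) * (I c \<alpha> * I c \<gamma>) \<le> ennreal M * I b (\<alpha> + \<gamma>)" .
  qed
  then show "\<exists>c>0. \<exists>M\<ge>0. super_at n I R c b M" using c(1,2) by blast
next
  fix R c :: real assume R: "1 \<le> R" and c: "0 < c"
  obtain a M where a: "0 < a" "0 \<le> M"
    "\<forall>\<alpha> \<gamma>. R ^ (mdeg n \<alpha> + mdeg n \<gamma>) * g a (\<alpha> + \<gamma>) \<le> M * (g c \<alpha> * g c \<gamma>)"
    using sub[OF R c] by blast
  have "sub_at n I R a c M"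
    unfolding sub_at_def
  proof (intro allI)
    fix \<alpha> \<gamma>
    have "ennreal (R ^ (mdeg n \<alpha> + mdeg n \<gamma>)) * I a (\<alpha> + \<gamma>) =
        ennreal (R ^ (mdeg n \<alpha> + mdeg n \<gamma>) * g a (\<alpha> + \<gamma>))"
      using R less_imp_le[OF pos[OF a(1)]] by (simp add: I[OF a(1)] ennreal_mult)
    also have "\<dots> \<le> ennreal (M * (g c \<alpha> * g c \<gamma>))" using a(3) by (intro ennreal_leI) blast
    also have "\<dots> = ennreal M * (I c \<alpha> * I c \<gamma>)"
      using a(2) less_imp_le[OF pos[OF c]] by (simp add: I[OF c] ennreal_mult)
    finally show "ennreal (R ^ (mdeg n \<alpha> + mdeg n \<gamma>)) * I a (\<alpha> + \<gamma>) \<le> ennreal M * (I c \<alpha> * I c \<gamma>)" .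
  qed
  then show "\<exists>a>0. \<exists>M\<ge>0. sub_at n I R a c M" using a(1,2) by blast
next
  show "\<exists>r>0. I r \<alpha> < top" for \<alpha> using I[of 1 \<alpha>] by (intro exI[of _ 1]) simp
qed (use I pos anti one in \<open>auto simp: ennreal_leI\<close>)

section \<open>Elementary inequalities for powers\<close>

text \<open>After division by \<open>x + y\<close> both terms lie between 0 and 1, where a power
  with exponent at least 1 does not exceed its base.\<close>

lemma powr_superadditive:
  fixes x y :: real
  assumes "0 \<le> x" "0 \<le> y" "1 \<le> \<kappa>"
  shows "x powr \<kappa> + y powr \<kappa> \<le> (x + y) powr \<kappa>"
proof (cases "x + y = 0")
  case True
  then have "x = 0" "y = 0" using assms by auto
  then show ?thesis by simp
next
  case False
  define s where "s = x + y"
  have s: "0 < s" using False assms by (simp add: s_def)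
  have le: "z powr \<kappa> \<le> s powr \<kappa> * (z / s)" if "0 \<le> z" "z \<le> s" for z
  proof -
    have "(z / s) powr \<kappa> \<le> (z / s) powr 1"
    proof (cases "z = 0")
      case False
      then show ?thesis using that s assms(3) by (intro powr_mono') auto
    qed simp
    then have "(z / s) powr \<kappa> \<le> z / s" using that s by simp
    moreover have "z powr \<kappa> = s powr \<kappa> * (z / s) powr \<kappa>"
      using that s by (simp add: powr_divide)
    ultimately show ?thesis using mult_left_mono[of "(z / s) powr \<kappa>" "z / s" "s powr \<kappa>"] by simp
  qed
  have "x powr \<kappa> + y powr \<kappa> \<le> s powr \<kappa> * (x / s) + s powr \<kappa> * (y / s)"
    using assms by (intro add_mono le) (auto simp: s_def)
  also have "\<dots> = s powr \<kappa>" using s by (simp add: s_def[symmetric] flip: distrib_left add_divide_distrib)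
  finally show ?thesis by (simp add: s_def)
qed

lemma powr_add_le:
  fixes x y :: real
  assumes "0 \<le> x" "0 \<le> y" "0 \<le> \<kappa>"
  shows "(x + y) powr \<kappa> \<le> 2 powr \<kappa> * (x powr \<kappa> + y powr \<kappa>)"
proof -
  have "(x + y) powr \<kappa> \<le> (2 * max x y) powr \<kappa>" using assms by (intro powr_mono2) auto
  also have "\<dots> = 2 powr \<kappa> * max x y powr \<kappa>" using assms by (simp add: powr_mult)
  also have "\<dots> \<le> 2 powr \<kappa> * (x powr \<kappa> + y powr \<kappa>)" by (intro mult_left_mono) (auto simp: max_def)
  finally show ?thesis .
qed

lemma le_powr: "1 \<le> \<kappa> \<Longrightarrow> real k \<le> real k powr \<kappa>"
  using powr_mono[of 1 \<kappa> "real k"] by (cases "k = 0") auto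

lemma linear_le_powr:
  assumes \<kappa>: "1 < \<kappa>" and "0 \<le> L" "0 < \<delta>"
  shows "\<exists>K. \<forall>k::nat. L * real k \<le> K + \<delta> * real k powr \<kappa>"
proof -
  \<comment> \<open>The crossing point of \<open>L * k\<close> and
    \<open>\<delta> * k powr \<kappa>\<close>: below it the constant \<open>L * n0\<close> is
    enough, above it the power dominates.\<close>
  define n0 where "n0 = (L / \<delta>) powr (1 / (\<kappa> - 1))"
  have "L * real k \<le> L * n0 + \<delta> * real k powr \<kappa>" for k
  proof (cases "real k \<le> n0")
    case True
    then have "L * real k \<le> L * n0" using assms by (intro mult_left_mono) auto
    then show ?thesis using assms by (simp add: add_increasing2)
  next
    case False
    moreover have "0 \<le> n0" by (simp add: n0_def)
    ultimately have k: "0 < real k" "n0 \<le> real k" by linarith+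
    have "L / \<delta> = n0 powr (\<kappa> - 1)" using assms by (cases "L = 0") (auto simp: n0_def powr_powr)
    also have "\<dots> \<le> real k powr (\<kappa> - 1)" using k assms by (intro powr_mono2) (auto simp: n0_def)
    finally have "L \<le> \<delta> * real k powr (\<kappa> - 1)" using assms by (simp add: field_simps)
    then have "L * real k \<le> \<delta> * real k powr (\<kappa> - 1) * real k" using k by (intro mult_right_mono) auto
    also have "\<dots> = \<delta> * real k powr \<kappa>" using k by (simp add: powr_diff)
    finally show ?thesis using assms by (simp add: n0_def add_increasing)
  qed
  then show ?thesis by blast
qed

section \<open>The exponential weights\<close>

lemma power_eq_exp: "0 < R \<Longrightarrow> R ^ k = exp (ln R * real k)" for R :: real
  by (simp add: exp_of_nat_mult mult.commute)

text \<open>Superadditivity of the power gives the first inequality and \<open>powr_add_le\<close>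
  the second. In both, half of the available rate is reserved for \<open>R ^ k\<close>, which
  \<open>linear_le_powr\<close> absorbs up to a constant; this is where \<open>1 < \<kappa>\<close>
  enters.\<close>

lemma factor_exp_inverse:
  assumes \<kappa>: "1 < \<kappa>"
    and I: "\<And>r \<alpha>. 0 < r \<Longrightarrow> I r \<alpha> = ennreal (exp (1 / r * real (mdeg n \<alpha>) powr \<kappa>))"
  shows "factor n I"
proof (rule factor_realI[OF I])
  fix r r' :: real and \<alpha> assume "0 < r" "r \<le> r'"
  then show "exp (1 / r' * real (mdeg n \<alpha>) powr \<kappa>) \<le> exp (1 / r * real (mdeg n \<alpha>) powr \<kappa>)"
    by (simp add: frac_le mult_right_mono)
next
  fix R b :: real assume R: "1 \<le> R" and b: "0 < b"
  have b2: "0 < 2 * b" using b by simp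
  obtain K where K: "\<forall>k::nat. ln R * real k \<le> K + 1 / (2 * b) * real k powr \<kappa>"
    using linear_le_powr[OF \<kappa>, of "ln R" "1 / (2 * b)"] R b by auto
  have "R ^ (x + y) * (exp (1 / (2 * b) * real x powr \<kappa>) * exp (1 / (2 * b) * real y powr \<kappa>)) \<le>
      exp K * exp (1 / b * real (x + y) powr \<kappa>)" for x y :: nat
  proof -
    have "real x powr \<kappa> + real y powr \<kappa> \<le> real (x + y) powr \<kappa>"
      using powr_superadditive[of "real x" "real y" \<kappa>] \<kappa> by simp
    then have "1 / (2 * b) * (real x powr \<kappa> + real y powr \<kappa>) \<le> 1 / (2 * b) * real (x + y) powr \<kappa>"
      using b by (intro mult_left_mono) auto
    moreover have "1 / b * real (x + y) powr \<kappa> = 1 / (2 * b) * real (x + y) powr \<kappa> + 1 / (2 * b) * real (x + y) powr \<kappa>"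
      by simp
    ultimately have "ln R * real (x + y) + (1 / (2 * b) * real x powr \<kappa> + 1 / (2 * b) * real y powr \<kappa>) \<le>
        K + 1 / b * real (x + y) powr \<kappa>"
      using spec[OF K, of "x + y"] by (simp only: distrib_left)
    then show ?thesis using R by (simp only: power_eq_exp exp_add[symmetric] exp_le_cancel_iff)
  qed
  then show "\<exists>c>0. \<exists>M\<ge>0. \<forall>\<alpha> \<gamma>. R ^ (mdeg n \<alpha> + mdeg n \<gamma>) *
      (exp (1 / c * real (mdeg n \<alpha>) powr \<kappa>) * exp (1 / c * real (mdeg n \<gamma>) powr \<kappa>)) \<le>
      M * exp (1 / b * real (mdeg n (\<alpha> + \<gamma>)) powr \<kappa>)"
    by (intro ex2I[OF b2 exp_ge_zero[of K]] allI) (simp only: mdeg_add)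
next
  fix R c :: real assume R: "1 \<le> R" and c: "0 < c"
  \<comment> \<open>\<open>2 powr \<kappa>\<close> compensates the loss in
    \<open>powr_add_le\<close>, and the other 2 leaves a second share \<open>\<delta>\<close> for
    \<open>R\<close>.\<close>
  define \<delta> where "\<delta> = 1 / (2 * 2 powr \<kappa> * c)"
  have c2: "0 < 2 * 2 powr \<kappa> * c" using c by simp
  then have \<delta>: "0 < \<delta>" by (simp add: \<delta>_def)
  obtain K where K: "\<forall>k::nat. ln R * real k \<le> K + \<delta> * real k powr \<kappa>"
    using linear_le_powr[OF \<kappa> _ \<delta>, of "ln R"] R by auto
  have "R ^ (x + y) * exp (1 / (2 * 2 powr \<kappa> * c) * real (x + y) powr \<kappa>) \<le>
      exp K * (exp (1 / c * real x powr \<kappa>) * exp (1 / c * real y powr \<kappa>))" for x y :: nat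
  proof -
    have "real (x + y) powr \<kappa> \<le> 2 powr \<kappa> * (real x powr \<kappa> + real y powr \<kappa>)"
      using powr_add_le[of "real x" "real y" \<kappa>] \<kappa> by simp
    then have "2 * \<delta> * real (x + y) powr \<kappa> \<le> 2 * \<delta> * (2 powr \<kappa> * (real x powr \<kappa> + real y powr \<kappa>))"
      using \<delta> by (intro mult_left_mono) auto
    also have "\<dots> = 1 / c * real x powr \<kappa> + 1 / c * real y powr \<kappa>"
      using c by (simp add: \<delta>_def field_simps)
    finally have "ln R * real (x + y) + \<delta> * real (x + y) powr \<kappa> \<le>
        K + (1 / c * real x powr \<kappa> + 1 / c * real y powr \<kappa>)"
      using spec[OF K, of "x + y"] by linarith
    then show ?thesis using R unfolding \<delta>_def[symmetric]
      by (simp only: power_eq_exp exp_add[symmetric] exp_le_cancel_iff)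
  qed
  then show "\<exists>a>0. \<exists>M\<ge>0. \<forall>\<alpha> \<gamma>. R ^ (mdeg n \<alpha> + mdeg n \<gamma>) *
      exp (1 / a * real (mdeg n (\<alpha> + \<gamma>)) powr \<kappa>) \<le>
      M * (exp (1 / c * real (mdeg n \<alpha>) powr \<kappa>) * exp (1 / c * real (mdeg n \<gamma>) powr \<kappa>))"
    by (intro ex2I[OF c2 exp_ge_zero[of K]] allI) (simp only: mdeg_add)
qed (auto simp: mdeg_def)

lemma factor_exp_minus:
  assumes \<kappa>: "1 \<le> \<kappa>"
    and I: "\<And>r \<alpha>. 0 < r \<Longrightarrow> I r \<alpha> = ennreal (exp (- (r * real (mdeg n \<alpha>) powr \<kappa>)))"
  shows "factor n I"
proof (rule factor_realI[OF I])
  fix r r' :: real and \<alpha> assume "0 < r" "r \<le> r'"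
  then show "exp (- (r' * real (mdeg n \<alpha>) powr \<kappa>)) \<le> exp (- (r * real (mdeg n \<alpha>) powr \<kappa>))"
    by (simp add: mult_right_mono)
next
  fix R b :: real assume R: "1 \<le> R" and b: "0 < b"
  define c where "c = b * 2 powr \<kappa> + ln R"
  have c: "0 < c" unfolding c_def using R b by (intro add_pos_nonneg) auto
  have "R ^ (x + y) * (exp (- (c * real x powr \<kappa>)) * exp (- (c * real y powr \<kappa>))) \<le>
      1 * exp (- (b * real (x + y) powr \<kappa>))" for x y :: nat
  proof -
    have "b * real (x + y) powr \<kappa> \<le> b * (2 powr \<kappa> * (real x powr \<kappa> + real y powr \<kappa>))"
      using powr_add_le[of "real x" "real y" \<kappa>] \<kappa> b by (intro mult_left_mono) auto
    moreover have "ln R * real (x + y) \<le> ln R * (real x powr \<kappa> + real y powr \<kappa>)"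
      using le_powr[OF \<kappa>, of x] le_powr[OF \<kappa>, of y] R by (intro mult_left_mono) auto
    ultimately have "ln R * real (x + y) + (- (c * real x powr \<kappa>) + - (c * real y powr \<kappa>)) \<le>
        - (b * real (x + y) powr \<kappa>)"
      by (simp add: c_def algebra_simps)
    then show ?thesis using R by (simp only: power_eq_exp exp_add[symmetric] exp_le_cancel_iff mult_1)
  qed
  then show "\<exists>c>0. \<exists>M\<ge>0. \<forall>\<alpha> \<gamma>. R ^ (mdeg n \<alpha> + mdeg n \<gamma>) *
      (exp (- (c * real (mdeg n \<alpha>) powr \<kappa>)) * exp (- (c * real (mdeg n \<gamma>) powr \<kappa>))) \<le>
      M * exp (- (b * real (mdeg n (\<alpha> + \<gamma>)) powr \<kappa>))"
    by (intro ex2I[OF c zero_le_one] allI) (simp only: mdeg_add)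
next
  fix R c :: real assume R: "1 \<le> R" and c: "0 < c"
  define a where "a = c + ln R"
  have a: "0 < a" unfolding a_def using R c by (intro add_pos_nonneg) auto
  have "R ^ (x + y) * exp (- (a * real (x + y) powr \<kappa>)) \<le>
      1 * (exp (- (c * real x powr \<kappa>)) * exp (- (c * real y powr \<kappa>)))" for x y :: nat
  proof -
    have "c * (real x powr \<kappa> + real y powr \<kappa>) \<le> c * real (x + y) powr \<kappa>"
      using powr_superadditive[of "real x" "real y" \<kappa>] \<kappa> c by (intro mult_left_mono) auto
    moreover have "ln R * real (x + y) \<le> ln R * real (x + y) powr \<kappa>"
      using le_powr[OF \<kappa>, of "x + y"] R by (intro mult_left_mono) auto
    ultimately have "ln R * real (x + y) + - (a * real (x + y) powr \<kappa>) \<le>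
        - (c * real x powr \<kappa>) + - (c * real y powr \<kappa>)"
      by (simp add: a_def algebra_simps)
    then show ?thesis using R by (simp only: power_eq_exp exp_add[symmetric] exp_le_cancel_iff mult_1)
  qed
  then show "\<exists>a>0. \<exists>M\<ge>0. \<forall>\<alpha> \<gamma>. R ^ (mdeg n \<alpha> + mdeg n \<gamma>) *
      exp (- (a * real (mdeg n (\<alpha> + \<gamma>)) powr \<kappa>)) \<le>
      M * (exp (- (c * real (mdeg n \<alpha>) powr \<kappa>)) * exp (- (c * real (mdeg n \<gamma>) powr \<kappa>)))"
    by (intro ex2I[OF a zero_le_one] allI) (simp only: mdeg_add)
qed (auto simp: mdeg_def)

section \<open>The factorial weights and the cutoff weights\<close>

lemma mfact_pos: "0 < mfact n \<alpha>"
  by (simp add: mfact_def)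

lemma mfact_super: "mfact n \<alpha> * mfact n \<gamma> \<le> mfact n (\<alpha> + \<gamma>)"
  unfolding mfact_def prod.distrib[symmetric]
  by (intro prod_mono conjI) (auto simp: dvd_imp_le fact_fact_dvd_fact)

text \<open>The quotient of the factorials is a product of binomial coefficients, which grows at
  most geometrically.\<close>

lemma mfact_sub: "mfact n (\<alpha> + \<gamma>) \<le> 2 ^ (mdeg n \<alpha> + mdeg n \<gamma>) * (mfact n \<alpha> * mfact n \<gamma>)"
proof -
  have "mfact n (\<alpha> + \<gamma>) = mbinom n (\<alpha> + \<gamma>) \<gamma> * (mfact n \<alpha> * mfact n \<gamma>)"
    unfolding mfact_def mbinom_def prod.distrib[symmetric]
  proof (rule prod.cong[OF refl])
    fix i
    have "fact (\<gamma> i) * fact (\<alpha> i + \<gamma> i - \<gamma> i) * (\<alpha> i + \<gamma> i choose \<gamma> i) = fact (\<alpha> i + \<gamma> i)"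
      by (rule binomial_fact_lemma) simp
    then show "fact ((\<alpha> + \<gamma>) i) = ((\<alpha> + \<gamma>) i choose \<gamma> i) * (fact (\<alpha> i) * fact (\<gamma> i))"
      by (simp add: ac_simps)
  qed
  then show ?thesis using mbinom_le[of n \<alpha> \<gamma>] by (simp add: mult_le_mono1)
qed

lemma mfact_powr:
  fixes e :: real
  assumes e: "0 < e"
  shows "real (mfact n \<alpha>) powr e * real (mfact n \<gamma>) powr e \<le> real (mfact n (\<alpha> + \<gamma>)) powr e"
    and "real (mfact n (\<alpha> + \<gamma>)) powr e \<le>
      (2 powr e) ^ (mdeg n \<alpha> + mdeg n \<gamma>) * (real (mfact n \<alpha>) powr e * real (mfact n \<gamma>) powr e)"
proof -
  have "(real (mfact n \<alpha>) * real (mfact n \<gamma>)) powr e \<le> real (mfact n (\<alpha> + \<gamma>)) powr e"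
    using e mfact_super[of n \<alpha> \<gamma>] by (intro powr_mono2) (auto simp flip: of_nat_mult)
  then show "real (mfact n \<alpha>) powr e * real (mfact n \<gamma>) powr e \<le> real (mfact n (\<alpha> + \<gamma>)) powr e"
    by (simp add: powr_mult)
  let ?k = "mdeg n \<alpha> + mdeg n \<gamma>"
  have "real (mfact n (\<alpha> + \<gamma>)) \<le> real (2 ^ ?k * (mfact n \<alpha> * mfact n \<gamma>))"
    using mfact_sub by (simp only: of_nat_le_iff)
  then have "real (mfact n (\<alpha> + \<gamma>)) powr e \<le> (2 ^ ?k * (real (mfact n \<alpha>) * real (mfact n \<gamma>))) powr e"
    using e by (intro powr_mono2) auto
  also have "\<dots> = (2 ^ ?k) powr e * (real (mfact n \<alpha>) powr e * real (mfact n \<gamma>) powr e)"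
    by (simp add: powr_mult)
  also have "(2 ^ ?k) powr e = (2 powr e) ^ ?k"
    by (simp add: powr_realpow[symmetric] powr_powr mult.commute)
  finally show "real (mfact n (\<alpha> + \<gamma>)) powr e \<le>
      (2 powr e) ^ ?k * (real (mfact n \<alpha>) powr e * real (mfact n \<gamma>) powr e)" .
qed

text \<open>The parameter is the base of a power, so changing it absorbs a geometric factor exactly
  and the constant is 1. The factor \<open>2 powr e\<close> in \<open>a\<close> is the loss in
  \<open>mfact_powr\<close>.\<close>

lemma factor_fact_inverse:
  assumes e: "0 < e"
    and I: "\<And>r \<alpha>. 0 < r \<Longrightarrow> I r \<alpha> = ennreal ((1 / r) ^ mdeg n \<alpha> * real (mfact n \<alpha>) powr e)"
  shows "factor n I"
proof (rule factor_realI[OF I])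
  fix r r' :: real and \<alpha> assume "0 < r" "r \<le> r'"
  then show "(1 / r') ^ mdeg n \<alpha> * real (mfact n \<alpha>) powr e \<le> (1 / r) ^ mdeg n \<alpha> * real (mfact n \<alpha>) powr e"
    by (intro mult_right_mono power_mono) (auto simp: frac_le)
next
  fix R b :: real assume R: "1 \<le> R" and b: "0 < b"
  have Rb: "0 < R * b" using R b by simp
  have "R ^ (mdeg n \<alpha> + mdeg n \<gamma>) * ((1 / (R * b)) ^ mdeg n \<alpha> * real (mfact n \<alpha>) powr e *
      ((1 / (R * b)) ^ mdeg n \<gamma> * real (mfact n \<gamma>) powr e)) \<le>
      1 * ((1 / b) ^ mdeg n (\<alpha> + \<gamma>) * real (mfact n (\<alpha> + \<gamma>)) powr e)" for \<alpha> \<gamma>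
  proof -
    let ?k = "mdeg n \<alpha> + mdeg n \<gamma>"
    have "R ^ ?k * (1 / (R * b)) ^ ?k = (1 / b) ^ ?k"
      using R by (simp flip: power_mult_distrib)
    then have "R ^ ?k * ((1 / (R * b)) ^ mdeg n \<alpha> * real (mfact n \<alpha>) powr e *
      ((1 / (R * b)) ^ mdeg n \<gamma> * real (mfact n \<gamma>) powr e)) =
      (1 / b) ^ ?k * (real (mfact n \<alpha>) powr e * real (mfact n \<gamma>) powr e)"
      by (simp only: power_add ac_simps)
    also have "\<dots> \<le> (1 / b) ^ ?k * real (mfact n (\<alpha> + \<gamma>)) powr e"
      using b by (intro mult_left_mono mfact_powr(1)[OF e]) auto
    finally show ?thesis by (simp only: mdeg_add mult_1)
  qed
  then show "\<exists>c>0. \<exists>M\<ge>0. \<forall>\<alpha> \<gamma>. R ^ (mdeg n \<alpha> + mdeg n \<gamma>) *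
      ((1 / c) ^ mdeg n \<alpha> * real (mfact n \<alpha>) powr e * ((1 / c) ^ mdeg n \<gamma> * real (mfact n \<gamma>) powr e)) \<le>
      M * ((1 / b) ^ mdeg n (\<alpha> + \<gamma>) * real (mfact n (\<alpha> + \<gamma>)) powr e)"
    by (intro ex2I[OF Rb zero_le_one] allI)
next
  fix R c :: real assume R: "1 \<le> R" and c: "0 < c"
  define a where "a = R * 2 powr e * c"
  have a: "0 < a" using R c by (simp add: a_def)
  have "R ^ (mdeg n \<alpha> + mdeg n \<gamma>) * ((1 / a) ^ mdeg n (\<alpha> + \<gamma>) * real (mfact n (\<alpha> + \<gamma>)) powr e) \<le>
      1 * ((1 / c) ^ mdeg n \<alpha> * real (mfact n \<alpha>) powr e * ((1 / c) ^ mdeg n \<gamma> * real (mfact n \<gamma>) powr e))" for \<alpha> \<gamma>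
  proof -
    let ?k = "mdeg n \<alpha> + mdeg n \<gamma>" and ?f = "real (mfact n \<alpha>) powr e * real (mfact n \<gamma>) powr e"
    have "R ^ ?k * ((1 / a) ^ ?k * real (mfact n (\<alpha> + \<gamma>)) powr e) \<le> R ^ ?k * ((1 / a) ^ ?k * ((2 powr e) ^ ?k * ?f))"
      using R a by (intro mult_left_mono mfact_powr(2)[OF e]) auto
    also have "\<dots> = (R * (1 / a) * 2 powr e) ^ ?k * ?f" by (simp only: power_mult_distrib ac_simps)
    also have "R * (1 / a) * 2 powr e = 1 / c" using R c by (simp add: a_def)
    finally show ?thesis by (simp only: mdeg_add power_add ac_simps mult_1)
  qed
  then show "\<exists>a>0. \<exists>M\<ge>0. \<forall>\<alpha> \<gamma>. R ^ (mdeg n \<alpha> + mdeg n \<gamma>) *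
      ((1 / a) ^ mdeg n (\<alpha> + \<gamma>) * real (mfact n (\<alpha> + \<gamma>)) powr e) \<le>
      M * ((1 / c) ^ mdeg n \<alpha> * real (mfact n \<alpha>) powr e * ((1 / c) ^ mdeg n \<gamma> * real (mfact n \<gamma>) powr e))"
    by (intro ex2I[OF a zero_le_one] allI)
qed (use mfact_pos in \<open>auto simp: mdeg_def mfact_def\<close>)

text \<open>Reciprocals exchange the two estimates of \<open>mfact_powr\<close>: the one with a loss
  now enters the first inequality, hence \<open>2 powr e\<close> in its witness.\<close>

lemma factor_fact_minus:
  assumes e: "0 < e"
    and I: "\<And>r \<alpha>. 0 < r \<Longrightarrow> I r \<alpha> = ennreal ((1 / r) ^ mdeg n \<alpha> * (1 / real (mfact n \<alpha>) powr e))"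
  shows "factor n I"
proof (rule factor_realI[OF I])
  fix r r' :: real and \<alpha> assume "0 < r" "r \<le> r'"
  then show "(1 / r') ^ mdeg n \<alpha> * (1 / real (mfact n \<alpha>) powr e) \<le> (1 / r) ^ mdeg n \<alpha> * (1 / real (mfact n \<alpha>) powr e)"
    by (intro mult_right_mono power_mono) (auto simp: frac_le)
next
  fix R b :: real assume R: "1 \<le> R" and b: "0 < b"
  define c where "c = R * 2 powr e * b"
  have c: "0 < c" using R b by (simp add: c_def)
  have "R ^ (mdeg n \<alpha> + mdeg n \<gamma>) * ((1 / c) ^ mdeg n \<alpha> * (1 / real (mfact n \<alpha>) powr e) *
      ((1 / c) ^ mdeg n \<gamma> * (1 / real (mfact n \<gamma>) powr e))) \<le>
      1 * ((1 / b) ^ mdeg n (\<alpha> + \<gamma>) * (1 / real (mfact n (\<alpha> + \<gamma>)) powr e))" for \<alpha> \<gamma>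
  proof -
    let ?k = "mdeg n \<alpha> + mdeg n \<gamma>" and ?f = "real (mfact n \<alpha>) powr e * real (mfact n \<gamma>) powr e"
    let ?F = "real (mfact n (\<alpha> + \<gamma>)) powr e"
    have f: "0 < ?f" "0 < ?F" using mfact_pos by (simp_all add: less_imp_neq[symmetric])
    have "(1 / (2 powr e) ^ ?k) * (1 / ?f) \<le> 1 / ?F"
      using mfact_powr(2)[OF e, of n \<alpha> \<gamma>] f by (simp add: divide_simps)
    then have "(1 / b) ^ ?k * ((1 / (2 powr e) ^ ?k) * (1 / ?f)) \<le> (1 / b) ^ ?k * (1 / ?F)"
      using b by (intro mult_left_mono) auto
    moreover have "R ^ ?k * (1 / c) ^ ?k = (1 / b) ^ ?k * (1 / (2 powr e) ^ ?k)"
      using R b by (simp add: c_def power_divide power_mult_distrib)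
    ultimately have "R ^ ?k * (1 / c) ^ ?k * (1 / ?f) \<le> (1 / b) ^ ?k * (1 / ?F)" by (simp only: mult.assoc)
    moreover have "R ^ ?k * (1 / c) ^ ?k * (1 / ?f) = R ^ ?k * ((1 / c) ^ mdeg n \<alpha> * (1 / real (mfact n \<alpha>) powr e) *
      ((1 / c) ^ mdeg n \<gamma> * (1 / real (mfact n \<gamma>) powr e)))"
      by (simp add: power_add)
    ultimately show ?thesis by (simp only: mdeg_add mult_1)
  qed
  then show "\<exists>c>0. \<exists>M\<ge>0. \<forall>\<alpha> \<gamma>. R ^ (mdeg n \<alpha> + mdeg n \<gamma>) *
      ((1 / c) ^ mdeg n \<alpha> * (1 / real (mfact n \<alpha>) powr e) * ((1 / c) ^ mdeg n \<gamma> * (1 / real (mfact n \<gamma>) powr e))) \<le>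
      M * ((1 / b) ^ mdeg n (\<alpha> + \<gamma>) * (1 / real (mfact n (\<alpha> + \<gamma>)) powr e))"
    by (intro ex2I[OF c zero_le_one] allI)
next
  fix R c :: real assume R: "1 \<le> R" and c: "0 < c"
  have Rc: "0 < R * c" using R c by simp
  have "R ^ (mdeg n \<alpha> + mdeg n \<gamma>) * ((1 / (R * c)) ^ mdeg n (\<alpha> + \<gamma>) * (1 / real (mfact n (\<alpha> + \<gamma>)) powr e)) \<le>
      1 * ((1 / c) ^ mdeg n \<alpha> * (1 / real (mfact n \<alpha>) powr e) * ((1 / c) ^ mdeg n \<gamma> * (1 / real (mfact n \<gamma>) powr e)))" for \<alpha> \<gamma>
  proof -
    let ?k = "mdeg n \<alpha> + mdeg n \<gamma>" and ?f = "real (mfact n \<alpha>) powr e * real (mfact n \<gamma>) powr e"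
    let ?F = "real (mfact n (\<alpha> + \<gamma>)) powr e"
    have f: "0 < ?f" using mfact_pos by (simp add: less_imp_neq[symmetric])
    have "R ^ ?k * (1 / (R * c)) ^ ?k = (1 / c) ^ ?k"
      using R by (simp flip: power_mult_distrib)
    then have "R ^ ?k * ((1 / (R * c)) ^ ?k * (1 / ?F)) = (1 / c) ^ ?k * (1 / ?F)" by (simp only: mult.assoc[symmetric])
    also have "\<dots> \<le> (1 / c) ^ ?k * (1 / ?f)"
      using mfact_powr(1)[OF e, of n \<alpha> \<gamma>] f c by (intro mult_left_mono frac_le) auto
    also have "\<dots> = (1 / c) ^ mdeg n \<alpha> * (1 / real (mfact n \<alpha>) powr e) * ((1 / c) ^ mdeg n \<gamma> * (1 / real (mfact n \<gamma>) powr e))"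
      by (simp add: power_add)
    finally show ?thesis by (simp only: mdeg_add mult_1)
  qed
  then show "\<exists>a>0. \<exists>M\<ge>0. \<forall>\<alpha> \<gamma>. R ^ (mdeg n \<alpha> + mdeg n \<gamma>) *
      ((1 / a) ^ mdeg n (\<alpha> + \<gamma>) * (1 / real (mfact n (\<alpha> + \<gamma>)) powr e)) \<le>
      M * ((1 / c) ^ mdeg n \<alpha> * (1 / real (mfact n \<alpha>) powr e) * ((1 / c) ^ mdeg n \<gamma> * (1 / real (mfact n \<gamma>) powr e)))"
    by (intro ex2I[OF Rc zero_le_one] allI)
qed (use mfact_pos in \<open>auto simp: mdeg_def mfact_def\<close>)

text \<open>Finite values bound the degrees, so \<open>R ^ k\<close> is bounded by a constant. The
  index \<open>2 * c\<close> arises because two degrees up to \<open>c\<close> add up to at most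
  \<open>2 * c\<close>.\<close>

lemma factor_cutoff:
  assumes I: "\<And>r \<alpha>. I r \<alpha> = (if real (mdeg n \<alpha>) \<le> r then 1 else top)"
  shows "factor n I"
proof
  fix R b :: real assume R: "1 \<le> R" and b: "0 < b"
  have M: "0 < R powr b" using R by simp
  have "super_at n I R b b (R powr b)"
    unfolding super_at_def
  proof (intro allI)
    fix \<alpha> \<gamma>
    show "ennreal (R ^ (mdeg n \<alpha> + mdeg n \<gamma>)) * (I b \<alpha> * I b \<gamma>) \<le> ennreal (R powr b) * I b (\<alpha> + \<gamma>)"
    proof (cases "real (mdeg n (\<alpha> + \<gamma>)) \<le> b")
      case True
      have "R ^ (mdeg n \<alpha> + mdeg n \<gamma>) = R powr real (mdeg n \<alpha> + mdeg n \<gamma>)" using R by (simp only: powr_realpow)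
      also have "\<dots> \<le> R powr b" using True R by (intro powr_mono) (auto simp: mdeg_add)
      finally show ?thesis using True by (simp add: I mdeg_add ennreal_leI)
    next
      case False
      then show ?thesis using M by (simp add: I ennreal_mult_top)
    qed
  qed
  then show "\<exists>c>0. \<exists>M\<ge>0. super_at n I R c b M" using b M by (intro exI[of _ b] conjI exI[of _ "R powr b"]) auto
next
  fix R c :: real assume R: "1 \<le> R" and c: "0 < c"
  have M: "0 < R powr (2 * c)" using R by simp
  have "sub_at n I R (2 * c) c (R powr (2 * c))"
    unfolding sub_at_def
  proof (intro allI)
    fix \<alpha> \<gamma>
    show "ennreal (R ^ (mdeg n \<alpha> + mdeg n \<gamma>)) * I (2 * c) (\<alpha> + \<gamma>) \<le> ennreal (R powr (2 * c)) * (I c \<alpha> * I c \<gamma>)"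
    proof (cases "real (mdeg n \<alpha>) \<le> c \<and> real (mdeg n \<gamma>) \<le> c")
      case True
      have "R ^ (mdeg n \<alpha> + mdeg n \<gamma>) = R powr real (mdeg n \<alpha> + mdeg n \<gamma>)" using R by (simp only: powr_realpow)
      also have "\<dots> \<le> R powr (2 * c)" using True R by (intro powr_mono) auto
      finally show ?thesis using True by (simp add: I mdeg_add ennreal_leI)
    next
      case False
      then have "I c \<alpha> * I c \<gamma> = top" by (auto simp: I ennreal_mult_top ennreal_top_mult)
      then show ?thesis using M by (simp add: ennreal_mult_top)
    qed
  qed
  then show "\<exists>a>0. \<exists>M\<ge>0. sub_at n I R a c M"
    using c M by (intro exI[of _ "2 * c"] conjI exI[of _ "R powr (2 * c)"]) auto
next
  show "\<exists>r>0. I r \<alpha> < top" for \<alpha> by (intro exI[of _ "real (mdeg n \<alpha>) + 1"]) (auto simp: I)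
qed (auto simp: I mdeg_def)

text \<open>For the index 0 the weight decreases in its parameter, otherwise it increases. After this
  substitution all weights decrease.\<close>

definition flip :: "rflat \<Rightarrow> real \<Rightarrow> real" where
  "flip s r = (if s = Num 0 then r else 1 / r)"

text \<open>For positive \<open>x\<close> the exponent \<open>1 / (2 * x)\<close> exceeds 1 exactly
  if \<open>x < 1/2\<close>, as \<open>factor_exp_inverse\<close> demands. Every
  \<open>Flat \<sigma>\<close> lies below \<open>Num (1/2)\<close>.\<close>

lemma factor_vtheta:
  assumes "s \<in> Rflat" "s < Num (1/2)"
  shows "factor n (\<lambda>r. vtheta n (flip s r) s)"
proof (cases s)
  case (Num x)
  then have x: "0 \<le> x" "x < 1/2" using assms by (auto simp: Rflat_def)
  show ?thesis
  proof (cases "x = 0")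
    case True
    then show ?thesis using Num by (intro factor_cutoff) (simp add: flip_def)
  next
    case False
    then show ?thesis
      using Num x by (intro factor_exp_inverse[of "1 / (2 * x)"]) (auto simp: flip_def)
  qed
next
  case (Flat \<sigma>)
  then have "0 < \<sigma>" using assms by (auto simp: Rflat_def)
  then show ?thesis using Flat by (intro factor_fact_inverse[of "1 / (2 * \<sigma>)"]) (auto simp: flip_def)
qed

text \<open>At \<open>x = 1/2\<close> the exponent is 1, which \<open>factor_exp_minus\<close> still
  allows. The index 0 is excluded, as \<open>1 / vtheta\<close> would vanish at large degrees and
  violate \<open>pos\<close>.\<close>

lemma factor_inverse_vtheta:
  assumes "s \<in> Rflat" "Num 0 < s" "s \<le> Num (1/2)"
  shows "factor n (\<lambda>r \<alpha>. inverse (vtheta n r s \<alpha>))"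
proof (cases s)
  case (Num x)
  then have x: "0 < x" "x \<le> 1/2" using assms by (auto simp: less_eq_rflat_def)
  show ?thesis
  proof (rule factor_exp_minus[of "1 / (2 * x)"])
    show "1 \<le> 1 / (2 * x)" using x by simp
    show "inverse (vtheta n r s \<alpha>) = ennreal (exp (- (r * real (mdeg n \<alpha>) powr (1 / (2 * x)))))" for r \<alpha>
      using Num x by (simp add: inverse_ennreal exp_minus)
  qed
next
  case (Flat \<sigma>)
  then have s: "0 < \<sigma>" using assms by (auto simp: Rflat_def)
  show ?thesis
  proof (rule factor_fact_minus[of "1 / (2 * \<sigma>)"])
    show "0 < 1 / (2 * \<sigma>)" using s by simp
    fix r :: real and \<alpha> assume "0 < r"
    then show "inverse (vtheta n r s \<alpha>) = ennreal ((1 / r) ^ mdeg n \<alpha> * (1 / real (mfact n \<alpha>) powr (1 / (2 * \<sigma>))))"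
      using Flat mfact_pos[of n \<alpha>] by (simp add: inverse_ennreal inverse_eq_divide power_divide)
  qed
qed

lemma proj_lim_flip: "proj_lim (\<lambda>r. T (flip s r)) = proj_lim T"
  by (cases "s = Num 0") (simp_all add: flip_def proj_lim_inverse)

lemma ind_lim_flip: "ind_lim (\<lambda>r. T (flip s r)) = ind_lim T"
  by (cases "s = Num 0") (simp_all add: flip_def ind_lim_inverse)

text \<open>Both factors share one parameter, so a single substitution must flip each of them. It
  follows an index that is not 0, if there is one; \<open>par\<close> then takes a factor with index
  0 back to \<open>r\<close>.\<close>

lemma vtheta2_flip:
  assumes "s' = (if s\<^sub>2 = Num 0 then s\<^sub>1 else s\<^sub>2)" "0 < r"
  shows "vtheta2 (d\<^sub>2, d\<^sub>1) (s\<^sub>2, s\<^sub>1) (flip s' r) \<alpha> =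
    vtheta d\<^sub>2 (flip s\<^sub>2 r) s\<^sub>2 (fst \<alpha>) * vtheta d\<^sub>1 (flip s\<^sub>1 r) s\<^sub>1 (snd \<alpha>)"
  using assms by (auto simp: vtheta2_def par_def flip_def)

lemma lim_cong:
  assumes "\<And>r. 0 < r \<Longrightarrow> T r = T' r"
  shows "proj_lim T = proj_lim T'" "ind_lim T = ind_lim T'"
proof -
  show "proj_lim T = proj_lim T'"
    by (rule topology_eq_id; rule proj_lim_mono) (auto simp: assms intro!: exI)
  show "ind_lim T = ind_lim T'"
    by (rule topology_eq_id; rule ind_lim_mono) (auto simp: assms intro!: exI)
qed

lemma ennreal_inverse_inverse: "inverse (inverse x) = (x :: ennreal)"
  using one_divide_one_divide_ennreal[of x] by (simp add: divide_ennreal_def)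

lemma ell_A_flip:
  defines "v \<equiv> \<lambda>d s r. vtheta d (flip s r) s"
  assumes s: "s\<^sub>2 \<in> Rflat" "s\<^sub>2 < Num (1/2)" "s\<^sub>1 \<in> Rflat" "s\<^sub>1 < Num (1/2)"
  shows "ell_A p (d\<^sub>2, d\<^sub>1) (s\<^sub>2, s\<^sub>1) =
      ind_lim (\<lambda>r. ell_top p (Lam (d\<^sub>2, d\<^sub>1)) (\<lambda>\<alpha>. v d\<^sub>2 s\<^sub>2 r (fst \<alpha>) * v d\<^sub>1 s\<^sub>1 r (snd \<alpha>)))" (is ?A)
    and "ell_A_star p (d\<^sub>2, d\<^sub>1) (s\<^sub>2, s\<^sub>1) =
      proj_lim (\<lambda>r. ell_top p (Lam (d\<^sub>2, d\<^sub>1)) (\<lambda>\<alpha>. inverse (v d\<^sub>2 s\<^sub>2 r (fst \<alpha>)) * inverse (v d\<^sub>1 s\<^sub>1 r (snd \<alpha>))))" (is ?A')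
proof -
  let ?s = "if s\<^sub>2 = Num 0 then s\<^sub>1 else s\<^sub>2"
  have v: "vtheta2 (d\<^sub>2, d\<^sub>1) (s\<^sub>2, s\<^sub>1) (flip ?s r) = (\<lambda>\<alpha>. v d\<^sub>2 s\<^sub>2 r (fst \<alpha>) * v d\<^sub>1 s\<^sub>1 r (snd \<alpha>))" if "0 < r" for r
    unfolding v_def by (rule ext) (rule vtheta2_flip[OF refl that])
  have pos: "0 < v d\<^sub>2 s\<^sub>2 r \<alpha>" "0 < v d\<^sub>1 s\<^sub>1 r \<alpha>" if "0 < r" for r \<alpha>
    using factor.pos[OF factor_vtheta[OF s(1,2)] that] factor.pos[OF factor_vtheta[OF s(3,4)] that]
    by (simp_all add: v_def)
  show ?A
    unfolding ell_A_def
    by (subst ind_lim_flip[of _ ?s, symmetric], rule lim_cong) (simp only: v)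
  show ?A'
    unfolding ell_A_star_def
  proof (subst proj_lim_flip[of _ ?s, symmetric], rule lim_cong)
    fix r :: real assume r: "0 < r"
    \<comment> \<open>Positive factors exclude the product infinity times 0, for which the two sides
      differ.\<close>
    have "1 / (v d\<^sub>2 s\<^sub>2 r x * v d\<^sub>1 s\<^sub>1 r y) = inverse (v d\<^sub>2 s\<^sub>2 r x) * inverse (v d\<^sub>1 s\<^sub>1 r y)" for x y
      using pos[OF r] by (simp add: divide_ennreal_def ennreal_inverse_mult')
    then show "ell_top p (Lam (d\<^sub>2, d\<^sub>1)) (\<lambda>\<alpha>. 1 / vtheta2 (d\<^sub>2, d\<^sub>1) (s\<^sub>2, s\<^sub>1) (flip ?s r) \<alpha>) =
        ell_top p (Lam (d\<^sub>2, d\<^sub>1)) (\<lambda>\<alpha>. inverse (v d\<^sub>2 s\<^sub>2 r (fst \<alpha>)) * inverse (v d\<^sub>1 s\<^sub>1 r (snd \<alpha>)))"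
      by (simp only: v[OF r])
  qed
qed

lemma ell_BC_flip:
  defines "v \<equiv> \<lambda>d s r. vtheta d (flip s r) s"
  shows "ell_B p (d\<^sub>2, d\<^sub>1) (s\<^sub>2, s\<^sub>1) = proj_lim (\<lambda>a. ind_lim (\<lambda>b. ell_top p (Lam (d\<^sub>2, d\<^sub>1))
      (\<lambda>\<alpha>. v d\<^sub>2 s\<^sub>2 b (fst \<alpha>) * inverse (v d\<^sub>1 s\<^sub>1 a (snd \<alpha>)))))" (is "?B = ?B'")
    and "ell_C p (d\<^sub>2, d\<^sub>1) (s\<^sub>2, s\<^sub>1) = ind_lim (\<lambda>b. proj_lim (\<lambda>a. ell_top p (Lam (d\<^sub>2, d\<^sub>1))
      (\<lambda>\<alpha>. v d\<^sub>2 s\<^sub>2 b (fst \<alpha>) * inverse (v d\<^sub>1 s\<^sub>1 a (snd \<alpha>)))))" (is "?C = ?C'")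
    and "ell_B_star p (d\<^sub>2, d\<^sub>1) (s\<^sub>2, s\<^sub>1) = proj_lim (\<lambda>a. ind_lim (\<lambda>b. ell_top p (Lam (d\<^sub>2, d\<^sub>1))
      (\<lambda>\<alpha>. v d\<^sub>1 s\<^sub>1 b (snd \<alpha>) * inverse (v d\<^sub>2 s\<^sub>2 a (fst \<alpha>)))))" (is "?Bs = ?Bs'")
    and "ell_C_star p (d\<^sub>2, d\<^sub>1) (s\<^sub>2, s\<^sub>1) = ind_lim (\<lambda>b. proj_lim (\<lambda>a. ell_top p (Lam (d\<^sub>2, d\<^sub>1))
      (\<lambda>\<alpha>. v d\<^sub>1 s\<^sub>1 b (snd \<alpha>) * inverse (v d\<^sub>2 s\<^sub>2 a (fst \<alpha>)))))" (is "?Cs = ?Cs'")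
proof -
  define T where "T x y = ell_top p (Lam (d\<^sub>2, d\<^sub>1)) (omega (d\<^sub>2, d\<^sub>1) (s\<^sub>2, s\<^sub>1) x y)" for x y
  define S where "S x y = ell_top p (Lam (d\<^sub>2, d\<^sub>1)) (omega_star (d\<^sub>2, d\<^sub>1) (s\<^sub>2, s\<^sub>1) x y)" for x y
  have T: "ell_top p (Lam (d\<^sub>2, d\<^sub>1)) (\<lambda>\<alpha>. v d\<^sub>2 s\<^sub>2 b (fst \<alpha>) * inverse (v d\<^sub>1 s\<^sub>1 a (snd \<alpha>))) =
      T (flip s\<^sub>2 b) (flip s\<^sub>1 a)" for a b
    by (simp add: T_def omega_def[abs_def] v_def divide_ennreal_def)
  have S: "ell_top p (Lam (d\<^sub>2, d\<^sub>1)) (\<lambda>\<alpha>. v d\<^sub>1 s\<^sub>1 b (snd \<alpha>) * inverse (v d\<^sub>2 s\<^sub>2 a (fst \<alpha>))) =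
      S (flip s\<^sub>2 a) (flip s\<^sub>1 b)" for a b
    by (simp add: S_def omega_star_def[abs_def] v_def divide_ennreal_def)
  show "?B = ?B'"
    unfolding T ell_B_def T_def[symmetric]
    using proj_lim_flip[of "\<lambda>a. ind_lim (\<lambda>b. T (flip s\<^sub>2 b) a)" s\<^sub>1] ind_lim_flip[of "\<lambda>b. T b _" s\<^sub>2] by simp
  show "?C = ?C'"
    unfolding T ell_C_def T_def[symmetric]
    using ind_lim_flip[of "\<lambda>b. proj_lim (\<lambda>a. T b (flip s\<^sub>1 a))" s\<^sub>2] proj_lim_flip[of "\<lambda>a. T _ a" s\<^sub>1] by simp
  show "?Bs = ?Bs'"
    unfolding S ell_B_star_def S_def[symmetric]
    using proj_lim_flip[of "\<lambda>a. ind_lim (\<lambda>b. S a (flip s\<^sub>1 b))" s\<^sub>2] ind_lim_flip[of "\<lambda>b. S _ b" s\<^sub>1] by simp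
  show "?Cs = ?Cs'"
    unfolding S ell_C_star_def S_def[symmetric]
    using ind_lim_flip[of "\<lambda>b. proj_lim (\<lambda>a. S (flip s\<^sub>2 a) b)" s\<^sub>1] proj_lim_flip[of "\<lambda>a. S a _" s\<^sub>2] by simp
qed

text \<open>The basic weight is now \<open>1 / vtheta\<close>, so the inductive limit
  \<open>ell_A0_star\<close> takes the place of \<open>ell_A\<close>, and \<open>ell_A0\<close> that
  of \<open>ell_A_star\<close>.\<close>

lemma ell_A0_inverse:
  defines "v \<equiv> \<lambda>d s r \<alpha>. inverse (vtheta d r s \<alpha>)"
  assumes s: "s\<^sub>2 \<in> Rflat" "Num 0 < s\<^sub>2" "s\<^sub>2 \<le> Num (1/2)" "s\<^sub>1 \<in> Rflat" "Num 0 < s\<^sub>1" "s\<^sub>1 \<le> Num (1/2)"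
  shows "ell_A0_star p (d\<^sub>2, d\<^sub>1) (s\<^sub>2, s\<^sub>1) =
      ind_lim (\<lambda>r. ell_top p (Lam (d\<^sub>2, d\<^sub>1)) (\<lambda>\<alpha>. v d\<^sub>2 s\<^sub>2 r (fst \<alpha>) * v d\<^sub>1 s\<^sub>1 r (snd \<alpha>)))" (is ?A')
    and "ell_A0 p (d\<^sub>2, d\<^sub>1) (s\<^sub>2, s\<^sub>1) =
      proj_lim (\<lambda>r. ell_top p (Lam (d\<^sub>2, d\<^sub>1)) (\<lambda>\<alpha>. inverse (v d\<^sub>2 s\<^sub>2 r (fst \<alpha>)) * inverse (v d\<^sub>1 s\<^sub>1 r (snd \<alpha>))))" (is ?A)
proof -
  have v: "vtheta2 (d\<^sub>2, d\<^sub>1) (s\<^sub>2, s\<^sub>1) r = (\<lambda>\<alpha>. vtheta d\<^sub>2 r s\<^sub>2 (fst \<alpha>) * vtheta d\<^sub>1 r s\<^sub>1 (snd \<alpha>))" for r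
    using s by (auto simp: vtheta2_def par_def)
  show ?A
    by (simp add: ell_A0_def v v_def ennreal_inverse_inverse)
  show ?A'
    unfolding ell_A0_star_def
  proof (rule lim_cong)
    fix r :: real assume r: "0 < r"
    \<comment> \<open>Finiteness of both factors excludes infinity times 0, so the reciprocal of the
      product splits.\<close>
    have "vtheta d\<^sub>2 r s\<^sub>2 x \<noteq> top" "vtheta d\<^sub>1 r s\<^sub>1 x \<noteq> top" for x
      using factor.pos[OF factor_inverse_vtheta[OF s(1-3)] r] factor.pos[OF factor_inverse_vtheta[OF s(4-6)] r]
      by (simp_all add: ennreal_inverse_positive)
    then have "1 / (vtheta d\<^sub>2 r s\<^sub>2 x * vtheta d\<^sub>1 r s\<^sub>1 y) = v d\<^sub>2 s\<^sub>2 r x * v d\<^sub>1 s\<^sub>1 r y" for x y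
      by (simp add: divide_ennreal_def ennreal_inverse_mult less_top v_def)
    then show "ell_top p (Lam (d\<^sub>2, d\<^sub>1)) (\<lambda>\<alpha>. 1 / vtheta2 (d\<^sub>2, d\<^sub>1) (s\<^sub>2, s\<^sub>1) r \<alpha>) =
        ell_top p (Lam (d\<^sub>2, d\<^sub>1)) (\<lambda>\<alpha>. v d\<^sub>2 s\<^sub>2 r (fst \<alpha>) * v d\<^sub>1 s\<^sub>1 r (snd \<alpha>))"
      by (simp only: v)
  qed
qed

lemma ell_BC0_inverse:
  defines "v \<equiv> \<lambda>d s r \<alpha>. inverse (vtheta d r s \<alpha>)"
  shows "ell_B0_star p (d\<^sub>2, d\<^sub>1) (s\<^sub>2, s\<^sub>1) = proj_lim (\<lambda>a. ind_lim (\<lambda>b. ell_top p (Lam (d\<^sub>2, d\<^sub>1))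
      (\<lambda>\<alpha>. v d\<^sub>2 s\<^sub>2 b (fst \<alpha>) * inverse (v d\<^sub>1 s\<^sub>1 a (snd \<alpha>)))))"
    and "ell_C0_star p (d\<^sub>2, d\<^sub>1) (s\<^sub>2, s\<^sub>1) = ind_lim (\<lambda>b. proj_lim (\<lambda>a. ell_top p (Lam (d\<^sub>2, d\<^sub>1))
      (\<lambda>\<alpha>. v d\<^sub>2 s\<^sub>2 b (fst \<alpha>) * inverse (v d\<^sub>1 s\<^sub>1 a (snd \<alpha>)))))"
    and "ell_B0 p (d\<^sub>2, d\<^sub>1) (s\<^sub>2, s\<^sub>1) = proj_lim (\<lambda>a. ind_lim (\<lambda>b. ell_top p (Lam (d\<^sub>2, d\<^sub>1))
      (\<lambda>\<alpha>. v d\<^sub>1 s\<^sub>1 b (snd \<alpha>) * inverse (v d\<^sub>2 s\<^sub>2 a (fst \<alpha>)))))"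
    and "ell_C0 p (d\<^sub>2, d\<^sub>1) (s\<^sub>2, s\<^sub>1) = ind_lim (\<lambda>b. proj_lim (\<lambda>a. ell_top p (Lam (d\<^sub>2, d\<^sub>1))
      (\<lambda>\<alpha>. v d\<^sub>1 s\<^sub>1 b (snd \<alpha>) * inverse (v d\<^sub>2 s\<^sub>2 a (fst \<alpha>)))))"
proof -
  have T: "(\<lambda>\<alpha>. v d\<^sub>2 s\<^sub>2 b (fst \<alpha>) * inverse (v d\<^sub>1 s\<^sub>1 a (snd \<alpha>))) = omega_star (d\<^sub>2, d\<^sub>1) (s\<^sub>2, s\<^sub>1) b a" for a b
    by (simp add: omega_star_def[abs_def] v_def divide_ennreal_def ennreal_inverse_inverse mult.commute)
  have S: "(\<lambda>\<alpha>. v d\<^sub>1 s\<^sub>1 b (snd \<alpha>) * inverse (v d\<^sub>2 s\<^sub>2 a (fst \<alpha>))) = omega (d\<^sub>2, d\<^sub>1) (s\<^sub>2, s\<^sub>1) a b" for a b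
    by (simp add: omega_def[abs_def] v_def divide_ennreal_def ennreal_inverse_inverse mult.commute)
  show "ell_B0_star p (d\<^sub>2, d\<^sub>1) (s\<^sub>2, s\<^sub>1) = proj_lim (\<lambda>a. ind_lim (\<lambda>b. ell_top p (Lam (d\<^sub>2, d\<^sub>1))
      (\<lambda>\<alpha>. v d\<^sub>2 s\<^sub>2 b (fst \<alpha>) * inverse (v d\<^sub>1 s\<^sub>1 a (snd \<alpha>)))))"
    "ell_C0_star p (d\<^sub>2, d\<^sub>1) (s\<^sub>2, s\<^sub>1) = ind_lim (\<lambda>b. proj_lim (\<lambda>a. ell_top p (Lam (d\<^sub>2, d\<^sub>1))
      (\<lambda>\<alpha>. v d\<^sub>2 s\<^sub>2 b (fst \<alpha>) * inverse (v d\<^sub>1 s\<^sub>1 a (snd \<alpha>)))))"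
    unfolding T ell_B0_star_def ell_C0_star_def by (rule refl)+
  show "ell_B0 p (d\<^sub>2, d\<^sub>1) (s\<^sub>2, s\<^sub>1) = proj_lim (\<lambda>a. ind_lim (\<lambda>b. ell_top p (Lam (d\<^sub>2, d\<^sub>1))
      (\<lambda>\<alpha>. v d\<^sub>1 s\<^sub>1 b (snd \<alpha>) * inverse (v d\<^sub>2 s\<^sub>2 a (fst \<alpha>)))))"
    "ell_C0 p (d\<^sub>2, d\<^sub>1) (s\<^sub>2, s\<^sub>1) = ind_lim (\<lambda>b. proj_lim (\<lambda>a. ell_top p (Lam (d\<^sub>2, d\<^sub>1))
      (\<lambda>\<alpha>. v d\<^sub>1 s\<^sub>1 b (snd \<alpha>) * inverse (v d\<^sub>2 s\<^sub>2 a (fst \<alpha>)))))"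
    unfolding S ell_B0_def ell_C0_def by (rule refl)+
qed

theorem proposition3p8:
  fixes t :: complex and s\<^sub>1 s\<^sub>2 :: rflat and d\<^sub>1 d\<^sub>2 :: nat and p :: ennreal
    and d :: "nat \<times> nat" and s :: "rflat \<times> rflat"
  assumes "0 < p"
    and "s\<^sub>1 \<in> Rflat" and "s\<^sub>2 \<in> Rflat"
    and "d = (d\<^sub>2, d\<^sub>1)" and "s = (s\<^sub>2, s\<^sub>1)"
  shows "(s\<^sub>1 < Num (1/2) \<and> s\<^sub>2 < Num (1/2) \<longrightarrow>
            U_extendable d t (ell_A p d s) (ell_A_star p d s) (ell_A_star p d s) \<and>
            U_extendable d t (ell_A_star p d s) (ell_A p d s) (ell_A p d s) \<and>
            U_extendable d t (ell_B p d s) (ell_C_star p d s) (ell_C_star p d s) \<and>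
            U_extendable d t (ell_B_star p d s) (ell_C p d s) (ell_C p d s) \<and>
            U_extendable d t (ell_C p d s) (ell_B_star p d s) (ell_B_star p d s) \<and>
            U_extendable d t (ell_C_star p d s) (ell_B p d s) (ell_B p d s)) \<and>
         (Num 0 < s\<^sub>1 \<and> s\<^sub>1 \<le> Num (1/2) \<and> Num 0 < s\<^sub>2 \<and> s\<^sub>2 \<le> Num (1/2) \<longrightarrow>
            U_extendable d t (ell_A0 p d s) (ell_A0_star p d s) (ell_A0_star p d s) \<and>
            U_extendable d t (ell_A0_star p d s) (ell_A0 p d s) (ell_A0 p d s) \<and>
            U_extendable d t (ell_B0 p d s) (ell_C0_star p d s) (ell_C0_star p d s) \<and>
            U_extendable d t (ell_B0_star p d s) (ell_C0 p d s) (ell_C0 p d s) \<and>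
            U_extendable d t (ell_C0 p d s) (ell_B0_star p d s) (ell_B0_star p d s) \<and>
            U_extendable d t (ell_C0_star p d s) (ell_B0 p d s) (ell_B0 p d s))"
proof (intro conjI[of "_ \<longrightarrow> _"] impI)
  assume s: "s\<^sub>1 < Num (1/2) \<and> s\<^sub>2 < Num (1/2)"
  then have s': "s\<^sub>1 < Num (1/2)" "s\<^sub>2 < Num (1/2)" by auto
  interpret factors "(d\<^sub>2, d\<^sub>1)" "\<lambda>r. vtheta d\<^sub>2 (flip s\<^sub>2 r) s\<^sub>2" "\<lambda>r. vtheta d\<^sub>1 (flip s\<^sub>1 r) s\<^sub>1"
    using factor_vtheta assms(2,3) s' by (simp add: factors_def)
  show "U_extendable d t (ell_A p d s) (ell_A_star p d s) (ell_A_star p d s) \<and>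
            U_extendable d t (ell_A_star p d s) (ell_A p d s) (ell_A p d s) \<and>
            U_extendable d t (ell_B p d s) (ell_C_star p d s) (ell_C_star p d s) \<and>
            U_extendable d t (ell_B_star p d s) (ell_C p d s) (ell_C p d s) \<and>
            U_extendable d t (ell_C p d s) (ell_B_star p d s) (ell_B_star p d s) \<and>
            U_extendable d t (ell_C_star p d s) (ell_B p d s) (ell_B p d s)"
    unfolding assms(4,5) ell_A_flip[OF assms(3) s'(2) assms(2) s'(1)] ell_BC_flip
    by (intro conjI extendable_A[OF assms(1)] extendable_B_C[OF assms(1)])
next
  assume s: "Num 0 < s\<^sub>1 \<and> s\<^sub>1 \<le> Num (1/2) \<and> Num 0 < s\<^sub>2 \<and> s\<^sub>2 \<le> Num (1/2)"
  then have s': "Num 0 < s\<^sub>1" "s\<^sub>1 \<le> Num (1/2)" "Num 0 < s\<^sub>2" "s\<^sub>2 \<le> Num (1/2)" by auto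
  \<comment> \<open>With reciprocal weights the starred spaces become \<open>A\<close>,
    \<open>B\<close> and \<open>C\<close> of the general theorems. Exchanging the stars only
    permutes the six claims.\<close>
  interpret factors "(d\<^sub>2, d\<^sub>1)" "\<lambda>r \<alpha>. inverse (vtheta d\<^sub>2 r s\<^sub>2 \<alpha>)" "\<lambda>r \<alpha>. inverse (vtheta d\<^sub>1 r s\<^sub>1 \<alpha>)"
    using factor_inverse_vtheta assms(2,3) s' by (simp add: factors_def)
  show "U_extendable d t (ell_A0 p d s) (ell_A0_star p d s) (ell_A0_star p d s) \<and>
            U_extendable d t (ell_A0_star p d s) (ell_A0 p d s) (ell_A0 p d s) \<and>
            U_extendable d t (ell_B0 p d s) (ell_C0_star p d s) (ell_C0_star p d s) \<and>
            U_extendable d t (ell_B0_star p d s) (ell_C0 p d s) (ell_C0 p d s) \<and>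
            U_extendable d t (ell_C0 p d s) (ell_B0_star p d s) (ell_B0_star p d s) \<and>
            U_extendable d t (ell_C0_star p d s) (ell_B0 p d s) (ell_B0 p d s)"
    unfolding assms(4,5) ell_A0_inverse[OF assms(3) s'(3,4) assms(2) s'(1,2)] ell_BC0_inverse
    by (intro conjI extendable_A[OF assms(1)] extendable_B_C[OF assms(1)])
qed

end
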